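(* Let $X$ be a $\Gamma$-nilpotent covering graph of a finite graph $X_0$ with a $\Gamma$-invariant random walk $\{w_n\}_{n\ge 0}$ started at $x\in V$, let $\Phi:X\to G$ be a periodic realization, and let $\{a_n\}_{n=1}^\infty$ be a monotone increasing sequence of positive real numbers with $a_n/\sqrt n\to+\infty$ and $a_n/n\to 0$ (all as in the context). Let $Z^{(n)}$ be the $\mathrm{AC}_0([0,1];\mathfrak g^{(1)})$-valued random variables $$Z^{(n)}_t=\frac1{a_n}\sum_{k=1}^{[nt]}\overline W_k+\frac1{a_n}(nt-[nt])\overline W_{[nt]+1},\qquad 0\le t\le 1,\ n\in\mathbb N .$$ Then $\{Z^{(n)}\}_{n=1}^\infty$ satisfies a moderate deviation principle with speed $a_n^2/n$ and good rate function $I'$: for every Borel set $A\subset \mathrm{AC}_0([0,1];\mathfrak g^{(1)})$, $$-\inf_{h\in A^\circ}I'(h)\le\liminf_{n\to\infty}\frac{n}{a_n^2}\log\mathbb P_x(Z^{(n)}\in A)\le\limsup_{n\to\infty}\frac{n}{a_n^2}\log\mathbb P_x(Z^{(n)}\in A)\le-\inf_{h\in\overline A}I'(h),$$ where $A^\circ$ and $\overline A$ are the interior and closure of $A$, and $I'$ is the good rate function $$I'(h)=\int_0^1\alpha^*(\dot h(t))\,dt\ \text{ if } h\in \mathrm{AC}_0([0,1];\mathfrak g^{(1)}),\qquad I'(h)=+\infty\ \text{ otherwise},$$ with $\alpha^*(\chi)=\frac12\langle\Sigma^{-1}\chi,\chi\rangle$ for $\chi\in\mathfrak g^{(1)}$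.
   Context: **Group.** $\Gamma$ is a finitely generated torsion-free nilpotent group and $G=(G,\cdot)$ a connected, simply connected nilpotent Lie group in which $\Gamma$ is (identified with) a cocompact lattice. $\mathfrak g$ is the Lie algebra of $G$; $\exp:\mathfrak g\to G$ is a diffeomorphism with inverse $\log$. Put $\mathfrak n_1=\mathfrak g$, $\mathfrak n_{k+1}=[\mathfrak g,\mathfrak n_k]$, $\mathfrak n_r\neq 0=\mathfrak n_{r+1}$; fix subspaces $\mathfrak g^{(k)}$ with $\mathfrak n_k=\mathfrak g^{(k)}\oplus\mathfrak n_{k+1}$, so $\mathfrak g=\mathfrak g^{(1)}\oplus\dots\oplus\mathfrak g^{(r)}$; $Z|_{\mathfrak g^{(k)}}$ denotes the $\mathfrak g^{(k)}$-component of $Z\in\mathfrak g$. Fix a basis $X^{(1)}_1,\dots,X^{(1)}_{d_1}$ of $\mathfrak g^{(1)}$; identify $\mathfrak g^{(1)}\cong\mathbb R^{d_1}$ by it, with $\langle\cdot,\cdot\rangle$ the standard inner product and $\|\cdot\|_{\mathfrak g^{(1)}}$ the Euclidean norm. **Graph and random walk.** $X=(V,E)$ is a connected covering graph of a finite connected graph $X_0=(V_0,E_0)=\Gamma\backslash X$ with covering transformation group $\Gamma$; $E,E_0$ are sets of oriented edges, $o(e),t(e),\overline e$ denote origin, terminus and inverse edge. $p:E_0\to(0,1]$ satisfies $\sum_{e:\,o(e)=y}p(e)=1$ for all $y\in V_0$, and is lifted to a $\Gamma$-invariant transition probability on $E$. $\Omega_x(X)$ is the set of infinite edge paths $c=(e_1,e_2,\dots)$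 in $X$ starting at $x\in V$, $\mathbb P_x$ the induced Markov probability measure, $w_n(c)=o(e_{n+1})$. The walk need not be symmetric. $m:V_0\to(0,1]$ is the normalized invariant measure of the walk on $X_0$ and $\widetilde m(e)=p(e)m(o(e))$. A periodic realization is a map $\Phi:V\to G$ with $\Phi(\gamma y)=\gamma\cdot\Phi(y)$ for $\gamma\in\Gamma$, $y\in V$. Put $\xi_n=\Phi(w_n)$, $\Xi_n=\log(\xi_n)|_{\mathfrak g^{(1)}}$. **Asymptotic direction.** $C_1(X_0,\mathbb R)$ is the space of real 1-chains ($\overline e=-e$), $\partial e=t(e)-o(e)$, $\mathrm H_1(X_0,\mathbb R)=\ker\partial$, $\mathrm H^1(X_0,\mathbb R)$ its dual, and $\gamma_p=\sum_{e\in E_0}\widetilde m(e)e\in \mathrm H_1(X_0,\mathbb R)$. The covering gives a surjective homomorphism $\rho:\pi_1(X_0)\to\Gamma$; the homomorphism $[c]\mapsto\log(\rho([c]))|_{\mathfrak g^{(1)}}$ into the abelian group $\mathfrak g^{(1)}$ induces the surjective linear map $\rho_{\mathbb R}:\mathrm H_1(X_0,\mathbb R)\to\mathfrak g^{(1)}$. $\rho_{\mathbb R}(\gamma_p)$ is the asymptotic direction. Put $W_n=\Xi_n-\Xi_{n-1}$, $\overline W_n=W_n-\rho_{\mathbb R}(\gamma_p)$ for $n\ge1$. **Albanese metric.** Each class in $\mathrm H^1(X_0,\mathbb R)$ is represented by the unique function $\omega:E_0\to\mathbb R$ in that class with $\omega(\overline e)=-\omega(e)$ and $\sum_{e:\,o(e)=y}p(e)\omega(e)=\langle\gamma_p,\omega\rangle$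 for all $y\in V_0$. With these representatives, $\langle\!\langle\omega_1,\omega_2\rangle\!\rangle_p=\sum_{e\in E_0}\widetilde m(e)\omega_1(e)\omega_2(e)-\langle\gamma_p,\omega_1\rangle\langle\gamma_p,\omega_2\rangle$ is an inner product on $\mathrm H^1(X_0,\mathbb R)$. $\mathrm{Hom}(\mathfrak g^{(1)},\mathbb R)$ is embedded in $\mathrm H^1(X_0,\mathbb R)$ by the transpose of $\rho_{\mathbb R}$; the dual of the restricted inner product is the Albanese metric $g_0$ on $\mathfrak g^{(1)}$. With $\omega_1,\dots,\omega_{d_1}$ the basis of $\mathrm{Hom}(\mathfrak g^{(1)},\mathbb R)$ dual to $(X^{(1)}_i)$, $\Sigma=(\langle\!\langle\omega_i,\omega_j\rangle\!\rangle_p)_{i,j}$ and $\Sigma^{-1}=(\langle X^{(1)}_i,X^{(1)}_j\rangle_{g_0})_{i,j}$. **Path space.** $\mathrm{AC}_0([0,1];\mathfrak g^{(1)})$ is the set of absolutely continuous $h:[0,1]\to\mathfrak g^{(1)}$ with $h(0)=0$, with the uniform convergence topology. $[\,\cdot\,]$ is the integer part. A good rate function is a $[0,\infty]$-valued lower semicontinuous function with compact sublevel sets. *)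

theory Defs
  imports "HOL-Probability.Probability" "HOL-Algebra.Generated_Groups" "HOL-Algebra.Group_Action"
begin

section \<open>Smooth manifolds and Lie groups\<close>

primrec Ck_on :: "nat \<Rightarrow> 'a::euclidean_space set \<Rightarrow> ('a \<Rightarrow> 'b::euclidean_space) \<Rightarrow> bool" where
  "Ck_on 0 S f \<longleftrightarrow> continuous_on S f"
| "Ck_on (Suc k) S f \<longleftrightarrow>
     (\<forall>x\<in>S. f differentiable (at x)) \<and> (\<forall>v. Ck_on k S (\<lambda>x. frechet_derivative f (at x) v))"

text \<open>Only used for open \<open>S\<close>.\<close>

definition smooth_on :: "'a::euclidean_space set \<Rightarrow> ('a \<Rightarrow> 'b::euclidean_space) \<Rightarrow> bool" where
  "smooth_on S f \<longleftrightarrow> (\<forall>k. Ck_on k S f)"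

type_synonym ('g, 'v) chart = "'g set \<times> ('g \<Rightarrow> 'v)"

definition smooth_atlas :: "('g::topological_space, 'v::euclidean_space) chart set \<Rightarrow> bool" where
  "smooth_atlas \<A> \<longleftrightarrow>
     (\<forall>(U, \<phi>)\<in>\<A>. open U \<and> open (\<phi> ` U) \<and> homeomorphism U (\<phi> ` U) \<phi> (inv_into U \<phi>)) \<and>
     (\<Union>(U, \<phi>)\<in>\<A>. U) = UNIV \<and>
     (\<forall>(U, \<phi>)\<in>\<A>. \<forall>(V, \<psi>)\<in>\<A>. smooth_on (\<phi> ` (U \<inter> V)) (\<psi> \<circ> inv_into U \<phi>))"

definition smooth_map ::
  "('g::topological_space, 'v::euclidean_space) chart set \<Rightarrow>
   ('h::topological_space, 'w::euclidean_space) chart set \<Rightarrow> ('g \<Rightarrow> 'h) \<Rightarrow> bool" where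
  "smooth_map \<A> \<B> f \<longleftrightarrow> continuous_on UNIV f \<and>
     (\<forall>(U, \<phi>)\<in>\<A>. \<forall>(V, \<psi>)\<in>\<B>. smooth_on (\<phi> ` (U \<inter> f -` V)) (\<psi> \<circ> f \<circ> inv_into U \<phi>))"

definition prod_atlas ::
  "('g, 'v) chart set \<Rightarrow> ('h, 'w) chart set \<Rightarrow> ('g \<times> 'h, 'v \<times> 'w) chart set" where
  "prod_atlas \<A> \<B> = {(U \<times> V, map_prod \<phi> \<psi>) | U \<phi> V \<psi>. (U, \<phi>) \<in> \<A> \<and> (V, \<psi>) \<in> \<B>}"

definition euclidean_atlas :: "('v, 'v) chart set" where
  "euclidean_atlas = {(UNIV, id)}"

locale lie_group = group G
  for G :: "'g::{t2_space, second_countable_topology} monoid" (structure) +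
  fixes \<A> :: "('g, 'v::euclidean_space) chart set"
  assumes carrier_UNIV: "carrier G = UNIV"
    and atlas: "smooth_atlas \<A>"
    and smooth_mult: "smooth_map (prod_atlas \<A> \<A>) \<A> (\<lambda>(g, h). g \<otimes> h)"
    and smooth_inv: "smooth_map \<A> \<A> (\<lambda>g. inv g)"

primrec group_lcs :: "('g, 'b) monoid_scheme \<Rightarrow> nat \<Rightarrow> 'g set" where
  "group_lcs G 0 = carrier G"
| "group_lcs G (Suc k) = generate G
     {g \<otimes>\<^bsub>G\<^esub> h \<otimes>\<^bsub>G\<^esub> inv\<^bsub>G\<^esub> g \<otimes>\<^bsub>G\<^esub> inv\<^bsub>G\<^esub> h | g h. g \<in> carrier G \<and> h \<in> group_lcs G k}"

definition nilpotent_group :: "('g, 'b) monoid_scheme \<Rightarrow> bool" where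
  "nilpotent_group G \<longleftrightarrow> group G \<and> (\<exists>k. group_lcs G k = {\<one>\<^bsub>G\<^esub>})"

definition lie_log :: "('v \<Rightarrow> 'g) \<Rightarrow> 'g \<Rightarrow> 'v" where
  "lie_log Exp = inv_into UNIV Exp"

text \<open>
  The type \<open>'v\<close> of \<open>Exp\<close>'s arguments is the Lie algebra as a vector space. The curves
  \<open>t \<mapsto> Exp (t X)\<close> are one-parameter subgroups and \<open>Exp\<close> is a diffeomorphism, so the differential
  of \<open>Exp\<close> at \<open>0\<close> identifies \<open>'v\<close> with the tangent space at the unit element, and under this
  identification \<open>Exp\<close> is the exponential map. That the exponential map is a diffeomorphism is a
  theorem for connected, simply connected nilpotent Lie groups; it is recorded here as part of the
  standing assumptions.
\<close>

locale nilpotent_lie_group = lie_group G \<A>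
  for G :: "'g::{t2_space, second_countable_topology} monoid" (structure)
    and \<A> :: "('g, 'v::euclidean_space) chart set" +
  fixes Exp :: "'v \<Rightarrow> 'g"
  assumes connected_group: "connected (UNIV :: 'g set)"
    and simply_connected_group: "simply_connected (UNIV :: 'g set)"
    and nilpotent: "nilpotent_group G"
    and one_parameter: "Exp ((s + t) *\<^sub>R X) = Exp (s *\<^sub>R X) \<otimes> Exp (t *\<^sub>R X)"
    and bij_Exp: "bij Exp"
    and smooth_Exp: "smooth_map euclidean_atlas \<A> Exp"
    and smooth_Log: "smooth_map \<A> euclidean_atlas (lie_log Exp)"

text \<open>
  \<open>Ad\<^sub>g\<close> is the differential at the unit element of conjugation by \<open>g\<close>, computed in the chart
  \<open>log\<close>; the bracket is \<open>[X, Y] = ad X Y\<close> with \<open>ad\<close> the differential of \<open>Ad\<close>.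
\<close>

definition lie_Ad :: "('g, 'b) monoid_scheme \<Rightarrow> ('v::euclidean_space \<Rightarrow> 'g) \<Rightarrow> 'g \<Rightarrow> 'v \<Rightarrow> 'v" where
  "lie_Ad G Exp g Y =
     vector_derivative (\<lambda>t. lie_log Exp (g \<otimes>\<^bsub>G\<^esub> Exp (t *\<^sub>R Y) \<otimes>\<^bsub>G\<^esub> inv\<^bsub>G\<^esub> g)) (at 0)"

definition lie_bracket ::
  "('g, 'b) monoid_scheme \<Rightarrow> ('v::euclidean_space \<Rightarrow> 'g) \<Rightarrow> 'v \<Rightarrow> 'v \<Rightarrow> 'v" where
  "lie_bracket G Exp X Y = vector_derivative (\<lambda>s. lie_Ad G Exp (Exp (s *\<^sub>R X)) Y) (at 0)"

text \<open>\<open>lie_lcs G Exp k\<close> is \<open>\<nn>\<^sub>k\<close> for \<open>k \<ge> 1\<close>; the value at \<open>0\<close> is a placeholder.\<close>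

primrec lie_lcs ::
  "('g, 'b) monoid_scheme \<Rightarrow> ('v::euclidean_space \<Rightarrow> 'g) \<Rightarrow> nat \<Rightarrow> 'v set" where
  "lie_lcs G Exp 0 = UNIV"
| "lie_lcs G Exp (Suc k) = (if k = 0 then UNIV
     else span {lie_bracket G Exp X Y | X Y. Y \<in> lie_lcs G Exp k})"

definition graded_complements ::
  "('g, 'b) monoid_scheme \<Rightarrow> ('v::euclidean_space \<Rightarrow> 'g) \<Rightarrow> nat \<Rightarrow> (nat \<Rightarrow> 'v set) \<Rightarrow> bool" where
  "graded_complements G Exp r gs \<longleftrightarrow>
     1 \<le> r \<and> lie_lcs G Exp r \<noteq> {0} \<and> lie_lcs G Exp (Suc r) = {0} \<and>
     (\<forall>k\<in>{1..r}. subspace (gs k) \<and> gs k \<inter> lie_lcs G Exp (Suc k) = {0} \<and>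
        lie_lcs G Exp k = {Y + Z | Y Z. Y \<in> gs k \<and> Z \<in> lie_lcs G Exp (Suc k)})"

definition graded_component :: "(nat \<Rightarrow> 'v::euclidean_space set) \<Rightarrow> nat \<Rightarrow> nat \<Rightarrow> 'v \<Rightarrow> 'v" where
  "graded_component gs r k Z =
     (THE Y. \<exists>f. (\<forall>i\<in>{1..r}. f i \<in> gs i) \<and> Z = (\<Sum>i=1..r. f i) \<and> Y = f k)"

text \<open>\<open>log g\<close> restricted to \<open>\<gg>\<^sup>(\<^sup>1\<^sup>)\<close>, in coordinates with respect to the basis \<open>B\<close>.\<close>

definition log1 ::
  "('v::euclidean_space \<Rightarrow> 'g) \<Rightarrow> nat \<Rightarrow> (nat \<Rightarrow> 'v set) \<Rightarrow> ('d::finite \<Rightarrow> 'v) \<Rightarrow> 'g \<Rightarrow> real ^ 'd" where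
  "log1 Exp r gs B g =
     (\<chi> i. representation (range B) (graded_component gs r 1 (lie_log Exp g)) (B i))"

section \<open>Cocompact lattices\<close>

text \<open>The quotient topology on \<open>\<Gamma>\<setminus>G\<close>; the library's right cosets are the sets \<open>\<Gamma> g\<close>.\<close>

definition orbit_topology :: "('g::topological_space, 'b) monoid_scheme \<Rightarrow> 'g set \<Rightarrow> 'g set topology" where
  "orbit_topology G \<Gamma> = topology (\<lambda>\<U>. \<U> \<subseteq> rcosets\<^bsub>G\<^esub> \<Gamma> \<and> open (\<Union>\<U>))"

lemma openin_orbit_topology:
  assumes "group G" "subgroup \<Gamma> G"
  shows "openin (orbit_topology G \<Gamma>) \<U> \<longleftrightarrow> \<U> \<subseteq> rcosets\<^bsub>G\<^esub> \<Gamma> \<and> open (\<Union>\<U>)"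
proof -
  interpret group G by fact
  have inter: "\<Union>(\<U> \<inter> \<V>) = \<Union>\<U> \<inter> \<Union>\<V>"
    if \<U>: "\<U> \<subseteq> rcosets\<^bsub>G\<^esub> \<Gamma>" and \<V>: "\<V> \<subseteq> rcosets\<^bsub>G\<^esub> \<Gamma>" for \<U> \<V>
  proof (intro equalityI subsetI)
    fix g assume "g \<in> \<Union>\<U> \<inter> \<Union>\<V>"
    then obtain C D where C: "C \<in> \<U>" "g \<in> C" and D: "D \<in> \<V>" "g \<in> D"
      by auto
    have "C \<in> rcosets\<^bsub>G\<^esub> \<Gamma>" "D \<in> rcosets\<^bsub>G\<^esub> \<Gamma>"
      using \<U> \<V> C(1) D(1) by auto
    then have "C = D"
      using pairwiseD[OF rcos_disjoint[OF assms(2)], of C D] C(2) D(2)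
      unfolding disjnt_iff by metis
    then show "g \<in> \<Union>(\<U> \<inter> \<V>)"
      using C D by auto
  qed auto
  have "istopology (\<lambda>\<U>. \<U> \<subseteq> rcosets\<^bsub>G\<^esub> \<Gamma> \<and> open (\<Union>\<U>))"
    unfolding istopology_def
  proof (intro conjI allI impI)
    fix \<K> assume *: "\<forall>K\<in>\<K>. K \<subseteq> rcosets\<^bsub>G\<^esub> \<Gamma> \<and> open (\<Union>K)"
    then show "\<Union>\<K> \<subseteq> rcosets\<^bsub>G\<^esub> \<Gamma>"
      by (meson Union_least)
    have "\<Union>(\<Union>\<K>) = \<Union>(Union ` \<K>)"
      by auto
    moreover have "open (\<Union>(Union ` \<K>))"
      using * by (intro open_Union) auto
    ultimately show "open (\<Union>(\<Union>\<K>))"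
      by (simp only:)
  next
    fix S T assume "S \<subseteq> rcosets\<^bsub>G\<^esub> \<Gamma> \<and> open (\<Union>S)" "T \<subseteq> rcosets\<^bsub>G\<^esub> \<Gamma> \<and> open (\<Union>T)"
    then show "S \<inter> T \<subseteq> rcosets\<^bsub>G\<^esub> \<Gamma>" "open (\<Union>(S \<inter> T))"
      by (simp_all add: inter open_Int le_infI1)
  qed
  then show ?thesis
    by (simp add: orbit_topology_def topology_inverse')
qed

definition cocompact_lattice :: "('g::topological_space, 'b) monoid_scheme \<Rightarrow> 'g set \<Rightarrow> bool" where
  "cocompact_lattice G \<Gamma> \<longleftrightarrow> subgroup \<Gamma> G \<and>
     (\<exists>U. open U \<and> U \<inter> \<Gamma> = {\<one>\<^bsub>G\<^esub>}) \<and> compact_space (orbit_topology G \<Gamma>)"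

definition finitely_generated_group :: "('g, 'b) monoid_scheme \<Rightarrow> bool" where
  "finitely_generated_group G \<longleftrightarrow> (\<exists>S. finite S \<and> S \<subseteq> carrier G \<and> generate G S = carrier G)"

definition torsion_free_group :: "('g, 'b) monoid_scheme \<Rightarrow> bool" where
  "torsion_free_group G \<longleftrightarrow>
     (\<forall>g\<in>carrier G. \<forall>n::nat. 0 < n \<longrightarrow> g [^]\<^bsub>G\<^esub> n = \<one>\<^bsub>G\<^esub> \<longrightarrow> g = \<one>\<^bsub>G\<^esub>)"

section \<open>Graphs and coverings\<close>

text \<open>
  Graphs in the sense of Serre, possibly with loops and multiple edges: the types \<open>'x\<close> and \<open>'e\<close>
  are the sets of vertices and of oriented edges.
\<close>

record ('x, 'e) ograph =
  org :: "'e \<Rightarrow> 'x"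
  ter :: "'e \<Rightarrow> 'x"
  bar :: "'e \<Rightarrow> 'e"

fun edge_path :: "('x, 'e) ograph \<Rightarrow> 'x \<Rightarrow> 'e list \<Rightarrow> 'x \<Rightarrow> bool" where
  "edge_path X x [] y \<longleftrightarrow> x = y"
| "edge_path X x (e # es) y \<longleftrightarrow> org X e = x \<and> edge_path X (ter X e) es y"

definition connected_graph :: "('x, 'e) ograph \<Rightarrow> bool" where
  "connected_graph X \<longleftrightarrow>
     (\<forall>e. bar X (bar X e) = e \<and> bar X e \<noteq> e \<and> org X (bar X e) = ter X e \<and> ter X (bar X e) = org X e) \<and>
     (\<forall>x y. \<exists>es. edge_path X x es y)"

text \<open>
  \<open>X\<close> is a connected covering graph of the finite connected graph \<open>X\<^sub>0\<close> with covering transformation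
  group \<open>\<Gamma>\<close>: \<open>\<Gamma>\<close> acts on \<open>X\<close> freely by graph automorphisms and \<open>(\<pi>V, \<pi>E)\<close> is the quotient
  morphism onto \<open>X\<^sub>0 = \<Gamma>\<setminus>X\<close>.
\<close>

locale covering_graph =
  fixes \<Gamma> :: "('g, 'b) monoid_scheme" (structure)
    and X :: "('x, 'e) ograph" and X0 :: "('x0::finite, 'e0::finite) ograph"
    and \<pi>V :: "'x \<Rightarrow> 'x0" and \<pi>E :: "'e \<Rightarrow> 'e0"
    and actV :: "'g \<Rightarrow> 'x \<Rightarrow> 'x" and actE :: "'g \<Rightarrow> 'e \<Rightarrow> 'e"
  assumes connected_X: "connected_graph X" and connected_X0: "connected_graph X0"
    and morphism: "org X0 (\<pi>E e) = \<pi>V (org X e)" "ter X0 (\<pi>E e) = \<pi>V (ter X e)"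
      "bar X0 (\<pi>E e) = \<pi>E (bar X e)"
    and actions: "group_action \<Gamma> UNIV actV" "group_action \<Gamma> UNIV actE"
    and automorphisms: "\<gamma> \<in> carrier \<Gamma> \<Longrightarrow> org X (actE \<gamma> e) = actV \<gamma> (org X e)"
      "\<gamma> \<in> carrier \<Gamma> \<Longrightarrow> ter X (actE \<gamma> e) = actV \<gamma> (ter X e)"
      "\<gamma> \<in> carrier \<Gamma> \<Longrightarrow> bar X (actE \<gamma> e) = actE \<gamma> (bar X e)"
    and free: "\<gamma> \<in> carrier \<Gamma> \<Longrightarrow> actV \<gamma> y = y \<Longrightarrow> \<gamma> = \<one>"
    and quotient: "surj \<pi>V" "surj \<pi>E"
      "\<pi>V y = \<pi>V z \<longleftrightarrow> (\<exists>\<gamma>\<in>carrier \<Gamma>. z = actV \<gamma> y)"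
      "\<pi>E e = \<pi>E f \<longleftrightarrow> (\<exists>\<gamma>\<in>carrier \<Gamma>. f = actE \<gamma> e)"

section \<open>Random walks\<close>

definition transition_probability :: "('x0, 'e0::finite) ograph \<Rightarrow> ('e0 \<Rightarrow> real) \<Rightarrow> bool" where
  "transition_probability X0 p \<longleftrightarrow>
     (\<forall>e. 0 < p e \<and> p e \<le> 1) \<and> (\<forall>y. (\<Sum>e | org X0 e = y. p e) = 1)"

definition normalized_invariant_measure ::
  "('x0::finite, 'e0::finite) ograph \<Rightarrow> ('e0 \<Rightarrow> real) \<Rightarrow> ('x0 \<Rightarrow> real) \<Rightarrow> bool" where
  "normalized_invariant_measure X0 p m \<longleftrightarrow>
     (\<forall>y. 0 < m y \<and> m y \<le> 1) \<and> (\<Sum>y\<in>UNIV. m y) = 1 \<and>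
     (\<forall>y. m y = (\<Sum>e | ter X0 e = y. p e * m (org X0 e)))"

text \<open>
  Infinite edge paths are indexed from \<open>0\<close>: \<open>c = (e\<^sub>1, e\<^sub>2, \<dots>)\<close> is the function with
  \<open>c n = e\<^sub>n\<^sub>+\<^sub>1\<close>, so the position \<open>w\<^sub>n(c) = o(e\<^sub>n\<^sub>+\<^sub>1)\<close> is \<open>org X (c n)\<close>.
\<close>

definition infinite_paths :: "('x, 'e) ograph \<Rightarrow> 'x \<Rightarrow> (nat \<Rightarrow> 'e) set" where
  "infinite_paths X x = {c. org X (c 0) = x \<and> (\<forall>n. ter X (c n) = org X (c (Suc n)))}"

definition walk :: "('x, 'e) ograph \<Rightarrow> nat \<Rightarrow> (nat \<Rightarrow> 'e) \<Rightarrow> 'x" where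
  "walk X n c = org X (c n)"

text \<open>The measure \<open>\<P>\<^sub>x\<close> is characterized by its values on cylinder sets.\<close>

definition markov_path_measure ::
  "('x, 'e) ograph \<Rightarrow> ('e \<Rightarrow> real) \<Rightarrow> 'x \<Rightarrow> (nat \<Rightarrow> 'e) measure \<Rightarrow> bool" where
  "markov_path_measure X q x P \<longleftrightarrow> prob_space P \<and> space P = infinite_paths X x \<and>
     sets P = sets (restrict_space (\<Pi>\<^sub>M n\<in>UNIV. count_space UNIV) (infinite_paths X x)) \<and>
     (\<forall>es y. edge_path X x es y \<longrightarrow>
        measure P {c \<in> infinite_paths X x. \<forall>i<length es. c i = es ! i} = (\<Prod>e\<leftarrow>es. q e))"

section \<open>Homology and the asymptotic direction\<close>

text \<open>
  Since \<open>\<bar>e = -e\<close> in \<open>C\<^sub>1(X\<^sub>0, \<real>)\<close> (with \<open>\<bar>e\<close> the inverse edge), this space is realized as the space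
  of antisymmetric vectors: the chain \<open>\<Sum>\<^sub>e f(e) e\<close> is the vector \<open>e \<mapsto> f(e) - f(bar e)\<close>. Conversely,
  an antisymmetric \<open>c\<close> stands for the chain \<open>\<Sum>\<^sub>e (c(e) / 2) e\<close>.
\<close>

definition chain :: "('x0, 'e0::finite) ograph \<Rightarrow> ('e0 \<Rightarrow> real) \<Rightarrow> real ^ 'e0" where
  "chain X0 f = (\<chi> e. f e - f (bar X0 e))"

definition C1 :: "('x0, 'e0::finite) ograph \<Rightarrow> (real ^ 'e0) set" where
  "C1 X0 = {c. \<forall>e. c $ bar X0 e = - c $ e}"

definition boundary :: "('x0::finite, 'e0::finite) ograph \<Rightarrow> real ^ 'e0 \<Rightarrow> real ^ 'x0" where
  "boundary X0 c = (\<Sum>e\<in>UNIV. (c $ e / 2) *\<^sub>R (axis (ter X0 e) 1 - axis (org X0 e) 1))"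

definition H1 :: "('x0::finite, 'e0::finite) ograph \<Rightarrow> (real ^ 'e0) set" where
  "H1 X0 = {c \<in> C1 X0. boundary X0 c = 0}"

text \<open>The evaluation of a 1-cochain \<open>\<omega>\<close> on a chain \<open>c \<in> C1 X0\<close>.\<close>

definition pairing :: "real ^ 'e0::finite \<Rightarrow> real ^ 'e0 \<Rightarrow> real" where
  "pairing c \<omega> = (\<Sum>e\<in>UNIV. (c $ e / 2) * \<omega> $ e)"

definition edge_weight :: "('x0, 'e0) ograph \<Rightarrow> ('e0 \<Rightarrow> real) \<Rightarrow> ('x0 \<Rightarrow> real) \<Rightarrow> 'e0 \<Rightarrow> real" where
  "edge_weight X0 p m e = p e * m (org X0 e)"

definition gamma_p :: "('x0, 'e0::finite) ograph \<Rightarrow> ('e0 \<Rightarrow> real) \<Rightarrow> ('x0 \<Rightarrow> real) \<Rightarrow> real ^ 'e0" where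
  "gamma_p X0 p m = chain X0 (edge_weight X0 p m)"

text \<open>
  \<open>\<rho>([c])\<close> for a closed path \<open>c\<close> in \<open>X\<^sub>0\<close> based at the projection of \<open>x\<close>: the lift of \<open>c\<close> starting
  at \<open>x\<close> ends at \<open>\<rho>([c]) x\<close>.
\<close>

definition deck_rho ::
  "'g set \<Rightarrow> ('x, 'e) ograph \<Rightarrow> ('e \<Rightarrow> 'e0) \<Rightarrow> ('g \<Rightarrow> 'x \<Rightarrow> 'x) \<Rightarrow> 'x \<Rightarrow> 'e0 list \<Rightarrow> 'g" where
  "deck_rho \<Gamma> X \<pi>E actV x c =
     (THE \<gamma>. \<gamma> \<in> \<Gamma> \<and> (\<exists>es. map \<pi>E es = c \<and> edge_path X x es (actV \<gamma> x)))"

text \<open>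
  \<open>\<rho>\<^sub>\<real>\<close>: the linear map on \<open>H1 X0\<close> which sends the class of a closed path \<open>c\<close> to \<open>l (\<rho>([c]))\<close>, where
  \<open>l\<close> stands for \<open>log(\<cdot>)\<close> restricted to \<open>\<gg>\<^sup>(\<^sup>1\<^sup>)\<close>. The values outside \<open>H1 X0\<close> are meaningless.
\<close>

definition rho_real ::
  "'g set \<Rightarrow> ('x, 'e) ograph \<Rightarrow> ('x0::finite, 'e0::finite) ograph \<Rightarrow> ('x \<Rightarrow> 'x0) \<Rightarrow> ('e \<Rightarrow> 'e0) \<Rightarrow>
   ('g \<Rightarrow> 'x \<Rightarrow> 'x) \<Rightarrow> 'x \<Rightarrow> ('g \<Rightarrow> real ^ 'd::finite) \<Rightarrow> real ^ 'e0 \<Rightarrow> real ^ 'd" where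
  "rho_real \<Gamma> X X0 \<pi>V \<pi>E actV x l a =
     (THE v. \<exists>L. linear L \<and>
        (\<forall>c. edge_path X0 (\<pi>V x) c (\<pi>V x) \<longrightarrow>
           L (chain X0 (\<lambda>e. real (count_list c e))) = l (deck_rho \<Gamma> X \<pi>E actV x c)) \<and>
        v = L a)"

section \<open>The Albanese metric\<close>

text \<open>
  A class in \<open>H\<^sup>1(X\<^sub>0, \<real>)\<close> is a linear functional \<open>\<xi>\<close> on \<open>H1 X0\<close>; only the values of \<open>\<xi>\<close> there matter.
\<close>

definition harmonic_rep ::
  "('x0::finite, 'e0::finite) ograph \<Rightarrow> ('e0 \<Rightarrow> real) \<Rightarrow> ('x0 \<Rightarrow> real) \<Rightarrow>
   (real ^ 'e0 \<Rightarrow> real) \<Rightarrow> real ^ 'e0" where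
  "harmonic_rep X0 p m \<xi> =
     (THE \<omega>. (\<forall>e. \<omega> $ bar X0 e = - \<omega> $ e) \<and> (\<forall>c\<in>H1 X0. pairing c \<omega> = \<xi> c) \<and>
        (\<forall>y. (\<Sum>e | org X0 e = y. p e * \<omega> $ e) = pairing (gamma_p X0 p m) \<omega>))"

definition albanese_form ::
  "('x0::finite, 'e0::finite) ograph \<Rightarrow> ('e0 \<Rightarrow> real) \<Rightarrow> ('x0 \<Rightarrow> real) \<Rightarrow>
   (real ^ 'e0 \<Rightarrow> real) \<Rightarrow> (real ^ 'e0 \<Rightarrow> real) \<Rightarrow> real" where
  "albanese_form X0 p m \<xi>\<^sub>1 \<xi>\<^sub>2 =
     (let \<omega>\<^sub>1 = harmonic_rep X0 p m \<xi>\<^sub>1; \<omega>\<^sub>2 = harmonic_rep X0 p m \<xi>\<^sub>2 in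
      (\<Sum>e\<in>UNIV. edge_weight X0 p m e * \<omega>\<^sub>1 $ e * \<omega>\<^sub>2 $ e)
        - pairing (gamma_p X0 p m) \<omega>\<^sub>1 * pairing (gamma_p X0 p m) \<omega>\<^sub>2)"

text \<open>
  In coordinates the dual basis \<open>\<omega>\<^sub>1, \<dots>, \<omega>\<^sub>d\<close> consists of the coordinate functions, and the
  transpose of \<open>R = \<rho>\<^sub>\<real>\<close> sends \<open>\<omega>\<^sub>i\<close> to \<open>\<omega>\<^sub>i \<circ> R\<close>.
\<close>

definition albanese_Sigma ::
  "('x0::finite, 'e0::finite) ograph \<Rightarrow> ('e0 \<Rightarrow> real) \<Rightarrow> ('x0 \<Rightarrow> real) \<Rightarrow>
   (real ^ 'e0 \<Rightarrow> real ^ 'd::finite) \<Rightarrow> real ^ 'd ^ 'd" where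
  "albanese_Sigma X0 p m R = (\<chi> i j. albanese_form X0 p m (\<lambda>a. R a $ i) (\<lambda>a. R a $ j))"

section \<open>Path space and rate function\<close>

definition absolutely_continuous_on ::
  "real set \<Rightarrow> (real \<Rightarrow> 'a::real_normed_vector) \<Rightarrow> bool" where
  "absolutely_continuous_on S h \<longleftrightarrow>
     (\<forall>\<epsilon>>0. \<exists>\<delta>>0. \<forall>(N::nat) s t.
        (\<forall>i<N. s i \<le> t i \<and> {s i..t i} \<subseteq> S) \<longrightarrow>
        pairwise (\<lambda>i j. {s i<..<t i} \<inter> {s j<..<t j} = {}) {..<N} \<longrightarrow>
        (\<Sum>i<N. t i - s i) < \<delta> \<longrightarrow> (\<Sum>i<N. norm (h (t i) - h (s i))) < \<epsilon>)"

text \<open>Functions on \<open>[0, 1]\<close> are functions on \<open>real\<close> with the value \<open>undefined\<close> outside \<open>[0, 1]\<close>.\<close>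

definition AC0 :: "(real \<Rightarrow> 'a::euclidean_space) set" where
  "AC0 = {h \<in> extensional {0..1}. h 0 = 0 \<and> absolutely_continuous_on {0..1} h}"

definition AC0_topology :: "(real \<Rightarrow> 'a::euclidean_space) topology" where
  "AC0_topology = mtopology_of (submetric (cfunspace (top_of_set {0..1}) euclidean_metric) AC0)"

definition borel_sets_of :: "'a topology \<Rightarrow> 'a set set" where
  "borel_sets_of T = sigma_sets (topspace T) {U. openin T U}"

definition good_rate_function :: "'a topology \<Rightarrow> ('a \<Rightarrow> ereal) \<Rightarrow> bool" where
  "good_rate_function T I \<longleftrightarrow>
     (\<forall>h\<in>topspace T. 0 \<le> I h) \<and>
     (\<forall>b. openin T {h \<in> topspace T. b < I h}) \<and>
     (\<forall>b::real. compactin T {h \<in> topspace T. I h \<le> ereal b})"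

definition mdp_rate :: "real ^ 'd::finite ^ 'd \<Rightarrow> (real \<Rightarrow> real ^ 'd) \<Rightarrow> ereal" where
  "mdp_rate \<Sigma> h = (if h \<in> AC0
     then enn2ereal (\<integral>\<^sup>+ t\<in>{0..1}.
       ennreal ((1 / 2) * ((matrix_inv \<Sigma> *v vector_derivative h (at t)) \<bullet> vector_derivative h (at t)))
       \<partial>lebesgue)
     else \<infinity>)"

text \<open>The logarithm on \<open>[0, 1]\<close> with \<open>log 0 = -\<infinity>\<close>.\<close>

definition log_prob :: "real \<Rightarrow> ereal" where
  "log_prob q = (if q = 0 then -\<infinity> else ereal (ln q))"

text \<open>\<open>Y k\<close> plays the role of the \<open>k\<close>-th centred increment; the sequence is used from \<open>k = 1\<close> on.\<close>

definition interpolated_path :: "(nat \<Rightarrow> 'a::real_normed_vector) \<Rightarrow> real \<Rightarrow> nat \<Rightarrow> real \<Rightarrow> 'a" where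
  "interpolated_path Y b n = restrict (\<lambda>t.
     (1 / b) *\<^sub>R (\<Sum>k=1..nat \<lfloor>real n * t\<rfloor>. Y k) +
     ((1 / b) * (real n * t - of_int \<lfloor>real n * t\<rfloor>)) *\<^sub>R Y (nat \<lfloor>real n * t\<rfloor> + 1)) {0..1}"

end

theory Submission
  imports Defs "HOL-Real_Asymp.Real_Asymp" "HOL-Complex_Analysis.Great_Picard"
begin

text \<open>
  Modulo \<open>[\<gg>, \<gg>]\<close> the logarithm is additive, so the increments of \<open>\<Xi>\<close> along the walk are a function of
  the edges of the finite graph \<open>X\<^sub>0\<close>. Adding the coboundary of a solution of the Poisson equation
  turns the centred increments into martingale differences with stationary covariance \<open>\<Sigma>\<close>; the
  coboundary sums telescope to a bounded term, which is invisible on the scale \<open>a\<^sub>n\<close>.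

  Cut the time interval into \<open>K\<close> blocks. A second-order expansion of the Laplace transform, in which a
  further corrector removes the dependence on the current vertex, gives the Gaussian exponential
  asymptotics of the block sums: the upper bound by exponential moments, the lower bound by tilting.
  Doob's inequality makes oscillations inside the blocks superexponentially unlikely as
  \<open>K \<rightarrow> \<infinity>\<close>. A path without such oscillations is uniformly close to the polygon through its \<open>K\<close> grid
  values, and the rate of this polygon is the quadratic functional of the block sums that governs
  their asymptotics. For closed sets one separates the set from a compact sublevel set of the rate;
  for open sets one follows the grid values of a given \<open>h\<close>, whose discrete energies are bounded by
  \<open>I'(h)\<close>.

  The discrete energies also give the compactness of the sublevel sets, through Arzela-Ascoli. Their
  comparison with the integral rests on the almost everywhere differentiability of absolutely
  continuous functions and on the fundamental theorem of calculus for them.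
\<close>

section \<open>Differentiability of absolutely continuous functions\<close>

text \<open>Every probabilistic estimate concerns finite edge lists in \<open>X0\<close> and is
  uniform in the starting vertex. This uniformity stands in for independence of the blocks, and
  uniqueness of path lifting is what carries the estimates over to the path measure on
  \<open>X\<close>. The path space \<open>AC0\<close> is not complete in the uniform metric: a
  uniform limit of paths of bounded rate has to be shown absolutely continuous, which calls for
  energies over arbitrary disjoint families of intervals and not only over grids. As the rate
  integrates the actual derivative, Lebesgue's theory of absolutely continuous functions is derived
  from Vitali coverings and gauge integrals. Additivity of the logarithm modulo brackets is reached
  without the Baker-Campbell-Hausdorff formula, from a C^1 group law and the halving of
  one-parameter subgroups. The walk may be non-reversible, so the Poisson equation is solved through
  the maximum principle, which asks only for positive weights and connectedness. Positive
  definiteness of \<Sigma> rests on cocompactness of the lattice and on each edge being present in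
  both orientations.\<close>

text \<open>The Vitali covering theorem gives countably many disjoint intervals exhausting
  \<open>S\<close> up to a null set. All of them lie in \<open>G\<close>, which has finite measure,
  so finitely many carry all but \<eta> of the total length; \<open>T\<close> is the rest.
  Finiteness matters because absolute continuity speaks of finite families. \<open>P\<close> stays
  abstract to cover large slopes, small slopes and steep pieces alike.\<close>

lemma vitali_intervals:
  fixes S G :: "real set"
  assumes "open G" "G \<in> lmeasurable" "S \<subseteq> G" "0 < \<eta>"
    and cov: "\<And>x d. x \<in> S \<Longrightarrow> 0 < d \<Longrightarrow> \<exists>a b. a < b \<and> a \<le> x \<and> x \<le> b \<and> b - a < d \<and> P a b"
  obtains \<F> T where "finite \<F>" "\<forall>K\<in>\<F>. \<exists>a b. a < b \<and> K = {a..b} \<and> K \<subseteq> G \<and> P a b"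
    "pairwise disjnt \<F>" "S \<subseteq> \<Union>\<F> \<union> T" "T \<in> lmeasurable" "measure lebesgue T < \<eta>"
proof -
  define I where "I = {(a, b). a < b \<and> {a..b} \<subseteq> G \<and> P a b}"
  \<comment> \<open>The covering theorem is about balls, so an interval enters as the ball around
    its midpoint.\<close>
  define ce where "ce = (\<lambda>(a, b). (a + b) / 2 :: real)"
  define ra where "ra = (\<lambda>(a, b). (b - a) / 2 :: real)"
  have ball: "cball (ce (a, b)) (ra (a, b)) = {a..b}" for a b
    by (auto simp: cball_eq_atLeastAtMost ce_def ra_def field_simps)
  have 1: "0 < ra i" if "i \<in> I" for i
    using that by (auto simp: I_def ra_def)
  have 2: "\<exists>i. i \<in> I \<and> x \<in> cball (ce i) (ra i) \<and> ra i < d" if x: "x \<in> S" and d: "0 < d" for x d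
  proof -
    obtain e where e: "e > 0" "ball x e \<subseteq> G"
      using assms(1,3) x by (meson open_contains_ball subsetD)
    obtain a b where ab: "a < b" "a \<le> x" "x \<le> b" "b - a < min d e" "P a b"
      using cov[OF x, of "min d e"] d e by auto
    have "{a..b} \<subseteq> ball x e"
      using ab by (auto simp: ball_eq_greaterThanLessThan)
    then have "(a, b) \<in> I"
      using ab e by (auto simp: I_def)
    then show ?thesis
      using ab by (intro exI[of _ "(a, b)"]) (auto simp: ball, simp add: ra_def)
  qed
  obtain C where C: "countable C" "C \<subseteq> I"
     "pairwise (\<lambda>i j. disjnt (cball (ce i) (ra i)) (cball (ce j) (ra j))) C"
     "negligible (S - (\<Union>i \<in> C. cball (ce i) (ra i)))"
    by (rule Vitali_covering_theorem_cballs[of I ra S ce, OF 1 2])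
  define \<C> where "\<C> = (\<lambda>i. cball (ce i) (ra i)) ` C"
  have \<C>: "\<exists>a b. a < b \<and> K = {a..b} \<and> K \<subseteq> G \<and> P a b" if "K \<in> \<C>" for K
    using that C(2) ball unfolding \<C>_def I_def by force
  have meas: "K \<in> lmeasurable" if "K \<in> \<C>" for K
    using \<C>[OF that] by auto
  have bound: "measure lebesgue (\<Union>D) \<le> measure lebesgue G" if "D \<subseteq> \<C>" "finite D" for D
  proof (rule measure_mono_fmeasurable)
    show "\<Union>D \<subseteq> G"
      using \<C> that(1) by blast
    show "\<Union>D \<in> sets lebesgue"
      using that meas by (intro fmeasurableD fmeasurable.finite_Union) auto
  qed (rule assms(2))
  have cC: "countable \<C>"
    using C(1) by (simp add: \<C>_def)
  obtain \<F> where \<F>: "\<F> \<subseteq> \<C>" "finite \<F>" "measure lebesgue (\<Union>\<C>) - \<eta> < measure lebesgue (\<Union>\<F>)"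
    using measure_countable_Union_approachable[OF cC assms(4) meas bound] by auto
  have mC: "\<Union>\<C> \<in> lmeasurable"
    by (intro fmeasurable_Union_bound[OF cC meas bound]) auto
  have mF: "\<Union>\<F> \<in> lmeasurable"
    using \<F> meas by (intro fmeasurable.finite_Union) auto
  have null: "S - \<Union>\<C> \<in> null_sets lebesgue"
    using C(4) by (simp add: \<C>_def negligible_iff_null_sets)
  define T where "T = (\<Union>\<C> - \<Union>\<F>) \<union> (S - \<Union>\<C>)"
  have "S - \<Union>\<C> \<in> lmeasurable"
    using null by (simp add: negligible_iff_null_sets negligible_imp_measurable)
  then have "T \<in> lmeasurable"
    unfolding T_def by (rule fmeasurable.Un[OF fmeasurable.Diff[OF mC mF]])
  moreover have "measure lebesgue T = measure lebesgue (\<Union>\<C> - \<Union>\<F>)"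
    unfolding T_def using mC mF null by (intro measure_Un_null_set) auto
  moreover have "measure lebesgue (\<Union>\<C> - \<Union>\<F>) = measure lebesgue (\<Union>\<C>) - measure lebesgue (\<Union>\<F>)"
    using mC mF \<F> by (intro measurable_measure_Diff) auto
  moreover have "pairwise disjnt \<C>"
    using C(3) unfolding \<C>_def pairwise_def by auto
  then have "pairwise disjnt \<F>"
    using \<F>(1) pairwise_subset by blast
  moreover have "S \<subseteq> \<Union>\<F> \<union> T"
    by (auto simp: T_def)
  moreover have "measure lebesgue T < \<eta>"
    using calculation(2,3) \<F>(3) by linarith
  ultimately show ?thesis
    using \<F>(1,2) \<C> by (intro that[of \<F> T]) blast+
qed

text \<open>The definition recast for finite sets of intervals, the shape in which Vitali families
  and divisions arrive. Only interiors have to be disjoint, since neighbouring pieces of a division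
  share an endpoint.\<close>

lemma absolutely_continuous_on_family:
  assumes "absolutely_continuous_on S h" "0 < \<epsilon>"
  obtains \<delta> where "\<delta> > 0" "\<And>\<D>. finite \<D> \<Longrightarrow> (\<And>K. K \<in> \<D> \<Longrightarrow> \<exists>a b. a \<le> b \<and> K = {a..b} \<and> K \<subseteq> S) \<Longrightarrow>
     pairwise (\<lambda>K L. interior K \<inter> interior L = {}) \<D> \<Longrightarrow> (\<Sum>K\<in>\<D>. Sup K - Inf K) < \<delta> \<Longrightarrow>
     (\<Sum>K\<in>\<D>. norm (h (Sup K) - h (Inf K))) < \<epsilon>"
proof -
  obtain \<delta> where \<delta>: "\<delta> > 0" "\<And>(N::nat) s t. (\<forall>i<N. s i \<le> t i \<and> {s i..t i} \<subseteq> S) \<Longrightarrow>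
        pairwise (\<lambda>i j. {s i<..<t i} \<inter> {s j<..<t j} = {}) {..<N} \<Longrightarrow>
        (\<Sum>i<N. t i - s i) < \<delta> \<Longrightarrow> (\<Sum>i<N. norm (h (t i) - h (s i))) < \<epsilon>"
    using assms unfolding absolutely_continuous_on_def by meson
  show ?thesis
  proof (rule that[OF \<delta>(1)])
    fix \<D> :: "real set set"
    assume D: "finite \<D>" "\<And>K. K \<in> \<D> \<Longrightarrow> \<exists>a b. a \<le> b \<and> K = {a..b} \<and> K \<subseteq> S"
      "pairwise (\<lambda>K L. interior K \<inter> interior L = {}) \<D>" "(\<Sum>K\<in>\<D>. Sup K - Inf K) < \<delta>"
    obtain k where k: "bij_betw k {..<card \<D>} \<D>"
      using D(1) bij_betw_from_nat_into_finite by blast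
    have kD: "k i \<in> \<D>" if "i < card \<D>" for i
      using k that by (auto simp: bij_betw_def)
    have *: "Inf (k i) \<le> Sup (k i) \<and> {Inf (k i)..Sup (k i)} = k i \<and> k i \<subseteq> S \<and> interior (k i) = {Inf (k i)<..<Sup (k i)}"
      if i: "i < card \<D>" for i
      using D(2)[OF kD[OF i]] by (auto simp: interior_atLeastAtMost_real)
    have "(\<Sum>i<card \<D>. norm (h (Sup (k i)) - h (Inf (k i)))) < \<epsilon>"
    proof (rule \<delta>(2))
      show "pairwise (\<lambda>i j. {Inf (k i)<..<Sup (k i)} \<inter> {Inf (k j)<..<Sup (k j)} = {}) {..<card \<D>}"
      proof (rule pairwiseI)
        fix i j assume "i \<in> {..<card \<D>}" "j \<in> {..<card \<D>}" "i \<noteq> j"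
        moreover from this have "k i \<noteq> k j"
          using k by (auto simp: bij_betw_def inj_on_def)
        ultimately show "{Inf (k i)<..<Sup (k i)} \<inter> {Inf (k j)<..<Sup (k j)} = {}"
          using D(3) * kD unfolding pairwise_def by (metis lessThan_iff)
      qed
      show "(\<Sum>i<card \<D>. Sup (k i) - Inf (k i)) < \<delta>"
        using D(4) sum.reindex_bij_betw[OF k, of "\<lambda>K. Sup K - Inf K"] by simp
    qed (use * in auto)
    then show "(\<Sum>K\<in>\<D>. norm (h (Sup K) - h (Inf K))) < \<epsilon>"
      using sum.reindex_bij_betw[OF k, of "\<lambda>K. norm (h (Sup K) - h (Inf K))"] by simp
  qed
qed

text \<open>Telescoping, reduced to additivity over tagged divisions by tagging each piece with its
  left endpoint.\<close>

lemma sum_increments_division: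
  fixes f :: "real \<Rightarrow> 'a::real_normed_vector"
  assumes "r division_of {a..b}" "a \<le> b"
  shows "(\<Sum>K\<in>r. f (Sup K) - f (Inf K)) = f b - f a"
proof -
  have I: "Inf K \<in> K" if "K \<in> r" for K
    using division_ofD(3,4)[OF assms(1) that] by (auto simp: cbox_interval)
  define p where "p = (\<lambda>K. (Inf K, K)) ` r"
  have disj: "interior K1 \<inter> interior K2 = {}" if "(x1, K1) \<in> p" "(x2, K2) \<in> p" "(x1, K1) \<noteq> (x2, K2)" for x1 K1 x2 K2
    using division_ofD(5)[OF assms(1), of K1 K2] that by (cases "K1 = K2") (auto simp: p_def)
  have "p tagged_division_of {a..b}"
    using division_ofD(1,2,4,6)[OF assms(1)] I disj
    by (intro tagged_division_ofI) (auto simp: p_def image_iff)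
  then have "(\<Sum>(x, K)\<in>p. f (Sup K) - f (Inf K)) = f b - f a"
    by (rule additive_tagged_division_1[OF assms(2)])
  moreover have "(\<Sum>(x, K)\<in>p. f (Sup K) - f (Inf K)) = (\<Sum>K\<in>r. f (Sup K) - f (Inf K))"
    unfolding p_def by (subst sum.reindex) (auto simp: inj_on_def)
  ultimately show ?thesis by simp
qed

text \<open>Once a disjoint family is completed to a division, the increment over
  \<open>{a..b}\<close> splits into the increments over the family and those over the gaps, and the
  gaps can be estimated separately.\<close>

lemma extend_disjoint_intervals:
  fixes F :: "real set set"
  assumes "finite F" "pairwise disjnt F" "\<And>K. K \<in> F \<Longrightarrow> \<exists>c d. c < d \<and> K = {c..d} \<and> K \<subseteq> {a..b}" "a < b"
  obtains r where "F \<subseteq> r" "r division_of {a..b}"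
proof -
  have "interior K1 \<inter> interior K2 = {}" if "K1 \<in> F" "K2 \<in> F" "K1 \<noteq> K2" for K1 K2
    using assms(2) that interior_subset[of K1] interior_subset[of K2] unfolding pairwise_def disjnt_def by blast
  moreover have "K \<noteq> {} \<and> (\<exists>c d. K = cbox c d)" if "K \<in> F" for K
    using assms(3)[OF that] by (auto simp: cbox_interval)
  ultimately have F: "F division_of \<Union>F"
    using assms(1) by (intro division_ofI) auto
  show ?thesis
  proof (rule partial_division_extend[OF F])
    show "{cbox a b} division_of cbox a b"
      using assms(4) by (intro division_of_self) auto
    show "\<Union>F \<subseteq> cbox a b"
      using assms(3) by (fastforce simp: cbox_interval)
  qed (use that in \<open>auto simp: cbox_interval\<close>)
qed

lemma measure_disjoint_intervals:
  fixes F :: "real set set"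
  assumes "finite F" "pairwise disjnt F" "\<forall>K\<in>F. \<exists>c d. c < d \<and> K = {c..d}"
  shows "measure lebesgue (\<Union>F) = (\<Sum>K\<in>F. Sup K - Inf K)" "\<Union>F \<in> lmeasurable"
proof -
  have K: "K \<in> lmeasurable" "measure lebesgue K = Sup K - Inf K" if "K \<in> F" for K
    using assms(3) that by auto
  show "measure lebesgue (\<Union>F) = (\<Sum>K\<in>F. Sup K - Inf K)"
    using assms K by (subst measure_Union') auto
  show "\<Union>F \<in> lmeasurable"
    using assms(1) K by (intro fmeasurable.finite_Union) auto
qed

text \<open>Cover \<open>E\<close>, up to small measure, by disjoint intervals of slope above \<open>q'\<close>, and then the part of
  \<open>E\<close> inside these by disjoint intervals of slope below \<open>q\<close>. If \<open>E\<close> has positive outer measure, the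
  two families have almost the same length but increments that differ by almost \<open>q' - q\<close> times that
  length, whereas \<open>f\<close> increases little over the small complement.\<close>

lemma absolutely_continuous_oscillation_negligible:
  fixes f :: "real \<Rightarrow> real"
  assumes AC: "absolutely_continuous_on {0..1} f" and qq: "q < q'" and E: "E \<subseteq> {0<..<1}"
    and up: "\<And>x d. x \<in> E \<Longrightarrow> 0 < d \<Longrightarrow> \<exists>a b. a < b \<and> a \<le> x \<and> x \<le> b \<and> b - a < d \<and> q' * (b - a) < f b - f a"
    and down: "\<And>x d. x \<in> E \<Longrightarrow> 0 < d \<Longrightarrow> \<exists>a b. a < b \<and> a \<le> x \<and> x \<le> b \<and> b - a < d \<and> f b - f a < q * (b - a)"
  shows "negligible E"
proof (rule ccontr)
  assume non: "\<not> negligible E"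
  \<comment> \<open>\<open>E\<close> is not known to be measurable; \<open>ou\<close> is its outer
    measure, taken over measurable supersets.\<close>
  define Ms where "Ms = {measure lebesgue T | T. T \<in> lmeasurable \<and> E \<subseteq> T}"
  define ou where "ou = Inf Ms"
  have M0: "measure lebesgue {0<..<1::real} \<in> Ms"
    using E by (auto simp: Ms_def intro!: exI[of _ "{0<..<1}"])
  obtain e where e: "e > 0" "\<And>T. E \<subseteq> T \<Longrightarrow> T \<in> lmeasurable \<Longrightarrow> e \<le> measure lebesgue T"
    using non unfolding negligible_outer by (meson not_less)
  have bdd: "bdd_below Ms"
    by (rule bdd_belowI[of _ 0]) (auto simp: Ms_def)
  have ou: "0 < ou"
    using e M0 unfolding ou_def by (intro less_le_trans[OF e(1)] cInf_greatest) (auto simp: Ms_def)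
  have oule: "ou \<le> measure lebesgue T" if "E \<subseteq> T" "T \<in> lmeasurable" for T
    unfolding ou_def using that by (intro cInf_lower bdd) (auto simp: Ms_def)
  \<comment> \<open>In the final count the intervals of \<open>H\<close> contribute at least
    \<open>(q' - q) * ou / 2\<close>, and the lengths of the gaps cost at most half of this. The
    remaining quarter of \<open>(q' - q) * ou\<close> must not be below \<epsilon>, which bounds the
    increments over the gaps.\<close>
  define \<epsilon> where "\<epsilon> = (q' - q) * ou / 4"
  have "\<epsilon> > 0"
    using qq ou by (simp add: \<epsilon>_def)
  obtain \<delta> where \<delta>: "\<delta> > 0" "\<And>\<D>. finite \<D> \<Longrightarrow> (\<And>K. K \<in> \<D> \<Longrightarrow> \<exists>a b. a \<le> b \<and> K = {a..b} \<and> K \<subseteq> {0..1}) \<Longrightarrow>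
     pairwise (\<lambda>K L. interior K \<inter> interior L = {}) \<D> \<Longrightarrow> (\<Sum>K\<in>\<D>. Sup K - Inf K) < \<delta> \<Longrightarrow>
     (\<Sum>K\<in>\<D>. norm (f (Sup K) - f (Inf K))) < \<epsilon>"
    using absolutely_continuous_on_family[OF AC \<open>\<epsilon> > 0\<close>] by blast
  \<comment> \<open>The three bounds keep the total length of \<open>H\<close> above
    \<open>ou / 2\<close>, the total length of the gaps, which is below \<open>3 * \<eta>\<close>,
    under \<delta>, and the loss \<open>\<bar>q'\<bar> * (3 * \<eta>)\<close> within the quarter
    allotted to it.\<close>
  define \<eta> where "\<eta> = min (ou / 4) (min (\<delta> / 4) ((q' - q) * ou / (12 * (\<bar>q'\<bar> + 1))))"
  have \<eta>: "0 < \<eta>" "\<eta> \<le> ou / 4" "3 * \<eta> < \<delta>" "\<bar>q'\<bar> * (3 * \<eta>) \<le> (q' - q) * ou / 4"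
  proof -
    show "0 < \<eta>"
      using qq ou \<delta> by (auto simp: \<eta>_def intro!: divide_pos_pos mult_pos_pos)
    show "\<eta> \<le> ou / 4"
      unfolding \<eta>_def by (rule min.cobounded1)
    have "\<eta> \<le> \<delta> / 4"
      unfolding \<eta>_def by linarith
    then show "3 * \<eta> < \<delta>"
      using \<delta>(1) by linarith
    have "\<bar>q'\<bar> * (3 * \<eta>) \<le> (\<bar>q'\<bar> + 1) * (3 * ((q' - q) * ou / (12 * (\<bar>q'\<bar> + 1))))"
      using \<open>0 < \<eta>\<close> by (intro mult_mono) (auto simp: \<eta>_def)
    also have "\<dots> = (q' - q) * ou / 4"
      by (simp add: field_simps)
    finally show "\<bar>q'\<bar> * (3 * \<eta>) \<le> (q' - q) * ou / 4" .
  qed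
  obtain T0 where T0: "T0 \<in> lmeasurable" "E \<subseteq> T0" "measure lebesgue T0 < ou + \<eta> / 2"
  proof -
    have "Inf Ms < ou + \<eta> / 2"
      using \<eta>(1) by (simp add: ou_def)
    then show ?thesis
      using cInf_lessD[of Ms "ou + \<eta> / 2"] M0 that by (auto simp: Ms_def)
  qed
  obtain G0 where G0: "open G0" "T0 \<subseteq> G0" "G0 - T0 \<in> lmeasurable" "emeasure lebesgue (G0 - T0) < ennreal (\<eta> / 2)"
    using sets_lebesgue_outer_open[of T0 "\<eta> / 2"] T0 \<eta>(1) by auto
  define G where "G = G0 \<inter> {0<..<1}"
  have Gm: "G \<in> lmeasurable"
    unfolding G_def using G0(1) by (intro lmeasurable_open bounded_Int) auto
  have "measure lebesgue G \<le> measure lebesgue (T0 \<union> (G0 - T0))"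
    using Gm fmeasurable.Un[OF T0(1) G0(3)] by (intro measure_mono_fmeasurable) (auto simp: G_def)
  also have "\<dots> \<le> measure lebesgue T0 + measure lebesgue (G0 - T0)"
    using T0 G0 by (intro measure_Un_le) auto
  also have "measure lebesgue (G0 - T0) < \<eta> / 2"
    using G0(3,4) \<eta>(1) by (simp add: emeasure_eq_measure2 ennreal_less_iff)
  finally have GM: "measure lebesgue G < ou + \<eta>"
    using T0 by simp
  have Go: "open G" and EG: "E \<subseteq> G"
    using G0 T0 E by (auto simp: G_def)
  obtain F T where F: "finite F" "\<forall>K\<in>F. \<exists>a b. a < b \<and> K = {a..b} \<and> K \<subseteq> G \<and> q' * (b - a) < f b - f a"
    "pairwise disjnt F" "E \<subseteq> \<Union>F \<union> T" "T \<in> lmeasurable" "measure lebesgue T < \<eta>"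
    by (rule vitali_intervals[where P = "\<lambda>a b. q' * (b - a) < f b - f a", OF Go Gm EG \<eta>(1) up])
  \<comment> \<open>Only points interior to a member of \<open>F\<close> are kept, so that the
    intervals of small slope around them fit inside that member. The discarded points of the members
    are endpoints, finitely many.\<close>
  define S2 where "S2 = E \<inter> (\<Union>K\<in>F. interior K)"
  have down2: "\<exists>a b. a < b \<and> a \<le> x \<and> x \<le> b \<and> b - a < d \<and> f b - f a < q * (b - a) \<and> (\<exists>J\<in>F. {a..b} \<subseteq> J)"
    if x: "x \<in> S2" and d: "0 < d" for x d
  proof -
    obtain J where J: "J \<in> F" "x \<in> interior J"
      using x by (auto simp: S2_def)
    then obtain e where e: "e > 0" "ball x e \<subseteq> J"
      by (meson mem_interior)
    obtain a b where ab: "a < b" "a \<le> x" "x \<le> b" "b - a < min d e" "f b - f a < q * (b - a)"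
      using down[of x "min d e"] d e x by (auto simp: S2_def)
    have "{a..b} \<subseteq> ball x e"
      using ab by (auto simp: ball_eq_greaterThanLessThan)
    then show ?thesis
      using ab e J by (intro exI[of _ a] exI[of _ b]) auto
  qed
  have S2G: "S2 \<subseteq> G"
    using EG by (auto simp: S2_def)
  obtain H T' where H: "finite H"
    "\<forall>K\<in>H. \<exists>a b. a < b \<and> K = {a..b} \<and> K \<subseteq> G \<and> f b - f a < q * (b - a) \<and> (\<exists>J\<in>F. {a..b} \<subseteq> J)"
    "pairwise disjnt H" "S2 \<subseteq> \<Union>H \<union> T'" "T' \<in> lmeasurable" "measure lebesgue T' < \<eta>"
    by (rule vitali_intervals[where P = "\<lambda>a b. f b - f a < q * (b - a) \<and> (\<exists>J\<in>F. {a..b} \<subseteq> J)", OF Go Gm S2G \<eta>(1) down2])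
  define len where "len = (\<lambda>K::real set. Sup K - Inf K)"
  define inc where "inc = (\<lambda>K. f (Sup K) - f (Inf K))"
  have Fi: "\<forall>K\<in>F. \<exists>c d. c < d \<and> K = {c..d}"
    using F(2) by blast
  have Hi: "\<forall>K\<in>H. \<exists>c d. c < d \<and> K = {c..d}"
    using H(2) by blast
  note mF = measure_disjoint_intervals[OF F(1,3) Fi, folded len_def]
  note mH = measure_disjoint_intervals[OF H(1,3) Hi, folded len_def]
  have "(\<Sum>K\<in>F. len K) \<le> measure lebesgue G"
    unfolding mF(1)[symmetric] using F(2) mF(2) Gm by (intro measure_mono_fmeasurable) blast+
  then have lenF: "(\<Sum>K\<in>F. len K) < ou + \<eta>"
    using GM by simp
  have "E \<subseteq> \<Union>H \<union> T' \<union> T \<union> (\<Union>K\<in>F. {Inf K, Sup K})"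
  proof
    fix x assume x: "x \<in> E"
    show "x \<in> \<Union>H \<union> T' \<union> T \<union> (\<Union>K\<in>F. {Inf K, Sup K})"
    proof (cases "x \<in> T \<or> x \<in> S2")
      case False
      then obtain K where K: "K \<in> F" "x \<in> K" "x \<notin> interior K"
        using x F(4) by (auto simp: S2_def)
      then have "x = Inf K \<or> x = Sup K"
        using bspec[OF Fi K(1)] by (auto simp: interior_atLeastAtMost_real)
      with K show ?thesis by auto
    qed (use H(4) in auto)
  qed
  then have "ou \<le> measure lebesgue (\<Union>H \<union> T' \<union> T \<union> (\<Union>K\<in>F. {Inf K, Sup K}))"
    using H(5) F(5) mH(2) F(1)
    by (intro oule fmeasurable.Un negligible_imp_measurable[of "\<Union>K\<in>F. {Inf K, Sup K}"]) (auto intro!: negligible_finite)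
  also have "\<dots> = measure lebesgue (\<Union>H \<union> T' \<union> T)"
    using H(5) F(5) mH(2) F(1)
    by (intro measure_Un_null_set) (auto intro!: negligible_finite simp flip: negligible_iff_null_sets)
  also have "\<dots> \<le> measure lebesgue (\<Union>H) + measure lebesgue T' + measure lebesgue T"
    using H(5) F(5) mH(2) by (intro order_trans[OF measure_Un_le] add_right_mono measure_Un_le) auto
  finally have lenH: "ou - 2 * \<eta> < (\<Sum>K\<in>H. len K)"
    using H(6) F(6) mH(1) by simp
  \<comment> \<open>\<open>p J\<close> are the members of \<open>H\<close> inside \<open>J\<close>;
    they get completed to a division \<open>r J\<close> of \<open>J\<close>. The added pieces form
    \<open>R\<close>, where neither slope bound is available and absolute continuity has to
    help.\<close>
  define p where "p = (\<lambda>J. {K \<in> H. K \<subseteq> J})"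
  have "\<exists>r. p J \<subseteq> r \<and> r division_of J" if J: "J \<in> F" for J
  proof -
    obtain a b where ab: "a < b" "J = {a..b}"
      using bspec[OF Fi J] by blast
    have "finite (p J)" "pairwise disjnt (p J)" "\<And>K. K \<in> p J \<Longrightarrow> \<exists>c d. c < d \<and> K = {c..d} \<and> K \<subseteq> {a..b}"
      using H(1,3) Hi ab by (auto simp: p_def pairwise_def)
    from extend_disjoint_intervals[OF this ab(1)] show ?thesis
      using ab(2) by metis
  qed
  then obtain r where r: "p J \<subseteq> r J" "r J division_of J" if "J \<in> F" for J
    by metis
  have rK: "K \<subseteq> J \<and> K \<noteq> {} \<and> (\<exists>a b. a \<le> b \<and> K = {a..b})" if "J \<in> F" "K \<in> r J" for J K
    using division_ofD(2,3,4)[OF r(2)[OF that(1)] that(2)] by (auto simp: cbox_interval) (use order_trans in blast)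
  have rdisj: "r J \<inter> r J' = {}" if J: "J \<in> F" "J' \<in> F" "J \<noteq> J'" for J J'
  proof -
    have "J \<inter> J' = {}"
      using F(3) J by (auto simp: pairwise_def disjnt_def)
    then show ?thesis
      using rK[OF J(1)] rK[OF J(2)] by blast
  qed
  have fin: "finite (r J)" if "J \<in> F" for J
    using r(2)[OF that] by auto
  define R where "R = (\<Union>J\<in>F. r J - p J)"
  \<comment> \<open>Kept general in \<open>g\<close>: the identity yields the balance of lengths,
    \<open>f\<close> the balance of increments.\<close>
  have split: "(\<Sum>J\<in>F. g (Sup J) - g (Inf J)) = (\<Sum>K\<in>H. g (Sup K) - g (Inf K)) + (\<Sum>K\<in>R. g (Sup K) - g (Inf K))" for g :: "real \<Rightarrow> real"
  proof -
    let ?g = "\<lambda>K. g (Sup K) - g (Inf K)"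
    have "?g J = sum ?g (p J) + sum ?g (r J - p J)" if J: "J \<in> F" for J
    proof -
      obtain a b where ab: "a < b" "J = {a..b}"
        using bspec[OF Fi J] by blast
      have "?g J = sum ?g (r J)"
        using sum_increments_division[of "r J" a b g] r(2)[OF J] ab by simp
      then show ?thesis
        using sum.subset_diff[OF r(1)[OF J] fin[OF J], of ?g] by simp
    qed
    then have "(\<Sum>J\<in>F. ?g J) = (\<Sum>J\<in>F. sum ?g (p J)) + (\<Sum>J\<in>F. sum ?g (r J - p J))"
      by (simp add: sum.distrib)
    also have "(\<Sum>J\<in>F. sum ?g (p J)) = sum ?g (\<Union>J\<in>F. p J)"
    proof (rule sum.UNION_disjoint[symmetric, OF F(1)])
      show "\<forall>J\<in>F. finite (p J)"
        using H(1) by (auto simp: p_def)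
      show "\<forall>J\<in>F. \<forall>J'\<in>F. J \<noteq> J' \<longrightarrow> p J \<inter> p J' = {}"
        using r(1) rdisj by blast
    qed
    also have "(\<Union>J\<in>F. p J) = H"
    proof -
      have "\<exists>J\<in>F. K \<subseteq> J" if "K \<in> H" for K
        using bspec[OF H(2) that] by auto
      then show ?thesis
        unfolding p_def by blast
    qed
    also have "(\<Sum>J\<in>F. sum ?g (r J - p J)) = sum ?g R"
      unfolding R_def using F(1) fin rdisj by (intro sum.UNION_disjoint[symmetric]) blast+
    finally show ?thesis .
  qed
  have lenR: "(\<Sum>K\<in>R. len K) < 3 * \<eta>"
    using split[of "\<lambda>x. x"] lenF lenH by (simp add: len_def)
  have "(\<Sum>K\<in>R. norm (f (Sup K) - f (Inf K))) < \<epsilon>"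
  proof (rule \<delta>(2))
    show "finite R"
      using F(1) fin by (auto simp: R_def)
    show "\<exists>a b. a \<le> b \<and> K = {a..b} \<and> K \<subseteq> {0..1}" if "K \<in> R" for K
    proof -
      obtain J where J: "J \<in> F" "K \<in> r J"
        using \<open>K \<in> R\<close> unfolding R_def by blast
      have "J \<subseteq> {0..1}"
        using bspec[OF F(2) J(1)] by (auto simp: G_def)
      moreover obtain a b where "a \<le> b" "K = {a..b}" "K \<subseteq> J"
        using rK[OF J] by blast
      ultimately show ?thesis
        by blast
    qed
    show "pairwise (\<lambda>K L. interior K \<inter> interior L = {}) R"
    proof (rule pairwiseI)
      fix K L assume "K \<in> R" "L \<in> R" and KL: "K \<noteq> L"
      then obtain J J' where J: "J \<in> F" "K \<in> r J" "J' \<in> F" "L \<in> r J'"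
        unfolding R_def by blast
      show "interior K \<inter> interior L = {}"
      proof (cases "J = J'")
        case True
        then show ?thesis
          using division_ofD(5)[OF r(2)] J KL by blast
      next
        case False
        then have "J \<inter> J' = {}"
          using F(3) J by (auto simp: pairwise_def disjnt_def)
        then show ?thesis
          using rK[OF J(1,2)] rK[OF J(3,4)] interior_subset by blast
      qed
    qed
    show "(\<Sum>K\<in>R. Sup K - Inf K) < \<delta>"
      using lenR \<eta>(3) by (simp add: len_def)
  qed
  then have incR: "(\<Sum>K\<in>R. inc K) < \<epsilon>"
    by (smt (verit) inc_def real_norm_def sum_mono)
  have "q' * (\<Sum>K\<in>F. len K) \<le> (\<Sum>K\<in>F. inc K)"
    unfolding sum_distrib_left using F(2) by (intro sum_mono) (fastforce simp: inc_def len_def)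
  moreover have "(\<Sum>K\<in>H. inc K) \<le> q * (\<Sum>K\<in>H. len K)"
    unfolding sum_distrib_left using H(2) by (intro sum_mono) (fastforce simp: inc_def len_def)
  moreover have "(\<Sum>K\<in>F. inc K) = (\<Sum>K\<in>H. inc K) + (\<Sum>K\<in>R. inc K)"
    using split[of f] by (simp add: inc_def)
  moreover have lens: "(\<Sum>K\<in>F. len K) = (\<Sum>K\<in>H. len K) + (\<Sum>K\<in>R. len K)"
    using split[of "\<lambda>x. x"] by (simp add: len_def)
  ultimately have "q' * (\<Sum>K\<in>R. len K) + (q' - q) * (\<Sum>K\<in>H. len K) < \<epsilon>"
    using incR by (simp add: algebra_simps)
  moreover have "(q' - q) * (ou / 2) \<le> (q' - q) * (\<Sum>K\<in>H. len K)"
    using qq lenH \<eta>(2) by (intro mult_left_mono) auto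
  moreover have "- ((q' - q) * ou / 4) \<le> q' * (\<Sum>K\<in>R. len K)"
  proof -
    have "0 \<le> (\<Sum>K\<in>R. len K)"
      using rK by (intro sum_nonneg) (fastforce simp: R_def len_def)
    then have "\<bar>q' * (\<Sum>K\<in>R. len K)\<bar> \<le> \<bar>q'\<bar> * (3 * \<eta>)"
      using lenR by (simp add: abs_mult mult_left_mono)
    then show ?thesis
      using \<eta>(4) by linarith
  qed
  ultimately show False
    by (simp add: \<epsilon>_def)
qed

text \<open>Disjoint intervals of total length below \<delta> have increments adding up to less than
  1; if their slopes exceed \<open>2 / e\<close>, their total length is therefore below
  \<open>e / 2\<close>. Working inside balls of radius \<open>\<delta> / 4\<close> keeps the length
  below \<delta>, and negligibility is a local property.\<close>

lemma absolutely_continuous_steep_negligible: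
  fixes f :: "real \<Rightarrow> real"
  assumes AC: "absolutely_continuous_on {0..1} f" and E: "E \<subseteq> {0<..<1}"
    and steep: "\<And>M x d. x \<in> E \<Longrightarrow> 0 < d \<Longrightarrow> \<exists>a b. a < b \<and> a \<le> x \<and> x \<le> b \<and> b - a < d \<and> M * (b - a) < \<bar>f b - f a\<bar>"
  shows "negligible E"
proof -
  obtain \<delta> where \<delta>: "\<delta> > 0" "\<And>\<D>. finite \<D> \<Longrightarrow> (\<And>K. K \<in> \<D> \<Longrightarrow> \<exists>a b. a \<le> b \<and> K = {a..b} \<and> K \<subseteq> {0..1}) \<Longrightarrow>
     pairwise (\<lambda>K L. interior K \<inter> interior L = {}) \<D> \<Longrightarrow> (\<Sum>K\<in>\<D>. Sup K - Inf K) < \<delta> \<Longrightarrow>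
     (\<Sum>K\<in>\<D>. norm (f (Sup K) - f (Inf K))) < 1"
    using absolutely_continuous_on_family[OF AC zero_less_one] by blast
  have local: "negligible (E \<inter> ball x (\<delta> / 4))" for x
    unfolding negligible_outer
  proof (intro allI impI)
    fix e :: real assume e: "e > 0"
    define G where "G = ball x (\<delta> / 4) \<inter> {0<..<1}"
    have G: "open G" "G \<in> lmeasurable" "E \<inter> ball x (\<delta> / 4) \<subseteq> G"
      using E by (auto simp: G_def intro!: lmeasurable_open)
    have "measure lebesgue G \<le> measure lebesgue (ball x (\<delta> / 4))"
      using G by (intro measure_mono_fmeasurable) (auto simp: G_def)
    then have mG: "measure lebesgue G < \<delta>"
      using \<delta>(1) by (simp add: ball_eq_greaterThanLessThan)
    obtain F T where F: "finite F" "\<forall>K\<in>F. \<exists>a b. a < b \<and> K = {a..b} \<and> K \<subseteq> G \<and> 2 / e * (b - a) < \<bar>f b - f a\<bar>"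
      "pairwise disjnt F" "E \<inter> ball x (\<delta> / 4) \<subseteq> \<Union>F \<union> T" "T \<in> lmeasurable" "measure lebesgue T < e / 2"
      using steep by (rule vitali_intervals[where P = "\<lambda>a b. 2 / e * (b - a) < \<bar>f b - f a\<bar>", OF G half_gt_zero[OF e]]) auto
    have Fi: "\<forall>K\<in>F. \<exists>c d. c < d \<and> K = {c..d}"
      using F(2) by blast
    note mF = measure_disjoint_intervals[OF F(1,3) Fi]
    have "measure lebesgue (\<Union>F) \<le> measure lebesgue G"
      using F(2) mF(2) G by (intro measure_mono_fmeasurable) blast+
    then have len: "(\<Sum>K\<in>F. Sup K - Inf K) < \<delta>"
      using mF(1) mG by simp
    have "(\<Sum>K\<in>F. norm (f (Sup K) - f (Inf K))) < 1"
    proof (rule \<delta>(2)[OF F(1) _ _ len])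
      show "\<exists>a b. a \<le> b \<and> K = {a..b} \<and> K \<subseteq> {0..1}" if "K \<in> F" for K
      proof -
        obtain a b where "a < b" "K = {a..b}" "K \<subseteq> G"
          using F(2) \<open>K \<in> F\<close> by blast
        moreover have "G \<subseteq> {0..1}"
          by (auto simp: G_def)
        ultimately have "K \<subseteq> {0..1}"
          by (metis order_trans)
        with \<open>a < b\<close> \<open>K = {a..b}\<close> show ?thesis
          by (intro exI[of _ a] exI[of _ b]) auto
      qed
      show "pairwise (\<lambda>K L. interior K \<inter> interior L = {}) F"
        using F(3) interior_subset unfolding pairwise_def disjnt_def by blast
    qed
    moreover have "2 / e * (\<Sum>K\<in>F. Sup K - Inf K) \<le> (\<Sum>K\<in>F. norm (f (Sup K) - f (Inf K)))"
      unfolding sum_distrib_left using F(2) by (intro sum_mono) fastforce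
    ultimately have "2 / e * (\<Sum>K\<in>F. Sup K - Inf K) < 1"
      by linarith
    then have "measure lebesgue (\<Union>F) < e / 2"
      using e mF(1) by (simp add: field_simps)
    moreover have "measure lebesgue (\<Union>F \<union> T) \<le> measure lebesgue (\<Union>F) + measure lebesgue T"
      using mF(2) F(5) by (intro measure_Un_le) auto
    ultimately show "\<exists>T. E \<inter> ball x (\<delta> / 4) \<subseteq> T \<and> T \<in> lmeasurable \<and> measure lebesgue T < e"
      using F(4,5,6) mF(2) by (intro exI[of _ "\<Union>F \<union> T"]) (auto intro: fmeasurable.Un)
  qed
  have "\<exists>U. openin (top_of_set E) U \<and> x \<in> U \<and> negligible U" if "x \<in> E" for x
    using local[of x] that \<delta>(1) by (intro exI[of _ "E \<inter> ball x (\<delta> / 4)"]) auto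
  then show ?thesis
    using locally_negligible_alt by blast
qed

text \<open>Off the two exceptional sets the slopes of small intervals around the point are bounded,
  and for no rationals \<open>q < q'\<close> do slopes below \<open>q\<close> and above
  \<open>q'\<close> both recur at arbitrarily small scale. The supremum of the recurrently exceeded
  slopes is then the derivative. Rational pairs make the second exceptional set a countable union of
  null sets.\<close>

lemma absolutely_continuous_differentiable_real:
  fixes f :: "real \<Rightarrow> real"
  assumes AC: "absolutely_continuous_on {0..1} f"
  shows "negligible {x \<in> {0<..<1}. \<not> f differentiable (at x)}"
proof -
  define up where "up = (\<lambda>q x. \<forall>d>0. \<exists>a b. a < b \<and> a \<le> x \<and> x \<le> b \<and> b - a < d \<and> q * (b - a) < f b - f a)"
  define dn where "dn = (\<lambda>q x. \<forall>d>0. \<exists>a b. a < b \<and> a \<le> x \<and> x \<le> b \<and> b - a < d \<and> f b - f a < q * (b - a))"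
  define steep where "steep = {x \<in> {0<..<1}. \<forall>M. \<forall>d>0. \<exists>a b. a < b \<and> a \<le> x \<and> x \<le> b \<and> b - a < d \<and> M * (b - a) < \<bar>f b - f a\<bar>}"
  define osc where "osc = (\<lambda>(q::rat, q'). if q < q' then {x \<in> {0<..<1}. up (of_rat q') x \<and> dn (of_rat q) x} else {})"
  have "negligible steep"
    by (rule absolutely_continuous_steep_negligible[OF AC]) (auto simp: steep_def)
  moreover have "negligible (osc z)" for z
  proof -
    obtain q q' where z: "z = (q, q')" by fastforce
    show ?thesis
    proof (cases "q < q'")
      case True
      then show ?thesis
        by (intro absolutely_continuous_oscillation_negligible[OF AC, of "of_rat q" "of_rat q'"])
          (auto simp: z osc_def up_def dn_def of_rat_less)
    qed (simp add: z osc_def)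
  qed
  then have "negligible (\<Union>z. osc z)"
    by (intro negligible_countable_Union) auto
  ultimately have "negligible (steep \<union> (\<Union>z. osc z))"
    by (rule negligible_Un)
  moreover have "f differentiable (at x)" if x: "x \<in> {0<..<1}" "x \<notin> steep" "x \<notin> (\<Union>z. osc z)" for x
  proof -
    have not_osc: "x \<notin> osc z" for z
      using x(3) by blast
    obtain M d0 where M0: "d0 > 0" "\<not> (\<exists>a b. a < b \<and> a \<le> x \<and> x \<le> b \<and> b - a < d0 \<and> M * (b - a) < \<bar>f b - f a\<bar>)"
      using x(1,2) unfolding steep_def by blast
    have M: "\<bar>f b - f a\<bar> \<le> M * (b - a)" if "a < b" "a \<le> x" "x \<le> b" "b - a < d0" for a b
      using M0(2) that not_less by blast
    have upM: "q \<le> M" if upq: "up q x" for q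
    proof -
      obtain a b where ab: "a < b" "a \<le> x" "x \<le> b" "b - a < d0" "q * (b - a) < f b - f a"
        using upq[unfolded up_def, THEN spec, THEN mp, OF M0(1)] by (elim exE conjE)
      then have "q * (b - a) < M * (b - a)"
        using M[OF ab(1-4)] by linarith
      then show ?thesis using ab(1) by simp
    qed
    \<comment> \<open>This makes the set of recurrently exceeded slopes nonempty; \<open>upM\<close>
      bounds it above, so its supremum is meaningful.\<close>
    have "up (- M - 1) x"
      unfolding up_def
    proof (intro allI impI)
      fix d :: real assume d: "d > 0"
      define b where "b = x + min d d0 / 2"
      have b: "x < b" "b - x < d" "b - x < d0"
        using d M0(1) by (auto simp: b_def min_def)
      have "\<bar>f b - f x\<bar> \<le> M * (b - x)"
        using M[of x b] b by simp
      then have "(- M - 1) * (b - x) < f b - f x"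
        using b by (simp add: algebra_simps)
      with b show "\<exists>a b. a < b \<and> a \<le> x \<and> x \<le> b \<and> b - a < d \<and> (- M - 1) * (b - a) < f b - f a"
        by (intro exI[of _ x] exI[of _ b]) auto
    qed
    define s where "s = Sup {q. up q x}"
    have ne: "{q. up q x} \<noteq> {}" and bd: "bdd_above {q. up q x}"
      using \<open>up (- M - 1) x\<close> upM by (auto intro: bdd_aboveI[of _ M])
    have "(f has_derivative (\<lambda>h. s * h)) (at x)"
      unfolding has_derivative_at_alt
    proof (intro conjI allI impI)
      show "bounded_linear (\<lambda>h. s * h)"
        by (rule bounded_linear_mult_right)
      fix e :: real assume e: "e > 0"
      have "\<not> up (s + e) x"
      proof
        assume "up (s + e) x"
        then have "s + e \<le> s"
          unfolding s_def by (intro cSup_upper bd) auto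
        with e show False by simp
      qed
      then obtain d1 where d1: "d1 > 0" "\<not> (\<exists>a b. a < b \<and> a \<le> x \<and> x \<le> b \<and> b - a < d1 \<and> (s + e) * (b - a) < f b - f a)"
        unfolding up_def by blast
      \<comment> \<open>A level \<open>q0\<close> just below \<open>s\<close> is exceeded at all
        scales. Two rationals between \<open>s - e\<close> and \<open>q0\<close> turn this, by
        \<open>not_osc\<close>, into a lower bound for all slopes of sufficiently small intervals
        around \<open>x\<close>.\<close>
      obtain q0 where q0: "up q0 x" "s - e / 2 < q0"
        using less_cSupD[OF ne, of "s - e / 2"] e by (auto simp: s_def)
      obtain q' :: rat where q': "s - e / 2 < of_rat q'" "of_rat q' < q0"
        using of_rat_dense[OF q0(2)] by auto
      obtain q :: rat where q: "s - e < of_rat q" "of_rat q < s - e / 2"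
        using of_rat_dense[of "s - e" "s - e / 2"] e by auto
      have "up (of_rat q') x"
        unfolding up_def
      proof (intro allI impI)
        fix d :: real assume "d > 0"
        from q0(1)[unfolded up_def, THEN spec, THEN mp, OF this]
        obtain a b where ab: "a < b" "a \<le> x" "x \<le> b" "b - a < d" "q0 * (b - a) < f b - f a"
          by (elim exE conjE)
        have "of_rat q' * (b - a) \<le> q0 * (b - a)"
          using ab(1) q'(2) by (intro mult_right_mono) auto
        then have "of_rat q' * (b - a) < f b - f a"
          using ab(5) by linarith
        with ab show "\<exists>a b. a < b \<and> a \<le> x \<and> x \<le> b \<and> b - a < d \<and> of_rat q' * (b - a) < f b - f a"
          by blast
      qed
      moreover have "q < q'"
        using q(2) q'(1) of_rat_less[of q q', where 'a=real] by linarith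
      ultimately have "\<not> dn (of_rat q) x"
        using x(1) not_osc[of "(q, q')"] by (auto simp: osc_def)
      then obtain d2 where d2: "d2 > 0" "\<not> (\<exists>a b. a < b \<and> a \<le> x \<and> x \<le> b \<and> b - a < d2 \<and> f b - f a < of_rat q * (b - a))"
        unfolding dn_def by blast
      have est: "\<bar>f b - f a - s * (b - a)\<bar> \<le> e * (b - a)"
        if "a < b" "a \<le> x" "x \<le> b" "b - a < min d1 d2" for a b
      proof -
        have "(s - e) * (b - a) \<le> of_rat q * (b - a)"
          using that(1) q(1) by (intro mult_right_mono) auto
        moreover have "f b - f a \<le> (s + e) * (b - a)" "of_rat q * (b - a) \<le> f b - f a"
          using d1(2) d2(2) that by (meson min_less_iff_conj not_less)+
        ultimately show ?thesis
          by (auto simp: algebra_simps abs_le_iff)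
      qed
      show "\<exists>d>0. \<forall>y. norm (y - x) < d \<longrightarrow> norm (f y - f x - s * (y - x)) \<le> e * norm (y - x)"
      proof (intro exI[of _ "min d1 d2"] conjI allI impI)
        fix y assume y: "norm (y - x) < min d1 d2"
        consider "y = x" | "y < x" | "x < y" by linarith
        then show "norm (f y - f x - s * (y - x)) \<le> e * norm (y - x)"
        proof cases
          case 2
          then show ?thesis
            using est[of y x] y by (auto simp: algebra_simps abs_le_iff)
        next
          case 3
          then show ?thesis
            using est[of x y] y by (auto simp: algebra_simps abs_le_iff)
        qed simp
      qed (use d1 d2 in auto)
    qed
    then show ?thesis
      by (auto simp: differentiable_def)
  qed
  ultimately show ?thesis
    by (elim negligible_subset) blast
qed

lemma absolutely_continuous_on_inner:
  fixes h :: "real \<Rightarrow> 'a::real_inner"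
  assumes "absolutely_continuous_on S h"
  shows "absolutely_continuous_on S (\<lambda>t. h t \<bullet> v)"
  unfolding absolutely_continuous_on_def
proof (intro allI impI)
  fix e :: real assume e: "e > 0"
  obtain d where d: "d > 0" "\<And>(N::nat) s t. (\<forall>i<N. s i \<le> t i \<and> {s i..t i} \<subseteq> S) \<Longrightarrow>
        pairwise (\<lambda>i j. {s i<..<t i} \<inter> {s j<..<t j} = {}) {..<N} \<Longrightarrow>
        (\<Sum>i<N. t i - s i) < d \<Longrightarrow> (\<Sum>i<N. norm (h (t i) - h (s i))) < e / (norm v + 1)"
  proof -
    have "e / (norm v + 1) > 0"
      using e by (simp add: add_nonneg_pos)
    from assms[unfolded absolutely_continuous_on_def, rule_format, OF this] show ?thesis
      using that by blast
  qed
  show "\<exists>\<delta>>0. \<forall>(N::nat) s t. (\<forall>i<N. s i \<le> t i \<and> {s i..t i} \<subseteq> S) \<longrightarrow>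
        pairwise (\<lambda>i j. {s i<..<t i} \<inter> {s j<..<t j} = {}) {..<N} \<longrightarrow>
        (\<Sum>i<N. t i - s i) < \<delta> \<longrightarrow> (\<Sum>i<N. norm (h (t i) \<bullet> v - h (s i) \<bullet> v)) < e"
  proof (intro exI[of _ d] conjI allI impI d(1))
    fix N :: nat and s t
    assume *: "\<forall>i<N. s i \<le> t i \<and> {s i..t i} \<subseteq> S" "pairwise (\<lambda>i j. {s i<..<t i} \<inter> {s j<..<t j} = {}) {..<N}"
        "(\<Sum>i<N. t i - s i) < d"
    have "(\<Sum>i<N. norm (h (t i) \<bullet> v - h (s i) \<bullet> v)) \<le> (\<Sum>i<N. norm (h (t i) - h (s i)) * (norm v + 1))"
    proof (rule sum_mono)
      fix i
      have "norm (h (t i) \<bullet> v - h (s i) \<bullet> v) \<le> norm (h (t i) - h (s i)) * norm v"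
        by (metis inner_diff_left real_norm_def Cauchy_Schwarz_ineq2)
      also have "\<dots> \<le> norm (h (t i) - h (s i)) * (norm v + 1)"
        by (intro mult_left_mono) auto
      finally show "norm (h (t i) \<bullet> v - h (s i) \<bullet> v) \<le> norm (h (t i) - h (s i)) * (norm v + 1)" .
    qed
    also have "\<dots> = (\<Sum>i<N. norm (h (t i) - h (s i))) * (norm v + 1)"
      by (simp add: sum_distrib_right)
    also have "\<dots> < e"
      using d(2)[OF *] by (simp add: pos_less_divide_eq add_nonneg_pos)
    finally show "(\<Sum>i<N. norm (h (t i) \<bullet> v - h (s i) \<bullet> v)) < e" .
  qed
qed

lemma absolutely_continuous_differentiable:
  fixes h :: "real \<Rightarrow> 'a::euclidean_space"
  assumes "absolutely_continuous_on {0..1} h"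
  shows "negligible {x \<in> {0<..<1}. \<not> h differentiable (at x)}"
proof -
  have "negligible (\<Union>i\<in>Basis. {x \<in> {0<..<1}. \<not> (\<lambda>t. h t \<bullet> i) differentiable (at x)})"
    using absolutely_continuous_differentiable_real[OF absolutely_continuous_on_inner[OF assms]]
    by (intro negligible_Union) auto
  moreover have "h differentiable (at x)" if "\<forall>i\<in>Basis. (\<lambda>t. h t \<bullet> i) differentiable (at x)" for x
    using that differentiable_componentwise_within[of h x UNIV] by simp
  ultimately show ?thesis
    by (elim negligible_subset) auto
qed

text \<open>The straddle lemma: the interval contains \<open>x\<close> without having it as an
  endpoint. This is the situation of a tagged division, and of a grid cell around a given
  point.\<close>

lemma has_vector_derivative_straddle:
  fixes h :: "real \<Rightarrow> 'a::real_normed_vector"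
  assumes h: "(h has_vector_derivative D) (at x)" and e: "0 < e"
  shows "\<exists>d>0. \<forall>u v. u \<le> x \<and> x \<le> v \<and> u \<in> ball x d \<and> v \<in> ball x d \<longrightarrow>
    norm ((v - u) *\<^sub>R D - (h v - h u)) \<le> e * (v - u)"
proof -
  obtain d where d: "d > 0" "\<And>y. norm (y - x) < d \<Longrightarrow> norm (h y - h x - (y - x) *\<^sub>R D) \<le> e * norm (y - x)"
    using h e unfolding has_vector_derivative_def has_derivative_at_alt by meson
  have "norm ((v - u) *\<^sub>R D - (h v - h u)) \<le> e * (v - u)"
    if uv: "u \<le> x" "x \<le> v" "u \<in> ball x d" "v \<in> ball x d" for u v
  proof -
    have *: "norm (h v - h x - (v - x) *\<^sub>R D) \<le> e * norm (v - x)" "norm (h u - h x - (u - x) *\<^sub>R D) \<le> e * norm (u - x)"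
      using uv(3,4) by (intro d(2); simp add: dist_real_def abs_minus_commute)+
    have eq: "(v - u) *\<^sub>R D - (h v - h u) = (h u - h x - (u - x) *\<^sub>R D) - (h v - h x - (v - x) *\<^sub>R D)"
      by (simp add: algebra_simps)
    have "norm ((v - u) *\<^sub>R D - (h v - h u)) \<le> e * norm (u - x) + e * norm (v - x)"
      unfolding eq using * norm_triangle_ineq4[of "h u - h x - (u - x) *\<^sub>R D" "h v - h x - (v - x) *\<^sub>R D"] by linarith
    then show ?thesis
      using uv by (simp add: algebra_simps)
  qed
  then show ?thesis
    using d(1) by blast
qed

text \<open>Henstock's gauge: near a tag outside \<open>N\<close> the straddle estimate applies; the pieces tagged
  in \<open>N\<close> lie in an open set of small measure, where absolute continuity takes over.\<close>

lemma absolutely_continuous_has_integral: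
  fixes h :: "real \<Rightarrow> 'a::euclidean_space"
  assumes AC: "absolutely_continuous_on {0..1} h" and ab: "0 \<le> a" "a \<le> b" "b \<le> 1"
  shows "((\<lambda>t. vector_derivative h (at t)) has_integral (h b - h a)) {a..b}"
proof -
  \<comment> \<open>The endpoints join \<open>N\<close> because a two-sided derivative there depends
    on values of \<open>h\<close> outside the unit interval.\<close>
  define N where "N = {x \<in> {0<..<1}. \<not> h differentiable (at x)} \<union> {0, 1}"
  have N: "negligible N"
    unfolding N_def using absolutely_continuous_differentiable[OF AC] by (intro negligible_Un) auto
  \<comment> \<open>With the value 0 on \<open>N\<close>, the pieces tagged in \<open>N\<close>
    contribute nothing but increments of \<open>h\<close> to the error.\<close>
  define g where "g = (\<lambda>t. if t \<in> N then 0 else vector_derivative h (at t))"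
  have "(g has_integral (h b - h a)) {a..b}"
    unfolding has_integral_real
  proof (intro allI impI)
    fix e :: real assume e: "e > 0"
    obtain \<delta> where \<delta>: "\<delta> > 0" "\<And>\<D>. finite \<D> \<Longrightarrow> (\<And>K. K \<in> \<D> \<Longrightarrow> \<exists>a b. a \<le> b \<and> K = {a..b} \<and> K \<subseteq> {0..1}) \<Longrightarrow>
      pairwise (\<lambda>K L. interior K \<inter> interior L = {}) \<D> \<Longrightarrow> (\<Sum>K\<in>\<D>. Sup K - Inf K) < \<delta> \<Longrightarrow>
      (\<Sum>K\<in>\<D>. norm (h (Sup K) - h (Inf K))) < e / 2"
      using absolutely_continuous_on_family[OF AC half_gt_zero[OF e]] by blast
    obtain U where U: "open U" "N \<subseteq> U" "U - N \<in> lmeasurable" "emeasure lebesgue (U - N) < ennreal \<delta>"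
      using sets_lebesgue_outer_open[of N \<delta>] \<delta>(1) N by (metis negligible_imp_sets)
    have Um: "U \<in> lmeasurable" and mU: "measure lebesgue U < \<delta>"
    proof -
      have eq: "U = (U - N) \<union> N"
        using U(2) by auto
      show "U \<in> lmeasurable"
        by (subst eq) (intro fmeasurable.Un U(3) negligible_imp_measurable[OF N])
      have "measure lebesgue U = measure lebesgue (U - N)"
        by (subst eq, rule measure_Un_null_set) (use U(3) N in \<open>auto simp: negligible_iff_null_sets\<close>)
      then show "measure lebesgue U < \<delta>"
        using U(3,4) \<delta>(1) by (simp add: emeasure_eq_measure2 ennreal_less_iff)
    qed
    define e' where "e' = e / (2 * (b - a + 1))"
    have e': "e' > 0"
      using e ab by (simp add: e'_def)
    have "\<exists>d>0. (x \<in> N \<longrightarrow> ball x d \<subseteq> U) \<and> (x \<in> {0..1} - N \<longrightarrow> (\<forall>u v. u \<le> x \<and> x \<le> v \<and> {u..v} \<subseteq> ball x d \<longrightarrow>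
        norm ((v - u) *\<^sub>R g x - (h v - h u)) \<le> e' * (v - u)))" for x
    proof (cases "x \<in> N")
      case True
      then show ?thesis
        using U(1,2) by (meson open_contains_ball subsetD DiffD2)
    next
      case False
      show ?thesis
      proof (cases "x \<in> {0..1}")
        case True
        with False have "h differentiable (at x)"
          by (auto simp: N_def)
        then have "(h has_vector_derivative g x) (at x)"
          using False by (simp add: g_def vector_derivative_works)
        then obtain d where d: "d > 0" "\<forall>u v. u \<le> x \<and> x \<le> v \<and> u \<in> ball x d \<and> v \<in> ball x d \<longrightarrow>
            norm ((v - u) *\<^sub>R g x - (h v - h u)) \<le> e' * (v - u)"
          using has_vector_derivative_straddle[OF _ e'] by metis
        have "norm ((v - u) *\<^sub>R g x - (h v - h u)) \<le> e' * (v - u)" if "u \<le> x" "x \<le> v" "{u..v} \<subseteq> ball x d" for u v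
        proof -
          have "u \<in> {u..v}" "v \<in> {u..v}"
            using that by auto
          then show ?thesis
            using d(2) that by blast
        qed
        then show ?thesis
          using d(1) False by blast
      qed (use False in \<open>auto intro: exI[of _ 1]\<close>)
    qed
    then obtain d where d: "\<And>x. d x > 0" "\<And>x. x \<in> N \<Longrightarrow> ball x (d x) \<subseteq> U"
      "\<And>x u v. x \<in> {0..1} - N \<Longrightarrow> u \<le> x \<Longrightarrow> x \<le> v \<Longrightarrow> {u..v} \<subseteq> ball x (d x) \<Longrightarrow> norm ((v - u) *\<^sub>R g x - (h v - h u)) \<le> e' * (v - u)"
      by metis
    show "\<exists>\<gamma>. gauge \<gamma> \<and> (\<forall>\<D>. \<D> tagged_division_of {a..b} \<and> \<gamma> fine \<D> \<longrightarrow>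
        norm ((\<Sum>(x, k)\<in>\<D>. measure lborel k *\<^sub>R g x) - (h b - h a)) < e)"
    proof (intro exI[of _ "\<lambda>x. ball x (d x)"] conjI allI impI)
      show "gauge (\<lambda>x. ball x (d x))"
        using d(1) by (auto simp: gauge_def)
      fix p assume "p tagged_division_of {a..b} \<and> (\<lambda>x. ball x (d x)) fine p"
      then have p: "p tagged_division_of {a..b}" and fine: "(\<lambda>x. ball x (d x)) fine p"
        by auto
      have K: "x \<in> K \<and> K \<subseteq> {a..b} \<and> K \<subseteq> ball x (d x) \<and> (\<exists>u v. u \<le> x \<and> x \<le> v \<and> K = {u..v} \<and> u \<le> v)" if "(x, K) \<in> p" for x K
        using tagged_division_ofD(2,3,4)[OF p that] fine that unfolding fine_def by (fastforce simp: cbox_interval)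
      define p1 where "p1 = {(x, K) \<in> p. x \<notin> N}"
      define p2 where "p2 = {(x, K) \<in> p. x \<in> N}"
      define nt where "nt = (\<lambda>(x, K). measure lborel K *\<^sub>R g x - (h (Sup K) - h (Inf K)))"
      have fin: "finite p" "finite p1" "finite p2"
        using tagged_division_of_finite[OF p] by (auto simp: p1_def p2_def intro: finite_subset)
      have p12: "p = p1 \<union> p2" "p1 \<inter> p2 = {}"
        by (auto simp: p1_def p2_def)
      have "(\<Sum>(x, k)\<in>p. measure lborel k *\<^sub>R g x) - (h b - h a) = sum nt p"
        unfolding nt_def additive_tagged_division_1[OF ab(2) p, symmetric] by (simp add: sum_subtractf split_def)
      also have "\<dots> = sum nt p1 + sum nt p2"
        using fin p12 by (metis sum.union_disjoint)
      finally have "norm ((\<Sum>(x, k)\<in>p. measure lborel k *\<^sub>R g x) - (h b - h a)) \<le> norm (sum nt p1) + norm (sum nt p2)"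
        using norm_triangle_ineq by metis
      moreover have "norm (sum nt p1) \<le> e' * (b - a)"
      proof -
        have "norm (nt z) \<le> e' * measure lborel (snd z)" if "z \<in> p1" for z
        proof -
          obtain x K' where z: "z = (x, K')" "(x, K') \<in> p" "x \<notin> N"
            using \<open>z \<in> p1\<close> unfolding p1_def by blast
          obtain u v where uv: "u \<le> x" "x \<le> v" "K' = {u..v}" "u \<le> v"
            using K[OF z(2)] by blast
          have "x \<in> {0..1} - N" "{u..v} \<subseteq> ball x (d x)"
            using K[OF z(2)] z(3) ab uv by auto
          from d(3)[OF this(1) uv(1,2) this(2)] show ?thesis
            using z uv by (simp add: nt_def)
        qed
        then have "norm (sum nt p1) \<le> (\<Sum>z\<in>p1. e' * measure lborel (snd z))"
          by (rule sum_norm_le)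
        also have "\<dots> \<le> (\<Sum>z\<in>p. e' * measure lborel (snd z))"
          using fin p12 e' by (intro sum_mono2) auto
        also have "\<dots> = e' * (b - a)"
          using additive_content_tagged_division[of p a b] p ab by (simp add: sum_distrib_left[symmetric] split_def cbox_interval)
        finally show ?thesis .
      qed
      moreover have "norm (sum nt p2) < e / 2"
      proof -
        \<comment> \<open>A degenerate piece may occur with several tags. Pieces with nonempty
          interior determine their tag, so one can pass from tagged pieces to sets of intervals; the
          degenerate ones have increment 0.\<close>
        define q where "q = {z \<in> p2. interior (snd z) \<noteq> {}}"
        have q: "finite q" "q \<subseteq> p2"
          using fin by (auto simp: q_def)
        have inj: "inj_on snd q"
        proof (rule inj_onI)
          fix z w assume zw: "z \<in> q" "w \<in> q" "snd z = snd w"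
          then have "z \<in> p" "w \<in> p" "interior (snd z) \<inter> interior (snd w) \<noteq> {}"
            by (auto simp: q_def p2_def)
          then show "z = w"
            using tagged_division_ofD(5)[OF p, of "fst z" "snd z" "fst w" "snd w"] by (metis prod.collapse)
        qed
        have nt0: "norm (nt z) = norm (h (Sup (snd z)) - h (Inf (snd z)))" if "z \<in> p2" for z
          using that by (auto simp: p2_def nt_def g_def norm_minus_commute)
        have "norm (sum nt p2) \<le> (\<Sum>z\<in>p2. norm (h (Sup (snd z)) - h (Inf (snd z))))"
          using nt0 by (intro sum_norm_le) auto
        also have "\<dots> = (\<Sum>z\<in>q. norm (h (Sup (snd z)) - h (Inf (snd z))))"
        proof (rule sum.mono_neutral_right[OF fin(3) q(2)], safe)
          fix x K' assume z: "(x, K') \<in> p2" "(x, K') \<notin> q"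
          then obtain u v where "u \<le> v" "K' = {u..v}" "interior K' = {}"
            using K[of x K'] by (auto simp: p2_def q_def)
          then have "u = v" by (auto simp: interior_atLeastAtMost_real)
          then show "norm (h (Sup (snd (x, K'))) - h (Inf (snd (x, K')))) = 0"
            using \<open>K' = {u..v}\<close> by simp
        qed
        also have "\<dots> = (\<Sum>K\<in>snd ` q. norm (h (Sup K) - h (Inf K)))"
          by (simp add: sum.reindex[OF inj])
        also have "\<dots> < e / 2"
        proof (rule \<delta>(2))
          show "finite (snd ` q)"
            using q by auto
          have qK: "K' \<subseteq> U \<and> K' \<subseteq> {0..1} \<and> (\<exists>u v. u \<le> v \<and> K' = {u..v})" if "K' \<in> snd ` q" for K'
          proof -
            obtain x where x: "(x, K') \<in> p" "x \<in> N"
              using \<open>K' \<in> snd ` q\<close> unfolding q_def p2_def by auto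
            have "K' \<subseteq> {a..b}"
              using K[OF x(1)] by blast
            then have "K' \<subseteq> {0..1}"
              using ab by auto
            then show ?thesis
              using K[OF x(1)] d(2)[OF x(2)] by blast
          qed
          then show "\<exists>a b. a \<le> b \<and> K = {a..b} \<and> K \<subseteq> {0..1}" if "K \<in> snd ` q" for K
            using that by metis
          have qKm: "K' \<in> lmeasurable" if "K' \<in> snd ` q" for K'
            using qK[OF that] by auto
          show pw: "pairwise (\<lambda>K L. interior K \<inter> interior L = {}) (snd ` q)"
            unfolding pairwise_image pairwise_def
            using tagged_division_ofD(5)[OF p] by (fastforce simp: q_def p2_def)
          have "(\<Sum>K\<in>snd ` q. Sup K - Inf K) = (\<Sum>K\<in>snd ` q. measure lebesgue K)"
            using qK by (intro sum.cong refl) force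
          also have "\<dots> = measure lebesgue (\<Union>(snd ` q))"
          proof (rule measure_negligible_finite_Union[symmetric])
            show "pairwise (\<lambda>S T. negligible (S \<inter> T)) (snd ` q)"
            proof (rule pairwiseI)
              fix S T assume *: "S \<in> snd ` q" "T \<in> snd ` q" "S \<noteq> T"
              obtain u v u' v' where uv: "S = {u..v}" "T = {u'..v'}"
                using qK *(1,2) by metis
              have "interior S \<inter> interior T = {}"
                using pw * by (auto simp: pairwise_def)
              then have "interior (S \<inter> T) = {}"
                by (simp add: interior_Int)
              then show "negligible (S \<inter> T)"
                unfolding uv Int_atLeastAtMost by (simp add: negligible_interval flip: box_real)
            qed
            show "finite (snd ` q)"
              using q by simp
            show "S \<in> lmeasurable" if "S \<in> snd ` q" for S
              using qKm that by blast
          qed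
          also have "\<dots> \<le> measure lebesgue U"
          proof (rule measure_mono_fmeasurable[OF _ _ Um])
            show "\<Union>(snd ` q) \<subseteq> U"
              using qK by blast
            show "\<Union>(snd ` q) \<in> sets lebesgue"
              using qKm q by (intro sets.finite_Union) (auto dest: fmeasurableD)
          qed
          finally show "(\<Sum>K\<in>snd ` q. Sup K - Inf K) < \<delta>"
            using mU by simp
        qed
        finally show ?thesis .
      qed
      moreover have "e' * (b - a) \<le> e / 2"
        using e ab by (simp add: e'_def field_simps)
      ultimately show "norm ((\<Sum>(x, k)\<in>p. measure lborel k *\<^sub>R g x) - (h b - h a)) < e"
        by linarith
    qed
  qed
  then show ?thesis
    by (rule has_integral_spike[OF N, rotated]) (auto simp: g_def)
qed

section \<open>The energy of a path\<close>

locale posdef_matrix =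
  fixes \<Sigma> :: "real ^ 'd::finite ^ 'd"
  assumes symmetric: "v \<bullet> (\<Sigma> *v w) = w \<bullet> (\<Sigma> *v v)" and posdef: "v \<noteq> 0 \<Longrightarrow> 0 < v \<bullet> (\<Sigma> *v v)"
begin

definition qf :: "real ^ 'd \<Rightarrow> real" where
  "qf v = (matrix_inv \<Sigma> *v v) \<bullet> v"

lemma inv_mult: "\<Sigma> *v (matrix_inv \<Sigma> *v v) = v"
proof -
  have "inj ((*v) \<Sigma>)"
    unfolding linear_injective_0[OF matrix_vector_mul_linear] using posdef by force
  then have "invertible \<Sigma>"
    by (simp add: invertible_left_inverse matrix_left_invertible_injective)
  then have "\<Sigma> ** matrix_inv \<Sigma> = mat 1"
    using someI_ex[of "\<lambda>B. \<Sigma> ** B = mat 1 \<and> B ** \<Sigma> = mat 1"] by (simp add: matrix_inv_def invertible_def)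
  then show ?thesis
    by (simp add: matrix_vector_mul_assoc)
qed

text \<open>Positivity of the covariance form at the difference of \<theta> and
  \<open>matrix_inv \<Sigma> *v v\<close>, with equality when the two agree: \<open>qf / 2\<close>
  is the Legendre transform of half the covariance form.\<close>

lemma qf_young: "\<theta> \<bullet> v \<le> (\<theta> \<bullet> (\<Sigma> *v \<theta>)) / 2 + qf v / 2"
proof -
  let ?w = "matrix_inv \<Sigma> *v v"
  have "0 \<le> (\<theta> - ?w) \<bullet> (\<Sigma> *v (\<theta> - ?w))"
    using posdef[of "\<theta> - ?w"] by (cases "\<theta> - ?w = 0") auto
  also have "\<dots> = \<theta> \<bullet> (\<Sigma> *v \<theta>) - 2 * (\<theta> \<bullet> v) + qf v"
    using symmetric[of ?w \<theta>] by (simp add: matrix_vector_mult_diff_distrib inner_diff_left inner_diff_right inv_mult qf_def)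
  finally show ?thesis
    by simp
qed

lemma qf_nonneg: "0 \<le> qf v"
  using qf_young[of 0 v] by simp

lemma qf_scale: "qf (c *\<^sub>R v) = c\<^sup>2 * qf v"
  by (simp add: qf_def matrix_vector_mult_scaleR power2_eq_square)

lemma qf_0 [simp]: "qf 0 = 0"
  by (simp add: qf_def)

lemma continuous_qf: "continuous_on A qf"
  unfolding qf_def[abs_def] by (intro continuous_intros linear_continuous_on matrix_vector_mul_bounded_linear)

text \<open>Coercivity of the inverse form follows from boundedness of \<Sigma>, by testing the
  duality inequality with \<open>v / B\<close>.\<close>

lemma qf_norm_bound: obtains B where "0 < B" "\<And>v. (norm v)\<^sup>2 \<le> B * qf v"
proof -
  obtain B where B: "0 < B" "\<And>v. norm (\<Sigma> *v v) \<le> B * norm v"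
    using bounded_linear.pos_bounded[OF matrix_vector_mul_bounded_linear[of \<Sigma>]] by (auto simp: mult.commute)
  have "(norm v)\<^sup>2 \<le> B * qf v" for v
  proof -
    have "v \<bullet> (\<Sigma> *v v) \<le> norm v * (B * norm v)"
      by (intro order_trans[OF norm_cauchy_schwarz] mult_left_mono B) auto
    then have *: "((1 / B) *\<^sub>R v) \<bullet> (\<Sigma> *v ((1 / B) *\<^sub>R v)) \<le> (norm v)\<^sup>2 / B"
      using B(1) by (simp add: matrix_vector_mult_scaleR power2_eq_square field_simps)
    have "(norm v)\<^sup>2 / B = ((1 / B) *\<^sub>R v) \<bullet> v"
      by (simp add: power2_norm_eq_inner)
    also have "\<dots> \<le> (norm v)\<^sup>2 / B / 2 + qf v / 2"
      by (rule order_trans[OF qf_young add_right_mono[OF divide_right_mono[OF *]]]) simp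
    finally show ?thesis
      using B(1) by (simp add: field_simps)
  qed
  then show ?thesis
    using that B(1) by blast
qed

definition energy :: "(real \<Rightarrow> real ^ 'd) \<Rightarrow> real set \<Rightarrow> ennreal" where
  "energy h S = (\<integral>\<^sup>+ t\<in>S. ennreal (qf (vector_derivative h (at t)) / 2) \<partial>lebesgue)"

lemma measurable_energy_density:
  assumes AC: "absolutely_continuous_on {0..1} h" and st: "0 \<le> s" "s \<le> t" "t \<le> 1"
  shows "(\<lambda>x. qf (vector_derivative h (at x)) / 2) \<in> borel_measurable (lebesgue_on {s..t})"
proof -
  have "(\<lambda>x. vector_derivative h (at x)) \<in> borel_measurable (lebesgue_on {s..t})"
    using absolutely_continuous_has_integral[OF AC st] by (intro integrable_imp_measurable) (auto simp: integrable_on_def)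
  moreover have "qf \<in> borel_measurable borel"
    by (intro borel_measurable_continuous_onI continuous_qf)
  ultimately show ?thesis
    by measurable
qed

text \<open>Jensen's inequality, by testing Young's inequality with the optimal constant \<open>\<theta>\<close>.\<close>

lemma energy_increment:
  assumes AC: "absolutely_continuous_on {0..1} h" and st: "0 \<le> s" "s \<le> t" "t \<le> 1"
  shows "ennreal (qf (h t - h s) / (2 * (t - s))) \<le> energy h {s..t}"
\<comment> \<open>For \<open>s = t\<close> the increment is 0, and the quotient is 0 by the
  convention for division by zero.\<close>
proof (cases "s = t \<or> energy h {s..t} = \<infinity>")
  case False
  then have st': "s < t" and fin: "energy h {s..t} < \<infinity>"
    using st by (auto simp: top.not_eq_extremum)
  let ?g = "\<lambda>x. vector_derivative h (at x)"
  let ?u = "\<lambda>x. qf (?g x) / 2"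
  have en: "energy h {s..t} = (\<integral>\<^sup>+x. ennreal (?u x) \<partial>lebesgue_on {s..t})"
    by (simp add: energy_def nn_integral_restrict_space)
  have int: "integrable (lebesgue_on {s..t}) ?u"
    using measurable_energy_density[OF AC st] fin qf_nonneg unfolding en by (intro integrableI_nonneg) auto
  define I where "I = integral\<^sup>L (lebesgue_on {s..t}) ?u"
  have I: "(?u has_integral I) {s..t}"
    unfolding I_def by (rule has_integral_integral_lebesgue_on[OF int]) simp
  have enI: "energy h {s..t} = ennreal I"
    unfolding en I_def using int qf_nonneg by (intro nn_integral_eq_integral) auto
  have *: "\<theta> \<bullet> (h t - h s) - (t - s) * (\<theta> \<bullet> (\<Sigma> *v \<theta>) / 2) \<le> I" for \<theta>
  proof (rule has_integral_le)
    have "((\<lambda>x. \<theta> \<bullet> ?g x) has_integral \<theta> \<bullet> (h t - h s)) {s..t}"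
      using has_integral_linear[OF absolutely_continuous_has_integral[OF AC st] bounded_linear_inner_right[of \<theta>]]
      by (simp add: o_def)
    moreover have "((\<lambda>x. \<theta> \<bullet> (\<Sigma> *v \<theta>) / 2) has_integral (t - s) * (\<theta> \<bullet> (\<Sigma> *v \<theta>) / 2)) {s..t}"
      using has_integral_const_real[of "\<theta> \<bullet> (\<Sigma> *v \<theta>) / 2" s t] st by simp
    ultimately show "((\<lambda>x. \<theta> \<bullet> ?g x - \<theta> \<bullet> (\<Sigma> *v \<theta>) / 2) has_integral \<theta> \<bullet> (h t - h s) - (t - s) * (\<theta> \<bullet> (\<Sigma> *v \<theta>) / 2)) {s..t}"
      by (rule has_integral_diff)
    show "\<theta> \<bullet> ?g x - \<theta> \<bullet> (\<Sigma> *v \<theta>) / 2 \<le> ?u x" for x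
      using qf_young[of \<theta> "?g x"] by linarith
  qed (rule I)
  define \<theta> where "\<theta> = (1 / (t - s)) *\<^sub>R (matrix_inv \<Sigma> *v (h t - h s))"
  have th1: "\<theta> \<bullet> (h t - h s) = qf (h t - h s) / (t - s)"
    by (simp add: \<theta>_def qf_def)
  have th2: "\<theta> \<bullet> (\<Sigma> *v \<theta>) = qf (h t - h s) / (t - s)\<^sup>2"
    by (simp add: \<theta>_def matrix_vector_mult_scaleR inv_mult qf_def power2_eq_square)
  have "\<theta> \<bullet> (h t - h s) - (t - s) * (\<theta> \<bullet> (\<Sigma> *v \<theta>) / 2) = qf (h t - h s) / (2 * (t - s))"
  proof -
    have "x / y - y * (x / y\<^sup>2 / 2) = x / (2 * y)" if "y \<noteq> 0" for x y :: real
      using that by (simp add: power2_eq_square field_simps)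
    from this[of "t - s" "qf (h t - h s)"] show ?thesis
      using st' unfolding th1 th2 by simp
  qed
  then have "qf (h t - h s) / (2 * (t - s)) \<le> I"
    using *[of \<theta>] by simp
  then show ?thesis
    unfolding enI by (rule ennreal_leI)
qed auto

text \<open>Intervals may form any disjoint family, not only a partition, because sums of this kind
  serve as the criterion by which a limit path is recognised as absolutely continuous.\<close>

lemma energy_family:
  fixes s t :: "nat \<Rightarrow> real"
  assumes AC: "absolutely_continuous_on {0..1} h" and st: "\<forall>i<N. s i \<le> t i \<and> {s i..t i} \<subseteq> {0..1}"
    and disj: "pairwise (\<lambda>i j. {s i<..<t i} \<inter> {s j<..<t j} = {}) {..<N}"
  shows "ennreal (\<Sum>i<N. qf (h (t i) - h (s i)) / (2 * (t i - s i))) \<le> energy h {0..1}"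
proof -
  let ?u = "\<lambda>x. ennreal (qf (vector_derivative h (at x)) / 2)"
  define w where "w = (\<lambda>x. ?u x * indicator {0..1} x)"
  have "?u \<in> borel_measurable (lebesgue_on {0..1})"
    using measurable_energy_density[OF AC, of 0 1] by measurable
  then have w: "w \<in> borel_measurable lebesgue"
    unfolding w_def by (subst (asm) borel_measurable_restrict_space_iff_ennreal) auto
  have st01: "0 \<le> s i" "t i \<le> 1" "s i \<le> t i" if "i < N" for i
    using st that by auto
  have "ennreal (\<Sum>i<N. qf (h (t i) - h (s i)) / (2 * (t i - s i))) = (\<Sum>i<N. ennreal (qf (h (t i) - h (s i)) / (2 * (t i - s i))))"
    using st01 qf_nonneg by (subst sum_ennreal) (auto intro!: divide_nonneg_nonneg)
  also have "\<dots> \<le> (\<Sum>i<N. energy h {s i..t i})"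
    using st01 by (intro sum_mono energy_increment[OF AC]) auto
  \<comment> \<open>Dropping the endpoints, a null set, makes the intervals disjoint, so that at
    most one indicator is nonzero at each point.\<close>
  also have "\<dots> = (\<Sum>i<N. \<integral>\<^sup>+x. w x * indicator {s i<..<t i} x \<partial>lebesgue)"
  proof (intro sum.cong refl)
    fix i assume "i \<in> {..<N}"
    then have i: "0 \<le> s i" "t i \<le> 1"
      using st01 by auto
    have "{s i, t i} \<in> null_sets lebesgue"
      by (intro finite_imp_null_set_lborel null_sets_completionI) auto
    then have "AE x in lebesgue. x \<notin> {s i, t i}"
      by (rule AE_not_in)
    then show "energy h {s i..t i} = (\<integral>\<^sup>+x. w x * indicator {s i<..<t i} x \<partial>lebesgue)"
      unfolding energy_def by (intro nn_integral_cong_AE, elim eventually_mono) (use i in \<open>auto simp: w_def indicator_def\<close>)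
  qed
  also have "\<dots> = (\<integral>\<^sup>+x. (\<Sum>i<N. w x * indicator {s i<..<t i} x) \<partial>lebesgue)"
    using w by (intro nn_integral_sum[symmetric]) (auto intro!: borel_measurable_times_ennreal borel_measurable_indicator)
  also have "\<dots> \<le> (\<integral>\<^sup>+x. w x \<partial>lebesgue)"
  proof (rule nn_integral_mono)
    fix x
    show "(\<Sum>i<N. w x * indicator {s i<..<t i} x) \<le> w x"
    proof (cases "\<exists>i<N. x \<in> {s i<..<t i}")
      case True
      then obtain i where i: "i < N" "x \<in> {s i<..<t i}" by blast
      have "x \<notin> {s j<..<t j}" if "j < N" "j \<noteq> i" for j
        using disj i that unfolding pairwise_def by blast
      then have "(\<Sum>j<N. w x * indicator {s j<..<t j} x) = (\<Sum>j<N. if j = i then w x else 0)"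
        using i by (intro sum.cong) (auto simp: indicator_def)
      also have "\<dots> = w x"
        using i by simp
      finally show ?thesis
        by (rule eq_refl)
    next
      case False
      then have zero: "(\<Sum>i<N. w x * indicator {s i<..<t i} x) = 0"
        by (intro sum.neutral) (auto simp: indicator_def)
      show ?thesis
        unfolding zero by simp
    qed
  qed
  also have "\<dots> = energy h {0..1}"
    by (simp add: w_def energy_def)
  finally show ?thesis .
qed

text \<open>The reverse of Jensen's bound, by Fatou's lemma: the difference quotients over the cells
  of length \<open>1 / m\<close> converge to the derivative wherever it exists, by the straddle
  estimate.\<close>

lemma energy_le_uniform:
  fixes h :: "real \<Rightarrow> real ^ 'd"
  assumes AC: "absolutely_continuous_on {0..1} h" and b: "0 \<le> b"
    and part: "\<And>m::nat. 0 < m \<Longrightarrow> (\<Sum>j<m. real m / 2 * qf (h ((real j + 1) / real m) - h (real j / real m))) \<le> b"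
  shows "energy h {0..1} \<le> ennreal b"
proof -
  define sl where "sl = (\<lambda>(m::nat) (j::nat). real m *\<^sub>R (h ((real j + 1) / real m) - h (real j / real m)))"
  \<comment> \<open>Half-open cells, so that each point of \<open>{0..<1}\<close> lies in exactly
    one of them.\<close>
  define u where "u = (\<lambda>m x. \<Sum>j<m. ennreal (qf (sl m j) / 2) * indicator {real j / real m..<(real j + 1) / real m} x)"
  have um: "u m \<in> borel_measurable lebesgue" for m
    unfolding u_def by (intro borel_measurable_sum borel_measurable_times_ennreal borel_measurable_indicator) auto
  have int: "(\<integral>\<^sup>+x. u m x \<partial>lebesgue) \<le> ennreal b" if m: "0 < m" for m
  proof -
    have "(\<integral>\<^sup>+x. u m x \<partial>lebesgue) = (\<Sum>j<m. \<integral>\<^sup>+x. ennreal (qf (sl m j) / 2) * indicator {real j / real m..<(real j + 1) / real m} x \<partial>lebesgue)"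
      unfolding u_def by (intro nn_integral_sum) (auto intro!: borel_measurable_times_ennreal borel_measurable_indicator)
    also have "\<dots> = (\<Sum>j<m. ennreal (qf (sl m j) / 2) * ennreal (1 / m))"
      using m by (intro sum.cong refl) (subst nn_integral_cmult_indicator, auto simp: divide_right_mono diff_divide_distrib[symmetric])
    also have "\<dots> = (\<Sum>j<m. ennreal (real m / 2 * qf (h ((real j + 1) / real m) - h (real j / real m))))"
      using m qf_nonneg by (intro sum.cong refl) (subst ennreal_mult[symmetric], auto simp: sl_def qf_scale power2_eq_square)
    also have "\<dots> = ennreal (\<Sum>j<m. real m / 2 * qf (h ((real j + 1) / real m) - h (real j / real m)))"
      using qf_nonneg by (intro sum_ennreal) auto
    also have "\<dots> \<le> ennreal b"
      using part[OF m] by (rule ennreal_leI)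
    finally show ?thesis .
  qed
  have lim: "(\<lambda>m. u m x) \<longlonglongrightarrow> ennreal (qf (vector_derivative h (at x)) / 2)"
    if x: "x \<in> {0<..<1}" "h differentiable (at x)" for x
  proof -
    define jj where "jj = (\<lambda>m. nat \<lfloor>real m * x\<rfloor>)"
    have jj: "real (jj m) \<le> real m * x" "real m * x < real (jj m) + 1" "jj m < m" if m: "0 < m" for m
    proof -
      have "real (jj m) = of_int \<lfloor>real m * x\<rfloor>"
        using x by (simp add: jj_def)
      then show 1: "real (jj m) \<le> real m * x" "real m * x < real (jj m) + 1"
        by linarith+
      have "real m * x < real m"
        using x m by simp
      then show "jj m < m"
        using 1 by linarith
    qed
    have ueq: "u m x = ennreal (qf (sl m (jj m)) / 2)" if m: "0 < m" for m
    proof -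
      have ind: "indicator {real j / real m..<(real j + 1) / real m} x = (if j = jj m then 1 else 0 :: ennreal)" for j :: nat
      proof -
        have "x \<in> {real j / real m..<(real j + 1) / real m} \<longleftrightarrow> real j \<le> real m * x \<and> real m * x < real j + 1"
          using m by (auto simp: field_simps)
        also have "\<dots> \<longleftrightarrow> j = jj m"
          using jj(1,2)[OF m] by auto
        finally show ?thesis
          by (simp add: indicator_def)
      qed
      show ?thesis
        unfolding u_def ind using jj(3)[OF m] by (simp add: if_distrib[of "\<lambda>z. _ * z"] sum.delta cong: if_cong)
    qed
    let ?D = "vector_derivative h (at x)"
    have "(\<lambda>m. sl m (jj m)) \<longlonglongrightarrow> ?D"
      unfolding LIMSEQ_def
    proof (intro allI impI)
      fix e :: real assume e: "0 < e"
      have D: "(h has_vector_derivative ?D) (at x)"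
        using x(2) by (simp add: vector_derivative_works)
      obtain d where d: "d > 0" "\<forall>u v. u \<le> x \<and> x \<le> v \<and> u \<in> ball x d \<and> v \<in> ball x d \<longrightarrow>
          norm ((v - u) *\<^sub>R ?D - (h v - h u)) \<le> e / 2 * (v - u)"
        using has_vector_derivative_straddle[OF D, of "e / 2"] e by auto
      obtain M :: nat where M: "1 / d < M"
        using reals_Archimedean2 by blast
      have "dist (sl m (jj m)) ?D < e" if m: "M \<le> m" for m
      proof -
        have "0 < real M"
          using M d(1) by (meson less_trans zero_less_divide_1_iff)
        then have m0: "0 < m"
          using m by simp
        have "1 / d < m"
          using M m by (meson less_le_trans of_nat_le_iff)
        then have md: "1 / m < d"
          using m0 d(1) by (simp add: field_simps)
        let ?p = "jj m / m" and ?r = "(real (jj m) + 1) / m"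
        have pr: "?p \<le> x" "x < ?r" "?r - ?p = 1 / m"
          using jj(1,2)[OF m0] m0 by (simp_all add: field_simps)
        then have "?p \<in> ball x d" "?r \<in> ball x d"
          using md by (auto simp: dist_real_def)
        then have "norm ((?r - ?p) *\<^sub>R ?D - (h ?r - h ?p)) \<le> e / 2 * (?r - ?p)"
          using d(2) pr by (metis less_imp_le)
        then have *: "norm ((1 / m) *\<^sub>R ?D - (h ?r - h ?p)) \<le> e / 2 * (1 / m)"
          unfolding pr(3) .
        have "?D - sl m (jj m) = real m *\<^sub>R ((1 / m) *\<^sub>R ?D - (h ?r - h ?p))"
          using m0 by (simp add: sl_def scaleR_diff_right)
        then have "norm (?D - sl m (jj m)) = real m * norm ((1 / m) *\<^sub>R ?D - (h ?r - h ?p))"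
          by simp
        also have "\<dots> \<le> real m * (e / 2 * (1 / m))"
          using * by (intro mult_left_mono) auto
        also have "\<dots> < e"
          using m0 e by simp
        finally show ?thesis
          by (simp add: dist_norm norm_minus_commute)
      qed
      then show "\<exists>no. \<forall>m\<ge>no. dist (sl m (jj m)) ?D < e"
        by blast
    qed
    moreover have "isCont qf ?D"
      using continuous_qf[of UNIV] by (simp add: continuous_on_eq_continuous_at)
    ultimately have "(\<lambda>m. qf (sl m (jj m))) \<longlonglongrightarrow> qf ?D"
      by (rule isCont_tendsto_compose[rotated])
    then have "(\<lambda>m. ennreal (qf (sl m (jj m)) / 2)) \<longlonglongrightarrow> ennreal (qf ?D / 2)"
      by (intro tendsto_ennrealI tendsto_divide tendsto_const) auto
    then show ?thesis
      by (rule Lim_transform_eventually) (use eventually_gt_at_top[of 0] in \<open>eventually_elim, simp add: ueq\<close>)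
  qed
  have "{x \<in> {0<..<1}. \<not> h differentiable (at x)} \<union> {0, 1} \<in> null_sets lebesgue"
    using absolutely_continuous_differentiable[OF AC] by (auto simp flip: negligible_iff_null_sets)
  then have "AE x in lebesgue. x \<notin> {x \<in> {0<..<1}. \<not> h differentiable (at x)} \<union> {0, 1}"
    by (rule AE_not_in)
  then have "AE x in lebesgue. ennreal (qf (vector_derivative h (at x)) / 2) * indicator {0..1} x \<le> liminf (\<lambda>m. u m x)"
  proof (elim eventually_mono)
    fix x assume x: "x \<notin> {x \<in> {0<..<1}. \<not> h differentiable (at x)} \<union> {0, 1}"
    show "ennreal (qf (vector_derivative h (at x)) / 2) * indicator {0..1} x \<le> liminf (\<lambda>m. u m x)"
    proof (cases "x \<in> {0..1}")
      case True
      with x have "x \<in> {0<..<1}" "h differentiable (at x)"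
        by auto
      from lim_imp_Liminf[OF _ lim[OF this]] show ?thesis
        using True by simp
    qed simp
  qed
  then have "energy h {0..1} \<le> (\<integral>\<^sup>+x. liminf (\<lambda>m. u m x) \<partial>lebesgue)"
    unfolding energy_def by (rule nn_integral_mono_AE)
  also have "\<dots> \<le> liminf (\<lambda>m. \<integral>\<^sup>+x. u m x \<partial>lebesgue)"
    using um by (rule nn_integral_liminf)
  also have "\<dots> \<le> liminf (\<lambda>m. ennreal b)"
    using eventually_gt_at_top[of 0] by (intro Liminf_mono, eventually_elim) (rule int)
  also have "\<dots> = ennreal b"
    by (simp add: Liminf_const)
  finally show ?thesis .
qed

text \<open>On each interval an increment of norm \<open>x\<close> over length \<open>y\<close>
  satisfies \<open>x \<le> c * x\<^sup>2 / y + y / (4 * c)\<close>. The first terms add up to a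
  multiple of the energy bound, the second ones to a multiple of the total length.\<close>

lemma absolutely_continuous_if_bounded_energy:
  fixes h :: "real \<Rightarrow> real ^ 'd"
  assumes bound: "\<And>(N::nat) s t. \<forall>i<N. s i \<le> t i \<and> {s i..t i} \<subseteq> {0..1} \<Longrightarrow>
      pairwise (\<lambda>i j. {s i<..<t i} \<inter> {s j<..<t j} = {}) {..<N} \<Longrightarrow>
      (\<Sum>i<N. qf (h (t i) - h (s i)) / (2 * (t i - s i))) \<le> b"
  shows "absolutely_continuous_on {0..1} h"
  unfolding absolutely_continuous_on_def
proof (intro allI impI)
  fix \<epsilon> :: real assume \<epsilon>: "0 < \<epsilon>"
  obtain B where B: "0 < B" "\<And>v. (norm v)\<^sup>2 \<le> B * qf v"
    using qf_norm_bound by blast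
  \<comment> \<open>Chosen so that the energy part is at most \<open>\<epsilon> / 2\<close>; the
    threshold \<open>2 * c * \<epsilon>\<close> for the total length then leaves less than
    \<open>\<epsilon> / 2\<close> for the other part.\<close>
  define c where "c = \<epsilon> / (4 * B * (\<bar>b\<bar> + 1))"
  have c: "0 < c"
    using \<epsilon> B by (simp add: c_def)
  show "\<exists>\<delta>>0. \<forall>(N::nat) s t. (\<forall>i<N. s i \<le> t i \<and> {s i..t i} \<subseteq> {0..1}) \<longrightarrow>
        pairwise (\<lambda>i j. {s i<..<t i} \<inter> {s j<..<t j} = {}) {..<N} \<longrightarrow>
        (\<Sum>i<N. t i - s i) < \<delta> \<longrightarrow> (\<Sum>i<N. norm (h (t i) - h (s i))) < \<epsilon>"
  proof (intro exI[of _ "2 * c * \<epsilon>"] conjI allI impI)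
    show "0 < 2 * c * \<epsilon>"
      using c \<epsilon> by simp
    fix N :: nat and s t
    assume st: "\<forall>i<N. s i \<le> t i \<and> {s i..t i} \<subseteq> {0..1}" and disj: "pairwise (\<lambda>i j. {s i<..<t i} \<inter> {s j<..<t j} = {}) {..<N}"
      and len: "(\<Sum>i<N. t i - s i) < 2 * c * \<epsilon>"
    let ?E = "\<lambda>i. qf (h (t i) - h (s i)) / (2 * (t i - s i))"
    have "norm (h (t i) - h (s i)) \<le> 2 * c * B * ?E i + (t i - s i) / (4 * c)" if i: "i < N" for i
    proof (cases "s i = t i")
      case False
      then have l: "0 < t i - s i"
        using st i by (simp add: less_le)
      let ?n = "norm (h (t i) - h (s i))" and ?l = "t i - s i"
      have "0 \<le> (2 * c * ?n - ?l)\<^sup>2"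
        by simp
      then have "?n * (4 * c * ?l) \<le> 4 * c\<^sup>2 * ?n\<^sup>2 + ?l\<^sup>2"
        by (simp add: power2_eq_square algebra_simps)
      then have "?n \<le> (4 * c\<^sup>2 * ?n\<^sup>2 + ?l\<^sup>2) / (4 * c * ?l)"
        using c l by (simp add: pos_le_divide_eq)
      also have "\<dots> = c * ?n\<^sup>2 / ?l + ?l / (4 * c)"
        using c l by (simp add: add_divide_distrib power2_eq_square)
      also have "c * ?n\<^sup>2 / ?l \<le> c * (B * qf (h (t i) - h (s i))) / ?l"
        using B(2) c l by (intro divide_right_mono mult_left_mono) auto
      also have "\<dots> = 2 * c * B * ?E i"
      proof -
        have "c * (B * x) / y = 2 * c * B * (x / (2 * y))" for x y :: real
          by simp
        then show ?thesis .
      qed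
      finally show ?thesis by simp
    qed (use c in simp)
    then have "(\<Sum>i<N. norm (h (t i) - h (s i))) \<le> (\<Sum>i<N. 2 * c * B * ?E i + (t i - s i) / (4 * c))"
      by (intro sum_mono) auto
    also have "\<dots> = 2 * c * B * (\<Sum>i<N. ?E i) + (\<Sum>i<N. t i - s i) / (4 * c)"
      by (simp add: sum.distrib sum_distrib_left sum_divide_distrib)
    also have "\<dots> < 2 * c * B * (\<bar>b\<bar> + 1) + 2 * c * \<epsilon> / (4 * c)"
    proof (rule add_le_less_mono)
      have "(\<Sum>i<N. ?E i) \<le> \<bar>b\<bar> + 1"
        using bound[OF st disj] by linarith
      then show "2 * c * B * (\<Sum>i<N. ?E i) \<le> 2 * c * B * (\<bar>b\<bar> + 1)"
        using c B by (intro mult_left_mono) auto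
      show "(\<Sum>i<N. t i - s i) / (4 * c) < 2 * c * \<epsilon> / (4 * c)"
        using len c by (intro divide_strict_right_mono) auto
    qed
    also have "2 * c * B * (\<bar>b\<bar> + 1) = \<epsilon> / 2"
    proof -
      have "2 * (x / (4 * B * y)) * B * y = x / 2" if "y \<noteq> 0" for x y :: real
        using that B(1) by simp
      from this[of "\<bar>b\<bar> + 1" \<epsilon>] show ?thesis
        unfolding c_def by linarith
    qed
    also have "\<epsilon> / 2 + 2 * c * \<epsilon> / (4 * c) = \<epsilon>"
      using c by simp
    finally show "(\<Sum>i<N. norm (h (t i) - h (s i))) < \<epsilon>" .
  qed
qed

end

section \<open>The path space and its rate function\<close>

lemma absolutely_continuous_on_imp_continuous_on:
  fixes h :: "real \<Rightarrow> 'a::real_normed_vector"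
  assumes "absolutely_continuous_on {0..1} h"
  shows "continuous_on {0..1} h"
  unfolding continuous_on_iff
proof (intro ballI allI impI)
  fix x e :: real assume x: "x \<in> {0..1}" and e: "0 < e"
  obtain d where d: "d > 0" "\<And>(N::nat) s t. (\<forall>i<N. s i \<le> t i \<and> {s i..t i} \<subseteq> {0..1}) \<Longrightarrow>
        pairwise (\<lambda>i j. {s i<..<t i} \<inter> {s j<..<t j} = {}) {..<N} \<Longrightarrow>
        (\<Sum>i<N. t i - s i) < d \<Longrightarrow> (\<Sum>i<N. norm (h (t i) - h (s i))) < e"
    using assms[unfolded absolutely_continuous_on_def, rule_format, OF e] by blast
  show "\<exists>d>0. \<forall>x'\<in>{0..1}. dist x' x < d \<longrightarrow> dist (h x') (h x) < e"
  proof (intro exI[of _ d] conjI ballI impI d(1))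
    fix y assume y: "y \<in> {0..1}" "dist y x < d"
    have "(\<Sum>i<1::nat. norm (h (max x y) - h (min x y))) < e"
      using x y by (intro d(2)[of 1 "\<lambda>_. min x y" "\<lambda>_. max x y"]) (auto simp: dist_real_def max_def min_def pairwise_def)
    then show "dist (h y) (h x) < e"
      by (simp add: dist_norm max_def min_def norm_minus_commute split: if_splits)
  qed
qed

lemma lipschitz_imp_absolutely_continuous_on:
  fixes h :: "real \<Rightarrow> 'a::real_normed_vector"
  assumes L: "\<And>s t. s \<in> {0..1} \<Longrightarrow> t \<in> {0..1} \<Longrightarrow> norm (h t - h s) \<le> L * \<bar>t - s\<bar>"
  shows "absolutely_continuous_on {0..1} h"
  unfolding absolutely_continuous_on_def
proof (intro allI impI)
  fix e :: real assume e: "0 < e"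
  show "\<exists>\<delta>>0. \<forall>(N::nat) s t. (\<forall>i<N. s i \<le> t i \<and> {s i..t i} \<subseteq> {0..1}) \<longrightarrow>
        pairwise (\<lambda>i j. {s i<..<t i} \<inter> {s j<..<t j} = {}) {..<N} \<longrightarrow>
        (\<Sum>i<N. t i - s i) < \<delta> \<longrightarrow> (\<Sum>i<N. norm (h (t i) - h (s i))) < e"
  proof (intro exI[of _ "e / (\<bar>L\<bar> + 1)"] conjI allI impI)
    show "0 < e / (\<bar>L\<bar> + 1)"
      using e by simp
    fix N :: nat and s t
    assume st: "\<forall>i<N. s i \<le> t i \<and> {s i..t i} \<subseteq> {0..1}" and len: "(\<Sum>i<N. t i - s i) < e / (\<bar>L\<bar> + 1)"
    have "(\<Sum>i<N. norm (h (t i) - h (s i))) \<le> (\<Sum>i<N. (\<bar>L\<bar> + 1) * (t i - s i))"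
    proof (rule sum_mono)
      fix i assume "i \<in> {..<N}"
      then have i: "s i \<in> {0..1}" "t i \<in> {0..1}" "s i \<le> t i"
        using st by auto
      have "norm (h (t i) - h (s i)) \<le> L * \<bar>t i - s i\<bar>"
        using L i by blast
      also have "\<dots> \<le> (\<bar>L\<bar> + 1) * (t i - s i)"
        using i(3) by (simp add: mult_right_mono)
      finally show "norm (h (t i) - h (s i)) \<le> (\<bar>L\<bar> + 1) * (t i - s i)" .
    qed
    also have "\<dots> = (\<bar>L\<bar> + 1) * (\<Sum>i<N. t i - s i)"
      by (simp add: sum_distrib_left)
    also have "\<dots> < (\<bar>L\<bar> + 1) * (e / (\<bar>L\<bar> + 1))"
      using len by (intro mult_strict_left_mono) auto
    also have "\<dots> = e"
      by simp
    finally show "(\<Sum>i<N. norm (h (t i) - h (s i))) < e" .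
  qed
qed

section \<open>The path space as a metric space\<close>

definition AC0_metric :: "(real \<Rightarrow> 'a::euclidean_space) metric" where
  "AC0_metric = submetric (cfunspace (top_of_set {0..1}) euclidean_metric) AC0"

lemma mspace_AC0: "mspace (AC0_metric :: (real \<Rightarrow> 'a::euclidean_space) metric) = AC0"
proof -
  have "h \<in> mspace (cfunspace (top_of_set {0..1}) euclidean_metric)" if h: "h \<in> AC0" for h :: "real \<Rightarrow> 'a"
  proof -
    have ext: "h \<in> extensional {0..1}" and cont: "continuous_on {0..1} h"
      using h absolutely_continuous_on_imp_continuous_on by (auto simp: AC0_def)
    have "bounded (h ` {0..1})"
      by (intro compact_imp_bounded compact_continuous_image cont) simp
    then show ?thesis
      using ext cont by (simp add: Met_TC.mbounded_def image_subset_iff) 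
  qed
  then show ?thesis
    by (auto simp: AC0_metric_def)
qed

lemma mdist_AC0:
  assumes "f \<in> AC0" "g \<in> AC0"
  shows "mdist AC0_metric f g \<le> r \<longleftrightarrow> (\<forall>t\<in>{0..1}. dist (f t) (g t) \<le> r)"
proof -
  have "f \<in> mspace (cfunspace (top_of_set {0..1}) euclidean_metric)" "g \<in> mspace (cfunspace (top_of_set {0..1}) euclidean_metric)"
    using assms mspace_AC0 by (auto simp: AC0_metric_def)
  from cfunspace_mdist_le[OF this, of r] show ?thesis
    by (simp add: AC0_metric_def)
qed

interpretation AC0: Metric_space "AC0 :: (real \<Rightarrow> 'a::euclidean_space) set" "mdist AC0_metric"
  using Metric_space_mspace_mdist[of "AC0_metric :: (real \<Rightarrow> 'a) metric"] by (simp only: mspace_AC0)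

lemma AC0_topology_eq: "AC0_topology = AC0.mtopology"
  by (simp add: AC0_topology_def mtopology_of_def AC0_metric_def[symmetric] mspace_AC0)

lemma topspace_AC0: "topspace AC0_topology = AC0"
  by (simp add: AC0_topology_eq)

lemma openin_AC0_ball:
  assumes "openin AC0_topology U" "h \<in> U"
  obtains r where "0 < r" "\<And>g. g \<in> AC0 \<Longrightarrow> \<forall>t\<in>{0..1}. dist (h t) (g t) \<le> r \<Longrightarrow> g \<in> U"
proof -
  obtain r where r: "0 < r" "AC0.mball h r \<subseteq> U"
    using assms unfolding AC0_topology_eq AC0.openin_mtopology by blast
  have h: "h \<in> AC0"
    using assms openin_subset topspace_AC0 by blast
  show ?thesis
  proof (rule that[of "r / 2"])
    fix g assume g: "g \<in> AC0" "\<forall>t\<in>{0..1}. dist (h t) (g t) \<le> r / 2"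
    then have "mdist AC0_metric h g \<le> r / 2"
      using mdist_AC0[OF h g(1), of "r / 2"] by blast
    then have "g \<in> AC0.mball h r"
      using g h r(1) by simp
    then show "g \<in> U"
      using r(2) by blast
  qed (use r in simp)
qed

text \<open>A Lebesgue number argument: cover \<open>K\<close> by balls of half the radius at which
  they still avoid \<open>F\<close>. The distance is phrased through a time \<open>t\<close> since
  polygon and walk are compared pointwise.\<close>

lemma AC0_compact_closed_separated:
  assumes K: "compactin AC0_topology K" and F: "closedin AC0_topology F" and "K \<inter> F = {}"
  obtains r where "0 < r" "\<And>h g. h \<in> K \<Longrightarrow> g \<in> F \<Longrightarrow> \<exists>t\<in>{0..1}. r < dist (h t) (g t)"
proof -
  have KM: "K \<subseteq> AC0" and FM: "F \<subseteq> AC0"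
    using compactin_subset_topspace[OF K] closedin_subset[OF F] by (simp_all add: topspace_AC0)
  have op: "openin AC0_topology (AC0 - F)"
    using F by (simp add: closedin_def topspace_AC0)
  have "\<exists>r>0. AC0.mball h (2 * r) \<subseteq> AC0 - F" if "h \<in> K" for h
  proof -
    have "h \<in> AC0 - F"
      using that KM assms(3) by auto
    then obtain r where "r > 0" "AC0.mball h r \<subseteq> AC0 - F"
      using op unfolding AC0_topology_eq AC0.openin_mtopology by blast
    then show ?thesis
      by (intro exI[of _ "r / 2"]) auto
  qed
  then obtain r where r: "\<And>h. h \<in> K \<Longrightarrow> 0 < r h" "\<And>h. h \<in> K \<Longrightarrow> AC0.mball h (2 * r h) \<subseteq> AC0 - F"
    by metis
  have "K \<subseteq> \<Union>((\<lambda>h. AC0.mball h (r h)) ` K)"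
    using r(1) KM by auto
  moreover have "\<forall>U\<in>(\<lambda>h. AC0.mball h (r h)) ` K. openin AC0_topology U"
    by (auto simp: AC0_topology_eq)
  ultimately obtain \<U> where \<U>: "finite \<U>" "\<U> \<subseteq> (\<lambda>h. AC0.mball h (r h)) ` K" "K \<subseteq> \<Union>\<U>"
    using K unfolding compactin_def by meson
  obtain T where T: "finite T" "T \<subseteq> K" "\<U> = (\<lambda>h. AC0.mball h (r h)) ` T"
    using finite_subset_image[OF \<U>(1,2)] by blast
  define e where "e = Min (insert 1 (r ` T))"
  have e: "0 < e" "\<And>h. h \<in> T \<Longrightarrow> e \<le> r h"
    using T r(1) by (auto simp: e_def)
  have "\<exists>t\<in>{0..1}. e / 2 < dist (h t) (g t)" if h: "h \<in> K" and g: "g \<in> F" for h g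
  proof (rule ccontr)
    assume "\<not> ?thesis"
    then have "\<forall>t\<in>{0..1}. dist (h t) (g t) \<le> e / 2"
      by (auto simp: not_less)
    then have hg: "mdist AC0_metric h g \<le> e / 2"
      using mdist_AC0 h g KM FM by blast
    obtain k where k: "k \<in> T" "h \<in> AC0.mball k (r k)"
      using h \<U>(3) T(3) by auto
    have kM: "k \<in> AC0" "h \<in> AC0" "g \<in> AC0"
      using k T h g KM FM by auto
    have "mdist AC0_metric k g \<le> mdist AC0_metric k h + mdist AC0_metric h g"
      using AC0.triangle kM by blast
    also have "\<dots> < 2 * r k"
      using k hg e by fastforce
    finally have "g \<in> AC0.mball k (2 * r k)"
      using kM by simp
    then show False
      using r(2)[of k] k(1) T(2) g by blast
  qed
  then show ?thesis
    using that[of "e / 2"] e(1) by simp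
qed

section \<open>Compactness of the sublevel sets\<close>

context posdef_matrix
begin

lemma mdp_rate_AC0: "h \<in> AC0 \<Longrightarrow> mdp_rate \<Sigma> h = enn2ereal (energy h {0..1})"
  by (simp add: mdp_rate_def energy_def qf_def)

lemma mdp_rate_le_iff: "h \<in> AC0 \<Longrightarrow> 0 \<le> b \<Longrightarrow> mdp_rate \<Sigma> h \<le> ereal b \<longleftrightarrow> energy h {0..1} \<le> ennreal b"
  by (simp add: mdp_rate_AC0 less_eq_ennreal.rep_eq enn2ereal_ennreal)

lemma mdp_rate_nonneg: "0 \<le> mdp_rate \<Sigma> h"
  by (cases "h \<in> AC0") (simp_all add: mdp_rate_AC0 mdp_rate_def)

lemma energy_family_real:
  fixes s t :: "nat \<Rightarrow> real"
  assumes h: "h \<in> AC0" and b: "mdp_rate \<Sigma> h \<le> ereal b"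
    and st: "\<forall>i<N. s i \<le> t i \<and> {s i..t i} \<subseteq> {0..1}"
    and disj: "pairwise (\<lambda>i j. {s i<..<t i} \<inter> {s j<..<t j} = {}) {..<N}"
  shows "(\<Sum>i<N. qf (h (t i) - h (s i)) / (2 * (t i - s i))) \<le> b"
proof -
  have b0: "0 \<le> b"
    using order_trans[OF mdp_rate_nonneg b] by simp
  have "ennreal (\<Sum>i<N. qf (h (t i) - h (s i)) / (2 * (t i - s i))) \<le> energy h {0..1}"
    using h by (intro energy_family[OF _ st disj]) (simp add: AC0_def)
  also have "\<dots> \<le> ennreal b"
    using b b0 h mdp_rate_le_iff by blast
  finally show ?thesis
    using b0 by (simp add: ennreal_le_iff)
qed

lemma energy_uniform_real:
  assumes h: "h \<in> AC0" and b: "mdp_rate \<Sigma> h \<le> ereal b" and K: "0 < (K::nat)"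
  shows "(\<Sum>j<K. real K / 2 * qf (h ((real j + 1) / real K) - h (real j / real K))) \<le> b"
proof -
  have "(\<Sum>j<K. qf (h ((real j + 1) / real K) - h (real j / real K)) / (2 * ((real j + 1) / real K - real j / real K))) \<le> b"
  proof (rule energy_family_real[OF h b])
    show "\<forall>j<K. real j / real K \<le> (real j + 1) / real K \<and> {real j / real K..(real j + 1) / real K} \<subseteq> {0..1}"
    proof (intro allI impI conjI)
      fix j assume "j < K"
      then have "(real j + 1) / real K \<le> 1"
        using K by (simp add: divide_le_eq_1)
      then show "{real j / real K..(real j + 1) / real K} \<subseteq> {0..1}"
        using K by (auto intro: order_trans[rotated])
      show "real j / real K \<le> (real j + 1) / real K"
        by (simp add: divide_right_mono)
    qed
    have "{real i / real K<..<(real i + 1) / real K} \<inter> {real j / real K<..<(real j + 1) / real K} = {}" if "i \<noteq> j" for i j :: nat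
    proof (rule ccontr)
      assume "\<not> ?thesis"
      then obtain x where "x \<in> {real i / real K<..<(real i + 1) / real K}" "x \<in> {real j / real K<..<(real j + 1) / real K}"
        by blast
      then have "real i < real j + 1" "real j < real i + 1"
        using K by (simp_all add: field_simps)
      with that show False by simp
    qed
    then show "pairwise (\<lambda>i j. {real i / real K<..<(real i + 1) / real K} \<inter> {real j / real K<..<(real j + 1) / real K} = {}) {..<K}"
      by (auto simp: pairwise_def)
  qed
  moreover have "2 * ((real j + 1) / real K - real j / real K) = 2 / K" for j
    by (simp add: diff_divide_distrib[symmetric])
  ultimately show ?thesis
    by (simp add: add.commute mult.commute)
qed

text \<open>A single interval in the energy bound gives Hoelder continuity of exponent 1/2,
  uniformly over the sublevel set, hence equicontinuity. Finite energy sums are continuous under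
  pointwise convergence, so both the general families, which force the limit into
  \<open>AC0\<close>, and the uniform partitions, which bound its rate, keep the bound
  \<open>b\<close>.\<close>

lemma compactin_mdp_rate: "compactin AC0_topology {h \<in> topspace AC0_topology. mdp_rate \<Sigma> h \<le> ereal b}"
  unfolding topspace_AC0 unfolding AC0_topology_eq AC0.compactin_sequentially
proof (intro conjI allI impI)
  show "{h \<in> AC0. mdp_rate \<Sigma> h \<le> ereal b} \<subseteq> AC0"
    by auto
  fix \<sigma> :: "nat \<Rightarrow> real \<Rightarrow> real ^ 'd"
  assume "range \<sigma> \<subseteq> {h \<in> AC0. mdp_rate \<Sigma> h \<le> ereal b}"
  then have \<sigma>: "\<sigma> n \<in> AC0" "mdp_rate \<Sigma> (\<sigma> n) \<le> ereal b" for n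
    by auto
  have b0: "0 \<le> b"
    using order_trans[OF mdp_rate_nonneg \<sigma>(2)] by simp
  obtain B where B: "0 < B" "\<And>v. (norm v)\<^sup>2 \<le> B * qf v"
    using qf_norm_bound by blast
  have hoelder: "(norm (\<sigma> n t - \<sigma> n s))\<^sup>2 \<le> 2 * B * b * \<bar>t - s\<bar>" if "s \<in> {0..1}" "t \<in> {0..1}" for n s t
  proof -
    have *: "(norm (\<sigma> n t - \<sigma> n s))\<^sup>2 \<le> 2 * B * b * (t - s)" if st: "0 \<le> s" "s \<le> t" "t \<le> 1" for s t
    proof (cases "s = t")
      case False
      have "(\<Sum>i<1::nat. qf (\<sigma> n t - \<sigma> n s) / (2 * (t - s))) \<le> b"
        using st by (intro energy_family_real[OF \<sigma>, of 1 "\<lambda>_. s" "\<lambda>_. t"]) (auto simp: pairwise_def)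
      then have "qf (\<sigma> n t - \<sigma> n s) \<le> b * (2 * (t - s))"
        using st False by (simp add: divide_le_eq)
      then have "B * qf (\<sigma> n t - \<sigma> n s) \<le> B * (b * (2 * (t - s)))"
        using B(1) by (intro mult_left_mono) auto
      then show ?thesis
        using B(2)[of "\<sigma> n t - \<sigma> n s"] by (simp add: algebra_simps)
    qed simp
    show ?thesis
      using *[of s t] *[of t s] that by (cases "s \<le> t") (auto simp: norm_minus_commute)
  qed
  have hoelder': "norm (\<sigma> n t - \<sigma> n s) \<le> sqrt (2 * B * b * \<bar>t - s\<bar>)" if "s \<in> {0..1}" "t \<in> {0..1}" for n s t
    using hoelder[OF that] by (rule real_le_rsqrt)
  obtain g k where g: "continuous_on {0..1} g" "strict_mono (k :: nat \<Rightarrow> nat)"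
    "\<And>e. 0 < e \<Longrightarrow> \<exists>N. \<forall>n x. n \<ge> N \<and> x \<in> {0..1} \<longrightarrow> norm (\<sigma> (k n) x - g x) < e"
  proof (rule Arzela_Ascoli[of "{0..1::real}" \<sigma> "sqrt (2 * B * b)"])
    show "norm (\<sigma> n x) \<le> sqrt (2 * B * b)" if x: "x \<in> {0..1}" for n x
    proof -
      have "norm (\<sigma> n x) \<le> sqrt (2 * B * b * x)"
        using hoelder'[of 0 x n] x \<sigma>(1)[of n] by (simp add: AC0_def)
      also have "\<dots> \<le> sqrt (2 * B * b)"
        using x B(1) b0 by (simp add: mult_left_le)
      finally show ?thesis .
    qed
    show "\<exists>d>0. \<forall>n y. y \<in> {0..1} \<and> norm (x - y) < d \<longrightarrow> norm (\<sigma> n x - \<sigma> n y) < e" if x: "x \<in> {0..1}" and e: "0 < e" for x e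
    \<comment> \<open>The added 1 covers the case \<open>b = 0\<close>.\<close>
    proof (intro exI[of _ "e\<^sup>2 / (2 * B * b + 1)"] conjI allI impI)
      have pos: "0 < 2 * B * b + 1"
        using B(1) b0 by (simp add: add_nonneg_pos)
      show "0 < e\<^sup>2 / (2 * B * b + 1)"
        using e pos by simp
      fix n y assume y: "y \<in> {0..1} \<and> norm (x - y) < e\<^sup>2 / (2 * B * b + 1)"
      have "(norm (\<sigma> n x - \<sigma> n y))\<^sup>2 \<le> 2 * B * b * \<bar>x - y\<bar>"
        using hoelder x y by blast
      also have "\<dots> \<le> (2 * B * b + 1) * \<bar>x - y\<bar>"
        by (simp add: distrib_right)
      also have "\<dots> < (2 * B * b + 1) * (e\<^sup>2 / (2 * B * b + 1))"
        using y pos by (intro mult_strict_left_mono) auto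
      also have "\<dots> = e\<^sup>2"
        using pos by simp
      finally show "norm (\<sigma> n x - \<sigma> n y) < e"
        using e by (simp add: power_less_imp_less_base)
    qed
    show "compact {0..1::real}"
      by simp
  qed (rule that)
  \<comment> \<open>The limit \<open>g\<close> is arbitrary outside the unit interval, whereas
    members of \<open>AC0\<close> are \<open>undefined\<close> there.\<close>
  define l where "l = restrict g {0..1}"
  have conv: "(\<lambda>n. \<sigma> (k n) x) \<longlonglongrightarrow> l x" if x: "x \<in> {0..1}" for x
    unfolding LIMSEQ_def dist_norm
  proof (intro allI impI)
    fix e :: real assume "0 < e"
    then show "\<exists>N. \<forall>n\<ge>N. norm (\<sigma> (k n) x - l x) < e"
      using g(3) x unfolding l_def by (metis restrict_apply')
  qed
  have fam: "(\<Sum>i<N. qf (l (t i) - l (s i)) / (2 * (t i - s i))) \<le> b"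
    if st: "\<forall>i<N. s i \<le> t i \<and> {s i..t i} \<subseteq> {0..1}" and disj: "pairwise (\<lambda>i j. {s i<..<t i} \<inter> {s j<..<t j} = {}) {..<N}"
    for N :: nat and s t
  proof (rule LIMSEQ_le_const2)
    have "(\<lambda>n. qf (\<sigma> (k n) (t i) - \<sigma> (k n) (s i))) \<longlonglongrightarrow> qf (l (t i) - l (s i))" if "i < N" for i
    proof (rule isCont_tendsto_compose[where g = qf])
      show "isCont qf (l (t i) - l (s i))"
        using continuous_qf[of UNIV] by (simp add: continuous_on_eq_continuous_at)
      show "(\<lambda>n. \<sigma> (k n) (t i) - \<sigma> (k n) (s i)) \<longlonglongrightarrow> l (t i) - l (s i)"
        using st that by (intro tendsto_diff conv) auto
    qed
    then show "(\<lambda>n. \<Sum>i<N. qf (\<sigma> (k n) (t i) - \<sigma> (k n) (s i)) / (2 * (t i - s i)))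
        \<longlonglongrightarrow> (\<Sum>i<N. qf (l (t i) - l (s i)) / (2 * (t i - s i)))"
      unfolding divide_inverse by (intro tendsto_sum tendsto_mult tendsto_const) auto
    show "\<exists>M. \<forall>n\<ge>M. (\<Sum>i<N. qf (\<sigma> (k n) (t i) - \<sigma> (k n) (s i)) / (2 * (t i - s i))) \<le> b"
      using energy_family_real[OF \<sigma> st disj] by blast
  qed
  have "l 0 = 0"
    using LIMSEQ_unique[OF conv[of 0]] \<sigma>(1) by (simp add: AC0_def)
  moreover have ACl: "absolutely_continuous_on {0..1} l"
    using fam by (rule absolutely_continuous_if_bounded_energy)
  ultimately have l: "l \<in> AC0"
    by (simp add: AC0_def l_def)
  have "energy l {0..1} \<le> ennreal b"
  proof (rule energy_le_uniform[OF ACl b0])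
    fix K :: nat assume K: "0 < K"
    show "(\<Sum>j<K. real K / 2 * qf (l ((real j + 1) / real K) - l (real j / real K))) \<le> b"
    proof (rule LIMSEQ_le_const2)
      have "(\<lambda>n. qf (\<sigma> (k n) ((real j + 1) / real K) - \<sigma> (k n) (real j / real K))) \<longlonglongrightarrow> qf (l ((real j + 1) / real K) - l (real j / real K))" if "j < K" for j
      proof (rule isCont_tendsto_compose[where g = qf])
        show "isCont qf (l ((real j + 1) / real K) - l (real j / real K))"
          using continuous_qf[of UNIV] by (simp add: continuous_on_eq_continuous_at)
        show "(\<lambda>n. \<sigma> (k n) ((real j + 1) / real K) - \<sigma> (k n) (real j / real K)) \<longlonglongrightarrow> l ((real j + 1) / real K) - l (real j / real K)"
          using that by (intro tendsto_diff conv) auto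
      qed
      then show "(\<lambda>n. \<Sum>j<K. real K / 2 * qf (\<sigma> (k n) ((real j + 1) / real K) - \<sigma> (k n) (real j / real K)))
          \<longlonglongrightarrow> (\<Sum>j<K. real K / 2 * qf (l ((real j + 1) / real K) - l (real j / real K)))"
        by (intro tendsto_sum tendsto_mult tendsto_const) auto
      show "\<exists>M. \<forall>n\<ge>M. (\<Sum>j<K. real K / 2 * qf (\<sigma> (k n) ((real j + 1) / real K) - \<sigma> (k n) (real j / real K))) \<le> b"
        using energy_uniform_real[OF \<sigma> K] by blast
    qed
  qed
  then have "l \<in> {h \<in> AC0. mdp_rate \<Sigma> h \<le> ereal b}"
    using l b0 mdp_rate_le_iff by blast
  moreover have "limitin AC0.mtopology (\<sigma> \<circ> k) l sequentially"
    unfolding AC0.limit_metric_sequentially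
  proof (intro conjI allI impI l)
    fix e :: real assume e: "0 < e"
    obtain N where N: "\<forall>n x. n \<ge> N \<and> x \<in> {0..1} \<longrightarrow> norm (\<sigma> (k n) x - g x) < e / 2"
      using g(3)[of "e / 2"] e by auto
    show "\<exists>N. \<forall>n\<ge>N. (\<sigma> \<circ> k) n \<in> AC0 \<and> mdist AC0_metric ((\<sigma> \<circ> k) n) l < e"
    proof (intro exI[of _ N] allI impI conjI)
      fix n assume "N \<le> n"
      then have "\<forall>t\<in>{0..1}. dist (\<sigma> (k n) t) (l t) \<le> e / 2"
        using N by (auto simp: l_def dist_norm intro: less_imp_le)
      then have "mdist AC0_metric (\<sigma> (k n)) l \<le> e / 2"
        using mdist_AC0[OF \<sigma>(1) l] by blast
      then show "mdist AC0_metric ((\<sigma> \<circ> k) n) l < e"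
        using e by simp
    qed (simp add: \<sigma>)
  qed
  ultimately show "\<exists>l r. l \<in> {h \<in> AC0. mdp_rate \<Sigma> h \<le> ereal b} \<and> strict_mono r \<and> limitin AC0.mtopology (\<sigma> \<circ> r) l sequentially"
    using g(2) by blast
qed

text \<open>Lower semicontinuity comes for free: compact sublevel sets are closed in a Hausdorff
  space, and the infinite levels are trivial.\<close>

lemma good_rate_function_mdp: "good_rate_function AC0_topology (mdp_rate \<Sigma>)"
  unfolding good_rate_function_def
proof (intro conjI ballI allI)
  show "0 \<le> mdp_rate \<Sigma> h" for h
    by (rule mdp_rate_nonneg)
  show "compactin AC0_topology {h \<in> topspace AC0_topology. mdp_rate \<Sigma> h \<le> ereal b}" for b
    by (rule compactin_mdp_rate)
  fix b :: ereal
  show "openin AC0_topology {h \<in> topspace AC0_topology. b < mdp_rate \<Sigma> h}"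
  proof (cases b)
    case (real r)
    have "Hausdorff_space (AC0_topology :: (real \<Rightarrow> real ^ 'd) topology)"
      unfolding AC0_topology_eq by (rule AC0.Hausdorff_space_mtopology)
    then have "closedin AC0_topology {h \<in> topspace AC0_topology. mdp_rate \<Sigma> h \<le> ereal r}"
      by (rule compactin_imp_closedin[OF _ compactin_mdp_rate])
    then have "openin AC0_topology (topspace AC0_topology - {h \<in> topspace AC0_topology. mdp_rate \<Sigma> h \<le> ereal r})"
      by (simp add: closedin_def)
    moreover have "topspace AC0_topology - {h \<in> topspace AC0_topology. mdp_rate \<Sigma> h \<le> ereal r} = {h \<in> topspace AC0_topology. b < mdp_rate \<Sigma> h}"
      using real by auto
    ultimately show ?thesis
      by simp
  next
    case MInf
    have "b < mdp_rate \<Sigma> h" for h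
      unfolding MInf using mdp_rate_nonneg[of h] by (metis less_le_trans ereal_less(6) MInfty_neq_ereal(1) ereal_infty_less(2) zero_ereal_def)
    then show ?thesis
      by simp
  qed simp
qed

end

section \<open>Piecewise linear interpolation\<close>

definition clamp01 :: "real \<Rightarrow> real" where
  "clamp01 x = max 0 (min 1 x)"

lemma clamp01_lipschitz: "\<bar>clamp01 x - clamp01 y\<bar> \<le> \<bar>x - y\<bar>"
  by (auto simp: clamp01_def max_def min_def abs_if)

text \<open>In this form the integer part is gone: the k-th step enters with a weight that is
  Lipschitz in \<open>t\<close>, so the Lipschitz continuity of the path can be read off.\<close>

lemma interpolated_path_clamp:
  assumes t: "t \<in> {0..1}"
  shows "interpolated_path Y b n t = (1 / b) *\<^sub>R (\<Sum>k=1..n. clamp01 (real n * t - (real k - 1)) *\<^sub>R Y k)"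
proof -
  define k0 where "k0 = nat \<lfloor>real n * t\<rfloor>"
  have k0: "real k0 = of_int \<lfloor>real n * t\<rfloor>" "real k0 \<le> real n * t" "real n * t < real k0 + 1"
    using t by (simp_all add: k0_def of_nat_nat)
  have nt: "real n * t \<le> n"
    using t by (simp add: mult_left_le)
  have kn: "k0 \<le> n"
    using k0(2) nt by linarith
  have 1: "clamp01 (real n * t - (real k - 1)) = 1" if "k \<in> {1..k0}" for k
    using that k0(2) by (auto simp: clamp01_def)
  have 2: "clamp01 (real n * t - (real k - 1)) = 0" if "k \<in> {k0 + 2..n}" for k
    using that k0(3) by (auto simp: clamp01_def)
  have "(\<Sum>k=1..n. clamp01 (real n * t - (real k - 1)) *\<^sub>R Y k) = (\<Sum>k=1..k0. Y k) + (real n * t - k0) *\<^sub>R Y (k0 + 1)"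
  proof (cases "k0 = n")
    case True
    then have "real n * t = k0"
      using nt k0(2) by simp
    then show ?thesis
      using 1 True by simp
  next
    case False
    then have "k0 < n" using kn by simp
    then have split: "{1..n} = {1..k0} \<union> {k0 + 1} \<union> {k0 + 2..n}"
      by auto
    have "(\<Sum>k=1..n. clamp01 (real n * t - (real k - 1)) *\<^sub>R Y k) = (\<Sum>k=1..k0. clamp01 (real n * t - (real k - 1)) *\<^sub>R Y k)
        + clamp01 (real n * t - (real (k0 + 1) - 1)) *\<^sub>R Y (k0 + 1) + (\<Sum>k=k0 + 2..n. clamp01 (real n * t - (real k - 1)) *\<^sub>R Y k)"
      unfolding split by (subst sum.union_disjoint, simp, simp, fastforce)+ simp
    moreover have "clamp01 (real n * t - (real (k0 + 1) - 1)) = real n * t - k0"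
      using k0(2,3) by (simp add: clamp01_def)
    ultimately show ?thesis
      using 1 2 by simp
  qed
  then show ?thesis
    using t by (simp add: interpolated_path_def k0_def[symmetric] k0(1)[symmetric] scaleR_add_right)
qed

lemma interpolated_path_AC0: "interpolated_path (Y :: nat \<Rightarrow> 'a::euclidean_space) b n \<in> AC0"
proof -
  have "interpolated_path Y b n 0 = 0"
    by (simp add: interpolated_path_def)
  moreover have "interpolated_path Y b n \<in> extensional {0..1}"
    by (simp add: interpolated_path_def)
  moreover have "absolutely_continuous_on {0..1} (interpolated_path Y b n)"
  proof (rule lipschitz_imp_absolutely_continuous_on)
    fix s t :: real assume st: "s \<in> {0..1}" "t \<in> {0..1}"
    let ?c = "\<lambda>t k. clamp01 (real n * t - (real k - 1))"
    have "interpolated_path Y b n t - interpolated_path Y b n s = (1 / b) *\<^sub>R (\<Sum>k=1..n. (?c t k - ?c s k) *\<^sub>R Y k)"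
      by (simp only: interpolated_path_clamp[OF st(1)] interpolated_path_clamp[OF st(2)] scaleR_diff_left sum_subtractf scaleR_diff_right)
    then have eq: "norm (interpolated_path Y b n t - interpolated_path Y b n s) = \<bar>1 / b\<bar> * norm (\<Sum>k=1..n. (?c t k - ?c s k) *\<^sub>R Y k)"
      by simp
    have "norm (\<Sum>k=1..n. (?c t k - ?c s k) *\<^sub>R Y k) \<le> (\<Sum>k=1..n. (n * \<bar>t - s\<bar>) * norm (Y k))"
    proof (rule sum_norm_le)
      fix k
      have "\<bar>?c t k - ?c s k\<bar> \<le> n * \<bar>t - s\<bar>"
        using clamp01_lipschitz[of "real n * t - (real k - 1)" "real n * s - (real k - 1)"]
        by (simp add: right_diff_distrib[symmetric] abs_mult)
      then show "norm ((?c t k - ?c s k) *\<^sub>R Y k) \<le> (n * \<bar>t - s\<bar>) * norm (Y k)"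
        by (simp add: mult_right_mono)
    qed
    then have "\<bar>1 / b\<bar> * norm (\<Sum>k=1..n. (?c t k - ?c s k) *\<^sub>R Y k) \<le> \<bar>1 / b\<bar> * (\<Sum>k=1..n. (n * \<bar>t - s\<bar>) * norm (Y k))"
      by (rule mult_left_mono) simp
    also have "\<dots> = (\<bar>1 / b\<bar> * n * (\<Sum>k=1..n. norm (Y k))) * \<bar>t - s\<bar>"
      by (simp add: sum_distrib_left sum_distrib_right mult_ac)
    finally show "norm (interpolated_path Y b n t - interpolated_path Y b n s) \<le> (\<bar>1 / b\<bar> * n * (\<Sum>k=1..n. norm (Y k))) * \<bar>t - s\<bar>"
      unfolding eq .
  qed
  ultimately show ?thesis
    by (simp add: AC0_def)
qed

text \<open>Off the grid points the polygon has slope \<open>real K *\<^sub>R Y (j + 1)\<close> on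
  the j-th cell. The quadratic functional of the block sums is thereby compared with the rate of a
  genuine element of \<open>AC0\<close>.\<close>

lemma (in posdef_matrix) mdp_rate_interpolated_path:
  assumes K: "0 < K"
  shows "mdp_rate \<Sigma> (interpolated_path Y 1 K) \<le> ereal (\<Sum>j<K. real K / 2 * qf (Y (j + 1)))"
proof -
  let ?h = "interpolated_path Y 1 K"
  have der: "vector_derivative ?h (at x) = real K *\<^sub>R Y (j + 1)" if j: "j < K" and x: "x \<in> {real j / real K<..<(real j + 1) / real K}" for j x
  proof -
    have "((\<lambda>t. (\<Sum>k=1..j. Y k) + (real K * t - j) *\<^sub>R Y (j + 1)) has_vector_derivative (real K *\<^sub>R Y (j + 1))) (at x)"
      by (auto intro!: derivative_eq_intros simp: has_vector_derivative_def)
    moreover have "?h t = (\<Sum>k=1..j. Y k) + (real K * t - j) *\<^sub>R Y (j + 1)" if t: "t \<in> {real j / real K<..<(real j + 1) / real K}" for t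
    proof -
      have *: "real j < real K * t" "real K * t < real j + 1"
        using t K by (simp_all add: field_simps)
      then have fl: "\<lfloor>real K * t\<rfloor> = int j"
        by linarith
      have "real j + 1 \<le> K"
        using j by simp
      then have "real K * t < K"
        using *(2) by linarith
      then have "t < 1" "0 < t"
        using K * by (simp, metis less_le_trans of_nat_0_le_iff le_less_trans zero_less_mult_iff not_less of_nat_less_0_iff)
      then show ?thesis
        by (simp add: interpolated_path_def fl)
    qed
    ultimately have "(?h has_vector_derivative (real K *\<^sub>R Y (j + 1))) (at x)"
      by (metis (no_types, lifting) has_vector_derivative_transform_within_open open_greaterThanLessThan x)
    then show ?thesis
      by (rule vector_derivative_at)
  qed
  define c where "c = (\<lambda>j. qf (real K *\<^sub>R Y (j + 1)) / 2)"
  have "(\<lambda>j. real j / real K) ` {..K} \<in> null_sets lebesgue"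
    by (intro null_sets_completionI finite_imp_null_set_lborel) auto
  then have "AE x in lebesgue. x \<notin> (\<lambda>j. real j / real K) ` {..K}"
    by (rule AE_not_in)
  then have "energy ?h {0..1} \<le> (\<integral>\<^sup>+x. (\<Sum>j<K. ennreal (c j) * indicator {real j / real K<..<(real j + 1) / real K} x) \<partial>lebesgue)"
    unfolding energy_def
  proof (intro nn_integral_mono_AE, elim eventually_mono)
    fix x assume x: "x \<notin> (\<lambda>j. real j / real K) ` {..K}"
    show "ennreal (qf (vector_derivative ?h (at x)) / 2) * indicator {0..1} x \<le> (\<Sum>j<K. ennreal (c j) * indicator {real j / real K<..<(real j + 1) / real K} x)"
    proof (cases "x \<in> {0..1}")
      case True
      define j where "j = nat \<lfloor>real K * x\<rfloor>"
      have j: "real j \<le> real K * x" "real K * x < real j + 1"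
        using True by (simp_all add: j_def of_nat_nat)
      have neq: "real K * x \<noteq> real i" if "i \<le> K" for i
      proof
        assume "real K * x = real i"
        then have "x = real i / real K"
          using K by (simp add: field_simps)
        with x that show False by auto
      qed
      have "real K * x \<le> K"
        using True by (simp add: mult_left_le)
      then have jK: "j < K"
        using j neq[of K] by linarith
      then have xj: "x \<in> {real j / real K<..<(real j + 1) / real K}"
        using j neq[of j] K by (auto simp: field_simps)
      then have "ennreal (qf (vector_derivative ?h (at x)) / 2) * indicator {0..1} x = ennreal (c j) * indicator {real j / real K<..<(real j + 1) / real K} x"
        using True der[OF jK xj] by (simp add: c_def)
      also have "\<dots> \<le> (\<Sum>j<K. ennreal (c j) * indicator {real j / real K<..<(real j + 1) / real K} x)"
        using jK by (intro member_le_sum[where f = "\<lambda>j. ennreal (c j) * indicator {real j / real K<..<(real j + 1) / real K} x"]) auto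
      finally show ?thesis .
    qed simp
  qed
  also have "\<dots> = (\<Sum>j<K. \<integral>\<^sup>+x. ennreal (c j) * indicator {real j / real K<..<(real j + 1) / real K} x \<partial>lebesgue)"
    by (intro nn_integral_sum) (auto intro!: borel_measurable_times_ennreal borel_measurable_indicator)
  also have "\<dots> = (\<Sum>j<K. ennreal (c j) * ennreal (1 / K))"
    by (intro sum.cong refl) (subst nn_integral_cmult_indicator, auto simp: divide_right_mono diff_divide_distrib[symmetric])
  also have "\<dots> = (\<Sum>j<K. ennreal (real K / 2 * qf (Y (j + 1))))"
    using K qf_nonneg by (intro sum.cong refl) (subst ennreal_mult[symmetric], auto simp: c_def qf_scale power2_eq_square)
  also have "\<dots> = ennreal (\<Sum>j<K. real K / 2 * qf (Y (j + 1)))"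
    using qf_nonneg by (intro sum_ennreal) auto
  finally show ?thesis
    using qf_nonneg by (subst mdp_rate_le_iff[OF interpolated_path_AC0]) (auto intro!: sum_nonneg)
qed

section \<open>Random walks on a finite graph\<close>

locale finite_walk =
  fixes X0 :: "('x0::finite, 'e0::finite) ograph" and p :: "'e0 \<Rightarrow> real" and m :: "'x0 \<Rightarrow> real"
  assumes connected: "connected_graph X0" and transition: "transition_probability X0 p"
    and invariant: "normalized_invariant_measure X0 p m"
begin

lemma p_pos: "0 < p e" and p_nonneg: "0 \<le> p e" and p_sum: "(\<Sum>e | org X0 e = y. p e) = 1"
  using transition by (auto simp: transition_probability_def less_imp_le)

lemma m_pos: "0 < m y" and m_sum: "(\<Sum>y\<in>UNIV. m y) = 1"
  and m_inv: "(\<Sum>e | ter X0 e = y. p e * m (org X0 e)) = m y"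
  using invariant unfolding normalized_invariant_measure_def by metis+

lemma sum_org: "(\<Sum>y\<in>UNIV. \<Sum>e | org X0 e = y. f e) = (\<Sum>e\<in>UNIV. f e)"
  using sum.group[of UNIV UNIV "org X0" f] by simp

lemma sum_ter: "(\<Sum>y\<in>UNIV. \<Sum>e | ter X0 e = y. f e) = (\<Sum>e\<in>UNIV. f e)"
  using sum.group[of UNIV UNIV "ter X0" f] by simp

lemma stationary:
  "(\<Sum>y\<in>UNIV. m y * (\<Sum>e | org X0 e = y. p e * g (ter X0 e))) = (\<Sum>y\<in>UNIV. m y * g y)"
proof -
  have "(\<Sum>y\<in>UNIV. m y * (\<Sum>e | org X0 e = y. p e * g (ter X0 e))) =
      (\<Sum>y\<in>UNIV. \<Sum>e | org X0 e = y. p e * m (org X0 e) * g (ter X0 e))"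
    by (intro sum.cong refl) (simp add: sum_distrib_left mult_ac)
  also have "\<dots> = (\<Sum>y\<in>UNIV. \<Sum>e | ter X0 e = y. p e * m (org X0 e) * g (ter X0 e))"
    by (simp only: sum_org sum_ter)
  also have "\<dots> = (\<Sum>y\<in>UNIV. \<Sum>e | ter X0 e = y. p e * m (org X0 e) * g y)"
    by (intro sum.cong refl) auto
  also have "\<dots> = (\<Sum>y\<in>UNIV. m y * g y)"
    by (simp only: sum_distrib_right[symmetric] m_inv)
  finally show ?thesis .
qed

text \<open>Maximum principle: as every edge has positive weight, a vertex where the maximum is
  attained passes it on to all its neighbours, and the graph is connected.\<close>

lemma harmonic_constant:
  assumes "\<And>y. g y = (\<Sum>e | org X0 e = y. p e * g (ter X0 e))"
  shows "g y = (g z :: real)"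
proof -
  define M where "M = Max (range g)"
  have le: "g y \<le> M" for y
    unfolding M_def by (rule Max_ge) auto
  have "M \<in> range g"
    unfolding M_def by (rule Max_in) auto
  then obtain y0 where y0: "g y0 = M"
    by auto
  have step: "g (ter X0 e) = M" if e: "g (org X0 e) = M" for e
  proof -
    have "(\<Sum>f | org X0 f = org X0 e. p f * (M - g (ter X0 f))) = 0"
      using assms[of "org X0 e"] e p_sum[of "org X0 e"]
      by (simp add: right_diff_distrib sum_subtractf sum_distrib_right[symmetric])
    then have "\<forall>f\<in>{f. org X0 f = org X0 e}. p f * (M - g (ter X0 f)) = 0"
      using le p_nonneg by (subst (asm) sum_nonneg_eq_0_iff) auto
    then show ?thesis
      using p_pos[of e] by auto
  qed
  have path: "edge_path X0 y es z \<Longrightarrow> g y = M \<Longrightarrow> g z = M" for y es z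
    by (induction es arbitrary: y) (auto simp: step)
  show ?thesis
    using connected path y0 unfolding connected_graph_def by metis
qed

text \<open>Adding the \<open>m\<close>-mean turns \<open>g - P g\<close> into an injective, hence surjective, operator; applying
  \<open>m\<close> to the equation shows that the added term vanishes for centred right-hand sides.\<close>

lemma poisson_equation:
  assumes b: "(\<Sum>y\<in>UNIV. m y * b y) = 0"
  shows "\<exists>g. \<forall>y. g y - (\<Sum>e | org X0 e = y. p e * g (ter X0 e)) = (b y :: real)"
proof -
  define T where "T = (\<lambda>g :: real ^ 'x0. (\<chi> y. g $ y - (\<Sum>e | org X0 e = y. p e * g $ ter X0 e) + (\<Sum>z\<in>UNIV. m z * g $ z)))"
  have lin: "linear T"
    by (rule linearI) (simp_all add: T_def vec_eq_iff distrib_left sum.distrib sum_distrib_left algebra_simps)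
  have T: "T g $ y = g $ y - (\<Sum>e | org X0 e = y. p e * g $ ter X0 e) + (\<Sum>z\<in>UNIV. m z * g $ z)" for g y
    by (simp only: T_def vec_lambda_beta)
  have mean: "(\<Sum>y\<in>UNIV. m y * T g $ y) = (\<Sum>z\<in>UNIV. m z * g $ z)" for g
  proof -
    have "(\<Sum>y\<in>UNIV. m y * T g $ y) = (\<Sum>y\<in>UNIV. m y * g $ y) - (\<Sum>y\<in>UNIV. m y * (\<Sum>e | org X0 e = y. p e * g $ ter X0 e))
       + (\<Sum>y\<in>UNIV. m y) * (\<Sum>z\<in>UNIV. m z * g $ z)"
      by (simp only: T distrib_left right_diff_distrib sum.distrib sum_subtractf sum_distrib_right)
    then show ?thesis
      using stationary[of "\<lambda>y. g $ y"] m_sum by simp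
  qed
  have "inj T"
    unfolding linear_injective_0[OF lin]
  proof (intro allI impI)
    fix g assume g: "T g = 0"
    then have m0: "(\<Sum>z\<in>UNIV. m z * g $ z) = 0"
      using mean[of g] by simp
    have "g $ y = (\<Sum>e | org X0 e = y. p e * g $ ter X0 e)" for y
      using T[of g y] m0 unfolding g by simp
    then have const: "g $ y = g $ z" for y z
      by (rule harmonic_constant)
    have "g $ y = 0" for y
    proof -
      have "(\<Sum>z\<in>UNIV. m z * g $ z) = (\<Sum>z\<in>UNIV. m z * g $ y)"
        by (intro sum.cong refl) (use const in metis)
      then show ?thesis
        using m0 m_sum by (simp add: sum_distrib_right[symmetric])
    qed
    then show "g = 0"
      by (simp add: vec_eq_iff)
  qed
  then have "surj T"
    by (intro linear_injective_imp_surjective[OF lin]) auto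
  then obtain g where g: "T g = (\<chi> y. b y)"
    by (metis surjD)
  have "(\<Sum>z\<in>UNIV. m z * g $ z) = 0"
    using mean[of g] b by (simp add: g)
  then show ?thesis
    using T[of g] unfolding g by (intro exI[of _ "\<lambda>y. g $ y"]) simp
qed

text \<open>Expectation of a functional of the first \<open>n\<close> edges for the walk started at
  \<open>y\<close>, by conditioning on the first step. Being a finite sum it needs no
  measurability.\<close>

primrec expect :: "nat \<Rightarrow> 'x0 \<Rightarrow> ('e0 list \<Rightarrow> real) \<Rightarrow> real" where
  "expect 0 y F = F []"
| "expect (Suc n) y F = (\<Sum>e | org X0 e = y. p e * expect n (ter X0 e) (\<lambda>es. F (e # es)))"

primrec endpt :: "'x0 \<Rightarrow> 'e0 list \<Rightarrow> 'x0" where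
  "endpt y [] = y"
| "endpt y (e # es) = endpt (ter X0 e) es"

text \<open>Only lists that are edge paths from \<open>y\<close> carry weight. This matters wherever
  a coboundary has to telescope along the list.\<close>

lemma expect_mono_path:
  "(\<And>es z. length es = n \<Longrightarrow> edge_path X0 y es z \<Longrightarrow> F es \<le> G es) \<Longrightarrow> expect n y F \<le> expect n y G"
proof (induction n arbitrary: y F G)
  case 0
  show ?case
    using "0.prems"[of "[]" y] by simp
next
  case (Suc n)
  show ?case
    unfolding expect.simps
  proof (intro sum_mono mult_left_mono p_nonneg)
    fix e assume e: "e \<in> {e. org X0 e = y}"
    show "expect n (ter X0 e) (\<lambda>es. F (e # es)) \<le> expect n (ter X0 e) (\<lambda>es. G (e # es))"
    proof (rule Suc.IH)
      fix es z assume "length es = n" "edge_path X0 (ter X0 e) es z"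
      then show "F (e # es) \<le> G (e # es)"
        using e by (intro Suc.prems[of "e # es" z]) auto
    qed
  qed
qed

lemma expect_mono: "(\<And>es. length es = n \<Longrightarrow> F es \<le> G es) \<Longrightarrow> expect n y F \<le> expect n y G"
  by (rule expect_mono_path)

lemma expect_cong_path:
  "(\<And>es z. length es = n \<Longrightarrow> edge_path X0 y es z \<Longrightarrow> F es = G es) \<Longrightarrow> expect n y F = expect n y G"
  by (intro antisym expect_mono_path) (auto simp: order.refl)

lemma expect_cong: "(\<And>es. length es = n \<Longrightarrow> F es = G es) \<Longrightarrow> expect n y F = expect n y G"
  by (rule expect_cong_path)

lemma expect_const: "expect n y (\<lambda>_. c) = c"
  by (induction n arbitrary: y) (simp_all add: sum_distrib_right[symmetric] p_sum)

lemma expect_add: "expect n y (\<lambda>es. F es + G es) = expect n y F + expect n y G"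
  by (induction n arbitrary: y F G) (simp_all add: distrib_left sum.distrib)

lemma expect_cmult: "expect n y (\<lambda>es. c * F es) = c * expect n y F"
  by (induction n arbitrary: y F) (simp_all add: sum_distrib_left mult_ac)

lemma expect_sum: "finite I \<Longrightarrow> expect n y (\<lambda>es. \<Sum>i\<in>I. F i es) = (\<Sum>i\<in>I. expect n y (F i))"
  by (induction I rule: finite_induct) (simp_all add: expect_const expect_add)

lemma expect_nonneg: "(\<And>es. length es = n \<Longrightarrow> 0 \<le> F es) \<Longrightarrow> 0 \<le> expect n y F"
  using expect_mono[of n "\<lambda>_. 0" F y] by (simp add: expect_const)

text \<open>The Markov property at time \<open>j\<close>.\<close>

lemma expect_append: "expect (j + k) y F = expect j y (\<lambda>es. expect k (endpt y es) (\<lambda>fs. F (es @ fs)))"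
  by (induction j arbitrary: y F) simp_all

lemma expect_take:
  assumes "k \<le> n"
  shows "expect n y (\<lambda>es. F (take k es)) = expect k y F"
proof -
  have "expect (k + (n - k)) y (\<lambda>es. F (take k es)) = expect k y (\<lambda>es. expect (n - k) (endpt y es) (\<lambda>fs. F es))"
    unfolding expect_append by (rule expect_cong) simp
  then show ?thesis
    using assms by (simp add: expect_const)
qed

definition block :: "nat \<Rightarrow> nat \<Rightarrow> 'e0 list \<Rightarrow> 'e0 list" where
  "block N j es = take N (drop (j * N) es)"

lemma block_append:
  assumes "length es = k * N" "length fs = N"
  shows "j < k \<Longrightarrow> block N j (es @ fs) = block N j es" "block N k (es @ fs) = fs"
proof -
  assume "j < k"
  then have "Suc j * N \<le> k * N"
    by (intro mult_le_mono) auto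
  then show "block N j (es @ fs) = block N j es"
    using assms by (simp add: block_def)
qed (use assms in \<open>simp add: block_def\<close>)

text \<open>Given the first \<open>k\<close> blocks, the next one starts at the vertex they end in.
  Since the bounds hold from every vertex, the factors can be peeled off one by one although the
  blocks are not independent.\<close>

lemma expect_blocks:
  assumes F: "\<And>j es. 0 \<le> F j es"
  shows "(\<And>j y. j < k \<Longrightarrow> expect N y (F j) \<le> u j) \<Longrightarrow> expect (k * N) y (\<lambda>es. \<Prod>j<k. F j (block N j es)) \<le> (\<Prod>j<k. u j)"
    and "(\<And>j y. j < k \<Longrightarrow> 0 \<le> l j \<and> l j \<le> expect N y (F j)) \<Longrightarrow> (\<Prod>j<k. l j) \<le> expect (k * N) y (\<lambda>es. \<Prod>j<k. F j (block N j es))"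
proof -
  have step: "expect (Suc k * N) y (\<lambda>es. \<Prod>j<Suc k. F j (block N j es)) =
      expect (k * N) y (\<lambda>es. expect N (endpt y es) (F k) * (\<Prod>j<k. F j (block N j es)))" for k y
  proof -
    have *: "(\<Prod>j<k. F j (block N j (es @ fs))) = (\<Prod>j<k. F j (block N j es))"
      if "length es = k * N" "length fs = N" for es fs
      using block_append(1)[OF that] by (intro prod.cong) auto
    have "expect (Suc k * N) y (\<lambda>es. \<Prod>j<Suc k. F j (block N j es)) = expect (k * N + N) y (\<lambda>es. \<Prod>j<Suc k. F j (block N j es))"
      by (simp add: add.commute)
    also have "\<dots> = expect (k * N) y (\<lambda>es. expect N (endpt y es) (\<lambda>fs. (\<Prod>j<k. F j (block N j es)) * F k fs))"
      unfolding expect_append by (intro expect_cong) (simp add: block_append(2) *)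
    finally show ?thesis
      by (simp only: expect_cmult mult.commute[of _ "expect N _ (F k)"])
  qed
  show "(\<And>j y. j < k \<Longrightarrow> expect N y (F j) \<le> u j) \<Longrightarrow> expect (k * N) y (\<lambda>es. \<Prod>j<k. F j (block N j es)) \<le> (\<Prod>j<k. u j)"
  proof (induction k)
    case (Suc k)
    have "0 \<le> u k"
      using expect_nonneg[of N "F k" y] F Suc.prems[of k y] by fastforce
    have "expect (Suc k * N) y (\<lambda>es. \<Prod>j<Suc k. F j (block N j es)) \<le> expect (k * N) y (\<lambda>es. u k * (\<Prod>j<k. F j (block N j es)))"
      unfolding step using Suc.prems F by (intro expect_mono mult_right_mono prod_nonneg) auto
    also have "\<dots> = u k * expect (k * N) y (\<lambda>es. \<Prod>j<k. F j (block N j es))"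
      by (rule expect_cmult)
    also have "\<dots> \<le> u k * (\<Prod>j<k. u j)"
      using Suc.prems by (intro mult_left_mono Suc.IH \<open>0 \<le> u k\<close>) auto
    finally show ?case
      by (simp add: mult.commute)
  qed simp
  show "(\<And>j y. j < k \<Longrightarrow> 0 \<le> l j \<and> l j \<le> expect N y (F j)) \<Longrightarrow> (\<Prod>j<k. l j) \<le> expect (k * N) y (\<lambda>es. \<Prod>j<k. F j (block N j es))"
  proof (induction k)
    case (Suc k)
    have "l k * (\<Prod>j<k. l j) \<le> l k * expect (k * N) y (\<lambda>es. \<Prod>j<k. F j (block N j es))"
      using Suc.prems by (intro mult_left_mono Suc.IH) auto
    also have "\<dots> = expect (k * N) y (\<lambda>es. l k * (\<Prod>j<k. F j (block N j es)))"
      by (rule expect_cmult[symmetric])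
    also have "\<dots> \<le> expect (Suc k * N) y (\<lambda>es. \<Prod>j<Suc k. F j (block N j es))"
      unfolding step using Suc.prems F by (intro expect_mono mult_right_mono prod_nonneg) auto
    finally show ?case
      by (simp add: mult.commute)
  qed simp
qed

lemma expect_block_le:
  assumes "Suc j * N \<le> n" "\<And>z. expect N z F \<le> u"
  shows "expect n y (\<lambda>es. F (block N j es)) \<le> u"
proof -
  have "expect n y (\<lambda>es. F (block N j es)) = expect (Suc j * N) y (\<lambda>es. F (drop (j * N) es))"
  proof -
    have "block N j es = drop (j * N) (take (Suc j * N) es)" for es
      by (simp only: block_def take_drop mult_Suc)
    then show ?thesis
      using expect_take[OF assms(1), where F = "\<lambda>es. F (drop (j * N) es)"] by (simp only:)
  qed
  also have "\<dots> = expect (j * N + N) y (\<lambda>es. F (drop (j * N) es))"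
    by (simp add: add.commute)
  also have "\<dots> = expect (j * N) y (\<lambda>es. expect N (endpt y es) F)"
    unfolding expect_append by (intro expect_cong) simp
  also have "\<dots> \<le> expect (j * N) y (\<lambda>_. u)"
    using assms(2) by (intro expect_mono)
  finally show ?thesis
    by (simp add: expect_const)
qed

end

section \<open>Martingale increments and their Laplace transforms\<close>

locale martingale_walk = finite_walk X0 p m
  for X0 :: "('x0::finite, 'e0::finite) ograph" and p m +
  fixes D :: "'e0 \<Rightarrow> real ^ 'd::finite"
  assumes martingale: "\<And>y. (\<Sum>e | org X0 e = y. p e *\<^sub>R D e) = 0"
begin

definition sumD :: "'e0 list \<Rightarrow> real ^ 'd" where
  "sumD es = (\<Sum>e\<leftarrow>es. D e)"

lemma sumD_simps [simp]: "sumD [] = 0" "sumD (e # es) = D e + sumD es" "sumD (es @ fs) = sumD es + sumD fs"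
  by (simp_all add: sumD_def)

text \<open>The stationary covariance as a bilinear form. It stays free of matrices until it is
  identified with the Albanese matrix.\<close>

definition cov :: "real ^ 'd \<Rightarrow> real ^ 'd \<Rightarrow> real" where
  "cov \<theta> \<phi> = (\<Sum>e\<in>UNIV. p e * m (org X0 e) * ((\<theta> \<bullet> D e) * (\<phi> \<bullet> D e)))"

lemma cov_commute: "cov \<theta> \<phi> = cov \<phi> \<theta>"
  by (simp add: cov_def mult_ac)

lemma cov_add_left: "cov (\<theta> + \<theta>') \<phi> = cov \<theta> \<phi> + cov \<theta>' \<phi>"
  by (simp add: cov_def inner_add_left algebra_simps sum.distrib)

lemma cov_scale_left: "cov (c *\<^sub>R \<theta>) \<phi> = c * cov \<theta> \<phi>"
  by (simp add: cov_def sum_distrib_left mult_ac)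

lemma cov_add_right: "cov \<phi> (\<theta> + \<theta>') = cov \<phi> \<theta> + cov \<phi> \<theta>'"
  and cov_scale_right: "cov \<phi> (c *\<^sub>R \<theta>) = c * cov \<phi> \<theta>"
  by (simp_all add: cov_commute[of \<phi>] cov_add_left cov_scale_left)

lemma cov_nonneg: "0 \<le> cov \<theta> \<theta>"
  unfolding cov_def by (intro sum_nonneg mult_nonneg_nonneg[OF mult_nonneg_nonneg[OF p_nonneg less_imp_le[OF m_pos]] zero_le_square])

lemma inner_martingale: "(\<Sum>e | org X0 e = y. p e * (\<theta> \<bullet> D e)) = 0"
proof -
  have "(\<Sum>e | org X0 e = y. p e * (\<theta> \<bullet> D e)) = \<theta> \<bullet> (\<Sum>e | org X0 e = y. p e *\<^sub>R D e)"
    by (simp add: inner_sum_right)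
  then show ?thesis
    by (simp add: martingale)
qed

lemma expect_sumD: "expect n y (\<lambda>es. \<theta> \<bullet> sumD es) = 0"
  by (induction n arbitrary: y) (simp_all add: inner_add_right expect_add expect_const distrib_left sum.distrib inner_martingale)

lemma exp_second_order: "((\<lambda>\<epsilon>::real. (exp (\<epsilon> * A + \<epsilon>\<^sup>2 * B) - 1 - \<epsilon> * A) / \<epsilon>\<^sup>2) \<longlongrightarrow> B + A\<^sup>2 / 2) (at_right 0)"
proof -
  \<comment> \<open>The continuous extension to 0 avoids dividing by a \<open>z\<close> that may
    vanish for small \<epsilon>.\<close>
  define \<phi> where "\<phi> = (\<lambda>z::real. if z = 0 then 1 / 2 else (exp z - 1 - z) / z\<^sup>2)"
  have "((\<lambda>z::real. (exp z - 1 - z) / z\<^sup>2) \<longlongrightarrow> 1 / 2) (at 0)"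
    by real_asymp
  then have "(\<phi> \<longlongrightarrow> 1 / 2) (at 0)"
    by (rule Lim_transform_eventually) (auto simp: \<phi>_def eventually_at_filter)
  moreover have "\<phi> 0 = 1 / 2"
    by (simp add: \<phi>_def)
  ultimately have "isCont \<phi> 0"
    by (simp only: isCont_def)
  moreover have "((\<lambda>\<epsilon>::real. \<epsilon> * A + \<epsilon>\<^sup>2 * B) \<longlongrightarrow> 0) (at_right 0)"
    by (auto intro!: tendsto_eq_intros)
  ultimately have "((\<lambda>\<epsilon>. \<phi> (\<epsilon> * A + \<epsilon>\<^sup>2 * B)) \<longlongrightarrow> \<phi> 0) (at_right 0)"
    by (rule isCont_tendsto_compose)
  then have "((\<lambda>\<epsilon>. B + (A + \<epsilon> * B)\<^sup>2 * \<phi> (\<epsilon> * A + \<epsilon>\<^sup>2 * B)) \<longlongrightarrow> B + (A + 0 * B)\<^sup>2 * \<phi> 0) (at_right 0)"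
    by (intro tendsto_intros)
  moreover have "\<forall>\<^sub>F \<epsilon> in at_right 0. B + (A + \<epsilon> * B)\<^sup>2 * \<phi> (\<epsilon> * A + \<epsilon>\<^sup>2 * B) = (exp (\<epsilon> * A + \<epsilon>\<^sup>2 * B) - 1 - \<epsilon> * A) / \<epsilon>\<^sup>2"
    using eventually_at_right_less[of "0::real"]
  proof eventually_elim
    case (elim \<epsilon>)
    define z where "z = \<epsilon> * A + \<epsilon>\<^sup>2 * B"
    have "exp z - 1 - z = z\<^sup>2 * \<phi> z"
      by (simp add: \<phi>_def)
    moreover have "z\<^sup>2 = \<epsilon>\<^sup>2 * (A + \<epsilon> * B)\<^sup>2"
      by (simp add: z_def power2_eq_square algebra_simps)
    ultimately have "exp z - 1 - \<epsilon> * A = \<epsilon>\<^sup>2 * (B + (A + \<epsilon> * B)\<^sup>2 * \<phi> z)"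
      by (simp add: z_def algebra_simps)
    then show ?case
      using elim by (simp add: z_def)
  qed
  ultimately show ?thesis
    by (simp add: \<phi>_def tendsto_cong)
qed

lemma exp_first_order: "((\<lambda>\<epsilon>::real. (exp (\<epsilon>\<^sup>2 * B) - 1) / \<epsilon>\<^sup>2) \<longlongrightarrow> B) (at_right 0)"
  using exp_second_order[of 0 B] by simp

text \<open>The corrector \<open>g\<close> solves \<open>g - P g = b - cov \<theta> \<theta> / 2\<close>, where \<open>b\<close> is half the conditional
  variance of an increment, and absorbs the dependence on the current vertex to second order.\<close>

lemma laplace_step:
  obtains g where "\<And>\<eta>. 0 < \<eta> \<Longrightarrow> \<forall>\<^sub>F \<epsilon> in at_right 0. \<forall>y.
     (\<Sum>e | org X0 e = y. p e * exp (\<epsilon> * (\<theta> \<bullet> D e) + \<epsilon>\<^sup>2 * g (ter X0 e))) \<le> exp (\<epsilon>\<^sup>2 * (cov \<theta> \<theta> / 2 + g y + \<eta>)) \<and>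
     exp (\<epsilon>\<^sup>2 * (cov \<theta> \<theta> / 2 + g y - \<eta>)) \<le> (\<Sum>e | org X0 e = y. p e * exp (\<epsilon> * (\<theta> \<bullet> D e) + \<epsilon>\<^sup>2 * g (ter X0 e)))"
proof -
  define b where "b = (\<lambda>y. (\<Sum>e | org X0 e = y. p e * ((\<theta> \<bullet> D e)\<^sup>2 / 2)))"
  have "(\<Sum>y\<in>UNIV. m y * b y) = cov \<theta> \<theta> / 2"
  proof -
    have "(\<Sum>y\<in>UNIV. m y * b y) = (\<Sum>y\<in>UNIV. \<Sum>e | org X0 e = y. p e * m (org X0 e) * ((\<theta> \<bullet> D e) * (\<theta> \<bullet> D e)) / 2)"
      unfolding b_def by (intro sum.cong refl) (auto simp: sum_distrib_left power2_eq_square intro!: sum.cong)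
    then show ?thesis
      by (simp only: sum_org cov_def sum_divide_distrib)
  qed
  moreover have "(\<Sum>y\<in>UNIV. m y * (b y - cov \<theta> \<theta> / 2)) = (\<Sum>y\<in>UNIV. m y * b y) - (\<Sum>y\<in>UNIV. m y) * (cov \<theta> \<theta> / 2)"
    by (simp only: right_diff_distrib sum_subtractf sum_distrib_right)
  moreover have "(\<Sum>y\<in>UNIV. m y) * (cov \<theta> \<theta> / 2) = cov \<theta> \<theta> / 2"
    unfolding m_sum by simp
  ultimately have "(\<Sum>y\<in>UNIV. m y * (b y - cov \<theta> \<theta> / 2)) = 0"
    by linarith
  from poisson_equation[OF this]
  obtain g where g: "\<forall>y. g y - (\<Sum>e | org X0 e = y. p e * g (ter X0 e)) = b y - cov \<theta> \<theta> / 2"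
    by (elim exE)
  define S where "S = (\<lambda>y \<epsilon>. \<Sum>e | org X0 e = y. p e * exp (\<epsilon> * (\<theta> \<bullet> D e) + \<epsilon>\<^sup>2 * g (ter X0 e)))"
  \<comment> \<open>The term of order \<epsilon> vanishes because the increments are centred at each
    vertex; at second order the equation for \<open>g\<close> exchanges the conditional variance for
    its stationary mean plus \<open>g y\<close>.\<close>
  have lim: "((\<lambda>\<epsilon>. (S y \<epsilon> - 1) / \<epsilon>\<^sup>2) \<longlongrightarrow> cov \<theta> \<theta> / 2 + g y) (at_right 0)" for y
  proof -
    have "((\<lambda>\<epsilon>. \<Sum>e | org X0 e = y. p e * ((exp (\<epsilon> * (\<theta> \<bullet> D e) + \<epsilon>\<^sup>2 * g (ter X0 e)) - 1 - \<epsilon> * (\<theta> \<bullet> D e)) / \<epsilon>\<^sup>2))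
        \<longlongrightarrow> (\<Sum>e | org X0 e = y. p e * (g (ter X0 e) + (\<theta> \<bullet> D e)\<^sup>2 / 2))) (at_right 0)"
      by (intro tendsto_intros exp_second_order)
    moreover have "(\<Sum>e | org X0 e = y. p e * (g (ter X0 e) + (\<theta> \<bullet> D e)\<^sup>2 / 2)) = cov \<theta> \<theta> / 2 + g y"
      using g[THEN spec, of y] by (simp add: distrib_left sum.distrib b_def)
    moreover have "(\<Sum>e | org X0 e = y. p e * ((exp (\<epsilon> * (\<theta> \<bullet> D e) + \<epsilon>\<^sup>2 * g (ter X0 e)) - 1 - \<epsilon> * (\<theta> \<bullet> D e)) / \<epsilon>\<^sup>2)) = (S y \<epsilon> - 1) / \<epsilon>\<^sup>2" for \<epsilon>
    proof -
      have "(\<Sum>e | org X0 e = y. p e * ((exp (\<epsilon> * (\<theta> \<bullet> D e) + \<epsilon>\<^sup>2 * g (ter X0 e)) - 1 - \<epsilon> * (\<theta> \<bullet> D e)) / \<epsilon>\<^sup>2)) =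
         ((\<Sum>e | org X0 e = y. p e * exp (\<epsilon> * (\<theta> \<bullet> D e) + \<epsilon>\<^sup>2 * g (ter X0 e))) - (\<Sum>e | org X0 e = y. p e)
           - \<epsilon> * (\<Sum>e | org X0 e = y. p e * (\<theta> \<bullet> D e))) / \<epsilon>\<^sup>2"
        by (simp add: right_diff_distrib sum_subtractf sum_divide_distrib[symmetric] sum_distrib_left mult_ac diff_divide_distrib)
      then show ?thesis
        by (simp only: p_sum inner_martingale S_def) simp
    qed
    ultimately show ?thesis
      by simp
  qed
  show ?thesis
  proof (rule that[of g])
    fix \<eta> :: real assume \<eta>: "0 < \<eta>"
    have "\<forall>\<^sub>F \<epsilon> in at_right 0. \<forall>y. S y \<epsilon> \<le> exp (\<epsilon>\<^sup>2 * (cov \<theta> \<theta> / 2 + g y + \<eta>)) \<and> exp (\<epsilon>\<^sup>2 * (cov \<theta> \<theta> / 2 + g y - \<eta>)) \<le> S y \<epsilon>"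
    proof (rule eventually_all_finite)
      fix y
      let ?L = "cov \<theta> \<theta> / 2 + g y"
      have "\<forall>\<^sub>F \<epsilon> in at_right 0. (S y \<epsilon> - 1) / \<epsilon>\<^sup>2 < ?L + \<eta>"
        using \<eta> by (intro order_tendstoD(2)[OF lim]) auto
      \<comment> \<open>For the lower bound the inequality between \<open>1 + x\<close> and the
        exponential points the wrong way. Half of \<eta> goes to the sum, the other half to the
        first-order expansion of the exponential.\<close>
      moreover have "\<forall>\<^sub>F \<epsilon> in at_right 0. ?L - \<eta> / 2 < (S y \<epsilon> - 1) / \<epsilon>\<^sup>2"
        using \<eta> by (intro order_tendstoD(1)[OF lim]) auto
      moreover have "\<forall>\<^sub>F \<epsilon> in at_right 0. (exp (\<epsilon>\<^sup>2 * (?L - \<eta>)) - 1) / \<epsilon>\<^sup>2 < ?L - \<eta> / 2"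
        using \<eta> by (intro order_tendstoD(2)[OF exp_first_order]) auto
      moreover have "\<forall>\<^sub>F \<epsilon> in at_right (0::real). 0 < \<epsilon>"
        by (rule eventually_at_right_less)
      ultimately show "\<forall>\<^sub>F \<epsilon> in at_right 0. S y \<epsilon> \<le> exp (\<epsilon>\<^sup>2 * (?L + \<eta>)) \<and> exp (\<epsilon>\<^sup>2 * (?L - \<eta>)) \<le> S y \<epsilon>"
      proof eventually_elim
        case (elim \<epsilon>)
        have pos: "0 < \<epsilon>\<^sup>2"
          using elim by simp
        have "S y \<epsilon> \<le> 1 + \<epsilon>\<^sup>2 * (?L + \<eta>)"
          using elim(1) pos by (simp add: divide_less_eq mult.commute)
        also have "\<dots> \<le> exp (\<epsilon>\<^sup>2 * (?L + \<eta>))"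
          by (rule exp_ge_add_one_self)
        finally show ?case
          using elim(2,3) pos by (simp add: divide_less_eq less_divide_eq)
      qed
    qed
    then show "\<forall>\<^sub>F \<epsilon> in at_right 0. \<forall>y.
       (\<Sum>e | org X0 e = y. p e * exp (\<epsilon> * (\<theta> \<bullet> D e) + \<epsilon>\<^sup>2 * g (ter X0 e))) \<le> exp (\<epsilon>\<^sup>2 * (cov \<theta> \<theta> / 2 + g y + \<eta>)) \<and>
       exp (\<epsilon>\<^sup>2 * (cov \<theta> \<theta> / 2 + g y - \<eta>)) \<le> (\<Sum>e | org X0 e = y. p e * exp (\<epsilon> * (\<theta> \<bullet> D e) + \<epsilon>\<^sup>2 * g (ter X0 e)))"
      by (simp only: S_def)
  qed
qed

text \<open>With the extra factor \<open>exp (\<epsilon>\<^sup>2 * g)\<close> at the endpoint the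
  one-step estimate can be iterated: the correctors cancel between consecutive steps, and only those
  at the two ends remain. They are bounded for \<epsilon> below 1, so \<open>C\<close> depends
  neither on \<open>N\<close> nor on the vertex.\<close>

lemma laplace:
  assumes "0 < \<eta>"
  obtains C where "\<forall>\<^sub>F \<epsilon> in at_right 0. \<forall>N y.
     expect N y (\<lambda>es. exp (\<epsilon> * (\<theta> \<bullet> sumD es))) \<le> exp (real N * \<epsilon>\<^sup>2 * (cov \<theta> \<theta> / 2 + \<eta>) + C) \<and>
     exp (real N * \<epsilon>\<^sup>2 * (cov \<theta> \<theta> / 2 - \<eta>) - C) \<le> expect N y (\<lambda>es. exp (\<epsilon> * (\<theta> \<bullet> sumD es)))"
proof -
  let ?q = "cov \<theta> \<theta> / 2"
  obtain g where g: "\<And>\<eta>. 0 < \<eta> \<Longrightarrow> \<forall>\<^sub>F \<epsilon> in at_right 0. \<forall>y.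
     (\<Sum>e | org X0 e = y. p e * exp (\<epsilon> * (\<theta> \<bullet> D e) + \<epsilon>\<^sup>2 * g (ter X0 e))) \<le> exp (\<epsilon>\<^sup>2 * (?q + g y + \<eta>)) \<and>
     exp (\<epsilon>\<^sup>2 * (?q + g y - \<eta>)) \<le> (\<Sum>e | org X0 e = y. p e * exp (\<epsilon> * (\<theta> \<bullet> D e) + \<epsilon>\<^sup>2 * g (ter X0 e)))"
    using laplace_step[of \<theta>] by blast
  define G where "G = (\<Sum>y\<in>UNIV. \<bar>g y\<bar>)"
  have G: "\<bar>g y\<bar> \<le> G" for y
    unfolding G_def by (rule member_le_sum) auto
  have "\<forall>\<^sub>F \<epsilon> in at_right (0::real). \<epsilon> < 1"
    by (rule eventually_at_right_real[THEN eventually_mono, of 0 1]) auto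
  moreover have "\<forall>\<^sub>F \<epsilon> in at_right (0::real). 0 < \<epsilon>"
    by (rule eventually_at_right_less)
  ultimately have "\<forall>\<^sub>F \<epsilon> in at_right 0. \<forall>N y.
     expect N y (\<lambda>es. exp (\<epsilon> * (\<theta> \<bullet> sumD es))) \<le> exp (real N * \<epsilon>\<^sup>2 * (?q + \<eta>) + 2 * G) \<and>
     exp (real N * \<epsilon>\<^sup>2 * (?q - \<eta>) - 2 * G) \<le> expect N y (\<lambda>es. exp (\<epsilon> * (\<theta> \<bullet> sumD es)))"
    using g[OF assms]
  proof eventually_elim
    case (elim \<epsilon>)
    define H where "H = (\<lambda>N y. expect N y (\<lambda>es. exp (\<epsilon> * (\<theta> \<bullet> sumD es) + \<epsilon>\<^sup>2 * g (endpt y es))))"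
    have HS: "H (Suc N) y = (\<Sum>e | org X0 e = y. p e * (exp (\<epsilon> * (\<theta> \<bullet> D e)) * H N (ter X0 e)))" for N y
      unfolding H_def expect.simps by (intro sum.cong refl arg_cong2[where f = "(*)"]) (simp add: expect_cmult[symmetric] inner_add_right exp_add[symmetric] algebra_simps)
    have up: "H N y \<le> exp (real N * \<epsilon>\<^sup>2 * (?q + \<eta>) + \<epsilon>\<^sup>2 * g y)" for N y
    proof (induction N arbitrary: y)
      case (Suc N)
      have "H (Suc N) y \<le> (\<Sum>e | org X0 e = y. p e * (exp (\<epsilon> * (\<theta> \<bullet> D e)) * exp (real N * \<epsilon>\<^sup>2 * (?q + \<eta>) + \<epsilon>\<^sup>2 * g (ter X0 e))))"
        unfolding HS by (intro sum_mono mult_left_mono Suc.IH p_nonneg) auto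
      also have "\<dots> = exp (real N * \<epsilon>\<^sup>2 * (?q + \<eta>)) * (\<Sum>e | org X0 e = y. p e * exp (\<epsilon> * (\<theta> \<bullet> D e) + \<epsilon>\<^sup>2 * g (ter X0 e)))"
        by (simp add: sum_distrib_left exp_add mult_ac)
      also have "\<dots> \<le> exp (real N * \<epsilon>\<^sup>2 * (?q + \<eta>)) * exp (\<epsilon>\<^sup>2 * (?q + g y + \<eta>))"
        using elim by (intro mult_left_mono) auto
      also have "\<dots> = exp (real (Suc N) * \<epsilon>\<^sup>2 * (?q + \<eta>) + \<epsilon>\<^sup>2 * g y)"
        by (simp add: exp_add[symmetric] algebra_simps)
      finally show ?case .
    qed (simp add: H_def)
    have lo: "exp (real N * \<epsilon>\<^sup>2 * (?q - \<eta>) + \<epsilon>\<^sup>2 * g y) \<le> H N y" for N y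
    proof (induction N arbitrary: y)
      case (Suc N)
      have "exp (real (Suc N) * \<epsilon>\<^sup>2 * (?q - \<eta>) + \<epsilon>\<^sup>2 * g y) = exp (real N * \<epsilon>\<^sup>2 * (?q - \<eta>)) * exp (\<epsilon>\<^sup>2 * (?q + g y - \<eta>))"
        by (simp add: exp_add[symmetric] algebra_simps)
      also have "\<dots> \<le> exp (real N * \<epsilon>\<^sup>2 * (?q - \<eta>)) * (\<Sum>e | org X0 e = y. p e * exp (\<epsilon> * (\<theta> \<bullet> D e) + \<epsilon>\<^sup>2 * g (ter X0 e)))"
        using elim by (intro mult_left_mono) auto
      also have "\<dots> = (\<Sum>e | org X0 e = y. p e * (exp (\<epsilon> * (\<theta> \<bullet> D e)) * exp (real N * \<epsilon>\<^sup>2 * (?q - \<eta>) + \<epsilon>\<^sup>2 * g (ter X0 e))))"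
        by (simp add: sum_distrib_left exp_add mult_ac)
      also have "\<dots> \<le> H (Suc N) y"
        unfolding HS by (intro sum_mono mult_left_mono Suc.IH p_nonneg) auto
      finally show ?case .
    qed (simp add: H_def)
    have e1: "\<epsilon>\<^sup>2 \<le> 1"
      using elim by (simp add: power_le_one)
    have gG: "\<bar>\<epsilon>\<^sup>2 * g y\<bar> \<le> G" for y
    proof -
      have "\<bar>\<epsilon>\<^sup>2 * g y\<bar> = \<epsilon>\<^sup>2 * \<bar>g y\<bar>"
        by (simp add: abs_mult)
      also have "\<dots> \<le> 1 * G"
        using e1 G by (intro mult_mono) auto
      finally show ?thesis by simp
    qed
    show ?case
    proof (intro allI conjI)
      fix N y
      have "expect N y (\<lambda>es. exp (\<epsilon> * (\<theta> \<bullet> sumD es))) \<le> expect N y (\<lambda>es. exp G * exp (\<epsilon> * (\<theta> \<bullet> sumD es) + \<epsilon>\<^sup>2 * g (endpt y es)))"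
        using gG by (intro expect_mono) (simp add: exp_add[symmetric] abs_le_iff, smt (verit))
      also have "\<dots> = exp G * H N y"
        unfolding H_def by (rule expect_cmult)
      also have "\<dots> \<le> exp G * exp (real N * \<epsilon>\<^sup>2 * (?q + \<eta>) + \<epsilon>\<^sup>2 * g y)"
        using up by (intro mult_left_mono) auto
      also have "\<dots> \<le> exp (real N * \<epsilon>\<^sup>2 * (?q + \<eta>) + 2 * G)"
        using gG[of y] by (simp add: exp_add[symmetric] abs_le_iff)
      finally show "expect N y (\<lambda>es. exp (\<epsilon> * (\<theta> \<bullet> sumD es))) \<le> exp (real N * \<epsilon>\<^sup>2 * (?q + \<eta>) + 2 * G)" .
      have "exp (real N * \<epsilon>\<^sup>2 * (?q - \<eta>) - 2 * G) \<le> exp (- G) * exp (real N * \<epsilon>\<^sup>2 * (?q - \<eta>) + \<epsilon>\<^sup>2 * g y)"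
        using gG[of y] by (simp add: exp_add[symmetric] abs_le_iff)
      also have "\<dots> \<le> exp (- G) * H N y"
        using lo by (intro mult_left_mono) auto
      also have "\<dots> = expect N y (\<lambda>es. exp (- G) * exp (\<epsilon> * (\<theta> \<bullet> sumD es) + \<epsilon>\<^sup>2 * g (endpt y es)))"
        unfolding H_def by (rule expect_cmult[symmetric])
      also have "\<dots> \<le> expect N y (\<lambda>es. exp (\<epsilon> * (\<theta> \<bullet> sumD es)))"
        using gG[THEN abs_le_D1] by (intro expect_mono) (simp add: exp_add[symmetric])
      finally show "exp (real N * \<epsilon>\<^sup>2 * (?q - \<eta>) - 2 * G) \<le> expect N y (\<lambda>es. exp (\<epsilon> * (\<theta> \<bullet> sumD es)))" .
    qed
  qed
  then show ?thesis
    by (rule that)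
qed

text \<open>Induction on the number of steps with the current value \<open>x\<close> as parameter.
  Below the level \<open>c\<close> one takes a step; once \<open>c\<close> is reached,
  \<open>1 + z \<le> exp z\<close> and the vanishing mean show that the exponential already has
  expectation at least 1. No stopping time is needed.\<close>

lemma doob:
  "expect n y (\<lambda>es. of_bool (\<exists>k\<le>n. c \<le> x + \<theta> \<bullet> sumD (take k es))) \<le> expect n y (\<lambda>es. exp (x + \<theta> \<bullet> sumD es - c))"
proof (induction n arbitrary: y x)
  case 0
  show ?case
    by simp
next
  case (Suc n)
  show ?case
  proof (cases "c \<le> x")
    case True
    have "expect (Suc n) y (\<lambda>es. of_bool (\<exists>k\<le>Suc n. c \<le> x + \<theta> \<bullet> sumD (take k es))) \<le> expect (Suc n) y (\<lambda>_. 1)"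
      by (intro expect_mono) auto
    also have "\<dots> = expect (Suc n) y (\<lambda>es. 1 + \<theta> \<bullet> sumD es)"
      by (simp only: expect_add expect_const expect_sumD)
    also have "\<dots> \<le> expect (Suc n) y (\<lambda>es. exp (x + \<theta> \<bullet> sumD es - c))"
    proof (rule expect_mono)
      fix es :: "'e0 list"
      have "1 + \<theta> \<bullet> sumD es \<le> exp (\<theta> \<bullet> sumD es)"
        by (rule exp_ge_add_one_self)
      also have "\<dots> \<le> exp (x + \<theta> \<bullet> sumD es - c)"
        using True by simp
      finally show "1 + \<theta> \<bullet> sumD es \<le> exp (x + \<theta> \<bullet> sumD es - c)" .
    qed
    finally show ?thesis .
  next
    case False
    have *: "(\<exists>k\<le>Suc n. c \<le> x + \<theta> \<bullet> sumD (take k (e # es))) \<longleftrightarrow> (\<exists>k\<le>n. c \<le> (x + \<theta> \<bullet> D e) + \<theta> \<bullet> sumD (take k es))" for e es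
    proof
      assume "\<exists>k\<le>Suc n. c \<le> x + \<theta> \<bullet> sumD (take k (e # es))"
      then obtain k where k: "k \<le> Suc n" "c \<le> x + \<theta> \<bullet> sumD (take k (e # es))" by blast
      with False obtain k' where "k = Suc k'" by (cases k) auto
      with k show "\<exists>k\<le>n. c \<le> (x + \<theta> \<bullet> D e) + \<theta> \<bullet> sumD (take k es)"
        by (intro exI[of _ k']) (auto simp: inner_add_right)
    next
      assume "\<exists>k\<le>n. c \<le> (x + \<theta> \<bullet> D e) + \<theta> \<bullet> sumD (take k es)"
      then obtain k where "k \<le> n" "c \<le> (x + \<theta> \<bullet> D e) + \<theta> \<bullet> sumD (take k es)" by blast
      then show "\<exists>k\<le>Suc n. c \<le> x + \<theta> \<bullet> sumD (take k (e # es))"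
        by (intro exI[of _ "Suc k"]) (auto simp: inner_add_right)
    qed
    show ?thesis
      unfolding expect.simps *
    proof (intro sum_mono mult_left_mono p_nonneg)
      fix e
      show "expect n (ter X0 e) (\<lambda>es. of_bool (\<exists>k\<le>n. c \<le> (x + \<theta> \<bullet> D e) + \<theta> \<bullet> sumD (take k es)))
         \<le> expect n (ter X0 e) (\<lambda>es. exp (x + \<theta> \<bullet> sumD (e # es) - c))"
        using Suc.IH[of "ter X0 e" "x + \<theta> \<bullet> D e"] by (simp add: inner_add_right add.assoc)
    qed
  qed
qed

end

section \<open>Exponential estimates on the moderate scale\<close>

text \<open>\<open>J\<close> is the inverse of the covariance, described only by the duality
  \<open>cov_J\<close>.\<close>

locale mdp_walk = martingale_walk X0 p m D
  for X0 :: "('x0::finite, 'e0::finite) ograph" and p m and D :: "'e0 \<Rightarrow> real ^ 'd::finite" +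
  fixes J :: "real ^ 'd \<Rightarrow> real ^ 'd" and a :: "nat \<Rightarrow> real"
  assumes linear_J: "linear J" and cov_J: "cov (J v) \<theta> = v \<bullet> \<theta>"
    and a_pos: "\<And>n. 1 \<le> n \<Longrightarrow> 0 < a n"
    and a_sqrt: "filterlim (\<lambda>n. a n / sqrt (real n)) at_top sequentially"
    and a_lin: "(\<lambda>n. a n / real n) \<longlonglongrightarrow> 0"
begin

definition speed :: "nat \<Rightarrow> real" where "speed n = (a n)\<^sup>2 / real n"
text \<open>The scale of the Laplace parameter: multiplied by \<open>a n\<close>, or squared and
  multiplied by \<open>n\<close>, it gives \<open>speed n\<close>, so linear and quadratic exponents
  live on the same scale.\<close>

definition tilt :: "nat \<Rightarrow> real" where "tilt n = a n / real n"
definition Q :: "real ^ 'd \<Rightarrow> real" where "Q v = J v \<bullet> v"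

lemma speed_at_top: "filterlim speed at_top sequentially"
proof -
  have "filterlim (\<lambda>n. (a n / sqrt (real n)) ^ 2) at_top sequentially"
    by (rule filterlim_pow_at_top[OF _ a_sqrt]) auto
  then show ?thesis
    by (simp add: speed_def[abs_def] power_divide)
qed

lemma eventually_speed_gt: "\<forall>\<^sub>F n in sequentially. c < speed n"
  using speed_at_top by (simp add: filterlim_at_top_dense)

lemma tilt_at_right: "filterlim tilt (at_right 0) sequentially"
proof -
  have "\<forall>\<^sub>F n in sequentially. tilt n \<in> {0<..} \<and> tilt n \<noteq> 0"
    using eventually_ge_at_top[of 1]
  proof eventually_elim
    case (elim n)
    then show ?case
      using a_pos[of n] by (simp add: tilt_def)
  qed
  then show ?thesis
    using a_lin by (simp add: filterlim_at tilt_def[abs_def])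
qed

lemma tilt_speed: "1 \<le> n \<Longrightarrow> tilt n * a n = speed n" "real N * (tilt n)\<^sup>2 = real N / real n * speed n"
  by (simp_all add: tilt_def speed_def power2_eq_square)

lemma div_limit:
  assumes "0 < (K::nat)"
  shows "(\<lambda>n. real (n div K) / real n) \<longlonglongrightarrow> 1 / real K"
proof (rule tendsto_sandwich)
  show "\<forall>\<^sub>F n in sequentially. 1 / real K - 1 / real n \<le> real (n div K) / real n"
    using eventually_gt_at_top[of 0]
  proof eventually_elim
    case (elim n)
    have "n < K * (n div K) + K"
      using assms by (metis mult_div_mod_eq add_less_cancel_left mod_less_divisor)
    then have "real n \<le> real K * real (n div K) + real K"
      by (metis less_imp_le of_nat_add of_nat_le_iff of_nat_mult)
    then have "1 / real K \<le> (real (n div K) + 1) / real n"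
      using elim assms by (simp add: field_simps)
    then show ?case
      by (simp add: add_divide_distrib)
  qed
  show "\<forall>\<^sub>F n in sequentially. real (n div K) / real n \<le> 1 / real K"
    using eventually_gt_at_top[of 0]
  proof eventually_elim
    case (elim n)
    have "real (n div K) * real K \<le> real n"
      by (metis div_times_less_eq_dividend of_nat_le_iff of_nat_mult)
    then show ?case
      using elim assms by (simp add: field_simps)
  qed
  show "(\<lambda>n. 1 / real K - 1 / real n) \<longlonglongrightarrow> 1 / real K"
    using tendsto_diff[OF tendsto_const[of "1 / real K"] lim_1_over_n] by simp
qed auto

text \<open>The block length \<open>n div K\<close> is asymptotic to \<open>n / K\<close>, and the
  constant left over from the correctors is small against the diverging speed.\<close>

lemma block_laplace:
  assumes K: "0 < K" and \<eta>: "0 < \<eta>"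
  shows "\<forall>\<^sub>F n in sequentially. \<forall>y.
     expect (n div K) y (\<lambda>es. exp (tilt n * (\<theta> \<bullet> sumD es))) \<le> exp (speed n * (cov \<theta> \<theta> / (2 * real K) + \<eta>)) \<and>
     exp (speed n * (cov \<theta> \<theta> / (2 * real K) - \<eta>)) \<le> expect (n div K) y (\<lambda>es. exp (tilt n * (\<theta> \<bullet> sumD es)))"
proof -
  let ?q = "cov \<theta> \<theta> / 2"
  obtain C where C: "\<forall>\<^sub>F \<epsilon> in at_right 0. \<forall>N y.
     expect N y (\<lambda>es. exp (\<epsilon> * (\<theta> \<bullet> sumD es))) \<le> exp (real N * \<epsilon>\<^sup>2 * (?q + \<eta> / 2) + C) \<and>
     exp (real N * \<epsilon>\<^sup>2 * (?q - \<eta> / 2) - C) \<le> expect N y (\<lambda>es. exp (\<epsilon> * (\<theta> \<bullet> sumD es)))"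
    using laplace[of "\<eta> / 2" \<theta>] \<eta> by auto
  have lim: "(\<lambda>n. C / speed n) \<longlonglongrightarrow> 0"
    by (rule tendsto_divide_0[OF tendsto_const filterlim_at_top_imp_at_infinity[OF speed_at_top]])
  have K2: "\<eta> / 2 / K < \<eta>"
    using K \<eta> by (simp add: field_simps)
  have 1: "(\<lambda>n. real (n div K) / real n * (?q + \<eta> / 2) + C / speed n) \<longlonglongrightarrow> 1 / K * (?q + \<eta> / 2) + 0"
    by (intro tendsto_intros div_limit K lim)
  have 2: "(\<lambda>n. real (n div K) / real n * (?q - \<eta> / 2) - C / speed n) \<longlonglongrightarrow> 1 / K * (?q - \<eta> / 2) - 0"
    by (intro tendsto_intros div_limit K lim)
  have "1 / K * (?q + \<eta> / 2) + 0 < cov \<theta> \<theta> / (2 * real K) + \<eta>" "cov \<theta> \<theta> / (2 * real K) - \<eta> < 1 / K * (?q - \<eta> / 2) - 0"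
    using K2 K by (simp_all add: distrib_left right_diff_distrib)
  from order_tendstoD(2)[OF 1 this(1)] order_tendstoD(1)[OF 2 this(2)]
    eventually_compose_filterlim[OF C tilt_at_right] eventually_speed_gt[of 0]
  show ?thesis
  proof eventually_elim
    case (elim n)
    have "real (n div K) / real n * speed n * (?q + \<eta> / 2) + C \<le> speed n * (cov \<theta> \<theta> / (2 * real K) + \<eta>)"
      using mult_left_mono[OF less_imp_le[OF elim(1)], of "speed n"] elim(4) by (simp add: distrib_left mult_ac)
    moreover have "speed n * (cov \<theta> \<theta> / (2 * real K) - \<eta>) \<le> real (n div K) / real n * speed n * (?q - \<eta> / 2) - C"
      using mult_left_mono[OF less_imp_le[OF elim(2)], of "speed n"] elim(4) by (simp add: right_diff_distrib mult_ac)
    ultimately show ?case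
      using elim(3) unfolding tilt_speed(2) by (meson exp_le_cancel_iff order_trans)
  qed
qed

text \<open>Replaces a norm by finitely many one-sided linear bounds, to which the exponential
  Chebyshev inequality applies; the price is the factor \<open>CARD('d)\<close>.\<close>

lemma norm_gt_component:
  fixes v :: "real ^ 'd"
  assumes "c \<le> norm v"
  obtains i \<sigma> where "\<sigma> \<in> {1, -1}" "c / CARD('d) \<le> (\<sigma> *\<^sub>R axis i 1) \<bullet> v"
proof -
  have "\<exists>i. c / CARD('d) \<le> \<bar>v $ i\<bar>"
  proof (rule ccontr)
    assume "\<not> (\<exists>i. c / CARD('d) \<le> \<bar>v $ i\<bar>)"
    then have "(\<Sum>i\<in>UNIV. \<bar>v $ i\<bar>) < (\<Sum>i\<in>(UNIV :: 'd set). c / CARD('d))"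
      by (intro sum_strict_mono) (auto simp: not_le)
    then show False
      using assms norm_le_l1_cart[of v] by simp
  qed
  then obtain i where i: "c / CARD('d) \<le> \<bar>v $ i\<bar>" by blast
  show ?thesis
  proof (cases "0 \<le> v $ i")
    case True
    then show ?thesis using i that[of 1 i] by (simp add: inner_axis' inner_axis)
  next
    case False
    then show ?thesis using i that[of "-1" i] by (simp add: inner_axis' inner_axis)
  qed
qed

definition dirs :: "(real ^ 'd) set" where
  "dirs = (\<lambda>(\<sigma>, i). \<sigma> *\<^sub>R axis i 1) ` ({1, -1} \<times> UNIV)"

lemma finite_dirs: "finite dirs"
  by (simp add: dirs_def)

lemma norm_gt_dirs:
  fixes v :: "real ^ 'd"
  assumes "c \<le> norm v"
  obtains u where "u \<in> dirs" "c / CARD('d) \<le> u \<bullet> v"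
  using norm_gt_component[OF assms] unfolding dirs_def by (metis (mono_tags, lifting) UNIV_I SigmaI image_eqI case_prod_conv)

definition maxcov :: real where
  "maxcov = (\<Sum>u\<in>dirs. cov u u)"

lemma maxcov: "u \<in> dirs \<Longrightarrow> cov u u \<le> maxcov" "0 \<le> maxcov"
  unfolding maxcov_def using finite_dirs cov_nonneg by (auto intro: member_le_sum sum_nonneg)

text \<open>Absorbs fixed multiplicative constants, such as the number of directions or of
  blocks.\<close>

lemma eventually_exp_speed:
  assumes "0 < c"
  shows "\<forall>\<^sub>F n in sequentially. C \<le> exp (speed n * c)"
  using eventually_speed_gt[of "\<bar>C\<bar> / c"]
proof eventually_elim
  case (elim n)
  have "C \<le> speed n * c"
    using elim assms by (simp add: divide_less_eq)
  also have "\<dots> \<le> exp (speed n * c)"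
    using exp_ge_add_one_self[of "speed n * c"] by linarith
  finally show ?case .
qed

text \<open>Doob's inequality with parameter \<open>\<kappa> *\<^sub>R u\<close> for every
  coordinate direction: a gain linear in \<kappa> against a quadratic cost that carries the factor
  \<open>1 / K\<close>, the share of time in one block.\<close>

lemma osc_rate:
  assumes K: "0 < K" and \<kappa>: "0 < \<kappa>" and R: "R < \<kappa> * \<delta> / CARD('d) - \<kappa>\<^sup>2 * maxcov / (2 * real K)"
  shows "\<forall>\<^sub>F n in sequentially. \<forall>y.
    expect (n div K) y (\<lambda>es. of_bool (\<exists>k\<le>n div K. \<delta> * a n < norm (sumD (take k es)))) \<le> exp (- (speed n * R))"
proof -
  \<comment> \<open>Half of the slack in the hypothesis: one \<eta> is spent on the Laplace
    asymptotics, the other on the number of directions.\<close>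
  define \<eta> where "\<eta> = (\<kappa> * \<delta> / CARD('d) - \<kappa>\<^sup>2 * maxcov / (2 * real K) - R) / 2"
  have \<eta>: "0 < \<eta>"
    using R by (simp add: \<eta>_def)
  have "\<forall>\<^sub>F n in sequentially. \<forall>u\<in>dirs. \<forall>y.
     expect (n div K) y (\<lambda>es. exp (tilt n * ((\<kappa> *\<^sub>R u) \<bullet> sumD es))) \<le> exp (speed n * (cov (\<kappa> *\<^sub>R u) (\<kappa> *\<^sub>R u) / (2 * real K) + \<eta>))"
  proof (intro eventually_ball_finite finite_dirs ballI)
    fix u
    show "\<forall>\<^sub>F n in sequentially. \<forall>y. expect (n div K) y (\<lambda>es. exp (tilt n * ((\<kappa> *\<^sub>R u) \<bullet> sumD es)))
        \<le> exp (speed n * (cov (\<kappa> *\<^sub>R u) (\<kappa> *\<^sub>R u) / (2 * real K) + \<eta>))"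
      using block_laplace[OF K \<eta>, of "\<kappa> *\<^sub>R u"] by (rule eventually_mono) blast
  qed
  then show ?thesis
    using eventually_exp_speed[OF \<eta>, of "card dirs"] eventually_speed_gt[of 0] eventually_ge_at_top[of 1]
  proof eventually_elim
    case (elim n)
    let ?N = "n div K"
    let ?d = "real CARD('d)"
    show ?case
    proof
      fix y
      have "expect ?N y (\<lambda>es. of_bool (\<exists>k\<le>?N. \<delta> * a n < norm (sumD (take k es))))
         \<le> expect ?N y (\<lambda>es. \<Sum>u\<in>dirs. of_bool (\<exists>k\<le>?N. speed n * (\<kappa> * \<delta> / ?d) \<le> 0 + ((tilt n * \<kappa>) *\<^sub>R u) \<bullet> sumD (take k es)))"
      proof (rule expect_mono)
        fix es :: "'e0 list"
        show "of_bool (\<exists>k\<le>?N. \<delta> * a n < norm (sumD (take k es)))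
          \<le> (\<Sum>u\<in>dirs. of_bool (\<exists>k\<le>?N. speed n * (\<kappa> * \<delta> / ?d) \<le> 0 + ((tilt n * \<kappa>) *\<^sub>R u) \<bullet> sumD (take k es)) :: real)"
        proof (cases "\<exists>k\<le>?N. \<delta> * a n < norm (sumD (take k es))")
          case True
          then obtain k where k: "k \<le> ?N" "\<delta> * a n \<le> norm (sumD (take k es))"
            by (auto intro: less_imp_le)
          obtain u where u: "u \<in> dirs" "\<delta> * a n / ?d \<le> u \<bullet> sumD (take k es)"
            using norm_gt_dirs[OF k(2)] by blast
          have "0 \<le> tilt n * \<kappa>"
            using elim(4) a_pos[of n] \<kappa> by (simp add: tilt_def)
          from mult_left_mono[OF u(2) this]
          have "speed n * (\<kappa> * \<delta> / ?d) \<le> 0 + ((tilt n * \<kappa>) *\<^sub>R u) \<bullet> sumD (take k es)"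
            using tilt_speed(1)[OF elim(4)] by (simp add: mult_ac)
          with k(1) have "\<exists>k\<le>?N. speed n * (\<kappa> * \<delta> / ?d) \<le> 0 + ((tilt n * \<kappa>) *\<^sub>R u) \<bullet> sumD (take k es)"
            by blast
          then have "1 \<le> (of_bool (\<exists>k\<le>?N. speed n * (\<kappa> * \<delta> / ?d) \<le> 0 + ((tilt n * \<kappa>) *\<^sub>R u) \<bullet> sumD (take k es)) :: real)"
            by simp
          also have "\<dots> \<le> (\<Sum>u\<in>dirs. of_bool (\<exists>k\<le>?N. speed n * (\<kappa> * \<delta> / ?d) \<le> 0 + ((tilt n * \<kappa>) *\<^sub>R u) \<bullet> sumD (take k es)))"
            by (rule member_le_sum[OF u(1) _ finite_dirs, where f = "\<lambda>u. of_bool (\<exists>k\<le>?N. speed n * (\<kappa> * \<delta> / ?d) \<le> 0 + ((tilt n * \<kappa>) *\<^sub>R u) \<bullet> sumD (take k es))"]) simp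
          finally show ?thesis
            using True by simp
        next
          case False
          show ?thesis
            unfolding of_bool_def if_not_P[OF False] by (intro sum_nonneg) simp
        qed
      qed
      also have "\<dots> = (\<Sum>u\<in>dirs. expect ?N y (\<lambda>es. of_bool (\<exists>k\<le>?N. speed n * (\<kappa> * \<delta> / ?d) \<le> 0 + ((tilt n * \<kappa>) *\<^sub>R u) \<bullet> sumD (take k es))))"
        by (rule expect_sum[OF finite_dirs])
      also have "\<dots> \<le> (\<Sum>u\<in>dirs. exp (- (speed n * (R + \<eta>))))"
      proof (rule sum_mono)
        fix u assume u: "u \<in> dirs"
        have "expect ?N y (\<lambda>es. of_bool (\<exists>k\<le>?N. speed n * (\<kappa> * \<delta> / ?d) \<le> 0 + ((tilt n * \<kappa>) *\<^sub>R u) \<bullet> sumD (take k es)))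
           \<le> expect ?N y (\<lambda>es. exp (0 + ((tilt n * \<kappa>) *\<^sub>R u) \<bullet> sumD es - speed n * (\<kappa> * \<delta> / ?d)))"
          by (rule doob)
        also have "\<dots> = expect ?N y (\<lambda>es. exp (- (speed n * (\<kappa> * \<delta> / ?d))) * exp (tilt n * ((\<kappa> *\<^sub>R u) \<bullet> sumD es)))"
          by (rule expect_cong) (simp add: exp_add[symmetric] mult.assoc)
        also have "\<dots> = exp (- (speed n * (\<kappa> * \<delta> / ?d))) * expect ?N y (\<lambda>es. exp (tilt n * ((\<kappa> *\<^sub>R u) \<bullet> sumD es)))"
          by (rule expect_cmult)
        also have "\<dots> \<le> exp (- (speed n * (\<kappa> * \<delta> / ?d))) * exp (speed n * (cov (\<kappa> *\<^sub>R u) (\<kappa> *\<^sub>R u) / (2 * real K) + \<eta>))"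
          using elim(1) u by (intro mult_left_mono) auto
        also have "\<dots> = exp (speed n * (cov (\<kappa> *\<^sub>R u) (\<kappa> *\<^sub>R u) / (2 * real K) + \<eta> - \<kappa> * \<delta> / ?d))"
          by (simp add: exp_add[symmetric] algebra_simps)
        also have "\<dots> \<le> exp (- (speed n * (R + \<eta>)))"
        proof -
          have "\<kappa>\<^sup>2 * cov u u / (2 * real K) \<le> \<kappa>\<^sup>2 * maxcov / (2 * real K)"
            using maxcov(1)[OF u] K by (intro divide_right_mono mult_left_mono) auto
          then have "cov (\<kappa> *\<^sub>R u) (\<kappa> *\<^sub>R u) / (2 * real K) + \<eta> - \<kappa> * \<delta> / ?d \<le> - (R + \<eta>)"
          proof -
            have eq: "cov (\<kappa> *\<^sub>R u) (\<kappa> *\<^sub>R u) = \<kappa>\<^sup>2 * cov u u"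
              by (simp add: cov_scale_left cov_scale_right power2_eq_square)
            have "2 * \<eta> = \<kappa> * \<delta> / ?d - \<kappa>\<^sup>2 * maxcov / (2 * real K) - R"
              by (simp add: \<eta>_def)
            then show ?thesis
              unfolding eq using \<open>\<kappa>\<^sup>2 * cov u u / (2 * real K) \<le> \<kappa>\<^sup>2 * maxcov / (2 * real K)\<close> by linarith
          qed
          then have "speed n * (cov (\<kappa> *\<^sub>R u) (\<kappa> *\<^sub>R u) / (2 * real K) + \<eta> - \<kappa> * \<delta> / ?d) \<le> speed n * - (R + \<eta>)"
            using elim(3) by (intro mult_left_mono) auto
          then show ?thesis
            by (simp only: exp_le_cancel_iff mult_minus_right)
        qed
        finally show "expect ?N y (\<lambda>es. of_bool (\<exists>k\<le>?N. speed n * (\<kappa> * \<delta> / ?d) \<le> 0 + ((tilt n * \<kappa>) *\<^sub>R u) \<bullet> sumD (take k es))) \<le> exp (- (speed n * (R + \<eta>)))" .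
      qed
      also have "\<dots> = real (card dirs) * exp (- (speed n * \<eta>)) * exp (- (speed n * R))"
        by (simp add: exp_add[symmetric] algebra_simps)
      also have "\<dots> \<le> 1 * exp (- (speed n * R))"
        using elim(2) by (intro mult_right_mono) (simp_all add: exp_minus field_simps)
      finally show "expect ?N y (\<lambda>es. of_bool (\<exists>k\<le>?N. \<delta> * a n < norm (sumD (take k es)))) \<le> exp (- (speed n * R))"
        by simp
    qed
  qed
qed

text \<open>\<kappa> is fixed first, with linear gain \<open>\<bar>R\<bar> + 1\<close>; refining the
  blocks then pushes the quadratic cost below 1.\<close>

lemma osc_rate_fine:
  assumes \<delta>: "0 < \<delta>"
  obtains K0 where "0 < K0" "\<And>K. K0 \<le> K \<Longrightarrow> \<forall>\<^sub>F n in sequentially. \<forall>y.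
    expect (n div K) y (\<lambda>es. of_bool (\<exists>k\<le>n div K. \<delta> * a n < norm (sumD (take k es)))) \<le> exp (- (speed n * R))"
proof -
  define \<kappa> where "\<kappa> = (\<bar>R\<bar> + 1) * CARD('d) / \<delta>"
  have \<kappa>: "0 < \<kappa>" "\<kappa> * \<delta> / CARD('d) = \<bar>R\<bar> + 1"
    using \<delta> by (auto simp: \<kappa>_def)
  obtain K0 :: nat where K0: "\<kappa>\<^sup>2 * maxcov < K0"
    using reals_Archimedean2 by blast
  have K0pos: "0 < K0"
    using K0 maxcov(2) by (smt (verit) mult_nonneg_nonneg of_nat_0 not_gr_zero zero_le_power2)
  show ?thesis
  proof (rule that[OF K0pos], rule osc_rate[OF _ \<kappa>(1)])
    fix K assume K: "K0 \<le> K"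
    then show "0 < K" using K0pos by simp
    have "\<kappa>\<^sup>2 * maxcov < K"
      using K K0 by (meson less_le_trans of_nat_le_iff)
    then have "\<kappa>\<^sup>2 * maxcov / (2 * real K) < 1"
      using \<open>0 < K\<close> by simp
    then show "R < \<kappa> * \<delta> / CARD('d) - \<kappa>\<^sup>2 * maxcov / (2 * real K)"
      unfolding \<kappa>(2) by linarith
  qed
qed

lemma Q_cov: "Q v = cov (J v) (J v)" "0 \<le> Q v"
  using cov_J[of v "J v"] cov_nonneg[of "J v"] by (simp_all add: Q_def inner_commute)

lemma cov_tilted: "cov (K *\<^sub>R J v + \<phi>) (K *\<^sub>R J v + \<phi>) = K\<^sup>2 * Q v + 2 * K * (v \<bullet> \<phi>) + cov \<phi> \<phi>"
proof -
  have "cov (J v) (J v) = Q v" "cov (J v) \<phi> = v \<bullet> \<phi>" "cov \<phi> (J v) = v \<bullet> \<phi>"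
    by (simp_all only: Q_cov(1) cov_J cov_commute[of \<phi> "J v"])
  then show ?thesis
    unfolding cov_add_left cov_add_right cov_scale_left cov_scale_right
    by (simp add: power2_eq_square algebra_simps)
qed

text \<open>Tilting by \<open>\<theta> = K J v\<close> makes \<open>v\<close> the typical value of the scaled block sum.\<close>

lemma block_lower:
  assumes K: "0 < K" and \<delta>: "0 < \<delta>" and \<eta>: "0 < \<eta>"
  shows "\<forall>\<^sub>F n in sequentially. \<forall>y.
    exp (- (speed n * (K / 2 * Q v + \<eta>))) \<le> expect (n div K) y (\<lambda>es. of_bool (norm (sumD es - a n *\<^sub>R v) < \<delta> * a n))"
proof -
  define \<theta> where "\<theta> = real K *\<^sub>R J v"
  define \<Lambda> where "\<Lambda> = K / 2 * Q v"
  \<comment> \<open>The ball is shrunk so that the exponential weight varies over it by at most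
    \<open>exp (speed n * (\<eta> / 2))\<close> relative to its centre value; the bound by
    \<open>\<eta> / 2\<close> also controls \<open>c\<close>.\<close>
  define \<delta>' where "\<delta>' = min \<delta> (\<eta> / (2 * (norm \<theta> + 1)))"
  let ?d = "real CARD('d)"
  \<comment> \<open>Strength of a second tilt, used to bound the mass outside the ball. It gains
    \<open>2 * c\<close> linearly, and \<kappa> is so small that its quadratic cost is at most
    \<open>c\<close>.\<close>
  define \<kappa> where "\<kappa> = min 1 (\<delta>' * K / (?d * (maxcov + 1)))"
  define c where "c = \<kappa> * \<delta>' / (2 * ?d)"
  have pos: "0 < norm \<theta> + 1" "0 < maxcov + 1"
    using maxcov(2) by (simp_all add: add_nonneg_pos)
  have \<delta>': "0 < \<delta>'" "\<delta>' \<le> \<delta>" "\<delta>' * norm \<theta> \<le> \<eta> / 2" "\<delta>' \<le> \<eta> / 2"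
  proof -
    show "0 < \<delta>'" "\<delta>' \<le> \<delta>"
      using \<delta> \<eta> pos by (auto simp: \<delta>'_def)
    have "\<delta>' * (norm \<theta> + 1) \<le> \<eta> / (2 * (norm \<theta> + 1)) * (norm \<theta> + 1)"
      using pos by (intro mult_right_mono) (auto simp: \<delta>'_def)
    also have "\<dots> = \<eta> / 2"
    proof -
      have "x / (2 * z) * z = x / 2" if "z \<noteq> 0" for x z :: real
        using that by simp
      then show ?thesis
        using pos(1) by (metis less_irrefl)
    qed
    finally have *: "\<delta>' * norm \<theta> + \<delta>' \<le> \<eta> / 2"
      by (simp add: distrib_left)
    show "\<delta>' * norm \<theta> \<le> \<eta> / 2" "\<delta>' \<le> \<eta> / 2"
      using * \<open>0 < \<delta>'\<close> mult_nonneg_nonneg[OF less_imp_le[OF \<open>0 < \<delta>'\<close>] norm_ge_zero[of \<theta>]] by linarith+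
  qed
  have \<kappa>: "0 < \<kappa>" "\<kappa> \<le> 1" "\<kappa> * maxcov / (2 * real K) \<le> \<delta>' / (2 * ?d)"
  proof -
    show "0 < \<kappa>" "\<kappa> \<le> 1"
      using \<delta>'(1) K pos by (auto simp: \<kappa>_def)
    have "\<kappa> * maxcov \<le> (\<delta>' * K / (?d * (maxcov + 1))) * (maxcov + 1)"
      using maxcov(2) \<open>0 < \<kappa>\<close> by (intro mult_mono) (auto simp: \<kappa>_def)
    also have "\<dots> = \<delta>' * K / ?d"
      using pos by simp
    finally show "\<kappa> * maxcov / (2 * real K) \<le> \<delta>' / (2 * ?d)"
      using K by (simp add: field_simps)
  qed
  have c: "0 < c" "c / 2 \<le> \<eta> / 2"
  proof -
    show "0 < c"
      using \<kappa>(1) \<delta>'(1) by (simp add: c_def)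
    have "\<kappa> * \<delta>' \<le> 1 * (\<eta> / 2)"
      using \<kappa> \<delta>' by (intro mult_mono) auto
    moreover have "c \<le> \<kappa> * \<delta>'"
    proof -
      have "1 \<le> 2 * ?d"
        using zero_less_card_finite[where 'a = 'd] by linarith
      then have "\<kappa> * \<delta>' / (2 * ?d) \<le> \<kappa> * \<delta>' / 1"
        using \<kappa>(1) \<delta>'(1) by (intro divide_left_mono) auto
      then show ?thesis
        by (simp add: c_def)
    qed
    ultimately show "c / 2 \<le> \<eta> / 2"
      using \<eta> by linarith
  qed
  have c4: "0 < c / 4" and c2: "0 < c / 2"
    using c by simp_all
  have "\<forall>\<^sub>F n in sequentially. \<forall>u\<in>dirs. \<forall>y.
     expect (n div K) y (\<lambda>es. exp (tilt n * ((\<theta> + \<kappa> *\<^sub>R u) \<bullet> sumD es))) \<le> exp (speed n * (cov (\<theta> + \<kappa> *\<^sub>R u) (\<theta> + \<kappa> *\<^sub>R u) / (2 * real K) + c / 4))"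
  proof (intro eventually_ball_finite finite_dirs ballI)
    fix u
    show "\<forall>\<^sub>F n in sequentially. \<forall>y. expect (n div K) y (\<lambda>es. exp (tilt n * ((\<theta> + \<kappa> *\<^sub>R u) \<bullet> sumD es)))
        \<le> exp (speed n * (cov (\<theta> + \<kappa> *\<^sub>R u) (\<theta> + \<kappa> *\<^sub>R u) / (2 * real K) + c / 4))"
      using block_laplace[OF K c4, of "\<theta> + \<kappa> *\<^sub>R u"] by (rule eventually_mono) blast
  qed
  moreover note block_laplace[OF K c4, of \<theta>] eventually_exp_speed[OF c4, of "2"] eventually_speed_gt[of 0] eventually_ge_at_top[of 1]
    eventually_exp_speed[OF c2, of "2 * real (card dirs)"]
  ultimately show ?thesis
  proof eventually_elim
    case (elim n)
    let ?N = "n div K"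
    let ?E = "\<lambda>es. exp (tilt n * (\<theta> \<bullet> sumD es))"
    let ?cl = "\<lambda>es. of_bool (norm (sumD es - a n *\<^sub>R v) < \<delta>' * a n) :: real"
    have an: "0 < a n" "0 < tilt n"
      using a_pos[of n] elim(5) by (auto simp: tilt_def)
    have \<theta>v: "\<theta> \<bullet> v = 2 * \<Lambda>"
      by (simp add: \<theta>_def \<Lambda>_def Q_def)
    have cov\<theta>: "cov \<theta> \<theta> / (2 * real K) = \<Lambda>"
      using K by (simp add: \<theta>_def \<Lambda>_def cov_scale_left cov_scale_right Q_cov(1))
    show ?case
    proof
      fix y
      \<comment> \<open>On the small ball the weight is at most
        \<open>exp (speed n * (2 * \<Lambda> + \<delta>' * norm \<theta>))\<close>; dividing by this
        bound removes the tilt.\<close>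
      have low: "exp (- (speed n * (2 * \<Lambda> + \<delta>' * norm \<theta>))) * (?E es * ?cl es) \<le> of_bool (norm (sumD es - a n *\<^sub>R v) < \<delta> * a n)" for es
      proof (cases "norm (sumD es - a n *\<^sub>R v) < \<delta>' * a n")
        case True
        have "\<theta> \<bullet> sumD es = a n * (\<theta> \<bullet> v) + \<theta> \<bullet> (sumD es - a n *\<^sub>R v)"
          by (simp add: inner_diff_right)
        moreover have "\<theta> \<bullet> (sumD es - a n *\<^sub>R v) \<le> norm \<theta> * (\<delta>' * a n)"
          using True by (intro order_trans[OF norm_cauchy_schwarz] mult_left_mono) auto
        ultimately have "tilt n * (\<theta> \<bullet> sumD es) \<le> tilt n * (a n * (2 * \<Lambda>) + norm \<theta> * (\<delta>' * a n))"
          using an \<theta>v by (intro mult_left_mono) auto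
        also have "\<dots> = speed n * (2 * \<Lambda> + \<delta>' * norm \<theta>)"
          using tilt_speed(1)[OF elim(5)] by (simp add: distrib_left) (metis mult.assoc mult.commute)
        finally have "exp (- (speed n * (2 * \<Lambda> + \<delta>' * norm \<theta>))) * ?E es \<le> 1"
          by (simp add: exp_add[symmetric])
        moreover have "norm (sumD es - a n *\<^sub>R v) < \<delta> * a n"
          using True \<delta>'(2) an by (meson less_le_trans mult_right_mono less_imp_le)
        ultimately show ?thesis
          using True by simp
      qed simp
      \<comment> \<open>Outside the ball some direction \<open>u\<close> deviates by
        \<open>\<delta>' * a n / CARD('d)\<close>, so the weight is dominated by the more strongly
        tilted one for this \<open>u\<close>.\<close>
      have far: "?E es \<le> ?E es * ?cl es + (\<Sum>u\<in>dirs. exp (- (speed n * (\<kappa> * (u \<bullet> v) + 2 * c))) * exp (tilt n * ((\<theta> + \<kappa> *\<^sub>R u) \<bullet> sumD es)))" for es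
      proof (cases "norm (sumD es - a n *\<^sub>R v) < \<delta>' * a n")
        case False
        then obtain u where u: "u \<in> dirs" "\<delta>' * a n / ?d \<le> u \<bullet> (sumD es - a n *\<^sub>R v)"
          using norm_gt_dirs[of "\<delta>' * a n"] by (metis not_less)
        have "0 \<le> tilt n * \<kappa>"
          using an \<kappa>(1) by simp
        from mult_left_mono[OF u(2) this]
        have "speed n * (2 * c) + speed n * (\<kappa> * (u \<bullet> v)) \<le> tilt n * (\<kappa> * (u \<bullet> sumD es))"
          unfolding tilt_speed(1)[OF elim(5), symmetric] by (simp add: c_def inner_diff_right algebra_simps)
        then have "?E es \<le> exp (- (speed n * (\<kappa> * (u \<bullet> v) + 2 * c))) * exp (tilt n * ((\<theta> + \<kappa> *\<^sub>R u) \<bullet> sumD es))"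
          by (simp add: exp_add[symmetric] inner_add_left algebra_simps)
        also have "\<dots> \<le> (\<Sum>u\<in>dirs. exp (- (speed n * (\<kappa> * (u \<bullet> v) + 2 * c))) * exp (tilt n * ((\<theta> + \<kappa> *\<^sub>R u) \<bullet> sumD es)))"
          by (rule member_le_sum[OF u(1) _ finite_dirs, where f = "\<lambda>u. exp (- (speed n * (\<kappa> * (u \<bullet> v) + 2 * c))) * exp (tilt n * ((\<theta> + \<kappa> *\<^sub>R u) \<bullet> sumD es))"]) simp
        finally show ?thesis
          using False by simp
      qed (simp add: sum_nonneg)
      have farE: "expect ?N y (\<lambda>es. exp (- (speed n * (\<kappa> * (u \<bullet> v) + 2 * c))) * exp (tilt n * ((\<theta> + \<kappa> *\<^sub>R u) \<bullet> sumD es))) \<le> exp (speed n * (\<Lambda> - 3 * c / 4))"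
        if u: "u \<in> dirs" for u
      proof -
        have "expect ?N y (\<lambda>es. exp (- (speed n * (\<kappa> * (u \<bullet> v) + 2 * c))) * exp (tilt n * ((\<theta> + \<kappa> *\<^sub>R u) \<bullet> sumD es)))
           = exp (- (speed n * (\<kappa> * (u \<bullet> v) + 2 * c))) * expect ?N y (\<lambda>es. exp (tilt n * ((\<theta> + \<kappa> *\<^sub>R u) \<bullet> sumD es)))"
          by (rule expect_cmult)
        also have "\<dots> \<le> exp (- (speed n * (\<kappa> * (u \<bullet> v) + 2 * c))) * exp (speed n * (cov (\<theta> + \<kappa> *\<^sub>R u) (\<theta> + \<kappa> *\<^sub>R u) / (2 * real K) + c / 4))"
          using elim(1) u by (intro mult_left_mono) auto
        also have "\<dots> = exp (speed n * (cov (\<theta> + \<kappa> *\<^sub>R u) (\<theta> + \<kappa> *\<^sub>R u) / (2 * real K) + c / 4 - (\<kappa> * (u \<bullet> v) + 2 * c)))"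
          by (simp add: exp_add[symmetric] algebra_simps)
        also have "\<dots> \<le> exp (speed n * (\<Lambda> - 3 * c / 4))"
        proof -
          have "cov (\<theta> + \<kappa> *\<^sub>R u) (\<theta> + \<kappa> *\<^sub>R u) = 2 * real K * \<Lambda> + 2 * real K * (\<kappa> * (u \<bullet> v)) + \<kappa>\<^sup>2 * cov u u"
            unfolding \<theta>_def cov_tilted by (simp add: \<Lambda>_def cov_scale_left cov_scale_right power2_eq_square inner_commute)
          then have "cov (\<theta> + \<kappa> *\<^sub>R u) (\<theta> + \<kappa> *\<^sub>R u) / (2 * real K) = \<Lambda> + \<kappa> * (u \<bullet> v) + \<kappa> * (\<kappa> * cov u u / (2 * real K))"
            using K by (simp add: field_simps power2_eq_square)
          moreover have "\<kappa> * (\<delta>' / (2 * ?d)) = c"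
            by (simp add: c_def)
          moreover have "\<kappa> * (\<kappa> * cov u u / (2 * real K)) \<le> \<kappa> * (\<delta>' / (2 * ?d))"
          proof (intro mult_left_mono)
            have "\<kappa> * cov u u / (2 * real K) \<le> \<kappa> * maxcov / (2 * real K)"
              using maxcov(1)[OF u] \<kappa>(1) K by (intro divide_right_mono mult_left_mono) auto
            then show "\<kappa> * cov u u / (2 * real K) \<le> \<delta>' / (2 * ?d)"
              using \<kappa>(3) by linarith
          qed (use \<kappa>(1) in simp)
          ultimately have "cov (\<theta> + \<kappa> *\<^sub>R u) (\<theta> + \<kappa> *\<^sub>R u) / (2 * real K) + c / 4 - (\<kappa> * (u \<bullet> v) + 2 * c) \<le> \<Lambda> - 3 * c / 4"
            by linarith
          then show ?thesis
            using elim(4) by simp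
        qed
        finally show ?thesis .
      qed
      have "exp (speed n * (\<Lambda> - c / 4)) \<le> expect ?N y ?E"
        using elim(2) by (simp add: cov\<theta>)
      also have "\<dots> \<le> expect ?N y (\<lambda>es. ?E es * ?cl es + (\<Sum>u\<in>dirs. exp (- (speed n * (\<kappa> * (u \<bullet> v) + 2 * c))) * exp (tilt n * ((\<theta> + \<kappa> *\<^sub>R u) \<bullet> sumD es))))"
        by (intro expect_mono far)
      also have "\<dots> \<le> expect ?N y (\<lambda>es. ?E es * ?cl es) + (\<Sum>u\<in>dirs. exp (speed n * (\<Lambda> - 3 * c / 4)))"
        unfolding expect_add expect_sum[OF finite_dirs] by (intro add_left_mono sum_mono farE)
      \<comment> \<open>The exponents differ by \<open>c / 2\<close>, which eventually beats twice
        the number of directions: at most half of the tilted mass sits outside the ball.\<close>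
      also have "(\<Sum>u\<in>dirs. exp (speed n * (\<Lambda> - 3 * c / 4))) \<le> exp (speed n * (\<Lambda> - c / 4)) / 2"
      proof -
        have "speed n * (\<Lambda> - c / 4) = speed n * (c / 2) + speed n * (\<Lambda> - 3 * c / 4)"
          by (simp add: algebra_simps)
        then have "exp (speed n * (\<Lambda> - c / 4)) = exp (speed n * (c / 2)) * exp (speed n * (\<Lambda> - 3 * c / 4))"
          by (simp only: exp_add)
        moreover have "2 * real (card dirs) * exp (speed n * (\<Lambda> - 3 * c / 4)) \<le> exp (speed n * (c / 2)) * exp (speed n * (\<Lambda> - 3 * c / 4))"
          using elim(6) by (intro mult_right_mono) auto
        ultimately show ?thesis
          by simp
      qed
      finally have half: "exp (speed n * (\<Lambda> - c / 4)) / 2 \<le> expect ?N y (\<lambda>es. ?E es * ?cl es)"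
        by linarith
      have "exp (- (speed n * (\<Lambda> + \<eta>))) \<le> exp (- (speed n * (2 * \<Lambda> + \<delta>' * norm \<theta>))) * exp (speed n * (\<Lambda> - c / 2))"
      proof -
        have "speed n * (- (\<Lambda> + \<eta>)) \<le> speed n * (- (2 * \<Lambda> + \<delta>' * norm \<theta>) + (\<Lambda> - c / 2))"
          using c(2) \<delta>'(3) elim(4) by (intro mult_left_mono) auto
        then show ?thesis
          by (simp add: exp_add[symmetric] algebra_simps)
      qed
      also have "\<dots> \<le> exp (- (speed n * (2 * \<Lambda> + \<delta>' * norm \<theta>))) * expect ?N y (\<lambda>es. ?E es * ?cl es)"
      proof (intro mult_left_mono)
        have "speed n * (\<Lambda> - c / 4) = speed n * (c / 4) + speed n * (\<Lambda> - c / 2)"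
          by (simp add: algebra_simps)
        then have "exp (speed n * (\<Lambda> - c / 4)) = exp (speed n * (c / 4)) * exp (speed n * (\<Lambda> - c / 2))"
          by (simp only: exp_add)
        moreover have "2 * exp (speed n * (\<Lambda> - c / 2)) \<le> exp (speed n * (c / 4)) * exp (speed n * (\<Lambda> - c / 2))"
          using elim(3) by (intro mult_right_mono) auto
        ultimately show "exp (speed n * (\<Lambda> - c / 2)) \<le> expect ?N y (\<lambda>es. ?E es * ?cl es)"
          using half by linarith
      qed simp
      also have "\<dots> = expect ?N y (\<lambda>es. exp (- (speed n * (2 * \<Lambda> + \<delta>' * norm \<theta>))) * (?E es * ?cl es))"
        by (rule expect_cmult[symmetric])
      also have "\<dots> \<le> expect ?N y (\<lambda>es. of_bool (norm (sumD es - a n *\<^sub>R v) < \<delta> * a n))"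
        by (intro expect_mono low)
      finally show "exp (- (speed n * (K / 2 * Q v + \<eta>))) \<le> expect ?N y (\<lambda>es. of_bool (norm (sumD es - a n *\<^sub>R v) < \<delta> * a n))"
        by (simp add: \<Lambda>_def)
    qed
  qed
qed

lemma Q_diff: "Q (v - w) = Q v - 2 * (J w \<bullet> v) + Q w"
proof -
  have "J v \<bullet> w = J w \<bullet> v"
    using cov_J[of w "J v"] cov_J[of v "J w"] by (simp add: cov_commute inner_commute)
  then show ?thesis
    by (simp add: Q_def linear_diff[OF linear_J] inner_diff_left inner_diff_right)
qed

lemma continuous_Q: "continuous_on A Q"
  unfolding Q_def[abs_def] by (intro continuous_intros linear_continuous_on linear_J[unfolded linear_conv_bounded_linear])

text \<open>The quadratic form lies above its tangent at \<open>w\<close> by exactly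
  \<open>Q (x - w)\<close>. Truncation makes the values range over a compact ball, finitely many
  tangents approximate the form there up to \<open>\<eta> / 4\<close>, and the exponential of each
  tangent has expectation close to 1 on the exponential scale.\<close>

lemma block_upper:
  assumes K: "0 < K" and \<eta>: "0 < \<eta>"
  shows "\<forall>\<^sub>F n in sequentially. \<forall>y.
    expect (n div K) y (\<lambda>es. of_bool (norm (sumD es) \<le> R * a n) * exp (speed n * (K / 2 * Q (sumD es /\<^sub>R a n)))) \<le> exp (speed n * \<eta>)"
proof -
  define nb where "nb = (\<lambda>w. {x. K / 2 * Q (x - w) < \<eta> / 4})"
  have "open (nb w)" for w
    unfolding nb_def
    by (intro open_Collect_less continuous_intros continuous_on_compose2[OF continuous_Q]) auto
  then have op: "\<And>w. w \<in> cball 0 R \<Longrightarrow> open (nb w)"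
    by blast
  have "w \<in> nb w" for w
    using \<eta> by (simp add: nb_def Q_def linear_0[OF linear_J])
  then have cover: "cball 0 R \<subseteq> (\<Union>w\<in>cball 0 R. nb w)"
    by blast
  obtain T where T: "T \<subseteq> cball 0 R" "finite T" "cball 0 R \<subseteq> (\<Union>w\<in>T. nb w)"
    by (rule compactE_image[OF compact_cball op cover])
  have e4: "0 < \<eta> / 4" and e2: "0 < \<eta> / 2"
    using \<eta> by auto
  have "\<forall>\<^sub>F n in sequentially. \<forall>w\<in>T. \<forall>y.
     expect (n div K) y (\<lambda>es. exp (tilt n * ((real K *\<^sub>R J w) \<bullet> sumD es))) \<le> exp (speed n * (cov (real K *\<^sub>R J w) (real K *\<^sub>R J w) / (2 * real K) + \<eta> / 4))"
  proof (intro eventually_ball_finite T(2) ballI)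
    fix w
    show "\<forall>\<^sub>F n in sequentially. \<forall>y. expect (n div K) y (\<lambda>es. exp (tilt n * ((real K *\<^sub>R J w) \<bullet> sumD es)))
        \<le> exp (speed n * (cov (real K *\<^sub>R J w) (real K *\<^sub>R J w) / (2 * real K) + \<eta> / 4))"
      using block_laplace[OF K e4, of "real K *\<^sub>R J w"] by (rule eventually_mono) blast
  qed
  then show ?thesis
    using eventually_exp_speed[OF e2, of "card T"] eventually_speed_gt[of 0] eventually_ge_at_top[of 1]
  proof eventually_elim
    case (elim n)
    let ?N = "n div K"
    have an: "0 < a n"
      using a_pos[of n] elim(4) by auto
    show ?case
    proof
      fix y
      define F where "F = (\<lambda>w es. exp (speed n * (\<eta> / 4 - K / 2 * Q w)) * exp (tilt n * ((real K *\<^sub>R J w) \<bullet> sumD es)))"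
      have "expect ?N y (\<lambda>es. of_bool (norm (sumD es) \<le> R * a n) * exp (speed n * (K / 2 * Q (sumD es /\<^sub>R a n)))) \<le> expect ?N y (\<lambda>es. \<Sum>w\<in>T. F w es)"
      proof (rule expect_mono)
        fix es :: "'e0 list"
        show "of_bool (norm (sumD es) \<le> R * a n) * exp (speed n * (K / 2 * Q (sumD es /\<^sub>R a n))) \<le> (\<Sum>w\<in>T. F w es)"
        proof (cases "norm (sumD es) \<le> R * a n")
          case True
          define x where "x = sumD es /\<^sub>R a n"
          have "x \<in> cball 0 R"
            using True an by (simp add: x_def field_simps)
          then obtain w where w: "w \<in> T" "x \<in> nb w"
            using T(3) by auto
          have "K / 2 * Q x \<le> K * (J w \<bullet> x) + (\<eta> / 4 - K / 2 * Q w)"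
            using w(2) by (simp add: nb_def Q_diff algebra_simps)
          then have "speed n * (K / 2 * Q x) \<le> speed n * (K * (J w \<bullet> x)) + speed n * (\<eta> / 4 - K / 2 * Q w)"
            using elim(3) by (metis distrib_left mult_left_mono less_imp_le)
          also have "speed n * (K * (J w \<bullet> x)) = tilt n * ((real K *\<^sub>R J w) \<bullet> sumD es)"
            unfolding tilt_speed(1)[OF elim(4), symmetric] using an by (simp add: x_def)
          finally have "exp (speed n * (K / 2 * Q x)) \<le> F w es"
            by (simp add: F_def exp_add[symmetric])
          also have "\<dots> \<le> (\<Sum>w\<in>T. F w es)"
            using w(1) T(2) by (intro member_le_sum) (auto simp: F_def)
          finally show ?thesis
            using True by (simp add: x_def)
        qed (simp add: F_def sum_nonneg)
      qed
      also have "\<dots> = (\<Sum>w\<in>T. expect ?N y (F w))"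
        by (rule expect_sum[OF T(2)])
      also have "\<dots> \<le> (\<Sum>w\<in>T. exp (speed n * (\<eta> / 2)))"
      proof (rule sum_mono)
        fix w assume w: "w \<in> T"
        have "expect ?N y (F w) = exp (speed n * (\<eta> / 4 - K / 2 * Q w)) * expect ?N y (\<lambda>es. exp (tilt n * ((real K *\<^sub>R J w) \<bullet> sumD es)))"
          unfolding F_def by (rule expect_cmult)
        also have "\<dots> \<le> exp (speed n * (\<eta> / 4 - K / 2 * Q w)) * exp (speed n * (cov (real K *\<^sub>R J w) (real K *\<^sub>R J w) / (2 * real K) + \<eta> / 4))"
          using elim(1) w by (intro mult_left_mono) auto
        also have "cov (real K *\<^sub>R J w) (real K *\<^sub>R J w) / (2 * real K) = K / 2 * Q w"
          using K by (simp add: cov_scale_left cov_scale_right Q_cov(1))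
        finally show "expect ?N y (F w) \<le> exp (speed n * (\<eta> / 2))"
          by (simp add: exp_add[symmetric] algebra_simps)
      qed
      also have "\<dots> \<le> exp (speed n * (\<eta> / 2)) * exp (speed n * (\<eta> / 2))"
        using elim(2) by (simp add: mult_right_mono)
      also have "\<dots> = exp (speed n * \<eta>)"
        by (simp add: exp_add[symmetric] algebra_simps)
      finally show "expect ?N y (\<lambda>es. of_bool (norm (sumD es) \<le> R * a n) * exp (speed n * (K / 2 * Q (sumD es /\<^sub>R a n)))) \<le> exp (speed n * \<eta>)" .
    qed
  qed
qed

lemma osc_blocks:
  assumes "\<And>y. expect (n div K) y (\<lambda>es. of_bool (\<exists>k\<le>n div K. \<delta> * a n < norm (sumD (take k es)))) \<le> u"
  shows "expect n y (\<lambda>es. of_bool (\<exists>j<K. \<exists>k\<le>n div K. \<delta> * a n < norm (sumD (take k (block (n div K) j es))))) \<le> real K * u"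
proof -
  let ?N = "n div K"
  let ?P = "\<lambda>es. of_bool (\<exists>k\<le>?N. \<delta> * a n < norm (sumD (take k es))) :: real"
  have "expect n y (\<lambda>es. of_bool (\<exists>j<K. \<exists>k\<le>?N. \<delta> * a n < norm (sumD (take k (block ?N j es))))) \<le> expect n y (\<lambda>es. \<Sum>j<K. ?P (block ?N j es))"
  proof (rule expect_mono)
    fix es :: "'e0 list"
    show "of_bool (\<exists>j<K. \<exists>k\<le>?N. \<delta> * a n < norm (sumD (take k (block ?N j es)))) \<le> (\<Sum>j<K. ?P (block ?N j es))"
    proof (cases "\<exists>j<K. \<exists>k\<le>?N. \<delta> * a n < norm (sumD (take k (block ?N j es)))")
      case True
      then obtain j where j: "j < K" "?P (block ?N j es) = 1"
        by auto
      have "?P (block ?N j es) \<le> (\<Sum>j<K. ?P (block ?N j es))"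
        using j(1) by (intro member_le_sum[where f = "\<lambda>j. ?P (block ?N j es)"]) auto
      then show ?thesis
        using j(2) True by simp
    next
      case False
      show ?thesis
        unfolding of_bool_def if_not_P[OF False] by (intro sum_nonneg) simp
    qed
  qed
  also have "\<dots> = (\<Sum>j<K. expect n y (\<lambda>es. ?P (block ?N j es)))"
    by (rule expect_sum) simp
  also have "\<dots> \<le> (\<Sum>j<K. u)"
  proof (intro sum_mono expect_block_le assms)
    fix j assume "j \<in> {..<K}"
    then have "Suc j * ?N \<le> K * ?N"
      by (intro mult_le_mono) auto
    then show "Suc j * ?N \<le> n"
      by (meson le_trans times_div_less_eq_dividend)
  qed
  finally show ?thesis
    by simp
qed

text \<open>The last \<open>n mod K\<close> edges belong to no block and integrate out.\<close>

lemma expect_all_blocks: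
  assumes F: "\<And>j es. 0 \<le> F j es"
  shows "(\<And>j y. j < K \<Longrightarrow> expect (n div K) y (F j) \<le> u j) \<Longrightarrow> expect n y (\<lambda>es. \<Prod>j<K. F j (block (n div K) j es)) \<le> (\<Prod>j<K. u j)"
    and "(\<And>j y. j < K \<Longrightarrow> 0 \<le> l j \<and> l j \<le> expect (n div K) y (F j)) \<Longrightarrow> (\<Prod>j<K. l j) \<le> expect n y (\<lambda>es. \<Prod>j<K. F j (block (n div K) j es))"
proof -
  have "expect n y (\<lambda>es. \<Prod>j<K. F j (block (n div K) j es)) = expect n y (\<lambda>es. \<Prod>j<K. F j (block (n div K) j (take (K * (n div K)) es)))"
  proof (intro expect_cong prod.cong refl arg_cong[where f = "F _"])
    fix j and es :: "'e0 list" assume "j \<in> {..<K}"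
    then have "Suc j * (n div K) \<le> K * (n div K)"
      by (intro mult_le_mono) auto
    then have "n div K \<le> K * (n div K) - j * (n div K)"
      by simp
    then show "block (n div K) j es = block (n div K) j (take (K * (n div K)) es)"
      by (simp add: block_def drop_take min_absorb1)
  qed
  also have "\<dots> = expect (K * (n div K)) y (\<lambda>es. \<Prod>j<K. F j (block (n div K) j es))"
    by (rule expect_take) simp
  finally have eq: "expect n y (\<lambda>es. \<Prod>j<K. F j (block (n div K) j es)) = expect (K * (n div K)) y (\<lambda>es. \<Prod>j<K. F j (block (n div K) j es))" .
  show "(\<And>j y. j < K \<Longrightarrow> expect (n div K) y (F j) \<le> u j) \<Longrightarrow> expect n y (\<lambda>es. \<Prod>j<K. F j (block (n div K) j es)) \<le> (\<Prod>j<K. u j)"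
    unfolding eq by (rule expect_blocks(1)[OF F])
  show "(\<And>j y. j < K \<Longrightarrow> 0 \<le> l j \<and> l j \<le> expect (n div K) y (F j)) \<Longrightarrow> (\<Prod>j<K. l j) \<le> expect n y (\<lambda>es. \<Prod>j<K. F j (block (n div K) j es))"
    unfolding eq by (rule expect_blocks(2)[OF F])
qed

lemma grid_lower:
  assumes K: "0 < K" and \<delta>: "0 < \<delta>" and \<eta>: "0 < \<eta>"
  shows "\<forall>\<^sub>F n in sequentially. \<forall>y.
    exp (- (speed n * ((\<Sum>j<K. K / 2 * Q (v j)) + \<eta>)))
      \<le> expect n y (\<lambda>es. of_bool (\<forall>j<K. norm (sumD (block (n div K) j es) - a n *\<^sub>R v j) < \<delta> * a n))"
proof -
  have eK: "0 < \<eta> / K"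
    using K \<eta> by simp
  have "\<forall>\<^sub>F n in sequentially. \<forall>j\<in>{..<K}. \<forall>y.
    exp (- (speed n * (K / 2 * Q (v j) + \<eta> / K))) \<le> expect (n div K) y (\<lambda>es. of_bool (norm (sumD es - a n *\<^sub>R v j) < \<delta> * a n))"
    by (intro eventually_ball_finite ballI block_lower[OF K \<delta> eK]) auto
  then show ?thesis
  proof eventually_elim
    case (elim n)
    show ?case
    proof
      fix y
      have "exp (- (speed n * ((\<Sum>j<K. K / 2 * Q (v j)) + \<eta>))) = (\<Prod>j<K. exp (- (speed n * (K / 2 * Q (v j) + \<eta> / K))))"
        using K by (simp add: exp_sum[symmetric] sum_negf sum_distrib_left[symmetric] sum.distrib)
      also have "\<dots> \<le> expect n y (\<lambda>es. \<Prod>j<K. of_bool (norm (sumD (block (n div K) j es) - a n *\<^sub>R v j) < \<delta> * a n))"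
        using elim by (intro expect_all_blocks(2)[where F = "\<lambda>j es. of_bool (norm (sumD es - a n *\<^sub>R v j) < \<delta> * a n)"]) auto
      also have "\<dots> \<le> expect n y (\<lambda>es. of_bool (\<forall>j<K. norm (sumD (block (n div K) j es) - a n *\<^sub>R v j) < \<delta> * a n))"
      proof (rule expect_mono)
        fix es :: "'e0 list"
        show "(\<Prod>j<K. of_bool (norm (sumD (block (n div K) j es) - a n *\<^sub>R v j) < \<delta> * a n))
            \<le> (of_bool (\<forall>j<K. norm (sumD (block (n div K) j es) - a n *\<^sub>R v j) < \<delta> * a n) :: real)"
        proof (cases "\<forall>j<K. norm (sumD (block (n div K) j es) - a n *\<^sub>R v j) < \<delta> * a n")
          case False
          then have zero: "(\<Prod>j<K. of_bool (norm (sumD (block (n div K) j es) - a n *\<^sub>R v j) < \<delta> * a n)) = (0 :: real)"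
            by (intro prod_zero) auto
          show ?thesis
            unfolding zero by simp
        qed simp
      qed
      finally show "exp (- (speed n * ((\<Sum>j<K. K / 2 * Q (v j)) + \<eta>)))
          \<le> expect n y (\<lambda>es. of_bool (\<forall>j<K. norm (sumD (block (n div K) j es) - a n *\<^sub>R v j) < \<delta> * a n))" .
    qed
  qed
qed

text \<open>Exponential Chebyshev inequality with the energy itself in the exponent; the truncated
  exponential moments factor over the blocks and cost only \<eta> in total.\<close>

lemma grid_upper:
  assumes K: "0 < K" and \<eta>: "0 < \<eta>"
  shows "\<forall>\<^sub>F n in sequentially. \<forall>y.
    expect n y (\<lambda>es. of_bool (\<alpha> < (\<Sum>j<K. K / 2 * Q (sumD (block (n div K) j es) /\<^sub>R a n)) \<and> (\<forall>j<K. norm (sumD (block (n div K) j es)) \<le> R * a n)))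
      \<le> exp (- (speed n * (\<alpha> - \<eta>)))"
proof -
  have eK: "0 < \<eta> / K"
    using K \<eta> by simp
  show ?thesis
    using block_upper[OF K eK, of R] eventually_speed_gt[of 0]
  proof eventually_elim
    case (elim n)
    define F where "F = (\<lambda>es. of_bool (norm (sumD es) \<le> R * a n) * exp (speed n * (K / 2 * Q (sumD es /\<^sub>R a n))))"
    show ?case
    proof
      fix y
      have "expect n y (\<lambda>es. of_bool (\<alpha> < (\<Sum>j<K. K / 2 * Q (sumD (block (n div K) j es) /\<^sub>R a n)) \<and> (\<forall>j<K. norm (sumD (block (n div K) j es)) \<le> R * a n)))
        \<le> expect n y (\<lambda>es. exp (- (speed n * \<alpha>)) * (\<Prod>j<K. F (block (n div K) j es)))"
      proof (rule expect_mono)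
        fix es :: "'e0 list"
        let ?S = "\<lambda>j. sumD (block (n div K) j es)"
        show "of_bool (\<alpha> < (\<Sum>j<K. K / 2 * Q (?S j /\<^sub>R a n)) \<and> (\<forall>j<K. norm (?S j) \<le> R * a n))
           \<le> exp (- (speed n * \<alpha>)) * (\<Prod>j<K. F (block (n div K) j es))"
        proof (cases "\<alpha> < (\<Sum>j<K. K / 2 * Q (?S j /\<^sub>R a n)) \<and> (\<forall>j<K. norm (?S j) \<le> R * a n)")
          case True
          have "(\<Prod>j<K. F (block (n div K) j es)) = exp (speed n * (\<Sum>j<K. K / 2 * Q (?S j /\<^sub>R a n)))"
            using True by (simp add: F_def exp_sum sum_distrib_left)
          moreover have "speed n * \<alpha> \<le> speed n * (\<Sum>j<K. K / 2 * Q (?S j /\<^sub>R a n))"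
            using True elim(2) by (intro mult_left_mono) auto
          ultimately show ?thesis
            using True by (simp add: exp_add[symmetric])
        next
          case False
          show ?thesis
            unfolding of_bool_def if_not_P[OF False]
            by (intro mult_nonneg_nonneg prod_nonneg) (auto simp: F_def)
        qed
      qed
      also have "\<dots> = exp (- (speed n * \<alpha>)) * expect n y (\<lambda>es. \<Prod>j<K. F (block (n div K) j es))"
        by (rule expect_cmult)
      also have "\<dots> \<le> exp (- (speed n * \<alpha>)) * (\<Prod>j<K. exp (speed n * (\<eta> / K)))"
        using elim(1) by (intro mult_left_mono expect_all_blocks(1)[where F = "\<lambda>j. F"]) (auto simp: F_def)
      also have "\<dots> = exp (- (speed n * (\<alpha> - \<eta>)))"
        using K by (simp add: exp_of_nat_mult[symmetric] exp_add[symmetric] algebra_simps)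
      finally show "expect n y (\<lambda>es. of_bool (\<alpha> < (\<Sum>j<K. K / 2 * Q (sumD (block (n div K) j es) /\<^sub>R a n)) \<and> (\<forall>j<K. norm (sumD (block (n div K) j es)) \<le> R * a n)))
        \<le> exp (- (speed n * (\<alpha> - \<eta>)))" .
    qed
  qed
qed

end

section \<open>The logarithm modulo commutators\<close>

lemma Ck_on_1: "Ck_on (Suc 0) S f \<longleftrightarrow>
    (\<forall>x\<in>S. f differentiable (at x)) \<and> (\<forall>v. continuous_on S (\<lambda>x. frechet_derivative f (at x) v))"
  by simp

lemma smooth_on_C1: "smooth_on S f \<Longrightarrow> Ck_on (Suc 0) S f"
  by (simp only: smooth_on_def)

lemma C1_compose:
  fixes f :: "'a::euclidean_space \<Rightarrow> 'b::euclidean_space" and g :: "'b \<Rightarrow> 'c::euclidean_space"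
  assumes f: "Ck_on (Suc 0) S f" and g: "Ck_on (Suc 0) T g" and fS: "f ` S \<subseteq> T"
  shows "Ck_on (Suc 0) S (g \<circ> f)"
proof -
  have df: "f differentiable (at x)" and dg: "g differentiable (at (f x))" if "x \<in> S" for x
    using f g fS that by (auto simp: Ck_on_1)
  \<comment> \<open>\<open>Ck_on\<close> controls the derivative in fixed directions only. Expanding
    the moving direction in the basis reduces the chain rule to these.\<close>
  have D: "frechet_derivative (g \<circ> f) (at x) v =
      (\<Sum>i\<in>Basis. (frechet_derivative f (at x) v \<bullet> i) *\<^sub>R frechet_derivative g (at (f x)) i)" if x: "x \<in> S" for x v
  proof -
    have lin: "linear (frechet_derivative g (at (f x)))"
      using dg[OF x] by (rule linear_frechet_derivative)
    have "frechet_derivative (g \<circ> f) (at x) v = frechet_derivative g (at (f x)) (frechet_derivative f (at x) v)"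
      using frechet_derivative_compose[OF df[OF x] dg[OF x]] by simp
    also have "\<dots> = frechet_derivative g (at (f x)) (\<Sum>i\<in>Basis. (frechet_derivative f (at x) v \<bullet> i) *\<^sub>R i)"
      by (simp add: euclidean_representation)
    also have "\<dots> = (\<Sum>i\<in>Basis. (frechet_derivative f (at x) v \<bullet> i) *\<^sub>R frechet_derivative g (at (f x)) i)"
      by (simp add: linear_sum[OF lin] linear_scale[OF lin])
    finally show ?thesis .
  qed
  have contf: "continuous_on S f"
    using df differentiable_imp_continuous_within by (intro continuous_at_imp_continuous_on) blast
  have "continuous_on S (\<lambda>x. frechet_derivative (g \<circ> f) (at x) v)" for v
  proof -
    have "continuous_on S (\<lambda>x. \<Sum>i\<in>Basis. (frechet_derivative f (at x) v \<bullet> i) *\<^sub>R frechet_derivative g (at (f x)) i)"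
    proof (intro continuous_intros)
      show "continuous_on S (\<lambda>x. frechet_derivative f (at x) v)"
        using f by (simp add: Ck_on_1)
      fix i
      have "continuous_on T (\<lambda>y. frechet_derivative g (at y) i)"
        using g by (simp add: Ck_on_1)
      then show "continuous_on S (\<lambda>x. frechet_derivative g (at (f x)) i)"
        by (rule continuous_on_compose2[OF _ contf fS])
    qed
    then show ?thesis
      by (rule continuous_on_eq) (simp add: D)
  qed
  moreover have "(g \<circ> f) differentiable (at x)" if "x \<in> S" for x
    using df[OF that] dg[OF that] by (rule differentiable_chain_at)
  ultimately show ?thesis
    by (simp add: Ck_on_1)
qed

lemma C1_map_prod:
  fixes f :: "'a::euclidean_space \<Rightarrow> 'b::euclidean_space" and g :: "'c::euclidean_space \<Rightarrow> 'd::euclidean_space"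
  assumes f: "Ck_on (Suc 0) S f" and g: "Ck_on (Suc 0) T g"
  shows "Ck_on (Suc 0) (S \<times> T) (map_prod f g)"
proof -
  have der: "(map_prod f g has_derivative (\<lambda>v. (frechet_derivative f (at (fst z)) (fst v), frechet_derivative g (at (snd z)) (snd v)))) (at z)"
    if z: "z \<in> S \<times> T" for z
  proof -
    have "(f has_derivative frechet_derivative f (at (fst z))) (at (fst z))" "(g has_derivative frechet_derivative g (at (snd z))) (at (snd z))"
      using f g z frechet_derivative_works by (simp_all add: Ck_on_1 mem_Times_iff) blast+
    then have "((\<lambda>z. (f (fst z), g (snd z))) has_derivative (\<lambda>v. (frechet_derivative f (at (fst z)) (fst v), frechet_derivative g (at (snd z)) (snd v)))) (at z)"
      by (intro has_derivative_Pair has_derivative_compose[OF has_derivative_fst[OF has_derivative_ident]]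
          has_derivative_compose[OF has_derivative_snd[OF has_derivative_ident]])
    then show ?thesis
      by (simp add: map_prod_def case_prod_unfold)
  qed
  have "continuous_on (S \<times> T) (\<lambda>z. frechet_derivative (map_prod f g) (at z) v)" for v
  proof -
    have "continuous_on S (\<lambda>x. frechet_derivative f (at x) (fst v))" "continuous_on T (\<lambda>x. frechet_derivative g (at x) (snd v))"
      using f g by (auto simp: Ck_on_1)
    then have "continuous_on (S \<times> T) (\<lambda>z. (frechet_derivative f (at (fst z)) (fst v), frechet_derivative g (at (snd z)) (snd v)))"
      by (intro continuous_on_Pair continuous_on_compose2[OF _ continuous_on_fst[OF continuous_on_id]]
          continuous_on_compose2[OF _ continuous_on_snd[OF continuous_on_id]]) auto
    then show ?thesis
      by (rule continuous_on_eq) (simp flip: frechet_derivative_at[OF der])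
  qed
  then show ?thesis
    using der unfolding Ck_on_1 differentiable_def by blast
qed

lemma C1_transform_open:
  fixes f :: "'a::euclidean_space \<Rightarrow> 'b::euclidean_space"
  assumes f: "Ck_on (Suc 0) S f" and "open S" and eq: "\<And>x. x \<in> S \<Longrightarrow> f x = g x"
  shows "Ck_on (Suc 0) S g"
proof -
  have g: "(g has_derivative frechet_derivative f (at x)) (at x)" if "x \<in> S" for x
  proof -
    have "(f has_derivative frechet_derivative f (at x)) (at x)"
      using f that frechet_derivative_works by (simp add: Ck_on_1) blast
    then show ?thesis
      by (rule has_derivative_transform_within_open[OF _ assms(2) that eq])
  qed
  have "continuous_on S (\<lambda>x. frechet_derivative g (at x) v)" for v
  proof -
    have "continuous_on S (\<lambda>x. frechet_derivative f (at x) v)"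
      using f by (simp add: Ck_on_1)
    then show ?thesis
      by (rule continuous_on_eq) (simp flip: frechet_derivative_at[OF g])
  qed
  then show ?thesis
    using g by (auto simp: Ck_on_1 differentiable_def)
qed

lemma C1_local:
  fixes f :: "'a::euclidean_space \<Rightarrow> 'b::euclidean_space"
  assumes "\<And>x. \<exists>S. open S \<and> x \<in> S \<and> Ck_on (Suc 0) S f"
  shows "Ck_on (Suc 0) UNIV f"
proof -
  have "isCont (\<lambda>x. frechet_derivative f (at x) v) x" for x v
    using assms[of x] by (auto simp: Ck_on_1 continuous_on_eq_continuous_at)
  then show ?thesis
    using assms by (fastforce simp: Ck_on_1 continuous_on_eq_continuous_at)
qed

text \<open>Scaling by powers of 2 carries any point into the range where the derivative at 0
  approximates \<open>f\<close>, with the relative error unchanged. Differentiability at one point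
  therefore yields linearity.\<close>

lemma doubling_imp_derivative:
  fixes f :: "'a::real_normed_vector \<Rightarrow> 'b::real_normed_vector"
  assumes f': "(f has_derivative f') (at 0)" and dbl: "\<And>x. f (2 *\<^sub>R x) = 2 *\<^sub>R f x"
  shows "f x = f' x"
proof -
  have lin: "linear f'"
    using f' has_derivative_linear by blast
  have f0: "f 0 = 0"
    using dbl[of 0] by (simp add: scaleR_2)
  have pow: "f x = 2 ^ n *\<^sub>R f ((1 / 2 ^ n) *\<^sub>R x)" for n x
  proof (induction n)
    case (Suc n)
    have "f ((1 / 2 ^ n) *\<^sub>R x) = 2 *\<^sub>R f ((1 / 2 ^ Suc n) *\<^sub>R x)"
      using dbl[of "(1 / 2 ^ Suc n) *\<^sub>R x"] by simp
    then show ?case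
      using Suc by simp
  qed simp
  have "norm (f x - f' x) \<le> e * norm x" if e: "0 < e" for e
  proof -
    obtain d where d: "d > 0" "\<And>y. norm (y - 0) < d \<Longrightarrow> norm (f y - f 0 - f' (y - 0)) \<le> e * norm (y - 0)"
      using f' e unfolding has_derivative_at_alt by meson
    obtain n :: nat where "norm x / d < 2 ^ n"
      using real_arch_pow[of 2 "norm x / d"] by auto
    then have "norm ((1 / 2 ^ n) *\<^sub>R x) < d"
      using d(1) by (simp add: field_simps)
    then have *: "norm (f ((1 / 2 ^ n) *\<^sub>R x) - f' ((1 / 2 ^ n) *\<^sub>R x)) \<le> e * norm ((1 / 2 ^ n) *\<^sub>R x)"
      using d(2)[of "(1 / 2 ^ n) *\<^sub>R x"] by (simp add: f0)
    have "f x - f' x = 2 ^ n *\<^sub>R (f ((1 / 2 ^ n) *\<^sub>R x) - f' ((1 / 2 ^ n) *\<^sub>R x))"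
      using pow[of x n] by (simp add: scaleR_diff_right linear_scale[OF lin])
    then have "norm (f x - f' x) = 2 ^ n * norm (f ((1 / 2 ^ n) *\<^sub>R x) - f' ((1 / 2 ^ n) *\<^sub>R x))"
      by simp
    also have "\<dots> \<le> 2 ^ n * (e * norm ((1 / 2 ^ n) *\<^sub>R x))"
      using * by (intro mult_left_mono) auto
    also have "\<dots> = e * norm x"
      by simp
    finally show ?thesis .
  qed
  then have "norm (f x - f' x) \<le> 0 + e" if "0 < e" for e
  proof -
    have "norm (f x - f' x) \<le> (e / (norm x + 1)) * norm x"
      using that by (intro \<open>\<And>e. 0 < e \<Longrightarrow> norm (f x - f' x) \<le> e * norm x\<close>) (simp add: add_nonneg_pos)
    also have "\<dots> \<le> e"
      using that norm_ge_zero[of x] by (simp add: divide_le_eq mult_left_mono del: norm_ge_zero)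
    finally show ?thesis by simp
  qed
  then have "norm (f x - f' x) \<le> 0"
    by (rule field_le_epsilon)
  then show ?thesis
    by simp
qed

lemma has_vector_derivative_line: "((\<lambda>t. t *\<^sub>R V) has_vector_derivative V) (at x within S)"
  by (auto intro!: derivative_eq_intros simp: has_vector_derivative_def)

section \<open>The group law in exponential coordinates\<close>

context nilpotent_lie_group
begin

abbreviation Log :: "'g \<Rightarrow> 'v" where "Log \<equiv> lie_log Exp"

lemma Log_Exp [simp]: "Log (Exp X) = X"
  using bij_Exp by (simp add: lie_log_def bij_is_inj)

lemma Exp_Log [simp]: "Exp (Log g) = g"
  using bij_Exp by (simp add: lie_log_def bij_is_surj surj_f_inv_f)

lemma in_carrier [simp]: "g \<in> carrier G"
  by (simp add: carrier_UNIV)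

lemma Exp_0 [simp]: "Exp 0 = \<one>"
  using one_parameter[of 0 0 0] by (simp add: r_cancel_one')

lemma Exp_minus: "Exp (- X) = inv (Exp X)"
  using one_parameter[of "-1" 1 X] by (intro inv_equality[symmetric]) simp_all

text \<open>The product that the Baker-Campbell-Hausdorff formula describes; here it is handled
  through its C^1 dependence on both factors.\<close>

definition mul :: "'v \<Rightarrow> 'v \<Rightarrow> 'v" where
  "mul X Y = Log (Exp X \<otimes> Exp Y)"

lemma Exp_mul [simp]: "Exp (mul X Y) = Exp X \<otimes> Exp Y"
  by (simp add: mul_def)

lemma Exp_eq_iff: "Exp X = Exp Y \<longleftrightarrow> X = Y"
  using bij_Exp by (meson bij_is_inj inj_eq)

lemma mul_assoc: "mul (mul X Y) Z = mul X (mul Y Z)"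
  by (simp add: Exp_eq_iff[symmetric] m_assoc)

lemma mul_0 [simp]: "mul 0 X = X" "mul X 0 = X"
  by (simp_all add: Exp_eq_iff[symmetric])

lemma mul_scale: "mul (s *\<^sub>R X) (t *\<^sub>R X) = (s + t) *\<^sub>R X"
  by (simp add: Exp_eq_iff[symmetric] one_parameter)

lemma mul_minus: "mul (- X) X = 0" "mul X (- X) = 0"
  using mul_scale[of "-1" X 1] mul_scale[of 1 X "-1"] by simp_all

lemma mul_minus_cancel: "mul (- X) (mul X Y) = Y" "mul X (mul (- X) Y) = Y"
  by (simp_all add: mul_assoc[symmetric] mul_minus)

lemma mul_self: "mul X X = 2 *\<^sub>R X"
  using mul_scale[of 1 X 1] by simp

lemma chart_at: obtains U \<phi> where "(U, \<phi>) \<in> \<A>" "g \<in> U" "open U" "inj_on \<phi> U"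
proof -
  obtain U \<phi> where U: "(U, \<phi>) \<in> \<A>" "g \<in> U"
    using atlas unfolding smooth_atlas_def by blast
  then have "open U" "homeomorphism U (\<phi> ` U) \<phi> (inv_into U \<phi>)"
    using atlas unfolding smooth_atlas_def by blast+
  then show ?thesis
    using that[OF U] by (auto simp: homeomorphism_def intro: inj_on_inverseI)
qed

text \<open>Smoothness is known only in charts of \<open>G\<close>. Near a given pair,
  \<open>mul\<close> is the composition of the chart expressions of \<open>Exp\<close>, of
  multiplication and of \<open>Log\<close>.\<close>

lemma C1_mul: "Ck_on (Suc 0) UNIV (\<lambda>z. mul (fst z) (snd z))"
proof (rule C1_local)
  fix z0 :: "'v \<times> 'v"
  obtain U \<phi> where U: "(U, \<phi>) \<in> \<A>" "Exp (fst z0) \<in> U" "open U" "inj_on \<phi> U"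
    using chart_at .
  obtain V \<psi> where V: "(V, \<psi>) \<in> \<A>" "Exp (snd z0) \<in> V" "open V" "inj_on \<psi> V"
    using chart_at .
  obtain T \<tau> where T: "(T, \<tau>) \<in> \<A>" "Exp (fst z0) \<otimes> Exp (snd z0) \<in> T" "open T" "inj_on \<tau> T"
    using chart_at .
  let ?m = "\<lambda>(g, h). g \<otimes> h"
  have contE: "continuous_on UNIV Exp"
    using smooth_Exp by (simp add: smooth_map_def)
  have contm: "continuous_on UNIV ?m"
    using smooth_mult by (simp add: smooth_map_def)
  define N where "N = {z. Exp (fst z) \<in> U \<and> Exp (snd z) \<in> V \<and> Exp (fst z) \<otimes> Exp (snd z) \<in> T}"
  have "N = (\<lambda>z. Exp (fst z)) -` U \<inter> (\<lambda>z. Exp (snd z)) -` V \<inter> (\<lambda>z. ?m (Exp (fst z), Exp (snd z))) -` T"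
    by (auto simp: N_def)
  also have "open \<dots>"
  proof (intro open_Int open_vimage U(3) V(3) T(3))
    show cE: "continuous_on UNIV (\<lambda>z :: 'v \<times> 'v. Exp (fst z))" "continuous_on UNIV (\<lambda>z :: 'v \<times> 'v. Exp (snd z))"
      by (intro continuous_on_compose2[OF contE] continuous_intros; simp)+
    show "continuous_on UNIV (\<lambda>z :: 'v \<times> 'v. ?m (Exp (fst z), Exp (snd z)))"
      by (rule continuous_on_compose2[OF contm continuous_on_Pair[OF cE]]) auto
  qed
  finally have oN: "open N" .
  have A: "Ck_on (Suc 0) (Exp -` U) (\<phi> \<circ> Exp)" and B: "Ck_on (Suc 0) (Exp -` V) (\<psi> \<circ> Exp)"
    using smooth_Exp U(1) V(1) unfolding smooth_map_def euclidean_atlas_def by (fastforce dest: smooth_on_C1)+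
  define mm where "mm = \<tau> \<circ> ?m \<circ> inv_into (U \<times> V) (map_prod \<phi> \<psi>)"
  have "(U \<times> V, map_prod \<phi> \<psi>) \<in> prod_atlas \<A> \<A>"
    using U(1) V(1) by (auto simp: prod_atlas_def)
  then have m: "Ck_on (Suc 0) (map_prod \<phi> \<psi> ` (U \<times> V \<inter> ?m -` T)) mm"
    using smooth_mult T(1) unfolding smooth_map_def mm_def by (fastforce dest: smooth_on_C1)
  define ll where "ll = Log \<circ> inv_into T \<tau>"
  have L: "Ck_on (Suc 0) (\<tau> ` T) ll"
    using smooth_Log T(1) unfolding smooth_map_def euclidean_atlas_def ll_def by (fastforce dest: smooth_on_C1)
  have AB: "Ck_on (Suc 0) N (map_prod (\<phi> \<circ> Exp) (\<psi> \<circ> Exp))"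
  proof -
    have sub: "N \<subseteq> (Exp -` U) \<times> (Exp -` V)"
      by (auto simp: N_def)
    show ?thesis
      using C1_map_prod[OF A B] sub unfolding Ck_on_1 by (meson continuous_on_subset subsetD)
  qed
  have inj: "inj_on (map_prod \<phi> \<psi>) (U \<times> V)"
    using U(4) V(4) by (rule map_prod_inj_on)
  have mval: "mm (\<phi> (Exp X), \<psi> (Exp Y)) = \<tau> (Exp X \<otimes> Exp Y)" if "(X, Y) \<in> N" for X Y
    using inv_into_f_f[OF inj, of "(Exp X, Exp Y)"] that by (simp add: mm_def N_def)
  have "Ck_on (Suc 0) N (mm \<circ> map_prod (\<phi> \<circ> Exp) (\<psi> \<circ> Exp))"
    by (rule C1_compose[OF AB m]) (force simp: N_def)
  then have "Ck_on (Suc 0) N (ll \<circ> (mm \<circ> map_prod (\<phi> \<circ> Exp) (\<psi> \<circ> Exp)))"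
    by (rule C1_compose[OF _ L]) (use mval in \<open>force simp: N_def\<close>)
  then have "Ck_on (Suc 0) N (\<lambda>z. mul (fst z) (snd z))"
  proof (rule C1_transform_open[OF _ oN])
    fix z assume z: "z \<in> N"
    then have "inv_into T \<tau> (\<tau> (Exp (fst z) \<otimes> Exp (snd z))) = Exp (fst z) \<otimes> Exp (snd z)"
      using T(4) by (simp add: N_def)
    then show "(ll \<circ> (mm \<circ> map_prod (\<phi> \<circ> Exp) (\<psi> \<circ> Exp))) z = mul (fst z) (snd z)"
      using mval[of "fst z" "snd z"] z by (simp add: ll_def mul_def map_prod_def case_prod_beta)
  qed
  moreover have "z0 \<in> N"
    using U V T by (simp add: N_def)
  ultimately show "\<exists>S. open S \<and> z0 \<in> S \<and> Ck_on (Suc 0) S (\<lambda>z. mul (fst z) (snd z))"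
    using oN by blast
qed

definition dmul :: "'v \<Rightarrow> 'v \<Rightarrow> 'v \<Rightarrow> 'v \<Rightarrow> 'v" where
  "dmul X Y V W = frechet_derivative (\<lambda>z. mul (fst z) (snd z)) (at (X, Y)) (V, W)"

lemma has_derivative_mul:
  "((\<lambda>z. mul (fst z) (snd z)) has_derivative (\<lambda>v. dmul X Y (fst v) (snd v))) (at (X, Y))"
proof -
  have "(\<lambda>z. mul (fst z) (snd z)) differentiable (at (X, Y))"
    using C1_mul by (simp only: Ck_on_1) blast
  then show ?thesis
    by (simp add: dmul_def frechet_derivative_works)
qed

lemma mul_has_derivative:
  assumes "(f has_derivative f') (at x)" "(g has_derivative g') (at x)"
  shows "((\<lambda>x. mul (f x) (g x)) has_derivative (\<lambda>v. dmul (f x) (g x) (f' v) (g' v))) (at x)"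
  using has_derivative_compose[OF has_derivative_Pair[OF assms] has_derivative_mul] by simp

lemma mul_has_vector_derivative:
  assumes "(f has_vector_derivative f') (at x)" "(g has_vector_derivative g') (at x)"
  shows "((\<lambda>x. mul (f x) (g x)) has_vector_derivative dmul (f x) (g x) f' g') (at x)"
proof -
  have lin: "linear (\<lambda>v. dmul (f x) (g x) (fst v) (snd v))"
    using has_derivative_mul has_derivative_linear by blast
  show ?thesis
    using mul_has_derivative[of f "\<lambda>t. t *\<^sub>R f'" x g "\<lambda>t. t *\<^sub>R g'"] assms linear_scale[OF lin, of _ "(f', g')"]
    by (simp add: has_vector_derivative_def)
qed

lemma dmul_0: "dmul 0 0 V W = V + W"
proof -
  have lin: "linear (\<lambda>v. dmul 0 0 (fst v) (snd v))"
    using has_derivative_mul has_derivative_linear by blast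
  have "((\<lambda>t. mul (t *\<^sub>R V) 0) has_vector_derivative dmul 0 0 V 0) (at 0)"
    using mul_has_vector_derivative[OF has_vector_derivative_line[of V 0] has_vector_derivative_const[of 0]] by simp
  then have 1: "dmul 0 0 V 0 = V"
    using vector_derivative_unique_at[OF _ has_vector_derivative_line[of V 0]] by simp
  have "((\<lambda>t. mul 0 (t *\<^sub>R W)) has_vector_derivative dmul 0 0 0 W) (at 0)"
    using mul_has_vector_derivative[OF has_vector_derivative_const[of 0] has_vector_derivative_line[of W 0]] by simp
  then have 2: "dmul 0 0 0 W = W"
    using vector_derivative_unique_at[OF _ has_vector_derivative_line[of W 0]] by simp
  show ?thesis
    using linear_add[OF lin, of "(V, 0)" "(0, W)"] 1 2 by simp
qed

definition Ad :: "'v \<Rightarrow> 'v \<Rightarrow> 'v" where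
  "Ad X Y = mul (mul X Y) (- X)"

lemma Exp_Ad: "Exp (Ad X Y) = Exp X \<otimes> Exp Y \<otimes> inv (Exp X)"
  by (simp add: Ad_def Exp_minus)

text \<open>Conjugation respects the group law and \<open>mul Y Y\<close> is
  \<open>2 *\<^sub>R Y\<close>, so \<open>Ad X\<close> commutes with doubling; together with
  differentiability at 0 this makes it linear.\<close>

lemma linear_Ad: "linear (Ad X)"
proof -
  have "((\<lambda>Y. mul (mul X Y) (- X)) has_derivative (\<lambda>v. dmul (mul X 0) (- X) (dmul X 0 0 v) 0)) (at 0)"
    by (intro mul_has_derivative) (auto intro!: derivative_eq_intros)
  then have der: "(Ad X has_derivative (\<lambda>v. dmul (mul X 0) (- X) (dmul X 0 0 v) 0)) (at 0)"
    by (simp add: Ad_def[abs_def])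
  have "Ad X (2 *\<^sub>R Y) = 2 *\<^sub>R Ad X Y" for Y
    unfolding mul_self[symmetric] by (simp add: Ad_def mul_assoc mul_minus_cancel)
  then have "Ad X Y = dmul (mul X 0) (- X) (dmul X 0 0 Y) 0" for Y
    by (rule doubling_imp_derivative[OF der])
  then have "Ad X = (\<lambda>v. dmul (mul X 0) (- X) (dmul X 0 0 v) 0)"
    by blast
  then show ?thesis
    using der has_derivative_linear by metis
qed

lemma lie_Ad_eq: "lie_Ad G Exp (Exp X) Y = Ad X Y"
proof -
  have "(\<lambda>t. Log (Exp X \<otimes> Exp (t *\<^sub>R Y) \<otimes> inv (Exp X))) = (\<lambda>t. t *\<^sub>R Ad X Y)"
  proof
    fix t
    have "Log (Exp X \<otimes> Exp (t *\<^sub>R Y) \<otimes> inv (Exp X)) = Ad X (t *\<^sub>R Y)"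
      by (simp add: Exp_Ad[symmetric])
    then show "Log (Exp X \<otimes> Exp (t *\<^sub>R Y) \<otimes> inv (Exp X)) = t *\<^sub>R Ad X Y"
      by (simp add: linear_scale[OF linear_Ad])
  qed
  then show ?thesis
    unfolding lie_Ad_def by (simp add: vector_derivative_at has_vector_derivative_line)
qed

text \<open>The bracket is defined by a derivative at parameter 0; the homomorphism property of
  \<open>s \<mapsto> Ad (s *\<^sub>R X)\<close> transports it to every \<open>s\<close>.\<close>

lemma Ad_has_derivative_bracket:
  "((\<lambda>s. Ad (s *\<^sub>R X) Y) has_vector_derivative lie_bracket G Exp X (Ad (s *\<^sub>R X) Y)) (at s)"
proof -
  have base: "((\<lambda>u. Ad (u *\<^sub>R X) Z) has_vector_derivative lie_bracket G Exp X Z) (at 0)" for Z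
  proof -
    have "((\<lambda>u. mul (mul (u *\<^sub>R X) Z) (- (u *\<^sub>R X))) has_vector_derivative
        dmul (mul (0 *\<^sub>R X) Z) (- (0 *\<^sub>R X)) (dmul (0 *\<^sub>R X) Z X 0) (- X)) (at 0)"
      by (intro mul_has_vector_derivative) (auto intro!: derivative_eq_intros simp: has_vector_derivative_def)
    then have "(\<lambda>u. Ad (u *\<^sub>R X) Z) differentiable (at 0)"
      unfolding Ad_def by (rule differentiableI_vector)
    then show ?thesis
      by (simp add: lie_bracket_def lie_Ad_eq vector_derivative_works)
  qed
  have shift: "Ad ((u - s) *\<^sub>R X) (Ad (s *\<^sub>R X) Y) = Ad (u *\<^sub>R X) Y" for u
  proof -
    have "mul ((u - s) *\<^sub>R X) (s *\<^sub>R X) = u *\<^sub>R X" "mul (- (s *\<^sub>R X)) (- ((u - s) *\<^sub>R X)) = - (u *\<^sub>R X)"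
      using mul_scale[of "u - s" X s] mul_scale[of "- s" X "- (u - s)"] by (simp_all only: scaleR_minus_left) simp_all
    then show ?thesis
      by (simp add: Ad_def mul_assoc) (simp add: mul_assoc[symmetric])
  qed
  have "((\<lambda>u. Ad ((u - s) *\<^sub>R X) (Ad (s *\<^sub>R X) Y)) has_vector_derivative lie_bracket G Exp X (Ad (s *\<^sub>R X) Y)) (at s)"
    using vector_diff_chain_at[of "\<lambda>u. u - s" 1 s "\<lambda>u. Ad (u *\<^sub>R X) (Ad (s *\<^sub>R X) Y)"] base[of "Ad (s *\<^sub>R X) Y"]
    by (simp add: o_def has_vector_derivative_diff_const)
  then show ?thesis
    by (simp add: shift)
qed

lemma functional_Ad:
  fixes f :: "'v \<Rightarrow> real"
  assumes f: "linear f" and van: "\<And>X Y. f (lie_bracket G Exp X Y) = 0"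
  shows "f (Ad X Y) = f Y"
proof -
  have bl: "bounded_linear f"
    using f by (simp add: linear_conv_bounded_linear)
  have "((\<lambda>s. f (Ad (s *\<^sub>R X) Y)) has_vector_derivative 0) (at s)" for s
    using bounded_linear.has_vector_derivative[OF bl Ad_has_derivative_bracket[of X Y s]] by (simp add: van)
  then have "((\<lambda>s. f (Ad (s *\<^sub>R X) Y)) has_derivative (\<lambda>h. 0)) (at s within UNIV)" for s
    by (simp add: has_vector_derivative_def)
  then have "f (Ad (1 *\<^sub>R X) Y) = f (Ad (0 *\<^sub>R X) Y)"
    by (intro has_derivative_zero_unique[of UNIV "\<lambda>s. f (Ad (s *\<^sub>R X) Y)"]) auto
  then show ?thesis
    by (simp add: Ad_def)
qed

text \<open>Because \<open>exp W\<close> is the square of \<open>exp (W / 2)\<close>, the left-trivialised differential of \<open>exp\<close> at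
  \<open>W\<close>, which is \<open>V \<mapsto> dmul (- W) W 0 V\<close>, is the average of that at \<open>W / 2\<close> and its image under \<open>Ad\<close>. A functional that vanishes on
  brackets does not see \<open>Ad\<close>, so its value is the same at \<open>W\<close>, \<open>W / 2\<close>, \<open>W / 4\<close>, \<dots>, hence at \<open>0\<close>.\<close>

lemma functional_dmul:
  fixes f :: "'v \<Rightarrow> real"
  assumes f: "linear f" and van: "\<And>X Y. f (lie_bracket G Exp X Y) = 0"
  shows "f (dmul (- W) W 0 V) = f V"
proof -
  have half: "f (dmul (- W) W 0 V) = f (dmul (- ((1 / 2) *\<^sub>R W)) ((1 / 2) *\<^sub>R W) 0 V)" for W
  proof -
    let ?H = "(1 / 2) *\<^sub>R W"
    let ?Z = "dmul (- ?H) ?H 0 V"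
    \<comment> \<open>\<open>B h\<close> is the left translate to the origin of the curve through
      \<open>?H\<close>. Squaring \<open>?H + h *\<^sub>R V\<close> produces one copy of
      \<open>B h\<close> conjugated by \<open>- ?H\<close> and one plain copy.\<close>
    define B where "B = (\<lambda>h::real. mul (- ?H) (?H + h *\<^sub>R V))"
    have "(B has_vector_derivative dmul (- ?H) (?H + 0 *\<^sub>R V) 0 V) (at 0)"
      unfolding B_def by (intro mul_has_vector_derivative) (auto intro!: derivative_eq_intros simp: has_vector_derivative_def)
    then have B: "(B has_vector_derivative ?Z) (at 0)" and B0: "B 0 = 0"
      by (simp_all add: B_def mul_minus)
    have lAd: "bounded_linear (Ad (- ?H))"
      using linear_Ad by (simp add: linear_conv_bounded_linear)
    have "((\<lambda>h. mul (Ad (- ?H) (B h)) (B h)) has_vector_derivative dmul (Ad (- ?H) (B 0)) (B 0) (Ad (- ?H) ?Z) ?Z) (at 0)"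
      by (intro mul_has_vector_derivative B bounded_linear.has_vector_derivative[OF lAd])
    then have 1: "((\<lambda>h. mul (Ad (- ?H) (B h)) (B h)) has_vector_derivative Ad (- ?H) ?Z + ?Z) (at 0)"
      by (simp add: B0 linear_0[OF linear_Ad] dmul_0)
    have "mul (- W) (W + h *\<^sub>R (2 *\<^sub>R V)) = mul (Ad (- ?H) (B h)) (B h)" for h
    proof -
      have "?H + h *\<^sub>R V = mul ?H (B h)"
        by (simp add: B_def mul_minus_cancel)
      then have "W + h *\<^sub>R (2 *\<^sub>R V) = mul (mul ?H (B h)) (mul ?H (B h))"
        by (simp add: mul_self scaleR_add_right[symmetric] flip: \<open>?H + h *\<^sub>R V = mul ?H (B h)\<close>) (simp add: scaleR_add_right)
      moreover have "mul (- W) ?H = - ?H"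
        using mul_scale[of "-1" W "1 / 2"] by simp
      ultimately show ?thesis
        by (simp add: Ad_def mul_assoc) (simp add: mul_assoc[symmetric])
    qed
    then have 2: "((\<lambda>h. mul (- W) (W + h *\<^sub>R (2 *\<^sub>R V))) has_vector_derivative Ad (- ?H) ?Z + ?Z) (at 0)"
      using 1 by simp
    have "((\<lambda>h. mul (- W) (W + h *\<^sub>R (2 *\<^sub>R V))) has_vector_derivative dmul (- W) (W + 0 *\<^sub>R (2 *\<^sub>R V)) 0 (2 *\<^sub>R V)) (at 0)"
      by (intro mul_has_vector_derivative) (auto intro!: derivative_eq_intros simp: has_vector_derivative_def)
    then have "dmul (- W) W 0 (2 *\<^sub>R V) = Ad (- ?H) ?Z + ?Z"
      using vector_derivative_unique_at[OF 2] by simp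
    moreover have lin: "linear (\<lambda>v. dmul (- W) W (fst v) (snd v))"
      using has_derivative_mul has_derivative_linear by blast
    have "dmul (- W) W 0 (2 *\<^sub>R V) = 2 *\<^sub>R dmul (- W) W 0 V"
      using linear_scale[OF lin, of 2 "(0, V)"] by simp
    ultimately have "2 * f (dmul (- W) W 0 V) = f (Ad (- ?H) ?Z) + f ?Z"
      by (metis linear_add[OF f] linear_scale[OF f] real_scaleR_def)
    then show ?thesis
      using functional_Ad[OF f van] by simp
  qed
  have pow: "f (dmul (- W) W 0 V) = f (dmul (- ((1 / 2 ^ n) *\<^sub>R W)) ((1 / 2 ^ n) *\<^sub>R W) 0 V)" for n
  proof (induction n)
    case (Suc n)
    then show ?case
      using half[of "(1 / 2 ^ n) *\<^sub>R W"] by simp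
  qed simp
  \<comment> \<open>Continuity of the differential of \<open>mul\<close> at the origin closes the
    halving argument.\<close>
  have "isCont (\<lambda>z. frechet_derivative (\<lambda>z. mul (fst z) (snd z)) (at z) (0, V)) (0, 0)"
    using C1_mul by (simp only: Ck_on_1 continuous_on_eq_continuous_at[OF open_UNIV]) blast
  moreover have "(\<lambda>n. (- ((1 / 2 ^ n) *\<^sub>R W), (1 / 2 ^ n) *\<^sub>R W)) \<longlonglongrightarrow> (0, 0)"
  proof -
    have "(\<lambda>n. (1 / 2 ^ n :: real)) \<longlonglongrightarrow> 0"
      using LIMSEQ_power_zero[of "1 / 2 :: real"] by (simp add: power_one_over)
    then have "(\<lambda>n. (1 / 2 ^ n) *\<^sub>R W) \<longlonglongrightarrow> 0 *\<^sub>R W"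
      by (intro tendsto_intros)
    then have "(\<lambda>n. (1 / 2 ^ n) *\<^sub>R W) \<longlonglongrightarrow> 0"
      by simp
    from tendsto_Pair[OF tendsto_minus[OF this] this] show ?thesis
      by simp
  qed
  ultimately have "(\<lambda>n. dmul (- ((1 / 2 ^ n) *\<^sub>R W)) ((1 / 2 ^ n) *\<^sub>R W) 0 V) \<longlonglongrightarrow> dmul 0 0 0 V"
    unfolding dmul_def by (rule isCont_tendsto_compose)
  then have "(\<lambda>n. dmul (- ((1 / 2 ^ n) *\<^sub>R W)) ((1 / 2 ^ n) *\<^sub>R W) 0 V) \<longlonglongrightarrow> V"
    by (simp add: dmul_0)
  moreover have "isCont f V"
    using f by (simp add: linear_continuous_at linear_conv_bounded_linear)
  ultimately have "(\<lambda>n. f (dmul (- ((1 / 2 ^ n) *\<^sub>R W)) ((1 / 2 ^ n) *\<^sub>R W) 0 V)) \<longlonglongrightarrow> f V"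
    by (rule isCont_tendsto_compose[rotated])
  then show ?thesis
    unfolding pow[symmetric] by (simp add: LIMSEQ_const_iff)
qed

text \<open>Along \<open>t \<mapsto> mul X (t *\<^sub>R Y)\<close> the velocity translated back to
  the origin is constantly \<open>Y\<close>. Since \<open>f\<close> does not see the translation, it
  grows linearly with slope \<open>f Y\<close>.\<close>

lemma functional_mul:
  fixes f :: "'v \<Rightarrow> real"
  assumes f: "linear f" and van: "\<And>X Y. f (lie_bracket G Exp X Y) = 0"
  shows "f (mul X Y) = f X + f Y"
proof -
  have bl: "bounded_linear f"
    using f by (simp add: linear_conv_bounded_linear)
  define c where "c = (\<lambda>t::real. mul X (t *\<^sub>R Y))"
  have der: "((\<lambda>t. f (c t)) has_vector_derivative f Y) (at t)" for t
  proof -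
    define V where "V = dmul X (t *\<^sub>R Y) 0 Y"
    have c: "(c has_vector_derivative V) (at t)"
      unfolding c_def V_def by (intro mul_has_vector_derivative) (auto intro!: derivative_eq_intros simp: has_vector_derivative_def)
    have "((\<lambda>u. mul (- c t) (c u)) has_vector_derivative dmul (- c t) (c t) 0 V) (at t)"
      by (intro mul_has_vector_derivative c) simp
    moreover have "mul (- c t) (c u) = (u - t) *\<^sub>R Y" for u
    proof -
      have "c u = mul (c t) ((u - t) *\<^sub>R Y)"
        using mul_scale[of t Y "u - t"] by (simp add: c_def mul_assoc)
      then show ?thesis
        by (simp add: mul_minus_cancel)
    qed
    ultimately have "((\<lambda>u. (u - t) *\<^sub>R Y) has_vector_derivative dmul (- c t) (c t) 0 V) (at t)"
      by simp
    moreover have "((\<lambda>u. (u - t) *\<^sub>R Y) has_vector_derivative Y) (at t)"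
      by (auto intro!: derivative_eq_intros simp: has_vector_derivative_def)
    ultimately have "dmul (- c t) (c t) 0 V = Y"
      by (rule vector_derivative_unique_at)
    then have "f V = f Y"
      using functional_dmul[OF f van, of "c t" V] by simp
    then show ?thesis
      using bounded_linear.has_vector_derivative[OF bl c] by simp
  qed
  have "((\<lambda>t. f (c t) - t * f Y) has_vector_derivative 0) (at t)" for t
    using has_vector_derivative_diff[OF der[of t] has_vector_derivative_line[of "f Y"]] by simp
  then have "((\<lambda>t. f (c t) - t * f Y) has_derivative (\<lambda>h. 0)) (at t within UNIV)" for t
    by (simp add: has_vector_derivative_def)
  then have "f (c 1) - 1 * f Y = f (c 0) - 0 * f Y"
    by (intro has_derivative_zero_unique[of UNIV "\<lambda>t. f (c t) - t * f Y"]) auto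
  then show ?thesis
    by (simp add: c_def)
qed

lemma continuous_Log: "continuous_on UNIV Log"
  using smooth_Log by (simp add: smooth_map_def)

end

section \<open>The first layer of the grading\<close>

locale graded_lie_group = nilpotent_lie_group G \<A> Exp
  for G :: "'g::{t2_space, second_countable_topology} monoid" (structure)
    and \<A> :: "('g, 'v::euclidean_space) chart set" and Exp :: "'v \<Rightarrow> 'g" +
  fixes r :: nat and gs :: "nat \<Rightarrow> 'v set" and B :: "'d::finite \<Rightarrow> 'v"
  assumes graded: "graded_complements G Exp r gs"
    and basis: "inj B" "independent (range B)" "span (range B) = gs 1"
begin

lemma subspace_lcs: "subspace (lie_lcs G Exp (Suc k))"
  by (cases k) (auto simp: subspace_UNIV)

lemma lcs_antimono_Suc: "lie_lcs G Exp (Suc (Suc k)) \<subseteq> lie_lcs G Exp (Suc k)"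
proof (induction k)
  case (Suc k)
  have "{lie_bracket G Exp X Y |X Y. Y \<in> lie_lcs G Exp (Suc (Suc k))} \<subseteq> {lie_bracket G Exp X Y |X Y. Y \<in> lie_lcs G Exp (Suc k)}"
    using Suc by blast
  from span_mono[OF this] show ?case
    by simp
qed simp

lemma lcs_subset_2: "2 \<le> k \<Longrightarrow> lie_lcs G Exp k \<subseteq> lie_lcs G Exp 2"
proof (induction k rule: dec_induct)
  case (step k)
  then obtain j where "k = Suc j" by (cases k) auto
  then show ?case
    using lcs_antimono_Suc[of j] step by auto
qed simp

lemma gs: "1 \<le> r" "subspace (gs k)" "gs k \<inter> lie_lcs G Exp (Suc k) = {0}"
  "lie_lcs G Exp k = {Y + Z | Y Z. Y \<in> gs k \<and> Z \<in> lie_lcs G Exp (Suc k)}" if "k \<in> {1..r}"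
  using graded that unfolding graded_complements_def by auto

lemma lcs_end: "lie_lcs G Exp (Suc r) = {0}"
  using graded unfolding graded_complements_def by auto

lemma one_le_r: "1 \<in> {1..r}"
  using graded unfolding graded_complements_def by auto

lemma gs_1_lcs_2: "Z \<in> gs 1 \<Longrightarrow> Z \<in> lie_lcs G Exp 2 \<Longrightarrow> Z = 0"
  using gs(3)[OF one_le_r] unfolding numeral_2_eq_2 One_nat_def by blast

lemma gs_subset_lcs: "k \<in> {1..r} \<Longrightarrow> gs k \<subseteq> lie_lcs G Exp k"
  using gs(4)[of k] subspace_0[OF subspace_lcs[of k]] by force

lemma graded_decomposition:
  assumes "k \<in> {1..Suc r}" "Z \<in> lie_lcs G Exp k"
  shows "\<exists>f. (\<forall>i\<in>{k..r}. f i \<in> gs i) \<and> Z = (\<Sum>i=k..r. f i)"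
  using assms
proof (induction "Suc r - k" arbitrary: k Z)
  case 0
  then have "k = Suc r" by auto
  then show ?case
    using 0 lcs_end by auto
next
  case (Suc n)
  then have k: "k \<in> {1..r}" by auto
  obtain Y Z' where YZ: "Y \<in> gs k" "Z' \<in> lie_lcs G Exp (Suc k)" "Z = Y + Z'"
    using Suc.prems(2) gs(4)[OF k] by auto
  obtain f where f: "\<forall>i\<in>{Suc k..r}. f i \<in> gs i" "Z' = (\<Sum>i=Suc k..r. f i)"
    using Suc.hyps(1)[of "Suc k" Z'] Suc.hyps(2) k YZ(2) by (force simp del: lie_lcs.simps)
  have "(\<Sum>i=k..r. (f(k := Y)) i) = Y + (\<Sum>i=Suc k..r. (f(k := Y)) i)"
    using k by (simp add: sum.atLeast_Suc_atMost)
  also have "(\<Sum>i=Suc k..r. (f(k := Y)) i) = Z'"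
    unfolding f(2) by (intro sum.cong) auto
  finally have "Z = (\<Sum>i=k..r. (f(k := Y)) i)"
    using YZ by simp
  moreover have "\<forall>i\<in>{k..r}. (f(k := Y)) i \<in> gs i"
    using f YZ by auto
  ultimately show ?case
    by blast
qed

text \<open>All layers from the second on lie in the commutator ideal, which meets
  \<open>gs 1\<close> only in 0. Hence the first component of any decomposition is the same, and the
  definite description is justified.\<close>

lemma graded_component_1:
  "graded_component gs r 1 Z \<in> gs 1" "Z - graded_component gs r 1 Z \<in> lie_lcs G Exp 2"
proof -
  obtain f where f: "\<forall>i\<in>{1..r}. f i \<in> gs i" "Z = (\<Sum>i=1..r. f i)"
    using graded_decomposition[of 1 Z] by auto
  have rest: "(\<Sum>i=1..r. f i) - f 1 \<in> lie_lcs G Exp 2" if f: "\<forall>i\<in>{1..r}. f i \<in> gs i" for f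
  proof -
    have "(\<Sum>i=1..r. f i) - f 1 = (\<Sum>i=Suc 1..r. f i)"
      using one_le_r by (simp add: sum.atLeast_Suc_atMost)
    also have "\<dots> \<in> lie_lcs G Exp 2"
    proof (rule subspace_sum)
      show "subspace (lie_lcs G Exp 2)"
        using subspace_lcs[of 1] by (simp add: numeral_2_eq_2)
      fix i assume "i \<in> {Suc 1..r}"
      then show "f i \<in> lie_lcs G Exp 2"
        using f gs_subset_lcs[of i] lcs_subset_2[of i] by (force simp del: lie_lcs.simps)
    qed
    finally show ?thesis .
  qed
  have "graded_component gs r 1 Z = f 1"
    unfolding graded_component_def
  proof (rule the_equality)
    show "\<exists>f'. (\<forall>i\<in>{1..r}. f' i \<in> gs i) \<and> Z = (\<Sum>i=1..r. f' i) \<and> f 1 = f' 1"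
      using f by blast
    fix Y assume "\<exists>f'. (\<forall>i\<in>{1..r}. f' i \<in> gs i) \<and> Z = (\<Sum>i=1..r. f' i) \<and> Y = f' 1"
    then obtain f' where f': "\<forall>i\<in>{1..r}. f' i \<in> gs i" "Z = (\<Sum>i=1..r. f' i)" "Y = f' 1"
      by blast
    have "f' 1 - f 1 \<in> lie_lcs G Exp 2"
      using subspace_diff[OF subspace_lcs[of 1], of "Z - f 1" "Z - f' 1"] rest[OF f(1)] rest[OF f'(1)] f(2) f'(2)
      by (simp add: numeral_2_eq_2)
    moreover have "f' 1 - f 1 \<in> gs 1"
      using f f' one_le_r by (intro subspace_diff gs(2)) auto
    ultimately have "f' 1 - f 1 = 0"
      by (intro gs_1_lcs_2)
    then show "Y = f 1"
      using f'(3) by simp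
  qed
  then show "graded_component gs r 1 Z \<in> gs 1" "Z - graded_component gs r 1 Z \<in> lie_lcs G Exp 2"
    using f rest[OF f(1)] one_le_r by auto
qed

lemma graded_component_1_unique:
  assumes "Y \<in> gs 1" "Z - Y \<in> lie_lcs G Exp 2"
  shows "graded_component gs r 1 Z = Y"
proof -
  have "graded_component gs r 1 Z - Y \<in> gs 1"
    using assms graded_component_1 one_le_r by (intro subspace_diff gs(2)) auto
  moreover have "graded_component gs r 1 Z - Y \<in> lie_lcs G Exp 2"
    using subspace_diff[OF subspace_lcs[of 1], of "Z - Y" "Z - graded_component gs r 1 Z"] assms graded_component_1(2)
    by (simp add: numeral_2_eq_2)
  ultimately have "graded_component gs r 1 Z - Y = 0"
    by (rule gs_1_lcs_2)
  then show ?thesis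
    by simp
qed

lemma linear_graded_component: "linear (graded_component gs r 1)"
proof (rule linearI)
  have s1: "subspace (gs 1)" and s2: "subspace (lie_lcs G Exp 2)"
    using gs(2)[OF one_le_r] subspace_lcs[of 1] by (simp_all add: numeral_2_eq_2)
  note gc = graded_component_1
  fix X Y :: 'v and c :: real
  show "graded_component gs r 1 (X + Y) = graded_component gs r 1 X + graded_component gs r 1 Y"
    using subspace_add[OF s2 gc(2)[of X] gc(2)[of Y]]
    by (intro graded_component_1_unique subspace_add[OF s1] gc) (simp add: algebra_simps)
  show "graded_component gs r 1 (c *\<^sub>R X) = c *\<^sub>R graded_component gs r 1 X"
    using subspace_scale[OF s2 gc(2)[of X], of c]
    by (intro graded_component_1_unique subspace_scale[OF s1] gc) (simp add: algebra_simps)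
qed

definition coords :: "'v \<Rightarrow> real ^ 'd" where
  "coords Z = (\<chi> i. representation (range B) (graded_component gs r 1 Z) (B i))"

lemma log1_eq: "log1 Exp r gs B g = coords (Log g)"
  by (simp add: log1_def coords_def)

lemma linear_coords: "linear coords"
proof (rule linearI)
  have sp: "graded_component gs r 1 Z \<in> span (range B)" for Z
    using graded_component_1 basis by simp
  fix X Y :: 'v and c :: real
  show "coords (X + Y) = coords X + coords Y"
    by (simp add: coords_def vec_eq_iff linear_add[OF linear_graded_component] representation_add[OF basis(2) sp sp] del: One_nat_def)
  show "coords (c *\<^sub>R X) = c *\<^sub>R coords X"
    by (simp add: coords_def vec_eq_iff linear_scale[OF linear_graded_component] representation_scale[OF basis(2) sp] del: One_nat_def)
qed

lemma coords_bracket: "coords (lie_bracket G Exp X Y) = 0"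
proof -
  have "lie_bracket G Exp X Y \<in> lie_lcs G Exp 2"
    by (auto simp: numeral_2_eq_2 intro!: span_base)
  then have "graded_component gs r 1 (lie_bracket G Exp X Y) = 0"
    using subspace_0[OF gs(2)[OF one_le_r]] by (intro graded_component_1_unique) auto
  then show ?thesis
    by (simp add: coords_def vec_eq_iff representation_zero)
qed

lemma coords_basis: "coords (B i) = axis i 1"
proof -
  have "B i \<in> gs 1"
    using span_base[of "B i" "range B"] basis(3) by auto
  then have "graded_component gs r 1 (B i) = B i"
    using subspace_0[OF subspace_lcs[of 1]] by (intro graded_component_1_unique) (auto simp: numeral_2_eq_2)
  then show ?thesis
    using representation_basis[OF basis(2), of "B i"] basis(1) by (auto simp: coords_def vec_eq_iff axis_def inj_eq)
qed

lemma log1_mult: "log1 Exp r gs B (g \<otimes> h) = log1 Exp r gs B g + log1 Exp r gs B h"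
proof -
  have "coords (mul X Y) $ i = coords X $ i + coords Y $ i" for X Y i
  proof (rule functional_mul)
    show "linear (\<lambda>X. coords X $ i)"
      using linear_coords by (simp add: linear_iff)
    show "coords (lie_bracket G Exp X Y) $ i = 0" for X Y
      by (simp add: coords_bracket)
  qed
  then have "coords (mul (Log g) (Log h)) = coords (Log g) + coords (Log h)"
    by (simp add: vec_eq_iff)
  then show ?thesis
    by (simp add: log1_eq mul_def)
qed

text \<open>A functional killing \<Gamma> descends to a continuous function on the compact coset
  space and is bounded. It is also linear along one-parameter subgroups, so it vanishes. In this
  form the surjectivity of \<open>\<rho>\<^sub>\<real>\<close> enters.\<close>

lemma log1_spans:
  assumes lattice: "cocompact_lattice G \<Gamma>" and \<theta>: "\<And>\<gamma>. \<gamma> \<in> \<Gamma> \<Longrightarrow> \<theta> \<bullet> log1 Exp r gs B \<gamma> = 0"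
  shows "\<theta> = 0"
proof -
  define F where "F = (\<lambda>g. \<theta> \<bullet> log1 Exp r gs B g)"
  have F_mult: "F (g \<otimes> h) = F g + F h" for g h
    by (simp add: F_def log1_mult inner_add_right)
  have sub: "subgroup \<Gamma> G" and comp: "compact_space (orbit_topology G \<Gamma>)"
    using lattice by (auto simp: cocompact_lattice_def)
  have cosets: "C \<in> rcosets \<Gamma> \<Longrightarrow> g \<in> C \<Longrightarrow> h \<in> C \<Longrightarrow> F g = F h" for C g h
    using \<theta> by (auto simp: RCOSETS_def r_coset_def F_mult) (auto simp: F_def)
  have contF: "continuous_on UNIV F"
  proof -
    have "continuous_on UNIV (\<lambda>g. \<theta> \<bullet> coords (Log g))"
      by (intro continuous_intros continuous_on_compose2[OF _ continuous_Log, of UNIV coords] linear_continuous_on)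
        (auto simp: linear_coords linear_conv_bounded_linear[symmetric])
    then show ?thesis
      by (simp add: F_def log1_eq)
  qed
  define U where "U = (\<lambda>n::nat. {C \<in> rcosets \<Gamma>. \<forall>g\<in>C. \<bar>F g\<bar> < n})"
  have coset_of: "g \<in> \<Gamma> #> g" "\<Gamma> #> g \<in> rcosets \<Gamma>" for g
    using rcos_self[OF _ sub, of g] rcosetsI[of \<Gamma> g] sub subgroup.subset by auto
  have UU: "\<Union>(U n) = {g. \<bar>F g\<bar> < n}" for n
    using coset_of cosets unfolding U_def by (auto, metis)
  have "openin (orbit_topology G \<Gamma>) (U n)" for n
  proof -
    have "open (\<Union>(U n))"
      unfolding UU by (intro open_Collect_less continuous_intros contF)
    then show ?thesis
      using openin_orbit_topology[OF is_group sub] by (auto simp: U_def)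
  qed
  moreover have "topspace (orbit_topology G \<Gamma>) \<subseteq> \<Union>(range U)"
  proof
    fix C assume "C \<in> topspace (orbit_topology G \<Gamma>)"
    then have C: "C \<in> rcosets \<Gamma>"
      using openin_orbit_topology[OF is_group sub] openin_topspace by blast
    then obtain g where g: "C = \<Gamma> #> g"
      by (auto simp: RCOSETS_def)
    obtain n :: nat where "\<bar>F g\<bar> < n"
      using reals_Archimedean2 by blast
    then have "C \<in> U n"
    proof -
      assume n: "\<bar>F g\<bar> < n"
      have "\<bar>F h\<bar> < n" if "h \<in> C" for h
        using cosets[OF C that, of g] coset_of(1)[of g] g n by simp
      then show ?thesis
        using C by (simp add: U_def)
    qed
    then show "C \<in> \<Union>(range U)"
      by blast
  qed
  ultimately obtain \<F> where \<F>: "finite \<F>" "\<F> \<subseteq> range U" "topspace (orbit_topology G \<Gamma>) \<subseteq> \<Union>\<F>"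
    using comp unfolding compact_space_alt by (metis (no_types, lifting) rangeE)
  obtain I where I: "finite I" "\<F> = U ` I"
    using finite_subset_image[OF \<F>(1,2)] by blast
  have bound: "\<bar>F g\<bar> < (\<Sum>n\<in>I. real n) + 1" for g
  proof -
    have "openin (orbit_topology G \<Gamma>) (rcosets \<Gamma>)"
    proof -
      have "\<Union>(rcosets \<Gamma>) = UNIV"
        using coset_of by blast
      then show ?thesis
        using openin_orbit_topology[OF is_group sub] by simp
    qed
    then have "\<Gamma> #> g \<in> topspace (orbit_topology G \<Gamma>)"
      using coset_of(2)[of g] openin_subset by blast
    then obtain n where n: "n \<in> I" "\<Gamma> #> g \<in> U n"
      using \<F>(3) I(2) by auto
    then have "\<bar>F g\<bar> < n"
      using coset_of(1)[of g] by (auto simp: U_def)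
    moreover have "real n \<le> (\<Sum>n\<in>I. real n)"
      using n(1) I(1) by (intro member_le_sum) auto
    ultimately show ?thesis
      by linarith
  qed
  have "\<theta> \<bullet> coords X = 0" for X
  proof (rule ccontr)
    assume nz: "\<theta> \<bullet> coords X \<noteq> 0"
    let ?t = "((\<Sum>n\<in>I. real n) + 1) / (\<theta> \<bullet> coords X)"
    have "F (Exp (?t *\<^sub>R X)) = (\<Sum>n\<in>I. real n) + 1"
      using nz by (simp add: F_def log1_eq linear_scale[OF linear_coords])
    then show False
      using bound[of "Exp (?t *\<^sub>R X)"] by simp
  qed
  from this[of "B _"] show ?thesis
    by (simp add: coords_basis vec_eq_iff inner_axis)
qed

end

section \<open>Closed paths and homology\<close>

context
  fixes X0 :: "('x0::finite, 'e0::finite) ograph"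
  assumes conn: "connected_graph X0"
begin

lemma bar_simps: "bar X0 (bar X0 e) = e" "org X0 (bar X0 e) = ter X0 e" "ter X0 (bar X0 e) = org X0 e"
  using conn by (auto simp: connected_graph_def)

lemma sum_bar: "(\<Sum>e\<in>UNIV. f (bar X0 e)) = (\<Sum>e\<in>UNIV. f e)"
  by (rule sum.reindex_bij_witness[of _ "bar X0" "bar X0"]) (auto simp: bar_simps)

text \<open>The factor 1/2 in \<open>boundary\<close> and \<open>pairing\<close> compensates the
  antisymmetrisation in \<open>chain\<close>.\<close>

lemma sum_chain:
  fixes g :: "'e0 \<Rightarrow> 'v::real_vector"
  assumes "\<And>e. g (bar X0 e) = - g e"
  shows "(\<Sum>e\<in>UNIV. (chain X0 f $ e / 2) *\<^sub>R g e) = (\<Sum>e\<in>UNIV. f e *\<^sub>R g e)"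
proof -
  have "(\<Sum>e\<in>UNIV. f (bar X0 e) *\<^sub>R g e) = (\<Sum>e\<in>UNIV. f e *\<^sub>R g (bar X0 e))"
    using sum_bar[of "\<lambda>e. f e *\<^sub>R g (bar X0 e)"] by (simp add: bar_simps)
  also have "\<dots> = - (\<Sum>e\<in>UNIV. f e *\<^sub>R g e)"
    by (simp add: assms sum_negf)
  finally have *: "(\<Sum>e\<in>UNIV. f (bar X0 e) *\<^sub>R g e) = - (\<Sum>e\<in>UNIV. f e *\<^sub>R g e)" .
  have "(\<Sum>e\<in>UNIV. (chain X0 f $ e / 2) *\<^sub>R g e) = (\<Sum>e\<in>UNIV. (1 / 2) *\<^sub>R (f e *\<^sub>R g e - f (bar X0 e) *\<^sub>R g e))"
    by (intro sum.cong refl) (simp add: chain_def scaleR_diff_left[symmetric])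
  also have "\<dots> = (1 / 2) *\<^sub>R (2 *\<^sub>R (\<Sum>e\<in>UNIV. f e *\<^sub>R g e))"
    unfolding scaleR_sum_right[symmetric] sum_subtractf * by (simp add: scaleR_2)
  finally show ?thesis
    by simp
qed

lemma chain_C1: "chain X0 f \<in> C1 X0"
  by (simp add: C1_def chain_def bar_simps)

lemma boundary_chain: "boundary X0 (chain X0 f) = (\<Sum>e\<in>UNIV. f e *\<^sub>R (axis (ter X0 e) 1 - axis (org X0 e) 1))"
  unfolding boundary_def by (rule sum_chain) (simp add: bar_simps)

lemma sum_count_list: "(\<Sum>e\<in>UNIV. real (count_list c e) *\<^sub>R g e) = (\<Sum>e\<leftarrow>c. g (e :: 'e0) :: 'v::real_vector)"
proof (induction c)
  case (Cons e c)
  have "(\<Sum>f\<in>UNIV. real (count_list (e # c) f) *\<^sub>R g f) = (\<Sum>f\<in>UNIV. (if e = f then g f else 0) + real (count_list c f) *\<^sub>R g f)"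
    by (intro sum.cong refl) (simp add: scaleR_add_left)
  then show ?case
    using Cons by (simp add: sum.distrib)
qed simp

lemma path_sum_exact: "edge_path X0 y c z \<Longrightarrow> (\<Sum>e\<leftarrow>c. u (ter X0 e) - u (org X0 e)) = u z - (u y :: 'v::ab_group_add)"
  by (induction c arbitrary: y) auto

lemma closed_path_H1: "edge_path X0 y c y \<Longrightarrow> chain X0 (\<lambda>e. real (count_list c e)) \<in> H1 X0"
  using path_sum_exact[of y c y "\<lambda>z. axis z (1::real)"]
  by (simp add: H1_def chain_C1 boundary_chain sum_count_list)

lemma edge_path_append: "edge_path X0 y c z \<Longrightarrow> edge_path X0 z d w \<Longrightarrow> edge_path X0 y (c @ d) w"
  by (induction c arbitrary: y) auto

lemma edge_path_rev: "edge_path X0 y c z \<Longrightarrow> edge_path X0 z (rev (map (bar X0) c)) y"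
proof (induction c arbitrary: y)
  case (Cons e c)
  then show ?case
    by (auto intro!: edge_path_append[where z = "ter X0 e"] simp: bar_simps)
qed simp

text \<open>Integration along paths from \<open>y\<close>; closed paths at this single base vertex
  suffice, since a loop through an edge can be made out of two chosen paths.\<close>

lemma potential_exists:
  fixes k :: "'e0 \<Rightarrow> 'v::ab_group_add"
  assumes anti: "\<And>e. k (bar X0 e) = - k e" and closed: "\<And>c. edge_path X0 y c y \<Longrightarrow> (\<Sum>e\<leftarrow>c. k e) = 0"
  shows "\<exists>h. \<forall>e. k e = h (ter X0 e) - h (org X0 e)"
proof -
  have "\<forall>z. \<exists>c. edge_path X0 y c z"
    using conn by (simp add: connected_graph_def)
  then obtain c where c: "\<And>z. edge_path X0 y (c z) z"
    by metis
  define h where "h = (\<lambda>z. \<Sum>e\<leftarrow>c z. k e)"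
  have rev: "(\<Sum>e\<leftarrow>rev (map (bar X0) d). k e) = - (\<Sum>e\<leftarrow>d. k e)" for d
    by (induction d) (simp_all add: anti)
  have "k e = h (ter X0 e) - h (org X0 e)" for e
  proof -
    have "edge_path X0 y (c (org X0 e) @ e # rev (map (bar X0) (c (ter X0 e)))) y"
      by (rule edge_path_append[OF c]) (simp add: edge_path_rev[OF c])
    from closed[OF this] have "h (org X0 e) + (k e - h (ter X0 e)) = 0"
      using rev[of "c (ter X0 e)"] by (simp add: h_def)
    then show ?thesis
      by (simp add: algebra_simps eq_neg_iff_add_eq_0)
  qed
  then show ?thesis
    by blast
qed

text \<open>Summation by parts: the sum pairs the boundary of \<open>c\<close> with
  \<open>u\<close>.\<close>

lemma H1_sum_exact:
  fixes u :: "'x0 \<Rightarrow> 'v::real_vector"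
  assumes "c \<in> H1 X0"
  shows "(\<Sum>e\<in>UNIV. (c $ e / 2) *\<^sub>R (u (ter X0 e) - u (org X0 e))) = 0"
proof -
  have pick: "u z = (\<Sum>y\<in>UNIV. (axis z 1 $ y :: real) *\<^sub>R u y)" for z
    by (simp add: axis_def if_distrib[of "\<lambda>a. a *\<^sub>R _"] cong: if_cong)
  have "(\<Sum>e\<in>UNIV. (c $ e / 2) *\<^sub>R (u (ter X0 e) - u (org X0 e))) =
      (\<Sum>e\<in>UNIV. \<Sum>y\<in>UNIV. (c $ e / 2 * (axis (ter X0 e) 1 $ y - axis (org X0 e) 1 $ y)) *\<^sub>R u y)"
  proof (intro sum.cong refl)
    fix e
    have "u (ter X0 e) - u (org X0 e) = (\<Sum>y\<in>UNIV. (axis (ter X0 e) 1 $ y - axis (org X0 e) 1 $ y) *\<^sub>R u y)"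
      by (subst (1 2) pick) (simp only: sum_subtractf[symmetric] scaleR_diff_left)
    then show "(c $ e / 2) *\<^sub>R (u (ter X0 e) - u (org X0 e)) =
        (\<Sum>y\<in>UNIV. (c $ e / 2 * (axis (ter X0 e) 1 $ y - axis (org X0 e) 1 $ y)) *\<^sub>R u y)"
      by (simp only: scaleR_sum_right scaleR_scaleR)
  qed
  also have "\<dots> = (\<Sum>y\<in>UNIV. boundary X0 c $ y *\<^sub>R u y)"
    by (subst sum.swap) (simp add: boundary_def scaleR_sum_left)
  also have "\<dots> = 0"
    using assms by (simp add: H1_def)
  finally show ?thesis .
qed

text \<open>Closed paths at one vertex span the cycles. Instead of exhibiting a basis, one views the
  values of \<open>K\<close> on edges as a cochain: it integrates to 0 over closed paths, so it is a
  gradient, and cycles annihilate gradients. This gives the uniqueness behind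
  \<open>rho_real\<close>.\<close>

lemma linear_zero_on_H1:
  fixes K :: "real ^ 'e0 \<Rightarrow> 'v::real_vector"
  assumes K: "linear K" and closed: "\<And>c. edge_path X0 y c y \<Longrightarrow> K (chain X0 (\<lambda>e. real (count_list c e))) = 0"
    and a: "a \<in> H1 X0"
  shows "K a = 0"
proof -
  define b :: "'e0 \<Rightarrow> real ^ 'e0" where "b = (\<lambda>e. axis e 1 - axis (bar X0 e) 1)"
  have b_bar: "b (bar X0 e) = - b e" for e
    by (simp add: b_def bar_simps)
  have chain_b: "chain X0 f = (\<Sum>e\<in>UNIV. f e *\<^sub>R b e)" for f
  proof -
    have "chain X0 f = (\<Sum>e\<in>UNIV. f e *\<^sub>R axis e 1) - (\<Sum>e\<in>UNIV. f (bar X0 e) *\<^sub>R axis e 1)"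
      by (simp add: vec_eq_iff chain_def axis_def if_distrib[of "\<lambda>a. _ * a"] cong: if_cong)
    also have "(\<Sum>e\<in>UNIV. f (bar X0 e) *\<^sub>R axis e 1) = (\<Sum>e\<in>UNIV. f e *\<^sub>R axis (bar X0 e) 1)"
      using sum_bar[of "\<lambda>e. f e *\<^sub>R axis (bar X0 e) 1"] by (simp add: bar_simps)
    finally show ?thesis
      by (simp only: b_def scaleR_diff_right sum_subtractf)
  qed
  have "\<exists>h. \<forall>e. K (b e) = h (ter X0 e) - h (org X0 e)"
  proof (rule potential_exists)
    show "K (b (bar X0 e)) = - K (b e)" for e
      by (simp add: b_bar linear_neg[OF K])
    show "(\<Sum>e\<leftarrow>c. K (b e)) = 0" if "edge_path X0 y c y" for c
    proof -
      have "K (\<Sum>e\<leftarrow>c. b e) = (\<Sum>e\<leftarrow>c. K (b e))"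
        by (induction c) (simp_all add: linear_0[OF K] linear_add[OF K])
      then show ?thesis
        using closed[OF that] by (simp add: chain_b sum_count_list)
    qed
  qed
  then obtain h where h: "\<And>e. K (b e) = h (ter X0 e) - h (org X0 e)"
    by blast
  have "a = chain X0 (\<lambda>e. a $ e / 2)"
    using a by (simp add: chain_def vec_eq_iff H1_def C1_def)
  then have "K a = K (\<Sum>e\<in>UNIV. (a $ e / 2) *\<^sub>R b e)"
    by (metis chain_b)
  also have "\<dots> = (\<Sum>e\<in>UNIV. (a $ e / 2) *\<^sub>R (h (ter X0 e) - h (org X0 e)))"
    by (simp only: linear_sum[OF K] linear_scale[OF K] h)
  also have "\<dots> = 0"
    by (rule H1_sum_exact[OF a])
  finally show ?thesis .
qed

end

section \<open>Equivariant maps on the covering graph\<close>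

text \<open>The Lie group is left behind here: \<open>l\<close> stands for the first-layer
  logarithm, \<Psi> for its composition with the realization, and \<open>spanning\<close> records
  cocompactness.\<close>

locale equivariant_map = covering_graph \<Gamma> X X0 \<pi>V \<pi>E actV actE
  for \<Gamma> :: "('g, 'b) monoid_scheme" (structure)
    and X :: "('x, 'e) ograph" and X0 :: "('x0::finite, 'e0::finite) ograph"
    and \<pi>V :: "'x \<Rightarrow> 'x0" and \<pi>E :: "'e \<Rightarrow> 'e0"
    and actV :: "'g \<Rightarrow> 'x \<Rightarrow> 'x" and actE :: "'g \<Rightarrow> 'e \<Rightarrow> 'e" +
  fixes l :: "'g \<Rightarrow> real ^ 'd::finite" and \<Psi> :: "'x \<Rightarrow> real ^ 'd"
  assumes equivariant: "\<gamma> \<in> carrier \<Gamma> \<Longrightarrow> \<Psi> (actV \<gamma> y) = l \<gamma> + \<Psi> y"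
    and spanning: "(\<And>\<gamma>. \<gamma> \<in> carrier \<Gamma> \<Longrightarrow> \<theta> \<bullet> l \<gamma> = 0) \<Longrightarrow> \<theta> = 0"
begin

lemma lift_edge_unique:
  assumes "\<pi>E e = \<pi>E f" "org X e = org X f"
  shows "e = f"
proof -
  obtain \<gamma> where \<gamma>: "\<gamma> \<in> carrier \<Gamma>" "f = actE \<gamma> e"
    using assms(1) quotient(4) by auto
  then have "actV \<gamma> (org X e) = org X e"
    using automorphisms(1)[of \<gamma> e] assms(2) by simp
  then have "\<gamma> = \<one>"
    using free \<gamma>(1) by blast
  then show ?thesis
    using \<gamma>(2) group_action.id_eq_one[OF actions(2)] by (metis UNIV_I restrict_apply)
qed

lemma lift_edge:
  assumes "org X0 e0 = \<pi>V y"
  shows "\<exists>e. \<pi>E e = e0 \<and> org X e = y"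
proof -
  obtain f where f: "\<pi>E f = e0"
    using quotient(2) by (metis surjD)
  then have "\<pi>V (org X f) = \<pi>V y"
    using assms morphism(1)[of f] by simp
  then obtain \<gamma> where \<gamma>: "\<gamma> \<in> carrier \<Gamma>" "y = actV \<gamma> (org X f)"
    using quotient(3) by auto
  then have "\<pi>E (actE \<gamma> f) = e0"
    using quotient(4)[of f "actE \<gamma> f"] f by auto
  then show ?thesis
    using \<gamma> automorphisms(1) by metis
qed

lemma lift_path: "edge_path X0 (\<pi>V y) c z0 \<Longrightarrow> \<exists>es z. map \<pi>E es = c \<and> edge_path X y es z \<and> \<pi>V z = z0"
proof (induction c arbitrary: y)
  case (Cons e0 c)
  obtain e where e: "\<pi>E e = e0" "org X e = y"
    using lift_edge Cons.prems by auto
  then have "edge_path X0 (\<pi>V (ter X e)) c z0"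
    using Cons.prems morphism(2)[of e] by simp
  from Cons.IH[OF this] obtain es z where "map \<pi>E es = c" "edge_path X (ter X e) es z" "\<pi>V z = z0"
    by blast
  then show ?case
    using e by (intro exI[of _ "e # es"] exI[of _ z]) simp
qed auto

lemma lift_path_unique:
  "map \<pi>E es = map \<pi>E fs \<Longrightarrow> edge_path X y es z \<Longrightarrow> edge_path X y fs w \<Longrightarrow> es = fs \<and> z = w"
proof (induction es arbitrary: y fs)
  case (Cons e es)
  then obtain f fs' where "fs = f # fs'"
    by (cases fs) auto
  then show ?case
    using Cons lift_edge_unique[of e f] by auto
qed auto

lemma project_path: "edge_path X y es z \<Longrightarrow> edge_path X0 (\<pi>V y) (map \<pi>E es) (\<pi>V z)"
  by (induction es arbitrary: y) (auto simp: morphism)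

definition incr :: "'e0 \<Rightarrow> real ^ 'd" where
  "incr e0 = (let e = SOME e. \<pi>E e = e0 in \<Psi> (ter X e) - \<Psi> (org X e))"

text \<open>Two lifts of an edge differ by a covering transformation, whose contribution
  \<open>l \<gamma>\<close> cancels in the difference of the endpoints.\<close>

lemma incr: "incr (\<pi>E e) = \<Psi> (ter X e) - \<Psi> (org X e)"
proof -
  define f where "f = (SOME f. \<pi>E f = \<pi>E e)"
  have "\<pi>E f = \<pi>E e"
    unfolding f_def by (rule someI) simp
  then obtain \<gamma> where "\<gamma> \<in> carrier \<Gamma>" "e = actE \<gamma> f"
    using quotient(4) by auto
  moreover have "incr (\<pi>E e) = \<Psi> (ter X f) - \<Psi> (org X f)"
    by (simp only: incr_def f_def Let_def)
  ultimately show ?thesis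
    by (simp add: automorphisms equivariant)
qed

lemma incr_bar: "incr (bar X0 e0) = - incr e0"
proof -
  obtain e where e: "\<pi>E e = e0"
    using quotient(2) by (metis surjD)
  have "org X (bar X e) = ter X e" "ter X (bar X e) = org X e"
    using connected_X by (auto simp: connected_graph_def)
  then show ?thesis
    using incr[of "bar X e"] incr[of e] morphism(3)[of e] by (simp add: e)
qed

lemma path_incr: "edge_path X y es z \<Longrightarrow> (\<Sum>e\<leftarrow>es. incr (\<pi>E e)) = \<Psi> z - \<Psi> y"
  by (induction es arbitrary: y) (auto simp: incr)

lemma actV_inj: "\<gamma> \<in> carrier \<Gamma> \<Longrightarrow> \<delta> \<in> carrier \<Gamma> \<Longrightarrow> actV \<gamma> y = actV \<delta> y \<Longrightarrow> \<gamma> = \<delta>"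
proof -
  assume *: "\<gamma> \<in> carrier \<Gamma>" "\<delta> \<in> carrier \<Gamma>" "actV \<gamma> y = actV \<delta> y"
  interpret A: group_action \<Gamma> UNIV actV
    by (rule actions)
  interpret group \<Gamma>
    using A.group_hom group_hom.axioms(1) by blast
  have "actV (inv \<delta> \<otimes> \<gamma>) y = actV (inv \<delta>) (actV \<delta> y)"
    using * by (simp add: A.composition_rule)
  also have "\<dots> = y"
    using A.orbit_sym_aux[of \<delta> y] * by simp
  finally have "inv \<delta> \<otimes> \<gamma> = \<one>"
    using * free by simp
  then show ?thesis
    using * by (metis inv_closed inv_equality inv_inv)
qed

text \<open>Unique path lifting and freeness of the action justify the definite description; the
  increments along the lift then telescope to \<open>l \<gamma>\<close>.\<close>

lemma deck_rho:
  assumes "edge_path X0 (\<pi>V x) c (\<pi>V x)"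
  shows "deck_rho (carrier \<Gamma>) X \<pi>E actV x c \<in> carrier \<Gamma>" "l (deck_rho (carrier \<Gamma>) X \<pi>E actV x c) = (\<Sum>e\<leftarrow>c. incr e)"
proof -
  obtain es z where es: "map \<pi>E es = c" "edge_path X x es z" "\<pi>V z = \<pi>V x"
    using lift_path[OF assms] by blast
  obtain \<gamma> where \<gamma>: "\<gamma> \<in> carrier \<Gamma>" "z = actV \<gamma> x"
    using quotient(3)[of x z] es(3) by auto
  have d: "deck_rho (carrier \<Gamma>) X \<pi>E actV x c = \<gamma>"
    unfolding deck_rho_def
  proof (rule the_equality)
    show "\<gamma> \<in> carrier \<Gamma> \<and> (\<exists>es. map \<pi>E es = c \<and> edge_path X x es (actV \<gamma> x))"
      using \<gamma> es by blast
    fix \<delta> assume \<delta>: "\<delta> \<in> carrier \<Gamma> \<and> (\<exists>es. map \<pi>E es = c \<and> edge_path X x es (actV \<delta> x))"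
    then obtain fs where "map \<pi>E fs = c" "edge_path X x fs (actV \<delta> x)"
      by blast
    then have z: "z = actV \<delta> x"
      using lift_path_unique[of es fs x z "actV \<delta> x"] es by simp
    show "\<delta> = \<gamma>"
      using actV_inj[OF conjunct1[OF \<delta>] \<gamma>(1)] z \<gamma>(2) by metis
  qed
  show "deck_rho (carrier \<Gamma>) X \<pi>E actV x c \<in> carrier \<Gamma>"
    using d \<gamma> by simp
  have "(\<Sum>e\<leftarrow>map \<pi>E es. incr e) = l \<gamma>"
    using path_incr[OF es(2)] \<gamma> equivariant[of \<gamma> x] by (simp add: o_def)
  then show "l (deck_rho (carrier \<Gamma>) X \<pi>E actV x c) = (\<Sum>e\<leftarrow>c. incr e)"
    unfolding d es(1) ..
qed

definition incr_chain :: "real ^ 'e0 \<Rightarrow> real ^ 'd" where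
  "incr_chain c = (\<Sum>e\<in>UNIV. (c $ e / 2) *\<^sub>R incr e)"

lemma linear_incr_chain: "linear incr_chain"
  by (rule linearI)
    (simp_all add: incr_chain_def add_divide_distrib scaleR_add_left sum.distrib scaleR_sum_right)

lemma incr_chain: "incr_chain (chain X0 f) = (\<Sum>e\<in>UNIV. f e *\<^sub>R incr e)"
  unfolding incr_chain_def by (rule sum_chain[OF connected_X0]) (rule incr_bar)

lemma rho_real:
  assumes a: "a \<in> H1 X0"
  shows "rho_real (carrier \<Gamma>) X X0 \<pi>V \<pi>E actV x l a = incr_chain a"
  unfolding rho_real_def
proof (rule the_equality)
  have closed: "incr_chain (chain X0 (\<lambda>e. real (count_list c e))) = l (deck_rho (carrier \<Gamma>) X \<pi>E actV x c)"
    if "edge_path X0 (\<pi>V x) c (\<pi>V x)" for c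
    by (simp add: incr_chain sum_count_list[OF connected_X0] deck_rho(2)[OF that])
  show "\<exists>L. linear L \<and> (\<forall>c. edge_path X0 (\<pi>V x) c (\<pi>V x) \<longrightarrow>
      L (chain X0 (\<lambda>e. real (count_list c e))) = l (deck_rho (carrier \<Gamma>) X \<pi>E actV x c)) \<and> incr_chain a = L a"
    using linear_incr_chain closed by blast
  fix v assume "\<exists>L. linear L \<and> (\<forall>c. edge_path X0 (\<pi>V x) c (\<pi>V x) \<longrightarrow>
      L (chain X0 (\<lambda>e. real (count_list c e))) = l (deck_rho (carrier \<Gamma>) X \<pi>E actV x c)) \<and> v = L a"
  then obtain L where L: "linear L" "v = L a" "\<And>c. edge_path X0 (\<pi>V x) c (\<pi>V x) \<Longrightarrow>
      L (chain X0 (\<lambda>e. real (count_list c e))) = l (deck_rho (carrier \<Gamma>) X \<pi>E actV x c)"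
    by blast
  have "L a - incr_chain a = 0"
    by (rule linear_zero_on_H1[OF connected_X0 linear_compose_sub[OF L(1) linear_incr_chain] _ a, of "\<pi>V x"])
      (simp add: L(3) closed)
  then show "v = incr_chain a"
    by (simp add: L(2))
qed

end

locale equivariant_walk = equivariant_map \<Gamma> X X0 \<pi>V \<pi>E actV actE l \<Psi> + finite_walk X0 p m
  for \<Gamma> :: "('g, 'b) monoid_scheme" (structure)
    and X :: "('x, 'e) ograph" and X0 :: "('x0::finite, 'e0::finite) ograph"
    and \<pi>V :: "'x \<Rightarrow> 'x0" and \<pi>E :: "'e \<Rightarrow> 'e0"
    and actV :: "'g \<Rightarrow> 'x \<Rightarrow> 'x" and actE :: "'g \<Rightarrow> 'e \<Rightarrow> 'e"
    and l :: "'g \<Rightarrow> real ^ 'd::finite" and \<Psi> :: "'x \<Rightarrow> real ^ 'd" and p m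
begin

lemma sum_edge_weight:
  fixes f :: "'e0 \<Rightarrow> 'v::real_vector"
  shows "(\<Sum>e\<in>UNIV. edge_weight X0 p m e *\<^sub>R f e) = (\<Sum>y\<in>UNIV. m y *\<^sub>R (\<Sum>e | org X0 e = y. p e *\<^sub>R f e))"
proof -
  have "(\<Sum>y\<in>UNIV. m y *\<^sub>R (\<Sum>e | org X0 e = y. p e *\<^sub>R f e)) =
      (\<Sum>y\<in>UNIV. \<Sum>e | org X0 e = y. edge_weight X0 p m e *\<^sub>R f e)"
  proof (rule sum.cong[OF refl])
    fix y
    have "m y *\<^sub>R (\<Sum>e | org X0 e = y. p e *\<^sub>R f e) = (\<Sum>e | org X0 e = y. m y *\<^sub>R p e *\<^sub>R f e)"
      by (rule scaleR_sum_right)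
    also have "\<dots> = (\<Sum>e | org X0 e = y. edge_weight X0 p m e *\<^sub>R f e)"
      by (rule sum.cong) (auto simp: edge_weight_def mult.commute)
    finally show "m y *\<^sub>R (\<Sum>e | org X0 e = y. p e *\<^sub>R f e) = (\<Sum>e | org X0 e = y. edge_weight X0 p m e *\<^sub>R f e)" .
  qed
  then show ?thesis
    using sum.group[of UNIV UNIV "org X0" "\<lambda>e. edge_weight X0 p m e *\<^sub>R f e"] by simp
qed

lemma edge_weight_total: "(\<Sum>e\<in>UNIV. edge_weight X0 p m e) = 1"
  using sum_edge_weight[of "\<lambda>_. 1 :: real"] by (simp add: p_sum m_sum)

lemma gamma_p_H1: "gamma_p X0 p m \<in> H1 X0"
proof -
  have "(\<Sum>e\<in>UNIV. edge_weight X0 p m e *\<^sub>R (axis (ter X0 e) 1 - axis (org X0 e) 1)) = (0 :: real ^ 'x0)"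
  proof -
    have "(\<Sum>e\<in>UNIV. edge_weight X0 p m e * of_bool (ter X0 e = y)) = m y" for y
      using m_inv[of y] by (simp add: edge_weight_def of_bool_def if_distrib sum.If_cases cong: if_cong)
    moreover have "(\<Sum>e\<in>UNIV. edge_weight X0 p m e * of_bool (org X0 e = y)) = m y" for y
    proof -
      have "(\<Sum>e\<in>UNIV. edge_weight X0 p m e * of_bool (org X0 e = y)) = (\<Sum>e | org X0 e = y. p e * m y)"
        by (simp add: edge_weight_def of_bool_def if_distrib sum.If_cases cong: if_cong)
      then show ?thesis
        by (simp add: sum_distrib_right[symmetric] p_sum)
    qed
    ultimately show ?thesis
      by (simp add: vec_eq_iff axis_def of_bool_def right_diff_distrib sum_subtractf eq_commute)
  qed
  then show ?thesis
    by (simp add: H1_def gamma_p_def chain_C1[OF connected_X0] boundary_chain[OF connected_X0])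
qed

definition drift :: "real ^ 'd" where
  "drift = (\<Sum>e\<in>UNIV. edge_weight X0 p m e *\<^sub>R incr e)"

lemma rho_real_gamma_p: "rho_real (carrier \<Gamma>) X X0 \<pi>V \<pi>E actV x l (gamma_p X0 p m) = drift"
  by (simp add: rho_real gamma_p_H1) (simp add: gamma_p_def incr_chain drift_def)

lemma corrector_exists:
  "\<exists>u. \<forall>y. (\<Sum>e | org X0 e = y. p e *\<^sub>R (incr e + u (ter X0 e) - u (org X0 e))) = drift"
proof -
  define b where "b = (\<lambda>i y. (\<Sum>e | org X0 e = y. p e * incr e $ i) - drift $ i)"
  have "(\<Sum>y\<in>UNIV. m y * b i y) = 0" for i
  proof -
    have "drift $ i = (\<Sum>e\<in>UNIV. edge_weight X0 p m e *\<^sub>R (incr e $ i))"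
      by (simp add: drift_def)
    also have "\<dots> = (\<Sum>y\<in>UNIV. m y * (\<Sum>e | org X0 e = y. p e * incr e $ i))"
      unfolding sum_edge_weight by simp
    finally have "drift $ i = (\<Sum>y\<in>UNIV. m y * (\<Sum>e | org X0 e = y. p e * incr e $ i))" .
    then show ?thesis
      by (simp add: b_def right_diff_distrib sum_subtractf sum_distrib_right[symmetric] m_sum)
  qed
  then have "\<forall>i. \<exists>g. \<forall>y. g y - (\<Sum>e | org X0 e = y. p e * g (ter X0 e)) = b i y"
    using poisson_equation by blast
  then obtain g where g: "\<And>i y. g i y - (\<Sum>e | org X0 e = y. p e * g i (ter X0 e)) = b i y"
    by metis
  have "(\<Sum>e | org X0 e = y. p e *\<^sub>R (incr e + (\<chi> i. g i (ter X0 e)) - (\<chi> i. g i (org X0 e)))) = drift" for y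
  proof -
    have "(\<Sum>e | org X0 e = y. p e * g i (org X0 e)) = g i y" for i
    proof -
      have "(\<Sum>e | org X0 e = y. p e * g i (org X0 e)) = (\<Sum>e | org X0 e = y. p e * g i y)"
        by (intro sum.cong) auto
      then show ?thesis
        by (simp add: sum_distrib_right[symmetric] p_sum)
    qed
    then show ?thesis
      using g[of _ y] by (simp add: vec_eq_iff b_def distrib_left right_diff_distrib sum.distrib sum_subtractf algebra_simps)
  qed
  then show ?thesis
    by (intro exI[of _ "\<lambda>y. \<chi> i. g i y"]) simp
qed

definition corrector :: "'x0 \<Rightarrow> real ^ 'd" where
  "corrector = (SOME u. \<forall>y. (\<Sum>e | org X0 e = y. p e *\<^sub>R (incr e + u (ter X0 e) - u (org X0 e))) = drift)"

text \<open>The vector-valued modified harmonic 1-form: it is cohomologous to \<open>incr\<close>,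
  and its coordinates are the harmonic representatives of the coordinate functionals.\<close>

definition harm :: "'e0 \<Rightarrow> real ^ 'd" where
  "harm e = incr e + corrector (ter X0 e) - corrector (org X0 e)"

lemma harm: "(\<Sum>e | org X0 e = y. p e *\<^sub>R harm e) = drift"
  using someI_ex[OF corrector_exists] unfolding harm_def corrector_def by blast

lemma harm_bar: "harm (bar X0 e) = - harm e"
  by (simp add: harm_def incr_bar bar_simps[OF connected_X0])

lemma harm_H1: "c \<in> H1 X0 \<Longrightarrow> (\<Sum>e\<in>UNIV. (c $ e / 2) *\<^sub>R harm e) = incr_chain c"
  using H1_sum_exact[OF connected_X0, of c corrector]
  by (simp add: harm_def incr_chain_def scaleR_add_right sum.distrib add_diff_eq[symmetric])

text \<open>For uniqueness, the difference of two representatives vanishes on cycles, so it is the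
  gradient of some \<open>h\<close>; equal drifts make \<open>h\<close> harmonic, hence
  constant.\<close>

lemma harmonic_rep_eq:
  assumes \<xi>: "\<And>c. c \<in> H1 X0 \<Longrightarrow> \<xi> c = incr_chain c $ i"
  shows "harmonic_rep X0 p m \<xi> = (\<chi> e. harm e $ i)"
  unfolding harmonic_rep_def
proof (rule the_equality)
  let ?h = "\<chi> e. harm e $ i"
  have pair: "pairing c ?h = incr_chain c $ i" if "c \<in> H1 X0" for c
    using harm_H1[OF that, symmetric] by (simp add: pairing_def)
  have drift: "incr_chain (gamma_p X0 p m) = drift"
    by (simp add: gamma_p_def incr_chain drift_def)
  have sum: "(\<Sum>e | org X0 e = y. p e * harm e $ i) = drift $ i" for y
    using harm[of y, symmetric] by simp
  show "(\<forall>e. ?h $ bar X0 e = - ?h $ e) \<and> (\<forall>c\<in>H1 X0. pairing c ?h = \<xi> c) \<and>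
      (\<forall>y. (\<Sum>e | org X0 e = y. p e * ?h $ e) = pairing (gamma_p X0 p m) ?h)"
    using pair gamma_p_H1 by (simp add: harm_bar \<xi> sum drift)
  fix \<omega> assume *: "(\<forall>e. \<omega> $ bar X0 e = - \<omega> $ e) \<and> (\<forall>c\<in>H1 X0. pairing c \<omega> = \<xi> c) \<and>
      (\<forall>y. (\<Sum>e | org X0 e = y. p e * \<omega> $ e) = pairing (gamma_p X0 p m) \<omega>)"
  define \<delta> where "\<delta> = (\<lambda>e. \<omega> $ e - harm e $ i)"
  have bar: "\<delta> (bar X0 e) = - \<delta> e" for e
    using * by (simp add: \<delta>_def harm_bar)
  have H1: "(\<Sum>e\<in>UNIV. (c $ e / 2) *\<^sub>R \<delta> e) = 0" if "c \<in> H1 X0" for c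
    using * pair[OF that] that by (simp add: \<delta>_def \<xi> pairing_def right_diff_distrib sum_subtractf)
  have harm0: "(\<Sum>e | org X0 e = y. p e * \<delta> e) = 0" for y
    using * gamma_p_H1 by (simp add: \<delta>_def \<xi> right_diff_distrib sum_subtractf sum drift)
  have "\<exists>h. \<forall>e. \<delta> e = h (ter X0 e) - h (org X0 e)"
  \<comment> \<open>Any base vertex will do.\<close>
  proof (rule potential_exists[OF connected_X0, where y = undefined])
    show "\<delta> (bar X0 e) = - \<delta> e" for e
      by (rule bar)
    fix c assume "edge_path X0 undefined c undefined"
    from H1[OF closed_path_H1[OF connected_X0 this]] show "(\<Sum>e\<leftarrow>c. \<delta> e) = 0"
      using sum_chain[OF connected_X0, where g = \<delta>] bar sum_count_list[OF connected_X0, where g = \<delta>] by simp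
  qed
  then obtain h where h: "\<And>e. \<delta> e = h (ter X0 e) - h (org X0 e)"
    by blast
  have "h y = (\<Sum>e | org X0 e = y. p e * h (ter X0 e))" for y
  proof -
    have "0 = (\<Sum>e | org X0 e = y. p e * h (ter X0 e) - p e * h y)"
      unfolding harm0[of y, symmetric] by (intro sum.cong refl) (simp add: h right_diff_distrib)
    then show ?thesis
      by (simp add: sum_subtractf sum_distrib_right[symmetric] p_sum)
  qed
  from harmonic_constant[of h, OF this] have "\<delta> e = 0" for e
    by (simp add: h)
  then show "\<omega> = ?h"
    by (simp add: vec_eq_iff \<delta>_def)
qed

sublocale martingale_walk X0 p m "\<lambda>e. harm e - drift"
  by unfold_locales (simp add: scaleR_diff_right sum_subtractf harm scaleR_sum_left[symmetric] p_sum)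

text \<open>The subtracted product of pairings centres the second moment, because
  \<open>harm\<close> has stationary mean \<open>drift\<close>.\<close>

lemma albanese_Sigma_eq:
  "\<phi> \<bullet> (albanese_Sigma X0 p m (rho_real (carrier \<Gamma>) X X0 \<pi>V \<pi>E actV x l) *v \<theta>) = cov \<phi> \<theta>"
proof -
  let ?R = "rho_real (carrier \<Gamma>) X X0 \<pi>V \<pi>E actV x l"
  let ?w = "edge_weight X0 p m"
  have rep: "harmonic_rep X0 p m (\<lambda>a. ?R a $ i) = (\<chi> e. harm e $ i)" for i
    by (rule harmonic_rep_eq) (simp add: rho_real)
  have mean: "(\<Sum>e\<in>UNIV. ?w e * harm e $ i) = drift $ i" for i
    using arg_cong[OF sum_edge_weight[of harm], of "\<lambda>v. v $ i"]
    by (simp add: harm scaleR_sum_left[symmetric] m_sum)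
  have pair: "pairing (gamma_p X0 p m) (\<chi> e. harm e $ i) = drift $ i" for i
    using sum_chain[OF connected_X0, of "\<lambda>e. harm e $ i" ?w] mean[of i] by (simp add: pairing_def gamma_p_def harm_bar)
  have entry: "albanese_Sigma X0 p m ?R $ i $ j = (\<Sum>e\<in>UNIV. ?w e * ((harm e - drift) $ i * (harm e - drift) $ j))" for i j
  proof -
    have "(\<Sum>e\<in>UNIV. ?w e * ((harm e - drift) $ i * (harm e - drift) $ j)) =
        (\<Sum>e\<in>UNIV. ?w e * harm e $ i * harm e $ j - drift $ j * (?w e * harm e $ i) - drift $ i * (?w e * harm e $ j) + drift $ i * drift $ j * ?w e)"
      by (intro sum.cong refl) (simp add: algebra_simps)
    also have "\<dots> = (\<Sum>e\<in>UNIV. ?w e * harm e $ i * harm e $ j) - drift $ i * drift $ j"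
      by (simp add: sum.distrib sum_subtractf sum_distrib_left[symmetric] mean edge_weight_total)
    finally show ?thesis
      by (simp add: albanese_Sigma_def albanese_form_def Let_def rep pair)
  qed
  have "\<phi> \<bullet> (albanese_Sigma X0 p m ?R *v \<theta>) =
      (\<Sum>i\<in>UNIV. \<Sum>j\<in>UNIV. \<Sum>e\<in>UNIV. ?w e * ((\<phi> $ i * (harm e - drift) $ i) * (\<theta> $ j * (harm e - drift) $ j)))"
    by (simp add: inner_vec_def matrix_vector_mult_def entry sum_distrib_left sum_distrib_right mult_ac del: vector_minus_component)
  also have "\<dots> = (\<Sum>e\<in>UNIV. ?w e * ((\<phi> \<bullet> (harm e - drift)) * (\<theta> \<bullet> (harm e - drift))))"
  proof -
    have "?w e * ((\<phi> \<bullet> (harm e - drift)) * (\<theta> \<bullet> (harm e - drift))) =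
       (\<Sum>i\<in>UNIV. \<Sum>j\<in>UNIV. ?w e * ((\<phi> $ i * (harm e - drift) $ i) * (\<theta> $ j * (harm e - drift) $ j)))" for e
      by (simp only: inner_vec_def inner_real_def sum_product) (simp only: sum_distrib_left)
    moreover have "(\<Sum>i\<in>UNIV. \<Sum>j\<in>UNIV. \<Sum>e\<in>UNIV. f i j e) = (\<Sum>e\<in>UNIV. \<Sum>i\<in>UNIV. \<Sum>j\<in>UNIV. f i j e)"
      for f :: "'d \<Rightarrow> 'd \<Rightarrow> 'e0 \<Rightarrow> real"
    proof -
      have "(\<Sum>i\<in>UNIV. \<Sum>j\<in>UNIV. \<Sum>e\<in>UNIV. f i j e) = (\<Sum>i\<in>UNIV. \<Sum>e\<in>UNIV. \<Sum>j\<in>UNIV. f i j e)"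
        by (intro sum.cong refl sum.swap)
      also have "\<dots> = (\<Sum>e\<in>UNIV. \<Sum>i\<in>UNIV. \<Sum>j\<in>UNIV. f i j e)"
        by (rule sum.swap)
      finally show ?thesis .
    qed
    ultimately show ?thesis
      by (simp only:)
  qed
  finally show ?thesis
    by (simp add: cov_def edge_weight_def)
qed

text \<open>Zero variance forces \<open>\<theta> \<bullet> harm e\<close> to take the same value on
  all edges. Opposite edges have opposite values, so it is 0. Summing along a path from
  \<open>y\<close> to \<open>actV \<gamma> y\<close> gives
  \<open>\<theta> \<bullet> l \<gamma> = 0\<close> for every \<gamma>.\<close>

lemma cov_positive:
  assumes "\<theta> \<noteq> 0"
  shows "0 < cov \<theta> \<theta>"
proof (rule ccontr)
  assume "\<not> 0 < cov \<theta> \<theta>"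
  then have "cov \<theta> \<theta> = 0"
    using cov_nonneg[of \<theta>] by simp
  then have "\<forall>e\<in>UNIV. p e * m (org X0 e) * ((\<theta> \<bullet> (harm e - drift)) * (\<theta> \<bullet> (harm e - drift))) = 0"
    unfolding cov_def by (subst (asm) sum_nonneg_eq_0_iff) (auto simp: p_nonneg less_imp_le[OF m_pos])
  then have "\<theta> \<bullet> (harm e - drift) = 0" for e
    using p_pos[of e] m_pos[of "org X0 e"] by (metis UNIV_I less_irrefl mult_eq_0_iff)
  then have eq: "\<theta> \<bullet> harm e = \<theta> \<bullet> drift" for e
    by (simp add: inner_diff_right)
  have z: "\<theta> \<bullet> harm e = 0" for e
    using eq[of e] eq[of "bar X0 e"] by (simp add: harm_bar)
  have "\<theta> \<bullet> l \<gamma> = 0" if \<gamma>: "\<gamma> \<in> carrier \<Gamma>" for \<gamma>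
  proof -
    fix y :: 'x
    obtain es where es: "edge_path X y es (actV \<gamma> y)"
      using connected_X unfolding connected_graph_def by blast
    have "\<pi>V (actV \<gamma> y) = \<pi>V y"
      using quotient(3)[of y "actV \<gamma> y"] \<gamma> by auto
    then have ex: "(\<Sum>e\<leftarrow>map \<pi>E es. corrector (ter X0 e) - corrector (org X0 e)) = 0"
      using path_sum_exact[OF connected_X0 project_path[OF es], of corrector] by simp
    have "(\<Sum>e\<leftarrow>map \<pi>E es. harm e) = (\<Sum>e\<leftarrow>map \<pi>E es. incr e) + (\<Sum>e\<leftarrow>map \<pi>E es. corrector (ter X0 e) - corrector (org X0 e))"
      unfolding sum_list_addf[symmetric] by (intro arg_cong[where f = sum_list] map_cong refl) (simp add: harm_def)
    also have "\<dots> = l \<gamma>"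
      unfolding ex using path_incr[OF es] equivariant[OF \<gamma>] by (simp add: o_def)
    finally have "l \<gamma> = (\<Sum>e\<leftarrow>map \<pi>E es. harm e)" ..
    moreover have "\<theta> \<bullet> (\<Sum>e\<leftarrow>c. harm e) = 0" for c
      by (induction c) (simp_all add: inner_add_right z)
    ultimately show ?thesis
      by metis
  qed
  then show False
    using spanning[of \<theta>] assms by blast
qed

section \<open>The path measure\<close>

primrec weight :: "'x0 \<Rightarrow> 'e0 list \<Rightarrow> real" where
  "weight y [] = 1"
| "weight y (e # es) = of_bool (org X0 e = y) * p e * weight (ter X0 e) es"

lemma weight_path: "edge_path X0 y c z \<Longrightarrow> weight y c = (\<Prod>e\<leftarrow>c. p e)"
  by (induction c arbitrary: y) auto

lemma weight_no_path: "(\<And>z. \<not> edge_path X0 y c z) \<Longrightarrow> weight y c = 0"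
  by (induction c arbitrary: y) auto

lemma expect_eq_sum: "expect n y F = (\<Sum>c | length c = n. weight y c * F c)"
proof (induction n arbitrary: y F)
  case (Suc n)
  have "(\<Sum>c | length c = Suc n. weight y c * F c) = (\<Sum>(e, c)\<in>UNIV \<times> {c. length c = n}. weight y (e # c) * F (e # c))"
    by (rule sum.reindex_bij_witness[of _ "\<lambda>(e, c). e # c" "\<lambda>c. (hd c, tl c)"]) (auto simp: length_Suc_conv)
  also have "\<dots> = (\<Sum>e\<in>UNIV. \<Sum>c | length c = n. weight y (e # c) * F (e # c))"
    by (rule sum.cartesian_product[symmetric])
  also have "\<dots> = (\<Sum>e\<in>UNIV. of_bool (org X0 e = y) * (p e * expect n (ter X0 e) (\<lambda>c. F (e # c))))"
    by (simp add: Suc.IH sum_distrib_left mult_ac)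
  also have "\<dots> = expect (Suc n) y F"
    by (simp add: of_bool_def if_distrib[of "\<lambda>a. a * _"] sum.If_cases cong: if_cong)
  finally show ?case ..
qed simp

text \<open>Each edge path in \<open>X0\<close> from the base point has exactly one lift from
  \<open>x\<close>, so prescribing the first \<open>n\<close> projected edges is a cylinder event in
  \<open>X\<close>. Lists that are not paths give the empty event and weight 0.\<close>

lemma measure_path_event:
  assumes P: "markov_path_measure X (p \<circ> \<pi>E) x P"
  shows "measure P {c \<in> space P. map (\<lambda>i. \<pi>E (c i)) [0..<n] \<in> L} = expect n (\<pi>V x) (\<lambda>es. of_bool (es \<in> L))"
proof -
  interpret prob_space P
    using P by (simp add: markov_path_measure_def)
  have space: "space P = infinite_paths X x"
    and sets: "sets P = sets (restrict_space (\<Pi>\<^sub>M n\<in>UNIV. count_space UNIV) (infinite_paths X x))"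
    and cyl: "\<And>es y. edge_path X x es y \<Longrightarrow>
        measure P {c \<in> infinite_paths X x. \<forall>i<length es. c i = es ! i} = (\<Prod>e\<leftarrow>es. (p \<circ> \<pi>E) e)"
    using P by (auto simp: markov_path_measure_def)
  define S where "S = (\<lambda>c0. {c \<in> space P. map (\<lambda>i. \<pi>E (c i)) [0..<n] = c0})"
  have path: "edge_path X (org X (c k)) (map c [k..<k+j]) (org X (c (k + j)))" if "c \<in> infinite_paths X x" for c k j
  proof (induction j arbitrary: k)
    case (Suc j)
    have "map c [k..<k + Suc j] = c k # map c [Suc k..<Suc k + j]"
      by (simp add: upt_conv_Cons del: upt_Suc)
    moreover have "ter X (c k) = org X (c (Suc k))"
      using that by (simp add: infinite_paths_def)
    ultimately show ?case
      using Suc[of "Suc k"] by (simp del: upt_Suc)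
  qed simp
  have S_sets: "S c0 \<in> sets P" for c0
  proof (cases "length c0 = n")
    case True
    \<comment> \<open>The outer intersection with the space takes care of \<open>n = 0\<close>,
      where the inner family is empty.\<close>
    have "(\<Inter>i<n. (\<lambda>c. c i) -` {e. \<pi>E e = c0 ! i} \<inter> space (\<Pi>\<^sub>M n\<in>UNIV. count_space (UNIV :: 'e set))) \<inter> space (\<Pi>\<^sub>M n\<in>UNIV. count_space (UNIV :: 'e set)) \<in> sets (\<Pi>\<^sub>M n\<in>(UNIV :: nat set). count_space (UNIV :: 'e set))"
    proof -
      have *: "(\<lambda>c. c i) -` {e. \<pi>E e = c0 ! i} \<inter> space (\<Pi>\<^sub>M n\<in>UNIV. count_space (UNIV :: 'e set)) \<in> sets (\<Pi>\<^sub>M n\<in>(UNIV :: nat set). count_space (UNIV :: 'e set))" for i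
        by (rule measurable_sets[OF measurable_component_singleton]) auto
      show ?thesis
      proof (cases "n = 0")
        case False
        then show ?thesis
          by (intro sets.Int sets.finite_INT sets.top *) auto
      qed simp
    qed
    moreover have "S c0 = infinite_paths X x \<inter> ((\<Inter>i<n. (\<lambda>c. c i) -` {e. \<pi>E e = c0 ! i} \<inter> space (\<Pi>\<^sub>M n\<in>UNIV. count_space (UNIV :: 'e set))) \<inter> space (\<Pi>\<^sub>M n\<in>UNIV. count_space (UNIV :: 'e set)))"
      using True by (auto simp: S_def space list_eq_iff_nth_eq space_PiM)
    ultimately show ?thesis
      unfolding sets sets_restrict_space by blast
  next
    case False
    then have "S c0 = {}"
      by (auto simp: S_def)
    then show ?thesis
      by simp
  qed
  have S_measure: "measure P (S c0) = weight (\<pi>V x) c0" if len: "length c0 = n" for c0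
  proof (cases "\<exists>z. edge_path X0 (\<pi>V x) c0 z")
    case True
    then obtain z0 where z0: "edge_path X0 (\<pi>V x) c0 z0"
      by blast
    from lift_path[OF z0] obtain es z where es: "map \<pi>E es = c0" "edge_path X x es z"
      by blast
    have "S c0 = {c \<in> infinite_paths X x. \<forall>i<length es. c i = es ! i}"
    proof (intro equalityI subsetI)
      fix c assume c: "c \<in> S c0"
      then have inf: "c \<in> infinite_paths X x" and m: "map (\<lambda>i. \<pi>E (c i)) [0..<n] = c0"
        by (auto simp: S_def space)
      have "edge_path X x (map c [0..<n]) (org X (c n))"
        using path[OF inf, of 0 n] inf by (simp add: infinite_paths_def)
      moreover have "map \<pi>E (map c [0..<n]) = map \<pi>E es"
        using m es by (simp add: o_def)
      ultimately have "map c [0..<n] = es"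
        using lift_path_unique es(2) by blast
      then show "c \<in> {c \<in> infinite_paths X x. \<forall>i<length es. c i = es ! i}"
        using inf by auto
    next
      fix c assume "c \<in> {c \<in> infinite_paths X x. \<forall>i<length es. c i = es ! i}"
      then show "c \<in> S c0"
        using es(1) len by (auto simp: S_def space list_eq_iff_nth_eq)
    qed
    then show ?thesis
      using cyl[OF es(2)] weight_path[OF z0] by (simp add: es(1)[symmetric] o_def)
  next
    case False
    have "S c0 = {}"
    proof (rule ccontr)
      assume "S c0 \<noteq> {}"
      then obtain c where c: "c \<in> infinite_paths X x" "map (\<lambda>i. \<pi>E (c i)) [0..<n] = c0"
        by (auto simp: S_def space)
      then have "edge_path X0 (\<pi>V x) c0 (\<pi>V (org X (c n)))"
        using project_path[OF path[OF c(1), of 0 n]] by (simp add: infinite_paths_def o_def)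
      then show False
        using False by blast
    qed
    then show ?thesis
      using weight_no_path False by auto
  qed
  have fin: "finite {c :: 'e0 list. length c = n}"
    using finite_lists_length_eq[of "UNIV :: 'e0 set" n] by simp
  have "{c \<in> space P. map (\<lambda>i. \<pi>E (c i)) [0..<n] \<in> L} = (\<Union>c0\<in>{c. length c = n} \<inter> L. S c0)"
    by (auto simp: S_def)
  also have "measure P \<dots> = (\<Sum>c0\<in>{c. length c = n} \<inter> L. measure P (S c0))"
    using fin S_sets by (intro finite_measure_finite_Union) (auto simp: disjoint_family_on_def S_def)
  also have "\<dots> = (\<Sum>c0\<in>{c. length c = n} \<inter> L. weight (\<pi>V x) c0)"
    by (intro sum.cong) (auto simp: S_measure)
  also have "\<dots> = (\<Sum>c0 | length c0 = n. weight (\<pi>V x) c0 * of_bool (c0 \<in> L))"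
    using fin by (simp add: of_bool_def sum.inter_restrict if_distrib cong: if_cong)
  also have "\<dots> = expect n (\<pi>V x) (\<lambda>es. of_bool (es \<in> L))"
    by (simp add: expect_eq_sum)
  finally show ?thesis .
qed

end

section \<open>The moderate deviation principle on path space\<close>

text \<open>At \<open>t = 1\<close> the definition mentions \<open>Y (n + 1)\<close>, but with
  coefficient 0; the clamped form shows that only the first \<open>n\<close> values matter.\<close>

lemma interpolated_path_cong:
  assumes "\<And>k. 1 \<le> k \<Longrightarrow> k \<le> n \<Longrightarrow> Y k = Y' k"
  shows "interpolated_path Y b n = interpolated_path Y' b n"
proof
  fix t
  show "interpolated_path Y b n t = interpolated_path Y' b n t"
  proof (cases "t \<in> {0..1}")
    case True
    have "(\<Sum>k=1..n. clamp01 (real n * t - (real k - 1)) *\<^sub>R Y k) = (\<Sum>k=1..n. clamp01 (real n * t - (real k - 1)) *\<^sub>R Y' k)"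
      by (intro sum.cong refl) (simp add: assms)
    then show ?thesis
      by (simp only: interpolated_path_clamp[OF True])
  next
    case False
    then show ?thesis
      unfolding interpolated_path_def restrict_apply by (simp only: if_False)
  qed
qed

lemma sum_nth_take: "i \<le> length es \<Longrightarrow> (\<Sum>k=1..i. f (es ! (k - 1))) = (\<Sum>e\<leftarrow>take i es. f e :: 'a::comm_monoid_add)"
  by (induction i) (simp_all add: take_Suc_conv_app_nth)

lemma (in finite_walk) edge_path_take:
  "edge_path X0 y es z \<Longrightarrow> edge_path X0 y (take i es) (endpt y (take i es))"
proof (induction es arbitrary: y i)
  case (Cons e es)
  then show ?case
    by (cases i) auto
qed simp

lemma ereal_log_prob_lower:
  assumes "0 < s" "exp (- (s * c)) \<le> q"
  shows "ereal (- c) \<le> ereal (1 / s) * log_prob q"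
proof -
  have q: "0 < q"
    using assms(2) exp_gt_zero less_le_trans by blast
  then have "- (s * c) \<le> ln q"
    using assms(2) by (subst ln_ge_iff) auto
  then have "- c \<le> 1 / s * ln q"
    using assms(1) by (simp add: field_simps)
  then show ?thesis
    using q by (simp add: log_prob_def)
qed

lemma ereal_log_prob_upper:
  assumes "0 < s" "0 \<le> q" "q \<le> exp (- (s * c))"
  shows "ereal (1 / s) * log_prob q \<le> ereal (- c)"
proof (cases "q = 0")
  case True
  then show ?thesis
    using assms(1) by (simp add: log_prob_def)
next
  case False
  then have q: "0 < q"
    using assms(2) by simp
  then have "ln q \<le> - (s * c)"
    using assms(3) by (metis ln_exp ln_mono exp_gt_zero)
  then have "1 / s * ln q \<le> - c"
    using assms(1) by (simp add: field_simps)
  then show ?thesis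
    using q by (simp add: log_prob_def)
qed

text \<open>\<open>Y\<close> is the observed centred increment and \<open>D\<close> the martingale
  increment; they differ by the coboundary of \<open>u\<close>.\<close>

locale mdp_increments = mdp_walk X0 p m D "\<lambda>v. matrix_inv \<Sigma> *v v" a + posdef_matrix \<Sigma>
  for X0 :: "('x0::finite, 'e0::finite) ograph" and p m and D :: "'e0 \<Rightarrow> real ^ 'd::finite" and a and \<Sigma> +
  fixes u :: "'x0 \<Rightarrow> real ^ 'd" and Y :: "'e0 \<Rightarrow> real ^ 'd"
  assumes Y: "Y e = D e - (u (ter X0 e) - u (org X0 e))"
begin

definition walk_path :: "nat \<Rightarrow> 'e0 list \<Rightarrow> real \<Rightarrow> real ^ 'd" where
  "walk_path n es = interpolated_path (\<lambda>k. Y (es ! (k - 1))) (a n) n"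

definition grid :: "nat \<Rightarrow> nat \<Rightarrow> 'e0 list \<Rightarrow> nat \<Rightarrow> real ^ 'd" where
  "grid K n es j = sumD (take (j * (n div K)) es) /\<^sub>R a n"

text \<open>Collects, before division by \<open>a n\<close>, every error not governed by the blocks:
  the interpolation term, the coboundary at both ends, and up to \<open>K\<close> edges by which
  step and block boundaries are out of phase.\<close>

definition gap :: "nat \<Rightarrow> real" where
  "gap K = (\<Sum>e\<in>UNIV. norm (Y e)) + 2 * (\<Sum>y\<in>UNIV. norm (u y)) + real K * (\<Sum>e\<in>UNIV. norm (D e))"

definition steady :: "real \<Rightarrow> nat \<Rightarrow> nat \<Rightarrow> 'e0 list \<Rightarrow> bool" where
  "steady \<delta> K n es \<longleftrightarrow> \<not> (\<exists>j<K. \<exists>k\<le>n div K. \<delta> * a n < norm (sumD (take k (block (n div K) j es))))"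

lemma Q_qf: "Q v = qf v"
  by (simp add: Q_def qf_def)

lemma norm_sumD_le: "norm (sumD es) \<le> length es * (\<Sum>e\<in>UNIV. norm (D e))"
proof (induction es)
  case (Cons e es)
  have "norm (D e) \<le> (\<Sum>e\<in>UNIV. norm (D e))"
    by (rule member_le_sum) auto
  then show ?case
    using Cons norm_triangle_ineq[of "D e" "sumD es"] by (simp add: distrib_right)
qed simp

lemma sumD_take_diff: "i \<le> j \<Longrightarrow> sumD (take j es) - sumD (take i es) = sumD (take (j - i) (drop i es))"
  using take_add[of i "j - i" es] by simp

lemma grid_0: "grid K n es 0 = 0"
  by (simp add: grid_def)

lemma grid_Suc: "grid K n es (Suc j) - grid K n es j = sumD (block (n div K) j es) /\<^sub>R a n"
proof -
  have "sumD (take (Suc j * (n div K)) es) - sumD (take (j * (n div K)) es) = sumD (block (n div K) j es)"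
    using sumD_take_diff[of "j * (n div K)" "Suc j * (n div K)" es] by (simp add: block_def)
  then show ?thesis
    by (simp only: grid_def scaleR_diff_right[symmetric])
qed

lemma floor_01:
  assumes "t \<in> {0..1}"
  shows "real (nat \<lfloor>real K * t\<rfloor>) \<le> real K * t" "real K * t < real (nat \<lfloor>real K * t\<rfloor>) + 1" "nat \<lfloor>real K * t\<rfloor> \<le> K"
    "of_int \<lfloor>real K * t\<rfloor> = real (nat \<lfloor>real K * t\<rfloor>)"
proof -
  have "real K * t \<le> K" "0 \<le> real K * t"
    using assms by (auto simp: mult_left_le)
  then show "real (nat \<lfloor>real K * t\<rfloor>) \<le> real K * t" "real K * t < real (nat \<lfloor>real K * t\<rfloor>) + 1" "nat \<lfloor>real K * t\<rfloor> \<le> K"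
    "of_int \<lfloor>real K * t\<rfloor> = real (nat \<lfloor>real K * t\<rfloor>)"
    by linarith+
qed

lemma steady_take:
  assumes "steady \<delta> K n es" "j < K" "j * (n div K) \<le> i" "i \<le> Suc j * (n div K)"
  shows "norm (sumD (take i es) - sumD (take (j * (n div K)) es)) \<le> \<delta> * a n"
proof -
  let ?N = "n div K"
  have k: "i - j * ?N \<le> ?N"
    using assms(4) by simp
  have "take (i - j * ?N) (drop (j * ?N) es) = take (i - j * ?N) (block ?N j es)"
    using k by (simp add: block_def min_def)
  moreover have "norm (sumD (take (i - j * ?N) (block ?N j es))) \<le> \<delta> * a n"
    using assms(1,2) k unfolding steady_def not_ex not_less de_Morgan_conj by (metis not_less)
  ultimately show ?thesis
    using sumD_take_diff[OF assms(3), of es] by simp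
qed

lemma steady_block:
  assumes "steady \<delta> K n es" "j < K"
  shows "norm (sumD (block (n div K) j es)) \<le> \<delta> * a n"
  using steady_take[OF assms, of "Suc j * (n div K)"] sumD_take_diff[of "j * (n div K)" "Suc j * (n div K)" es]
  by (simp add: block_def)

lemma grid_path_near:
  assumes n: "1 \<le> n" and st: "steady \<delta> K n es" and t: "t \<in> {0..1}" and \<delta>: "0 \<le> \<delta>"
  shows "norm (interpolated_path (\<lambda>k. grid K n es k - grid K n es (k - 1)) 1 K t - grid K n es (nat \<lfloor>real K * t\<rfloor>)) \<le> \<delta>"
proof -
  let ?q = "grid K n es"
  define j where "j = nat \<lfloor>real K * t\<rfloor>"
  note fl = floor_01[OF t, of K, folded j_def]
  have tel: "(\<Sum>k=1..i. ?q k - ?q (k - 1)) = ?q i" for i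
    by (induction i) (simp_all add: grid_0)
  have eq: "interpolated_path (\<lambda>k. ?q k - ?q (k - 1)) 1 K t - ?q j = (real K * t - j) *\<^sub>R (?q (Suc j) - ?q j)"
    using t by (simp add: interpolated_path_def j_def[symmetric] fl(4) tel[unfolded One_nat_def])
  show ?thesis
  proof (cases "j < K")
    case True
    have "norm (sumD (block (n div K) j es)) \<le> \<delta> * a n"
      by (rule steady_block[OF st True])
    then have "norm (?q (Suc j) - ?q j) \<le> \<delta>"
      using a_pos[OF n] unfolding grid_Suc by (simp add: divide_le_eq field_simps)
    moreover have "\<bar>real K * t - j\<bar> \<le> 1"
      using fl by linarith
    ultimately have "\<bar>real K * t - j\<bar> * norm (?q (Suc j) - ?q j) \<le> 1 * \<delta>"
      by (intro mult_mono) auto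
    then show ?thesis
      unfolding j_def[symmetric] eq by simp
  next
    case False
    have "real K * t \<le> K"
      using t by (auto simp: mult_left_le)
    then have "real K * t - j = 0"
      using False fl by linarith
    then show ?thesis
      unfolding j_def[symmetric] eq using \<delta> by simp
  qed
qed

text \<open>Because \<open>n div K\<close> may be smaller than \<open>n / K\<close>, the step
  reached at time \<open>t\<close> can overshoot the end of its grid cell, but by at most
  \<open>K\<close> edges. Inside the cell steadiness applies, and the overshoot is bounded edge by
  edge.\<close>

lemma walk_path_near:
  assumes n: "1 \<le> n" and K: "0 < K" and es: "length es = n" "edge_path X0 y es z"
    and st: "steady \<delta> K n es" and t: "t \<in> {0..1}" and \<delta>: "0 \<le> \<delta>"
  shows "norm (walk_path n es t - grid K n es (nat \<lfloor>real K * t\<rfloor>)) \<le> \<delta> + gap K / a n"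
proof -
  let ?N = "n div K"
  define MD where "MD = (\<Sum>e\<in>UNIV. norm (D e))"
  define MY where "MY = (\<Sum>e\<in>UNIV. norm (Y e))"
  define MU where "MU = (\<Sum>y\<in>UNIV. norm (u y))"
  have MD0: "0 \<le> MD"
    by (simp add: MD_def sum_nonneg)
  have MY: "norm (Y e) \<le> MY" for e
    unfolding MY_def by (rule member_le_sum) auto
  have MU: "norm (u y) \<le> MU" for y
    unfolding MU_def by (rule member_le_sum) auto
  define j where "j = nat \<lfloor>real K * t\<rfloor>"
  define i where "i = nat \<lfloor>real n * t\<rfloor>"
  note fj = floor_01[OF t, of K, folded j_def] and fi = floor_01[OF t, of n, folded i_def]
  have an: "0 < a n"
    using a_pos[OF n] .
  have nK: "K * ?N \<le> n" "n \<le> K * ?N + K"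
    using mult_div_mod_eq[of K n] mod_less_divisor[OF K, of n] by linarith+
  have lo: "j * ?N \<le> i"
  proof -
    have "real j * ?N \<le> real K * t * ?N"
      using fj(1) by (intro mult_right_mono) auto
    also have "\<dots> = real (K * ?N) * t"
      by simp
    also have "\<dots> \<le> real n * t"
      using nK(1) t by (intro mult_right_mono of_nat_mono) auto
    finally have "real (j * ?N) < real (i + 1)"
      using fi(2) by simp
    then show ?thesis
      by linarith
  qed
  have hi: "i \<le> Suc j * ?N + K"
  proof -
    have "real i \<le> real (K * ?N + K) * t"
      using fi(1) mult_right_mono[OF of_nat_mono[OF nK(2), where 'a = real], of t] t by simp
    also have "\<dots> = real K * t * ?N + real K * t"
      by (simp add: algebra_simps)
    also have "\<dots> \<le> (real j + 1) * ?N + K"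
      using fj(2) t by (intro add_mono mult_right_mono) (auto simp: mult_left_le)
    finally have "real i \<le> real (Suc j * ?N + K)"
      by (simp add: distrib_right)
    then show ?thesis
      by linarith
  qed
  have tail: "norm (sumD (take i es) - sumD (take k es)) \<le> real K * MD" if "k \<le> i" "i \<le> k + K" for k
  proof -
    have "norm (sumD (take (i - k) (drop k es))) \<le> real (length (take (i - k) (drop k es))) * MD"
      unfolding MD_def by (rule norm_sumD_le)
    also have "\<dots> \<le> real K * MD"
      using that MD0 by (intro mult_right_mono) auto
    finally show ?thesis
      by (simp add: sumD_take_diff[OF that(1)])
  qed
  have main: "norm (sumD (take i es) - sumD (take (j * ?N) es)) \<le> \<delta> * a n + real K * MD"
  proof (cases "j < K")
    case True
    show ?thesis
    proof (cases "i \<le> Suc j * ?N")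
      case le: True
      have "0 \<le> real K * MD"
        using MD0 by simp
      then show ?thesis
        using steady_take[OF st True lo le] by linarith
    next
      case False
      have "norm (sumD (take (Suc j * ?N) es) - sumD (take (j * ?N) es)) \<le> \<delta> * a n"
        using steady_take[OF st True, of "Suc j * ?N"] by simp
      moreover have "norm (sumD (take i es) - sumD (take (Suc j * ?N) es)) \<le> real K * MD"
        using False hi by (intro tail) auto
      moreover have eq: "sumD (take i es) - sumD (take (j * ?N) es) = (sumD (take i es) - sumD (take (Suc j * ?N) es)) + (sumD (take (Suc j * ?N) es) - sumD (take (j * ?N) es))"
        by simp
      ultimately show ?thesis
        unfolding eq by (intro order_trans[OF norm_triangle_ineq]) linarith
    qed
  next
    \<comment> \<open>This is \<open>t = 1\<close>: only edges after the last block remain.\<close>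
    case False
    then have "j = K"
      using fj(3) by simp
    then have "norm (sumD (take i es) - sumD (take (j * ?N) es)) \<le> real K * MD"
      using lo nK(2) fi(3) by (intro tail) auto
    moreover have "0 \<le> \<delta> * a n"
      using \<delta> an by simp
    ultimately show ?thesis
      by linarith
  qed
  have part: "(\<Sum>k=1..i. Y (es ! (k - 1))) = sumD (take i es) - (u (endpt y (take i es)) - u y)"
  proof -
    have "(\<Sum>e\<leftarrow>take i es. Y e) = sumD (take i es) - (\<Sum>e\<leftarrow>take i es. u (ter X0 e) - u (org X0 e))"
      unfolding sumD_def sum_list_subtractf[symmetric] by (simp add: Y)
    also have "(\<Sum>e\<leftarrow>take i es. u (ter X0 e) - u (org X0 e)) = u (endpt y (take i es)) - u y"
      by (rule path_sum_exact[OF connected edge_path_take[OF es(2)]])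
    finally show ?thesis
      using sum_nth_take[of i es Y] fi(3) es(1) by simp
  qed
  let ?E = "(u (endpt y (take i es)) - u y)"
  let ?F = "(real n * t - real i) *\<^sub>R Y (es ! i)"
  have "walk_path n es t = ((\<Sum>k=1..i. Y (es ! (k - 1))) + ?F) /\<^sub>R a n"
    using t by (simp add: walk_path_def interpolated_path_def i_def[symmetric] fi(4) scaleR_add_right divide_inverse)
  then have val: "walk_path n es t - grid K n es j = (sumD (take i es) - sumD (take (j * ?N) es) - ?E + ?F) /\<^sub>R a n"
    unfolding part grid_def by (simp add: scaleR_add_right scaleR_diff_right)
  have "norm ?E \<le> 2 * MU"
    using norm_triangle_ineq4[of "u (endpt y (take i es))" "u y"] MU[of "endpt y (take i es)"] MU[of y] by linarith
  moreover have "norm ?F \<le> MY"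
  proof -
    have "\<bar>real n * t - real i\<bar> * norm (Y (es ! i)) \<le> 1 * MY"
      using fi(1,2) MY by (intro mult_mono) auto
    then show ?thesis
      by simp
  qed
  ultimately have "norm (sumD (take i es) - sumD (take (j * ?N) es) - ?E + ?F) \<le> \<delta> * a n + gap K"
    using main norm_triangle_ineq[of "sumD (take i es) - sumD (take (j * ?N) es) - ?E" ?F]
      norm_triangle_ineq4[of "sumD (take i es) - sumD (take (j * ?N) es)" ?E]
    unfolding gap_def MD_def[symmetric] MY_def[symmetric] MU_def[symmetric] by linarith
  then have "norm (sumD (take i es) - sumD (take (j * ?N) es) - ?E + ?F) / a n \<le> (\<delta> * a n + gap K) / a n"
    using an by (intro divide_right_mono) auto
  moreover have "norm (walk_path n es t - grid K n es j) = norm (sumD (take i es) - sumD (take (j * ?N) es) - ?E + ?F) / a n"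
    unfolding val norm_scaleR using an by (simp only: abs_of_pos positive_imp_inverse_positive divide_inverse mult.commute)
  ultimately have "norm (walk_path n es t - grid K n es j) \<le> (\<delta> * a n + gap K) / a n"
    by simp
  then show ?thesis
    using an by (simp add: j_def add_divide_distrib)
qed

lemma a_at_top: "filterlim a at_top sequentially"
proof (rule filterlim_at_top_mono[OF a_sqrt])
  show "\<forall>\<^sub>F n in sequentially. a n / sqrt (real n) \<le> a n"
    using eventually_ge_at_top[of 1]
  proof eventually_elim
    case (elim n)
    then have "1 \<le> sqrt (real n)"
      by simp
    then have "a n * 1 \<le> a n * sqrt (real n)"
      using a_pos[OF elim] by (intro mult_left_mono) auto
    then show ?case
      using elim by (simp add: divide_le_eq)
  qed
qed

lemma eventually_gap: "0 < \<delta> \<Longrightarrow> \<forall>\<^sub>F n in sequentially. gap K / a n \<le> \<delta>"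
  using filterlim_at_top_dense[THEN iffD1, OF a_at_top, rule_format, of "max 0 (gap K / \<delta>)"]
  by eventually_elim (auto simp: field_simps)

text \<open>The hypothesis is restricted to genuine edge paths because the comparison with the grid
  telescopes the coboundary.\<close>

lemma expect_union:
  assumes "\<And>es z. length es = n \<Longrightarrow> edge_path X0 y es z \<Longrightarrow> A es \<Longrightarrow> B es \<or> C es"
  shows "expect n y (\<lambda>es. of_bool (A es)) \<le> expect n y (\<lambda>es. of_bool (B es)) + expect n y (\<lambda>es. of_bool (C es))"
  unfolding expect_add[symmetric] by (rule expect_mono_path) (use assms in \<open>force simp: of_bool_def\<close>)

lemma steady_prob:
  assumes "0 < \<delta>"
  obtains K0 where "0 < K0" "\<And>K. K0 \<le> K \<Longrightarrow>
    \<forall>\<^sub>F n in sequentially. \<forall>y. expect n y (\<lambda>es. of_bool (\<not> steady \<delta> K n es)) \<le> real K * exp (- (speed n * R))"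
proof -
  obtain K0 where K0: "0 < K0" "\<And>K. K0 \<le> K \<Longrightarrow> \<forall>\<^sub>F n in sequentially. \<forall>y.
      expect (n div K) y (\<lambda>es. of_bool (\<exists>k\<le>n div K. \<delta> * a n < norm (sumD (take k es)))) \<le> exp (- (speed n * R))"
    using osc_rate_fine[OF assms, of R] by blast
  show ?thesis
  proof (rule that[OF K0(1)])
    fix K assume "K0 \<le> K"
    from K0(2)[OF this] show "\<forall>\<^sub>F n in sequentially. \<forall>y. expect n y (\<lambda>es. of_bool (\<not> steady \<delta> K n es)) \<le> real K * exp (- (speed n * R))"
    proof eventually_elim
      case (elim n)
      then show ?case
        unfolding steady_def not_not by (blast intro: osc_blocks)
    qed
  qed
qed

lemma walk_path_AC0: "walk_path n es \<in> AC0"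
  by (simp add: walk_path_def interpolated_path_AC0)

lemma closed_upper:
  assumes F: "closedin AC0_topology F" and rate: "\<And>h. h \<in> F \<Longrightarrow> ereal \<alpha> < mdp_rate \<Sigma> h" and \<eta>: "0 < \<eta>"
  shows "\<forall>\<^sub>F n in sequentially. \<forall>y. expect n y (\<lambda>es. of_bool (walk_path n es \<in> F)) \<le> exp (- (speed n * (\<alpha> - \<eta>)))"
proof -
  have "{h \<in> topspace AC0_topology. mdp_rate \<Sigma> h \<le> ereal \<alpha>} \<inter> F = {}"
    using rate by (auto dest!: leD)
  from AC0_compact_closed_separated[OF compactin_mdp_rate F this]
  obtain r where r: "0 < r" "\<And>h g. h \<in> {h \<in> topspace AC0_topology. mdp_rate \<Sigma> h \<le> ereal \<alpha>} \<Longrightarrow> g \<in> F \<Longrightarrow> \<exists>t\<in>{0..1}. r < dist (h t) (g t)"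
    by blast
  \<comment> \<open>Three errors: polygon to grid value, grid value to walk, and the gap
    term.\<close>
  define \<delta> where "\<delta> = r / 3"
  have \<delta>: "0 < \<delta>"
    using r(1) by (simp add: \<delta>_def)
  obtain K where K: "0 < K" and osc: "\<And>K'. K \<le> K' \<Longrightarrow>
      \<forall>\<^sub>F n in sequentially. \<forall>y. expect n y (\<lambda>es. of_bool (\<not> steady \<delta> K' n es)) \<le> real K' * exp (- (speed n * \<alpha>))"
    using steady_prob[OF \<delta>, of \<alpha>] by blast
  have \<eta>2: "0 < \<eta> / 2"
    using \<eta> by simp
  show ?thesis
    \<comment> \<open>Steadiness bounds each block sum by \<open>\<delta> * a n\<close>, so \<delta>
      itself can serve as truncation level in \<open>grid_upper\<close>.\<close>
    using osc[OF order_refl] grid_upper[OF K \<eta>2, of \<alpha> \<delta>] eventually_gap[OF \<delta>, of K] eventually_ge_at_top[of 1]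
      eventually_exp_speed[OF \<eta>2, of "real K + 1"] eventually_speed_gt[of 0]
  proof eventually_elim
    case (elim n)
    let ?S = "\<lambda>es. (\<Sum>j<K. K / 2 * Q (sumD (block (n div K) j es) /\<^sub>R a n))"
    show ?case
    proof
      fix y
      have "expect n y (\<lambda>es. of_bool (walk_path n es \<in> F)) \<le> expect n y (\<lambda>es. of_bool (\<not> steady \<delta> K n es)) +
          expect n y (\<lambda>es. of_bool (\<alpha> < ?S es \<and> (\<forall>j<K. norm (sumD (block (n div K) j es)) \<le> \<delta> * a n)))"
      proof (rule expect_union, rule disjCI)
        fix es z assume es: "length es = n" "edge_path X0 y es z" and inF: "walk_path n es \<in> F"
          and "\<not> (\<alpha> < ?S es \<and> (\<forall>j<K. norm (sumD (block (n div K) j es)) \<le> \<delta> * a n))"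
        show "\<not> steady \<delta> K n es"
        proof
          assume st: "steady \<delta> K n es"
          then have "?S es \<le> \<alpha>"
            using steady_block \<open>\<not> (\<alpha> < ?S es \<and> _)\<close> by (meson not_less)
          let ?g = "interpolated_path (\<lambda>k. grid K n es k - grid K n es (k - 1)) 1 K"
          have "mdp_rate \<Sigma> ?g \<le> ereal (\<Sum>j<K. real K / 2 * qf (grid K n es (j + 1) - grid K n es (j + 1 - 1)))"
            by (rule mdp_rate_interpolated_path[OF K])
          also have "(\<Sum>j<K. real K / 2 * qf (grid K n es (j + 1) - grid K n es (j + 1 - 1))) = ?S es"
            by (simp add: grid_Suc Q_qf)
          finally have "mdp_rate \<Sigma> ?g \<le> ereal (?S es)" .
          also have "\<dots> \<le> ereal \<alpha>"
            using \<open>?S es \<le> \<alpha>\<close> by simp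
          finally have "mdp_rate \<Sigma> ?g \<le> ereal \<alpha>" .
          then have "?g \<in> {h \<in> topspace AC0_topology. mdp_rate \<Sigma> h \<le> ereal \<alpha>}"
            by (simp add: topspace_AC0 interpolated_path_AC0)
          from r(2)[OF this inF] obtain t where t: "t \<in> {0..1}" "r < dist (?g t) (walk_path n es t)"
            by blast
          have "dist (?g t) (walk_path n es t) \<le> norm (?g t - grid K n es (nat \<lfloor>real K * t\<rfloor>)) + norm (walk_path n es t - grid K n es (nat \<lfloor>real K * t\<rfloor>))"
            using dist_triangle2[of "?g t" "walk_path n es t" "grid K n es (nat \<lfloor>real K * t\<rfloor>)"] by (simp only: dist_norm)
          also have "\<dots> \<le> \<delta> + (\<delta> + gap K / a n)"
            using grid_path_near[OF elim(4) st t(1)] walk_path_near[OF elim(4) K es st t(1)] \<delta> by (intro add_mono) auto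
          also have "\<dots> \<le> r"
            using elim(3) unfolding \<delta>_def by linarith
          finally show False
            using t(2) by simp
        qed
      qed
      also have "\<dots> \<le> real K * exp (- (speed n * \<alpha>)) + exp (- (speed n * (\<alpha> - \<eta> / 2)))"
        using elim(1,2) by (intro add_mono) auto
      also have "\<dots> \<le> (real K + 1) * exp (- (speed n * (\<alpha> - \<eta> / 2)))"
      proof -
        have "exp (- (speed n * \<alpha>)) \<le> exp (- (speed n * (\<alpha> - \<eta> / 2)))"
          using elim(6) \<eta> by simp
        then have "real K * exp (- (speed n * \<alpha>)) \<le> real K * exp (- (speed n * (\<alpha> - \<eta> / 2)))"
          by (rule mult_left_mono) simp
        then show ?thesis
          by (simp add: distrib_right)
      qed
      also have "\<dots> \<le> exp (speed n * (\<eta> / 2)) * exp (- (speed n * (\<alpha> - \<eta> / 2)))"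
        using elim(5) by (intro mult_right_mono) auto
      also have "\<dots> = exp (- (speed n * (\<alpha> - \<eta>)))"
        by (simp add: exp_add[symmetric] algebra_simps)
      finally show "expect n y (\<lambda>es. of_bool (walk_path n es \<in> F)) \<le> exp (- (speed n * (\<alpha> - \<eta>)))" .
    qed
  qed
qed

lemma open_lower:
  assumes U: "openin AC0_topology U" "h \<in> U" and rate: "mdp_rate \<Sigma> h \<le> ereal b" and \<eta>: "0 < \<eta>"
  shows "\<forall>\<^sub>F n in sequentially. \<forall>y. exp (- (speed n * (b + \<eta>))) \<le> expect n y (\<lambda>es. of_bool (walk_path n es \<in> U))"
proof -
  have h: "h \<in> AC0"
    using U openin_subset topspace_AC0 by blast
  then have h0: "h 0 = 0" and cont: "continuous_on {0..1} h"
    using absolutely_continuous_on_imp_continuous_on by (auto simp: AC0_def)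
  obtain r where r: "0 < r" "\<And>g. g \<in> AC0 \<Longrightarrow> \<forall>t\<in>{0..1}. dist (h t) (g t) \<le> r \<Longrightarrow> g \<in> U"
    using openin_AC0_ball[OF U] by blast
  \<comment> \<open>Four errors: the modulus of continuity of \<open>h\<close>, grid value against
    \<open>h\<close>, walk against grid value, and the gap term.\<close>
  define \<delta> where "\<delta> = r / 4"
  have \<delta>: "0 < \<delta>"
    using r(1) by (simp add: \<delta>_def)
  have "uniformly_continuous_on {0..1} h"
    by (rule compact_uniformly_continuous[OF cont]) simp
  then obtain d where d: "0 < d" "\<And>s t. s \<in> {0..1} \<Longrightarrow> t \<in> {0..1} \<Longrightarrow> dist s t < d \<Longrightarrow> dist (h s) (h t) < \<delta>"
    using \<delta> unfolding uniformly_continuous_on_def by metis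
  obtain K0 where K0: "0 < K0" "\<And>K. K0 \<le> K \<Longrightarrow>
      \<forall>\<^sub>F n in sequentially. \<forall>y. expect n y (\<lambda>es. of_bool (\<not> steady \<delta> K n es)) \<le> real K * exp (- (speed n * (b + \<eta>)))"
    using steady_prob[OF \<delta>, of "b + \<eta>"] by blast
  obtain K1 :: nat where K1: "1 / d < K1"
    using reals_Archimedean2 by blast
  define K where "K = max K0 K1"
  have K: "0 < K" "K0 \<le> K"
    using K0(1) by (auto simp: K_def)
  have Kd: "1 / real K < d"
  proof -
    have "1 / d < real K"
      using K1 by (simp add: K_def)
    then show ?thesis
      using d(1) K(1) by (simp add: field_simps)
  qed
  define v where "v = (\<lambda>j. h ((real j + 1) / real K) - h (real j / real K))"
  have energy: "(\<Sum>j<K. K / 2 * Q (v j)) \<le> b"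
    using energy_uniform_real[OF h rate K(1)] by (simp add: v_def Q_qf)
  have \<eta>2: "0 < \<eta> / 2"
    using \<eta> by simp
  \<comment> \<open>The errors of up to \<open>K\<close> blocks accumulate along the grid, so each
    may use only a K-th part of \<delta>.\<close>
  have \<delta>K: "0 < \<delta> / K"
    using \<delta> K by simp
  show ?thesis
    using K0(2)[OF K(2)] grid_lower[OF K(1) \<delta>K \<eta>2, of v] eventually_gap[OF \<delta>, of K] eventually_ge_at_top[of 1]
      eventually_exp_speed[OF \<eta>2, of "real K + 1"] eventually_speed_gt[of 0]
  proof eventually_elim
    case (elim n)
    have an: "0 < a n"
      using a_pos[OF elim(4)] .
    let ?G = "\<lambda>es. \<forall>j<K. norm (sumD (block (n div K) j es) - a n *\<^sub>R v j) < \<delta> / K * a n"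
    show ?case
    proof
      fix y
      have "expect n y (\<lambda>es. of_bool (?G es)) \<le> expect n y (\<lambda>es. of_bool (walk_path n es \<in> U)) + expect n y (\<lambda>es. of_bool (\<not> steady \<delta> K n es))"
      proof (rule expect_union, rule disjCI)
        fix es z assume es: "length es = n" "edge_path X0 y es z" and G: "?G es" and "\<not> \<not> steady \<delta> K n es"
        then have st: "steady \<delta> K n es"
          by simp
        have near: "norm (grid K n es j - h (real j / real K)) \<le> real j * (\<delta> / K)" if "j \<le> K" for j
          using that
        proof (induction j)
          case 0
          then show ?case
            by (simp add: grid_0 h0)
        next
          case (Suc j)
          have "norm (sumD (block (n div K) j es) /\<^sub>R a n - v j) = norm (sumD (block (n div K) j es) - a n *\<^sub>R v j) / a n"
          proof -
            have "sumD (block (n div K) j es) /\<^sub>R a n - v j = (sumD (block (n div K) j es) - a n *\<^sub>R v j) /\<^sub>R a n"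
              using an by (simp add: scaleR_diff_right)
            then show ?thesis
              using an by (simp add: divide_inverse mult.commute)
          qed
          also have "\<dots> \<le> \<delta> / K"
            using G Suc.prems an by (simp add: divide_le_eq less_imp_le)
          finally have step: "norm (sumD (block (n div K) j es) /\<^sub>R a n - v j) \<le> \<delta> / K" .
          have "grid K n es (Suc j) - h (real (Suc j) / real K) =
              (grid K n es j - h (real j / real K)) + (sumD (block (n div K) j es) /\<^sub>R a n - v j)"
            using grid_Suc[of K n es j] by (simp add: v_def algebra_simps)
          then have "norm (grid K n es (Suc j) - h (real (Suc j) / real K)) \<le> real j * (\<delta> / K) + \<delta> / K"
            using norm_triangle_mono[OF Suc.IH step] Suc.prems by simp
          moreover have "real (Suc j) * (\<delta> / K) = real j * (\<delta> / K) + \<delta> / K"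
            by (simp add: distrib_right add_divide_distrib)
          ultimately show ?case
            by (simp only:)
        qed
        show "walk_path n es \<in> U"
        proof (rule r(2)[OF walk_path_AC0], intro ballI)
          fix t :: real assume t: "t \<in> {0..1}"
          define j where "j = nat \<lfloor>real K * t\<rfloor>"
          note fl = floor_01[OF t, of K, folded j_def]
          have "norm (walk_path n es t - grid K n es j) \<le> \<delta> + gap K / a n"
            using walk_path_near[OF elim(4) K(1) es st t] \<delta> by (simp add: j_def)
          moreover have "norm (grid K n es j - h (real j / real K)) \<le> \<delta>"
          proof -
            have "real j * (\<delta> / K) \<le> real K * (\<delta> / K)"
              using fl(3) \<delta>K by (intro mult_right_mono) auto
            then show ?thesis
              using near[OF fl(3)] K(1) by simp
          qed
          moreover have "dist (h t) (h (real j / real K)) < \<delta>"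
          proof (rule d(2)[OF t])
            show "real j / real K \<in> {0..1}"
              using fl(3) K(1) by simp
            have "\<bar>real K * t - real j\<bar> \<le> 1"
              using fl(1,2) by linarith
            moreover have "real K * (t - real j / real K) = real K * t - real j"
              using K(1) by (simp add: right_diff_distrib)
            ultimately have "\<bar>real K * (t - real j / real K)\<bar> \<le> 1"
              by (simp only:)
            then have "real K * \<bar>t - real j / real K\<bar> \<le> 1"
              by (simp only: abs_mult abs_of_nat)
            then have "\<bar>t - real j / real K\<bar> \<le> 1 / real K"
              using K(1) by (simp add: field_simps)
            then show "dist t (real j / real K) < d"
              using Kd by (simp add: dist_real_def)
          qed
          ultimately have "dist (h t) (walk_path n es t) \<le> \<delta> + \<delta> + (\<delta> + gap K / a n)"
            using dist_triangle[of "h t" "walk_path n es t" "h (real j / real K)"]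
              dist_triangle[of "h (real j / real K)" "walk_path n es t" "grid K n es j"]
            unfolding dist_norm by (smt (verit) norm_minus_commute)
          then show "dist (h t) (walk_path n es t) \<le> r"
            using elim(3) unfolding \<delta>_def by linarith
        qed
      qed
      moreover have "exp (- (speed n * (b + \<eta> / 2))) \<le> expect n y (\<lambda>es. of_bool (?G es))"
      proof -
        have "exp (- (speed n * (b + \<eta> / 2))) \<le> exp (- (speed n * ((\<Sum>j<K. K / 2 * Q (v j)) + \<eta> / 2)))"
          using energy elim(6) by (simp add: mult_left_mono)
        then show ?thesis
          using elim(2) by (meson order_trans)
      qed
      moreover have "expect n y (\<lambda>es. of_bool (\<not> steady \<delta> K n es)) \<le> real K * exp (- (speed n * (b + \<eta>)))"
        using elim(1) by blast
      moreover have "(real K + 1) * exp (- (speed n * (b + \<eta>))) \<le> exp (- (speed n * (b + \<eta> / 2)))"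
      proof -
        have "(real K + 1) * exp (- (speed n * (b + \<eta>))) \<le> exp (speed n * (\<eta> / 2)) * exp (- (speed n * (b + \<eta>)))"
          using elim(5) by (intro mult_right_mono) auto
        also have "\<dots> = exp (- (speed n * (b + \<eta> / 2)))"
          by (simp add: exp_add[symmetric] algebra_simps)
        finally show ?thesis .
      qed
      ultimately show "exp (- (speed n * (b + \<eta>))) \<le> expect n y (\<lambda>es. of_bool (walk_path n es \<in> U))"
        by (simp add: distrib_right)
    qed
  qed
qed

lemma moderate_deviations:
  assumes A: "A \<subseteq> AC0" and \<pi>: "\<And>n. 1 \<le> n \<Longrightarrow> \<pi> n = expect n y (\<lambda>es. of_bool (walk_path n es \<in> A))"
  shows "- (INF h\<in>AC0_topology interior_of A. mdp_rate \<Sigma> h) \<le> liminf (\<lambda>n. ereal (1 / speed n) * log_prob (\<pi> n))"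
    and "limsup (\<lambda>n. ereal (1 / speed n) * log_prob (\<pi> n)) \<le> - (INF h\<in>AC0_topology closure_of A. mdp_rate \<Sigma> h)"
proof -
  let ?f = "\<lambda>n. ereal (1 / speed n) * log_prob (\<pi> n)"
  have "- liminf ?f \<le> (INF h\<in>AC0_topology interior_of A. mdp_rate \<Sigma> h)"
  proof (rule INF_greatest)
    fix h assume h: "h \<in> AC0_topology interior_of A"
    show "- liminf ?f \<le> mdp_rate \<Sigma> h"
    proof (cases "mdp_rate \<Sigma> h")
      case (real b)
      have rb: "mdp_rate \<Sigma> h \<le> ereal b"
        by (simp add: real)
      have "- liminf ?f \<le> ereal b + ereal \<eta>" if \<eta>: "0 < \<eta>" for \<eta>
      proof -
        have "\<forall>\<^sub>F n in sequentially. ereal (- (b + \<eta>)) \<le> ?f n"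
          using open_lower[OF openin_interior_of h rb \<eta>] eventually_speed_gt[of 0] eventually_ge_at_top[of 1]
        proof eventually_elim
          case (elim n)
          have "exp (- (speed n * (b + \<eta>))) \<le> expect n y (\<lambda>es. of_bool (walk_path n es \<in> AC0_topology interior_of A))"
            using elim(1) by blast
          also have "\<dots> \<le> \<pi> n"
            unfolding \<pi>[OF elim(3)] by (rule expect_mono) (use interior_of_subset[of AC0_topology A] in \<open>auto simp: of_bool_def\<close>)
          finally show ?case
            by (rule ereal_log_prob_lower[OF elim(2)])
        qed
        then have "ereal (- (b + \<eta>)) \<le> liminf ?f"
          by (rule Liminf_bounded)
        then show ?thesis
          by (simp add: ereal_uminus_le_reorder)
      qed
      then show ?thesis
        unfolding real by (rule ereal_le_epsilon2)
    next
      case MInf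
      then show ?thesis
        using mdp_rate_nonneg[of h] by simp
    qed simp
  qed
  then show "- (INF h\<in>AC0_topology interior_of A. mdp_rate \<Sigma> h) \<le> liminf ?f"
    by (simp add: ereal_uminus_le_reorder)
  \<comment> \<open>Approaching the infimum from below by arbitrary levels covers an infinite
    infimum too.\<close>
  have "(INF h\<in>AC0_topology closure_of A. mdp_rate \<Sigma> h) \<le> - limsup ?f"
  proof (rule dense_le)
    fix z assume z: "z < (INF h\<in>AC0_topology closure_of A. mdp_rate \<Sigma> h)"
    show "z \<le> - limsup ?f"
    proof (cases z)
      case (real \<alpha>)
      have rate: "ereal \<alpha> < mdp_rate \<Sigma> h" if "h \<in> AC0_topology closure_of A" for h
        using z that unfolding real by (meson INF_lower less_le_trans)
      have "ereal \<alpha> \<le> - limsup ?f + ereal \<eta>" if \<eta>: "0 < \<eta>" for \<eta>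
      proof -
        have "\<forall>\<^sub>F n in sequentially. \<forall>y. expect n y (\<lambda>es. of_bool (walk_path n es \<in> AC0_topology closure_of A)) \<le> exp (- (speed n * (\<alpha> - \<eta>)))"
          by (rule closed_upper[OF closedin_closure_of rate \<eta>])
        then have "\<forall>\<^sub>F n in sequentially. ?f n \<le> ereal (- (\<alpha> - \<eta>))"
          using eventually_speed_gt[of 0] eventually_ge_at_top[of 1]
        proof eventually_elim
          case (elim n)
          have "\<pi> n \<le> expect n y (\<lambda>es. of_bool (walk_path n es \<in> AC0_topology closure_of A))"
            unfolding \<pi>[OF elim(3)] by (rule expect_mono) (use closure_of_subset[of A AC0_topology] A in \<open>auto simp: of_bool_def topspace_AC0\<close>)
          also have "\<dots> \<le> exp (- (speed n * (\<alpha> - \<eta>)))"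
            using elim(1) by blast
          finally have "\<pi> n \<le> exp (- (speed n * (\<alpha> - \<eta>)))" .
          moreover have "0 \<le> \<pi> n"
            unfolding \<pi>[OF elim(3)] by (rule expect_nonneg) simp
          ultimately show ?case
            using ereal_log_prob_upper[OF elim(2)] by blast
        qed
        then have "limsup ?f \<le> ereal (- (\<alpha> - \<eta>))"
          by (rule Limsup_bounded)
        then have "ereal (\<alpha> - \<eta>) \<le> - limsup ?f"
          by (metis ereal_minus_le_minus ereal_uminus_uminus uminus_ereal.simps(1))
        then have "ereal (\<alpha> - \<eta>) + ereal \<eta> \<le> - limsup ?f + ereal \<eta>"
          by (rule add_right_mono)
        then show ?thesis
          by simp
      qed
      then show ?thesis
        unfolding real by (rule ereal_le_epsilon2)
    qed (use z in simp_all)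
  qed
  then show "limsup ?f \<le> - (INF h\<in>AC0_topology closure_of A. mdp_rate \<Sigma> h)"
    by (metis ereal_minus_le_minus ereal_uminus_uminus)
qed

end

theorem proposition1p2:
  fixes G :: "'g::{t2_space, second_countable_topology} monoid" and \<Gamma> :: "'g set"
    and \<A> :: "('g, 'v::euclidean_space) chart set" and Exp :: "'v \<Rightarrow> 'g"
    and r :: nat and gs :: "nat \<Rightarrow> 'v set" and B :: "'d::finite \<Rightarrow> 'v"
    and X :: "('x, 'e) ograph" and X0 :: "('x0::finite, 'e0::finite) ograph"
    and \<pi>V :: "'x \<Rightarrow> 'x0" and \<pi>E :: "'e \<Rightarrow> 'e0"
    and actV :: "'g \<Rightarrow> 'x \<Rightarrow> 'x" and actE :: "'g \<Rightarrow> 'e \<Rightarrow> 'e"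
    and p :: "'e0 \<Rightarrow> real" and m :: "'x0 \<Rightarrow> real"
    and x :: 'x and P :: "(nat \<Rightarrow> 'e) measure" and \<Phi> :: "'x \<Rightarrow> 'g" and a :: "nat \<Rightarrow> real"
  defines "l \<equiv> log1 Exp r gs B"
  defines "\<rho>R \<equiv> rho_real \<Gamma> X X0 \<pi>V \<pi>E actV x l"
  defines "\<Xi> \<equiv> (\<lambda>n c. l (\<Phi> (walk X n c)))"
  defines "W \<equiv> (\<lambda>k c. \<Xi> k c - \<Xi> (k - 1) c)"
  defines "Wbar \<equiv> (\<lambda>k c. W k c - \<rho>R (gamma_p X0 p m))"
  defines "Z \<equiv> (\<lambda>n c. interpolated_path (\<lambda>k. Wbar k c) (a n) n)"
  defines "I' \<equiv> mdp_rate (albanese_Sigma X0 p m \<rho>R)"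
  assumes "nilpotent_lie_group G \<A> Exp"
    and "cocompact_lattice G \<Gamma>"
    and "finitely_generated_group (G\<lparr>carrier := \<Gamma>\<rparr>)"
    and "torsion_free_group (G\<lparr>carrier := \<Gamma>\<rparr>)"
    and "nilpotent_group (G\<lparr>carrier := \<Gamma>\<rparr>)"
    and "graded_complements G Exp r gs"
    and "inj B" "independent (range B)" "span (range B) = gs 1"
    and "covering_graph (G\<lparr>carrier := \<Gamma>\<rparr>) X X0 \<pi>V \<pi>E actV actE"
    and "transition_probability X0 p"
    and "normalized_invariant_measure X0 p m"
    and "markov_path_measure X (p \<circ> \<pi>E) x P"
    and "\<And>\<gamma> y. \<gamma> \<in> \<Gamma> \<Longrightarrow> \<Phi> (actV \<gamma> y) = \<gamma> \<otimes>\<^bsub>G\<^esub> \<Phi> y"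
    and "\<And>n. 1 \<le> n \<Longrightarrow> 0 < a n"
    and "mono_on {1..} a"
    and "filterlim (\<lambda>n. a n / sqrt (real n)) at_top sequentially"
    and "(\<lambda>n. a n / real n) \<longlonglongrightarrow> 0"
  shows "good_rate_function AC0_topology I' \<and>
    (\<forall>A\<in>borel_sets_of AC0_topology.
       - (INF h\<in>AC0_topology interior_of A. I' h)
         \<le> liminf (\<lambda>n. ereal (real n / (a n)\<^sup>2) * log_prob (measure P {c \<in> space P. Z n c \<in> A})) \<and>
       liminf (\<lambda>n. ereal (real n / (a n)\<^sup>2) * log_prob (measure P {c \<in> space P. Z n c \<in> A}))
         \<le> limsup (\<lambda>n. ereal (real n / (a n)\<^sup>2) * log_prob (measure P {c \<in> space P. Z n c \<in> A})) \<and>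
       limsup (\<lambda>n. ereal (real n / (a n)\<^sup>2) * log_prob (measure P {c \<in> space P. Z n c \<in> A}))
         \<le> - (INF h\<in>AC0_topology closure_of A. I' h))"
proof -
  interpret L: graded_lie_group G \<A> Exp r gs B
    using assms(8,13-16) by (simp add: graded_lie_group_def graded_lie_group_axioms_def)
  interpret C: covering_graph "G\<lparr>carrier := \<Gamma>\<rparr>" X X0 \<pi>V \<pi>E actV actE
    by fact
  interpret equivariant_walk "G\<lparr>carrier := \<Gamma>\<rparr>" X X0 \<pi>V \<pi>E actV actE l "\<lambda>y. l (\<Phi> y)" p m
  proof unfold_locales
    show "l (\<Phi> (actV \<gamma> y)) = l \<gamma> + l (\<Phi> y)" if "\<gamma> \<in> carrier (G\<lparr>carrier := \<Gamma>\<rparr>)" for \<gamma> y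
      using that assms(21)[of \<gamma> y] by (simp add: l_def L.log1_mult)
    show "\<theta> = 0" if "\<And>\<gamma>. \<gamma> \<in> carrier (G\<lparr>carrier := \<Gamma>\<rparr>) \<Longrightarrow> \<theta> \<bullet> l \<gamma> = 0" for \<theta>
      by (rule L.log1_spans[OF assms(9)]) (use that in \<open>simp add: l_def\<close>)
  qed (fact C.connected_X0 assms(18,19))+
  have \<rho>R: "\<rho>R = rho_real (carrier (G\<lparr>carrier := \<Gamma>\<rparr>)) X X0 \<pi>V \<pi>E actV x l"
    by (simp add: \<rho>R_def)
  have \<rho>\<gamma>: "\<rho>R (gamma_p X0 p m) = drift"
    unfolding \<rho>R by (rule rho_real_gamma_p)
  define \<Sigma> where "\<Sigma> = albanese_Sigma X0 p m \<rho>R"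
  have \<Sigma>: "\<phi> \<bullet> (\<Sigma> *v \<theta>) = cov \<phi> \<theta>" for \<phi> \<theta>
    unfolding \<Sigma>_def \<rho>R by (rule albanese_Sigma_eq)
  interpret S: posdef_matrix \<Sigma>
    by unfold_locales (simp_all add: \<Sigma> cov_commute cov_positive)
  \<comment> \<open>The corrector plays the role of \<open>u\<close>: \<open>harm\<close> and
    \<open>incr\<close> differ by its coboundary, and both are centred by
    \<open>drift\<close>.\<close>
  interpret M: mdp_increments X0 p m "\<lambda>e. harm e - drift" a \<Sigma> corrector "\<lambda>e. incr e - drift"
  proof (intro mdp_increments.intro mdp_walk.intro mdp_walk_axioms.intro mdp_increments_axioms.intro
      martingale_walk_axioms S.posdef_matrix_axioms)
    show "linear (\<lambda>v. matrix_inv \<Sigma> *v v)"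
      by simp
    show "cov (matrix_inv \<Sigma> *v v) \<theta> = v \<bullet> \<theta>" for v \<theta>
      using \<Sigma>[of \<theta> "matrix_inv \<Sigma> *v v"] by (simp add: S.inv_mult cov_commute inner_commute)
    show "incr e - drift = harm e - drift - (corrector (ter X0 e) - corrector (org X0 e))" for e
      by (simp add: harm_def)
  qed fact+
  have Z: "Z n c = M.walk_path n (map (\<lambda>i. \<pi>E (c i)) [0..<n])" if "c \<in> infinite_paths X x" for n c
    unfolding Z_def M.walk_path_def
  proof (rule interpolated_path_cong)
    fix k assume k: "1 \<le> k" "k \<le> n"
    \<comment> \<open>Edges count from 0 and increments from 1: the k-th increment runs along
      \<open>c (k - 1)\<close>, whose terminus is the position at time \<open>k\<close>.\<close>
    have "org X (c k) = ter X (c (k - 1))"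
      using that k(1) by (cases k) (auto simp: infinite_paths_def)
    then show "Wbar k c = incr (map (\<lambda>i. \<pi>E (c i)) [0..<n] ! (k - 1)) - drift"
      using k by (simp add: Wbar_def W_def \<Xi>_def walk_def \<rho>\<gamma> incr)
  qed
  have prob: "measure P {c \<in> space P. Z n c \<in> A} = expect n (\<pi>V x) (\<lambda>es. of_bool (M.walk_path n es \<in> A))" for n A
  proof -
    have "space P = infinite_paths X x"
      using assms(20) by (simp add: markov_path_measure_def)
    then have "{c \<in> space P. Z n c \<in> A} = {c \<in> space P. map (\<lambda>i. \<pi>E (c i)) [0..<n] \<in> {es. M.walk_path n es \<in> A}}"
      by (auto simp: Z)
    then show ?thesis
      using measure_path_event[OF assms(20), of n "{es. M.walk_path n es \<in> A}"] by simp
  qed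
  have speed: "real n / (a n)\<^sup>2 = 1 / M.speed n" for n
    by (simp add: M.speed_def)
  have "A \<subseteq> AC0" if "A \<in> borel_sets_of AC0_topology" for A :: "(real \<Rightarrow> real ^ 'd) set"
  proof -
    have "A \<subseteq> topspace AC0_topology"
      by (rule sigma_sets_into_sp[OF _ that[unfolded borel_sets_of_def]]) (auto dest: openin_subset)
    then show ?thesis
      by (simp add: topspace_AC0)
  qed
  then show ?thesis
    using S.good_rate_function_mdp M.moderate_deviations[OF _ prob]
    unfolding I'_def \<Sigma>_def[symmetric] speed by (auto intro!: Liminf_le_Limsup)
qed

end
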